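(* Let $\Gamma_1$ be a convex closed curve in the Euclidean plane, and let $\Gamma\in BV^1$ be a closed plane curve lying inside $\Gamma_1$ (that is, contained in the closed convex region bounded by $\Gamma_1$). Then: 1. $T(\Gamma)\ge T(\Gamma_1)$. 2. If $T(\Gamma)=T(\Gamma_1)$, then $\Gamma$ is a multiple circuit of $\Gamma_1$.
   Context: Closed plane curves are naturally (arc-length) parametrized: $\Gamma(s)$, $s\in[0,L(\Gamma)]$, $\Gamma(0)=\Gamma(L(\Gamma))$, where $L(\Gamma)>0$ is the length of $\Gamma$. The variation of a function $f$ with values in the unit circle, defined on a segment except possibly on a countable set, is the supremum of the sums $\sum_{i=1}^n\rho(f(t_i),f(t_{i-1}))+\rho(f(t_n),f(t_0))$ over all subdivisions $t_0<t_1<\dots<t_n$ of the segment such that $f$ is defined at all the nodes $t_i$; here $\rho$ is the intrinsic (angular) metric of the unit circle, with values in $[0,\pi]$. The curve $\Gamma$ belongs to the class $BV^1$ if the velocity $\Gamma'(s)$ exists and is continuous on $[0,L(\Gamma)]$ with the exception of an (at most) countable set, at the points of this set $\Gamma'$ has left and right limits, and the variation of $\Gamma'$ is bounded. The full rotation $V(\Gamma)$ of $\Gamma\in BV^1$ is the variation of $\Gamma'$. (For a closed convex curve it exists and equals $2\pi$.) The mean absolute curvature is $T(\Gamma)=V(\Gamma)/L(\Gamma)$. A multiple circuit of $\Gamma_1$ is a closed curve that goes around $\Gamma_1$ a whole number $k\ge1$ of times in one and the same direction (with arbitrary starting point and arbitrary orientation). *)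

theory Defs
  imports "HOL-Analysis.Analysis"
begin

text \<open>A closed plane curve is given by its arc-length parametrization \<open>\<Gamma> :: real \<Rightarrow> complex\<close> together
  with its length \<open>L\<close>; only the values of \<open>\<Gamma>\<close> on \<open>{0..L}\<close> matter.\<close>

definition subdivision :: "real set \<Rightarrow> nat \<Rightarrow> (nat \<Rightarrow> real) \<Rightarrow> bool" where
  "subdivision D n t \<longleftrightarrow> (\<forall>i\<le>n. t i \<in> D) \<and> (\<forall>i<n. t i < t (Suc i))"

definition chord_sums :: "(real \<Rightarrow> complex) \<Rightarrow> real \<Rightarrow> real \<Rightarrow> real set" where
  "chord_sums \<Gamma> a b = {\<Sum>i=1..n. dist (\<Gamma> (t i)) (\<Gamma> (t (i - 1))) | n t. subdivision {a..b} n t}"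

definition has_arc_length :: "(real \<Rightarrow> complex) \<Rightarrow> real \<Rightarrow> real \<Rightarrow> real \<Rightarrow> bool" where
  "has_arc_length \<Gamma> a b l \<longleftrightarrow> bdd_above (chord_sums \<Gamma> a b) \<and> Sup (chord_sums \<Gamma> a b) = l"

definition closed_curve :: "(real \<Rightarrow> complex) \<Rightarrow> real \<Rightarrow> bool" where
  "closed_curve \<Gamma> L \<longleftrightarrow> 0 < L \<and> \<Gamma> 0 = \<Gamma> L \<and> (\<forall>s\<in>{0..L}. has_arc_length \<Gamma> 0 s s)"

text \<open>The intrinsic metric of the unit circle; meaningful for unit vectors only.\<close>

definition circle_dist :: "complex \<Rightarrow> complex \<Rightarrow> real" where
  "circle_dist u v = arccos (u \<bullet> v)"

text \<open>Here \<open>D\<close> is the set on which \<open>f\<close> is defined. The nodes need not include the end points of the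
  segment, since \<open>f\<close> may be undefined there.\<close>

definition variation_sums :: "(real \<Rightarrow> complex) \<Rightarrow> real set \<Rightarrow> real set" where
  "variation_sums f D =
     {(\<Sum>i=1..n. circle_dist (f (t i)) (f (t (i - 1)))) + circle_dist (f (t n)) (f (t 0)) | n t.
        subdivision D n t}"

definition variation :: "(real \<Rightarrow> complex) \<Rightarrow> real set \<Rightarrow> real" where
  "variation f D = Sup (variation_sums f D)"

text \<open>Derivatives are taken within \<open>{0..L}\<close>, hence are one-sided at the end points.\<close>

definition velocity :: "(real \<Rightarrow> complex) \<Rightarrow> real \<Rightarrow> real \<Rightarrow> complex" where
  "velocity \<Gamma> L s = vector_derivative \<Gamma> (at s within {0..L})"

definition velocity_dom :: "(real \<Rightarrow> complex) \<Rightarrow> real \<Rightarrow> real set" where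
  "velocity_dom \<Gamma> L = {s \<in> {0..L}. \<Gamma> differentiable (at s within {0..L})}"

definition BV1 :: "(real \<Rightarrow> complex) \<Rightarrow> real \<Rightarrow> bool" where
  "BV1 \<Gamma> L \<longleftrightarrow>
     (\<exists>E\<subseteq>{0..L}. countable E \<and>
        (\<forall>s\<in>{0..L} - E. s \<in> velocity_dom \<Gamma> L \<and>
           continuous (at s within velocity_dom \<Gamma> L) (velocity \<Gamma> L)) \<and>
        (\<forall>s\<in>E.
           (0 < s \<longrightarrow> (\<exists>v. (velocity \<Gamma> L \<longlongrightarrow> v) (at s within (velocity_dom \<Gamma> L \<inter> {..<s})))) \<and>
           (s < L \<longrightarrow> (\<exists>v. (velocity \<Gamma> L \<longlongrightarrow> v) (at s within (velocity_dom \<Gamma> L \<inter> {s<..})))))) \<and>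
     bdd_above (variation_sums (velocity \<Gamma> L) (velocity_dom \<Gamma> L))"

definition full_rotation :: "(real \<Rightarrow> complex) \<Rightarrow> real \<Rightarrow> real" where
  "full_rotation \<Gamma> L = variation (velocity \<Gamma> L) (velocity_dom \<Gamma> L)"

definition mean_abs_curvature :: "(real \<Rightarrow> complex) \<Rightarrow> real \<Rightarrow> real" where
  "mean_abs_curvature \<Gamma> L = full_rotation \<Gamma> L / L"

definition closed_region :: "(real \<Rightarrow> complex) \<Rightarrow> real \<Rightarrow> complex set" where
  "closed_region \<Gamma> L = \<Gamma> ` {0..L} \<union> inside (\<Gamma> ` {0..L})"

definition convex_closed_curve :: "(real \<Rightarrow> complex) \<Rightarrow> real \<Rightarrow> bool" where
  "convex_closed_curve \<Gamma> L \<longleftrightarrow>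
     closed_curve \<Gamma> L \<and> inj_on \<Gamma> {0..<L} \<and> convex (closed_region \<Gamma> L)"

definition periodic_ext :: "(real \<Rightarrow> complex) \<Rightarrow> real \<Rightarrow> real \<Rightarrow> complex" where
  "periodic_ext \<Gamma> L s = \<Gamma> (L * frac (s / L))"

text \<open>The number of rounds is \<open>k\<close>, the starting point is given by \<open>a\<close> and the orientation by \<open>\<sigma>\<close>;
  both curves are parametrized by arc length, so no further reparametrization is involved.\<close>

definition multiple_circuit :: "(real \<Rightarrow> complex) \<Rightarrow> real \<Rightarrow> (real \<Rightarrow> complex) \<Rightarrow> real \<Rightarrow> bool" where
  "multiple_circuit \<Gamma> L \<Gamma>1 L1 \<longleftrightarrow>
     (\<exists>k::nat. \<exists>a::real. \<exists>\<sigma>\<in>{1, -1::real}. 1 \<le> k \<and> L = real k * L1 \<and>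
        (\<forall>s\<in>{0..L}. \<Gamma> s = periodic_ext \<Gamma>1 L1 (a + \<sigma> * s)))"

end

(* Let crad K be the mean value of the support function of a convex body K, so that 2 pi crad K is the
   perimeter of K. For a polygonal path in K that starts and ends on the boundary, the quantity
   (length) - crad K * (turning), where the turning is measured from a tangent of K at the start to a tangent at
   the end, is at most the increment of a potential that depends only on the two end points and tangents. This is
   an estimate for chords, and for interior vertices it follows by sliding a vertex along one of its edges: the
   quantity is a convex function of the turning angle there, so that the vertex can be moved to the boundary or
   be removed. For a closed curve that touches the boundary the potential cancels, hence L <= crad K * V.
   Applied to the convex hull of Gamma, together with the monotonicity of crad, Cauchy's formula
   2 pi crad K <= L1 and V(Gamma1) <= 2 pi, this gives the inequality.

   In the case of equality the convex hull of Gamma is the whole region and all inscribed paths are almost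
   extremal. A change of the sense of rotation costs a fixed amount, so the sense is constant; an excursion into
   the interior would contradict the inequality for its own, smaller convex hull. Hence Gamma runs on Gamma1,
   and the path inequality, applied to the part between two points, says that the elapsed parameter is at least
   the length of the boundary arc. As the chords add up to the length, it is equal to the length of the arc. *)

theory Submission
  imports Defs "HOL-Analysis.Analysis"
begin

text \<open>For a chord that is counterclockwise at both ends the estimate merely compares it with
  its boundary arc, and the potential is the boundary position minus its mean growth. The obstacle
  is a change of the sense of rotation along a chord: then neither arc bounds it. There the distance
  from an end point to a rotating support line is averaged over half a period with the sawtooth
  weight \<open>t / pi - 1/2\<close>; the two half periods, one for each end point, fit together to
  a full one, and what remains is a mean value. This is the origin of the reflected potential for
  the clockwise sense.

  Everything is estimated for inscribed polygons. Differentiability enters only through the bound of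
  their turning by the full rotation, so that \<Gamma> and \<Gamma>1 are treated through the same
  interface. The price is that extremality is known only up to an error \<delta>; the cost of a
  change of sense does not depend on \<delta>, and this makes the case of equality
  accessible.\<close>

definition ang :: "complex \<Rightarrow> complex \<Rightarrow> real" where
  "ang u v = \<bar>Arg (v / u)\<bar>"

lemma abs_Arg_cis: "\<bar>x\<bar> \<le> pi \<Longrightarrow> \<bar>Arg (cis x)\<bar> = \<bar>x\<bar>"
proof (cases "x = - pi")
  \<comment> \<open>\<open>Arg\<close> takes values in the half-open interval from -pi to pi, so the
    end -pi needs the other representative.\<close>
  case True
  then have "cis x = cis pi" by (simp add: complex_eq_iff)
  then show ?thesis using True Arg_cis[of pi] by simp
next
  case False
  assume "\<bar>x\<bar> \<le> pi"
  then have "x \<in> {-pi<..pi}" using False by auto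
  then show ?thesis using Arg_cis[of x] by auto
qed

lemma abs_Arg_cis_le: "\<bar>Arg (cis x)\<bar> \<le> \<bar>x\<bar>"
  using abs_Arg_cis[of x] Arg_bounded[of "cis x"] by (cases "\<bar>x\<bar> \<le> pi") auto

lemma ang_polar:
  assumes "r > 0" "s > 0"
  shows "ang (of_real r * cis a) (of_real s * cis b) = \<bar>Arg (cis (b - a))\<bar>"
proof -
  have "of_real s * cis b / (of_real r * cis a) = of_real (s / r) * cis (b - a)"
    by (simp add: cis_divide[symmetric])
  then show ?thesis unfolding ang_def
    by (metis Arg_times_of_real assms divide_pos_pos)
qed

lemma ang_polar_eq:
  assumes "r > 0" "s > 0" "\<bar>b - a\<bar> \<le> pi"
  shows "ang (of_real r * cis a) (of_real s * cis b) = \<bar>b - a\<bar>"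
  using ang_polar[OF assms(1,2)] abs_Arg_cis[OF assms(3)] by simp

lemma polar_form:
  assumes "u \<noteq> 0"
  obtains r a where "r > 0" "u = of_real r * cis a" "- pi < a" "a \<le> pi"
  by (metis Arg_bounded assms rcis_cmod_Arg rcis_def zero_less_norm_iff)

lemma ang_bounds: "0 \<le> ang u v" "ang u v \<le> pi"
  unfolding ang_def using Arg_bounded[of "v / u"] by auto

lemma ang_scale1: "r > 0 \<Longrightarrow> ang (of_real r * u) v = ang u v"
proof -
  assume r: "r > 0"
  have "v / (of_real r * u) = of_real (1 / r) * (v / u)" by simp
  then show ?thesis unfolding ang_def by (metis Arg_times_of_real r zero_less_divide_1_iff)
qed

lemma ang_scale2: "r > 0 \<Longrightarrow> ang u (of_real r * v) = ang u v"
proof -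
  assume r: "r > 0"
  have "(of_real r * v) / u = of_real r * (v / u)" by simp
  then show ?thesis unfolding ang_def by (metis Arg_times_of_real r)
qed

lemma ang_self [simp]: "u \<noteq> 0 \<Longrightarrow> ang u u = 0"
  by (simp add: ang_def)

lemma ang_sym: "ang u v = ang v u"
proof -
  have "\<bar>Arg (inverse (v / u))\<bar> = \<bar>Arg (v / u)\<bar>" by (simp only: Arg_inverse split: if_splits) auto
  then show ?thesis by (simp add: ang_def)
qed

lemma ang_cnj: "ang (cnj u) (cnj v) = ang u v"
proof -
  have "\<bar>Arg (cnj (v / u))\<bar> = \<bar>Arg (v / u)\<bar>" by (simp only: Arg_cnj split: if_splits) auto
  then show ?thesis by (simp add: ang_def)
qed

lemma ang_minus_minus: "ang (- u) (- v) = ang u v"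
  by (simp add: ang_def)

lemma ang_mult_cancel: "w \<noteq> 0 \<Longrightarrow> ang (u * w) (v * w) = ang u v"
  by (simp add: ang_def)

lemma ang_minus:
  assumes "u \<noteq> 0" "v \<noteq> 0"
  shows "ang u (- v) = pi - ang u v"
proof -
  have "v / u \<noteq> 0" using assms by simp
  moreover have "- v / u = - (v / u)" by simp
  ultimately show ?thesis unfolding ang_def using Arg_minus[of "v/u"] Arg_bounded[of "v/u"]
    by (simp split: if_splits)
qed

lemma ang_minus1:
  assumes "u \<noteq> 0" "v \<noteq> 0"
  shows "ang (- u) v = pi - ang u v"
  using ang_minus[of v u] assms by (simp add: ang_sym)

text \<open>The three vectors are lifted to the real angles \<open>a\<close>, \<open>a + b\<close>
  and \<open>a + b + c\<close>; the angle between the outer ones is at most the absolute value of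
  any lift of their difference.\<close>

lemma ang_triangle:
  assumes "u \<noteq> 0" "v \<noteq> 0" "w \<noteq> 0"
  shows "ang u w \<le> ang u v + ang v w"
proof -
  obtain r a where u: "r > 0" "u = of_real r * cis a" using polar_form[OF assms(1)] by metis
  define b where "b = Arg (v / u)"
  define c where "c = Arg (w / v)"
  have v: "v = of_real (norm (v / u) * r) * cis (a + b)"
  proof -
    have "v / u = of_real (norm (v / u)) * cis b" unfolding b_def by (metis rcis_cmod_Arg rcis_def)
    then have "v = of_real (norm (v / u)) * cis b * u" using assms by (simp add: field_simps)
    then show ?thesis using u by (simp add: cis_mult[symmetric] ac_simps)
  qed
  have w: "w = of_real (norm (w / v) * (norm (v / u) * r)) * cis (a + b + c)"
  proof -
    have "w / v = of_real (norm (w / v)) * cis c" unfolding c_def by (metis rcis_cmod_Arg rcis_def)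
    then have "w = of_real (norm (w / v)) * cis c * v" using assms by (simp add: field_simps)
    then have "w = of_real (norm (w / v)) * cis c * (of_real (norm (v / u) * r) * cis (a + b))"
      using v by simp
    then show ?thesis by (simp add: cis_mult[symmetric] ac_simps)
  qed
  have pos: "norm (w / v) * (norm (v / u) * r) > 0" using assms u(1) by simp
  have "ang u w = \<bar>Arg (cis (b + c))\<bar>"
    using ang_polar[OF u(1) pos, of a "a + b + c"] w u(2) by (simp add: algebra_simps)
  also have "\<dots> \<le> \<bar>b + c\<bar>" by (rule abs_Arg_cis_le)
  also have "\<dots> \<le> ang u v + ang v w" unfolding ang_def b_def c_def by simp
  finally show ?thesis .
qed

text \<open>A sum of the arguments beyond pi would put the product into the lower half-plane. Only
  the sum 2 * pi, from two negative reals, escapes.\<close>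

lemma Arg_mult_upper:
  assumes "x \<noteq> 0" "y \<noteq> 0" "0 \<le> Im x" "0 \<le> Im y" "0 \<le> Im (x * y)"
  shows "Arg (x * y) = Arg x + Arg y \<or> (Arg x = pi \<and> Arg y = pi)"
proof -
  have b: "0 \<le> Arg x" "0 \<le> Arg y" "0 \<le> Arg (x * y)" using assms by (simp_all add: Arg_less_0)
  have b2: "Arg x \<le> pi" "Arg y \<le> pi" using Arg_bounded by auto
  show ?thesis
  proof (cases "Arg x + Arg y \<le> pi")
    case True
    then show ?thesis using Arg_times[of x y] assms b b2 pi_gt_zero by auto
  next
    case False
    then have "Arg (x * y) = Arg x + Arg y - 2 * pi"
      using Arg_times'[OF assms(1,2)] b b2 by (auto simp: Let_def split: if_splits)
    then show ?thesis using b b2 by auto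
  qed
qed

text \<open>The direction of \<open>a + b\<close> lies in the cone between \<open>a\<close> and
  \<open>b\<close>. This equality, in contrast to a triangle inequality, is what allows edges to be
  merged without an increase of the turning.\<close>

lemma ang_cone:
  assumes "a \<noteq> 0" "b \<noteq> 0" "a + b \<noteq> 0"
  shows "ang a b = ang a (a + b) + ang (a + b) b"
proof -
  \<comment> \<open>Division by \<open>a\<close> reduces the claim to \<open>1\<close>,
    \<open>z = b / a\<close> and \<open>1 + z\<close>. In the upper half-plane the arguments of the
    factors of \<open>z = (1 + z) * (z / (1 + z))\<close> add up; both factors cannot be negative,
    since \<open>1 + z < 0\<close> makes the second one positive.\<close>
  have main: "\<bar>Arg z\<bar> = \<bar>Arg (1 + z)\<bar> + \<bar>Arg (z / (1 + z))\<bar>"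
    if z: "z \<noteq> 0" "1 + z \<noteq> 0" "0 \<le> Im z" for z
  proof -
    have i2: "0 \<le> Im (z / (1 + z))"
    proof -
      have "Im (z / (1 + z)) = Im z / ((1 + Re z)\<^sup>2 + (Im z)\<^sup>2)"
        by (simp add: Im_divide algebra_simps power2_eq_square)
      then show ?thesis using z by simp
    qed
    have n: "z / (1 + z) \<noteq> 0" using z by simp
    have i3: "0 \<le> Im ((1 + z) * (z / (1 + z)))" using z by simp
    have i4: "0 \<le> Im (1 + z)" using z by simp
    from Arg_mult_upper[OF z(2) n i4 i2 i3]
    consider "Arg ((1 + z) * (z / (1 + z))) = Arg (1 + z) + Arg (z / (1 + z))"
      | "Arg (1 + z) = pi" "Arg (z / (1 + z)) = pi" by blast
    then show ?thesis
    proof cases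
      case 1
      have "0 \<le> Arg (1 + z)" "0 \<le> Arg (z / (1 + z))" "0 \<le> Arg z"
        using i2 i4 z(3) by (simp_all only: Arg_less_0)
      then show ?thesis using 1 z by simp
    next
      case 2
      then have "Im (1 + z) = 0" "Re (1 + z) < 0"
        using Arg_pos_iff[of "1+z"] Arg_lt_pi[of "1+z"] by auto
      then have "Im z = 0" "Re z < -1" by auto
      then have "z / (1 + z) = of_real (Re z / (1 + Re z))" by (simp add: complex_eq_iff Re_divide Im_divide power2_eq_square)
      moreover have "Re z / (1 + Re z) > 0" using \<open>Re z < -1\<close> by (simp add: divide_neg_neg)
      ultimately have "Arg (z / (1 + z)) = 0" by (simp add: Arg_eq_0)
      then show ?thesis using 2 by simp
    qed
  qed
  have main': "\<bar>Arg z\<bar> = \<bar>Arg (1 + z)\<bar> + \<bar>Arg (z / (1 + z))\<bar>"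
    if z: "z \<noteq> 0" "1 + z \<noteq> 0" for z
  proof (cases "0 \<le> Im z")
    case True then show ?thesis using main z by simp
  next
    case False
    have ab: "\<bar>Arg (cnj w)\<bar> = \<bar>Arg w\<bar>" for w by (simp add: Arg_cnj)
    have "\<bar>Arg (cnj z)\<bar> = \<bar>Arg (1 + cnj z)\<bar> + \<bar>Arg (cnj z / (1 + cnj z))\<bar>"
      using main[of "cnj z"] z False by (metis add.commute cnj.sel(2) complex_cnj_add complex_cnj_one complex_cnj_zero_iff le_minus_iff linear minus_zero)
    moreover have "1 + cnj z = cnj (1 + z)" "cnj z / (1 + cnj z) = cnj (z / (1 + z))" by simp_all
    ultimately show ?thesis by (simp only: ab)
  qed
  have "b / a \<noteq> 0" "1 + b / a \<noteq> 0" using assms by (auto simp: field_simps)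
  from main'[OF this] show ?thesis using assms unfolding ang_def
    by (simp add: add_divide_distrib[symmetric] field_simps)
qed

text \<open>\<open>Arg\<close> jumps at the negative axis, but its absolute value is the
  \<open>arccos\<close> of a continuous function of the quotient.\<close>

lemma tendsto_ang:
  assumes "(f \<longlongrightarrow> u) F" "(g \<longlongrightarrow> v) F" "u \<noteq> 0" "v \<noteq> 0"
  shows "((\<lambda>x. ang (f x) (g x)) \<longlongrightarrow> ang u v) F"
proof -
  have cos_ang: "cos (ang a b) = Re (b / a) / norm (b / a)" if "a \<noteq> 0" "b \<noteq> 0" for a b
    using that unfolding ang_def by (simp add: cos_Arg)
  have eq: "ang a b = arccos (Re (b / a) / norm (b / a))" if "a \<noteq> 0" "b \<noteq> 0" for a b
    using cos_ang[OF that] arccos_cos[of "ang a b"] ang_bounds[of a b] by simp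
  have "\<forall>\<^sub>F x in F. f x \<noteq> 0 \<and> g x \<noteq> 0"
    using tendsto_imp_eventually_ne[OF assms(1,3)] tendsto_imp_eventually_ne[OF assms(2,4)]
    by eventually_elim auto
  then have ev: "\<forall>\<^sub>F x in F. arccos (Re (g x / f x) / norm (g x / f x)) = ang (f x) (g x)"
    by eventually_elim (simp add: eq)
  have t: "((\<lambda>x. Re (g x / f x) / norm (g x / f x)) \<longlongrightarrow> Re (v / u) / norm (v / u)) F"
    using assms by (intro tendsto_intros) auto
  have ca: "continuous_on {-1..1} arccos" by (rule continuous_on_arccos')
  have r: "Re z / norm z \<in> {-1..1}" for z :: complex
    using abs_Re_le_cmod[of z] by (cases "z = 0") (auto simp: field_simps abs_le_iff)
  have "((\<lambda>x. arccos (Re (g x / f x) / norm (g x / f x))) \<longlongrightarrow> arccos (Re (v / u) / norm (v / u))) F"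
    by (rule continuous_on_tendsto_compose[OF ca t]) (use r in auto)
  then show ?thesis unfolding eq[OF assms(3,4)] using ev by (rule Lim_transform_eventually)
qed

lemma ang_arccos:
  assumes "norm u = 1" "norm v = 1"
  shows "ang u v = arccos (u \<bullet> v)"
proof -
  have n: "u \<noteq> 0" "v \<noteq> 0" using assms by auto
  have "cos (ang u v) = Re (v / u) / norm (v / u)" using n unfolding ang_def by (simp add: cos_Arg)
  also have "\<dots> = u \<bullet> v" using assms n
    by (simp add: norm_divide Re_divide inner_complex_def cmod_power2[symmetric] mult.commute)
  finally show ?thesis using arccos_cos[of "ang u v"] ang_bounds[of u v] by simp
qed

subsection \<open>Turning of polygonal paths\<close>

fun edges :: "complex list \<Rightarrow> complex list" where
  "edges (x # y # ps) = (y - x) # edges (y # ps)"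
| "edges _ = []"

fun plen :: "complex list \<Rightarrow> real" where
  "plen (x # y # ps) = dist x y + plen (y # ps)"
| "plen _ = 0"

fun trn :: "complex list \<Rightarrow> real" where
  "trn (u # v # us) = ang u v + trn (v # us)"
| "trn _ = 0"

text \<open>Turning of a closed polygon: the last edge is repeated in front, so that the angle at
  the starting vertex is counted as well.\<close>

definition ctrn :: "complex list \<Rightarrow> real" where
  "ctrn us = trn (last us # us)"

lemma trn_split: "trn (us @ v # ws) = trn (us @ [v]) + trn (v # ws)"
  by (induction us rule: trn.induct) (cases ws; simp)+

lemma trn_Cons: "us \<noteq> [] \<Longrightarrow> trn (u # us) = ang u (hd us) + trn us"
  by (cases us) auto

lemma trn_snoc: "us \<noteq> [] \<Longrightarrow> trn (us @ [u]) = trn us + ang (last us) u"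
  by (induction us rule: trn.induct) auto

lemma edges_split: "edges (us @ v # ws) = edges (us @ [v]) @ edges (v # ws)"
  by (induction us rule: edges.induct) (cases ws; simp)+

lemma plen_split: "plen (us @ v # ws) = plen (us @ [v]) + plen (v # ws)"
  by (induction us rule: plen.induct) (cases ws; simp)+

lemma trn_nonneg: "trn us \<ge> 0"
  by (induction us rule: trn.induct) (auto simp: ang_bounds)

lemma sum_edges: "ps \<noteq> [] \<Longrightarrow> sum_list (edges ps) = last ps - hd ps"
  by (induction ps rule: edges.induct) auto

lemma plen_edges: "plen ps = sum_list (map norm (edges ps))"
  by (induction ps rule: plen.induct) (auto simp: dist_norm norm_minus_commute)

lemma edges_append: "ps \<noteq> [] \<Longrightarrow> qs \<noteq> [] \<Longrightarrow> edges (ps @ qs) = edges ps @ (hd qs - last ps) # edges qs"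
  by (induction ps rule: edges.induct) (cases qs; simp)+

lemma distinct_adj_edges: "distinct_adj ps \<longleftrightarrow> 0 \<notin> set (edges ps)"
  by (induction ps rule: edges.induct) auto

text \<open>An angle at a zero edge is meaningless, so coinciding neighbours are removed. As a
  filter on the edges this removal commutes with cutting and joining paths.\<close>

lemma edges_remdups_adj: "edges (remdups_adj ps) = filter (\<lambda>e. e \<noteq> 0) (edges ps)"
proof (induction ps rule: remdups_adj.induct)
  case (3 x y xs)
  then show ?case
  proof (cases "x = y")
    case True then show ?thesis using 3 by simp
  next
    case False
    have "remdups_adj (y # xs) = y # tl (remdups_adj (y # xs))"
      by (metis hd_remdups_adj list.collapse list.sel(1) list.distinct(1) remdups_adj_Nil_iff)
    then obtain zs where z: "remdups_adj (y # xs) = y # zs" by blast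
    have "edges (remdups_adj (x # y # xs)) = edges (x # y # zs)" using False z by simp
    also have "\<dots> = (y - x) # edges (remdups_adj (y # xs))" using z by simp
    finally show ?thesis using 3 False by simp
  qed
qed auto

lemma trn_merge2:
  assumes "0 \<notin> set us" "a \<noteq> 0" "b \<noteq> 0" "a + b \<noteq> 0" "q \<noteq> 0" "d \<noteq> 0"
  shows "trn (d # (a + b) # q # us) \<le> trn (d # a # b # q # us)"
  using ang_cone[of a b] ang_triangle[of d a "a + b"] ang_triangle[of "a + b" b q] assms by simp

lemma trn_drop:
  assumes "0 \<notin> set us" "0 \<notin> set ws" "v \<noteq> 0"
  shows "trn (us @ ws) \<le> trn (us @ v # ws)"
proof (cases "us = [] \<or> ws = []")
  case True
  then show ?thesis
  proof
    assume "us = []" then show ?thesis by (cases ws) (auto simp: ang_bounds)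
  next
    assume "ws = []" then show ?thesis using trn_snoc[of us v] by (cases us) (auto simp: ang_bounds)
  qed
next
  case False
  then have ne: "us \<noteq> []" "ws \<noteq> []" by auto
  have 1: "trn (us @ ws) = trn us + ang (last us) (hd ws) + trn ws"
    using ne by (induction us rule: trn.induct) (auto simp: trn_Cons)
  have 2: "trn (us @ v # ws) = trn us + ang (last us) v + (ang v (hd ws) + trn ws)"
    using trn_split[of us v ws] trn_snoc[OF ne(1), of v] trn_Cons[OF ne(2), of v] by simp
  have "last us \<noteq> 0" "hd ws \<noteq> 0" using assms ne by (metis last_in_set, metis hd_in_set)
  then show ?thesis using 1 2 ang_triangle[of "last us" v "hd ws"] assms by simp
qed

lemma trn_append: "us \<noteq> [] \<Longrightarrow> ws \<noteq> [] \<Longrightarrow> trn (us @ ws) = trn us + ang (last us) (hd ws) + trn ws"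
  by (induction us rule: trn.induct) (auto simp: trn_Cons)

text \<open>A short cut turns no more than the edges it replaces. The first two edges are merged by
  \<open>ang_cone\<close>; if they cancel, both are dropped by the triangle inequality.\<close>

lemma trn_merge:
  assumes "0 \<notin> set es" "sum_list es \<noteq> 0" "d \<noteq> 0" "d' \<noteq> 0"
  shows "ang d (sum_list es) + ang (sum_list es) d' \<le> trn (d # es @ [d'])"
  using assms
proof (induction "length es" arbitrary: es rule: less_induct)
  case less
  consider "es = []" | a where "es = [a]" | a b r where "es = a # b # r"
    by (cases es; cases "tl es") auto
  then show ?case
  proof cases
    case (3 a b r)
    have ab: "a \<noteq> 0" "b \<noteq> 0" "0 \<notin> set r" using less.prems 3 by auto
    have ne: "hd (r @ [d']) \<noteq> 0" using ab less.prems by (cases r) auto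
    obtain q qs where q: "r @ [d'] = q # qs" by (cases "r @ [d']") auto
    have q0: "q \<noteq> 0" "0 \<notin> set qs" using q ab less.prems by (metis list.sel(1) ne, metis Un_iff empty_iff insert_iff list.set(1) list.set(2) list.set_intros(2) set_append)
    show ?thesis
    proof (cases "a + b = 0")
      case True
      then have s: "sum_list es = sum_list r" using 3 by (simp add: add.assoc[symmetric])
      have "ang d (sum_list r) + ang (sum_list r) d' \<le> trn (d # r @ [d'])"
        using less.hyps[of r] 3 less.prems(2-4) ab(3) unfolding s by auto
      also have "\<dots> \<le> trn ([d] @ b # r @ [d'])"
        using trn_drop[of "[d]" "r @ [d']" b] ab less.prems by auto
      also have "\<dots> \<le> trn ([d] @ a # b # r @ [d'])"
        using trn_drop[of "[d]" "b # r @ [d']" a] ab less.prems by auto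
      finally show ?thesis unfolding s unfolding 3 by simp
    next
      case False
      have "ang d (sum_list es) + ang (sum_list es) d' \<le> trn (d # ((a + b) # r) @ [d'])"
        using less.hyps[of "(a + b) # r"] 3 less.prems ab False by (simp add: add.assoc)
      also have "\<dots> = trn (d # (a + b) # q # qs)" using q by simp
      also have "\<dots> \<le> trn (d # a # b # q # qs)"
        using trn_merge2[of qs a b q d] ab False q0 less.prems by simp
      finally show ?thesis using 3 q by simp
    qed
  qed (use less in auto)
qed

subsection \<open>Support functions\<close>

text \<open>The outer normal of a convex set that lies to the left of an oriented line of direction \<open>cis t\<close>.\<close>

definition nrm :: "real \<Rightarrow> complex" where "nrm t = - \<i> * cis t"

lemma inner_nrm: "x \<bullet> nrm t = Re x * sin t - Im x * cos t"
  by (simp add: nrm_def inner_complex_def)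

lemma inner_cis: "x \<bullet> cis t = Re x * cos t + Im x * sin t"
  by (simp add: inner_complex_def)

lemma norm_nrm [simp]: "norm (nrm t) = 1" by (simp add: nrm_def norm_mult)

lemma abs_sin_diff: "\<bar>sin a - sin b\<bar> \<le> \<bar>a - b :: real\<bar>"
proof -
  have "\<bar>sin a - sin b\<bar> = 2 * \<bar>sin ((a - b) / 2)\<bar> * \<bar>cos ((a + b) / 2)\<bar>"
    by (simp add: sin_diff_sin abs_mult)
  also have "\<dots> \<le> 2 * \<bar>(a - b) / 2\<bar> * 1"
    by (intro mult_mono abs_sin_x_le_abs_x) auto
  finally show ?thesis by simp
qed

lemma abs_cos_diff: "\<bar>cos a - cos b\<bar> \<le> \<bar>a - b :: real\<bar>"
  using abs_sin_diff[of "pi/2 - a" "pi/2 - b"] by (simp add: cos_sin_eq abs_minus_commute)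

lemma inner_nrm_lipschitz: "\<bar>x \<bullet> nrm a - x \<bullet> nrm b\<bar> \<le> 2 * norm x * \<bar>a - b\<bar>"
proof -
  have "\<bar>x \<bullet> nrm a - x \<bullet> nrm b\<bar> = \<bar>Re x * (sin a - sin b) - Im x * (cos a - cos b)\<bar>"
    by (simp add: inner_nrm algebra_simps)
  also have "\<dots> \<le> \<bar>Re x\<bar> * \<bar>sin a - sin b\<bar> + \<bar>Im x\<bar> * \<bar>cos a - cos b\<bar>"
    by (metis abs_mult abs_triangle_ineq4)
  also have "\<dots> \<le> norm x * \<bar>a - b\<bar> + norm x * \<bar>a - b\<bar>"
    by (intro add_mono mult_mono abs_sin_diff abs_cos_diff abs_Re_le_cmod abs_Im_le_cmod) auto
  finally show ?thesis by simp
qed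

text \<open>The weight is odd about pi / 2, so the integral folds into one of
  \<open>(1/2 - t/pi) * (f (pi - t) - f t)\<close> over half the interval. From \<phi> on this is
  nonnegative, before it the loss is at most half of \<open>f t\<close>. In the applications
  \<open>f\<close> is the distance of a point from a rotating support line that touches it at the
  angle \<phi>.\<close>

lemma integral_weighted_ge:
  fixes f :: "real \<Rightarrow> real"
  assumes cont: "continuous_on {0..pi} f" and nn: "\<And>t. t \<in> {0..pi} \<Longrightarrow> 0 \<le> f t"
    and \<phi>: "0 \<le> \<phi>" "\<phi> \<le> pi"
    and le: "\<And>t. \<phi> \<le> t \<Longrightarrow> t \<le> pi / 2 \<Longrightarrow> f t \<le> f (pi - t)"
  shows "integral {0..pi} (\<lambda>t. (t / pi - 1/2) * f t) \<ge> - (1/2) * integral {0..\<phi>} f"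
proof -
  let ?g = "\<lambda>t. (t / pi - 1/2) * f t"
  have cg: "continuous_on {0..pi} ?g" using cont by (intro continuous_intros) auto
  have split: "integral {0..pi} ?g = integral {0..pi/2} ?g + integral {pi/2..pi} ?g"
    using Henstock_Kurzweil_Integration.integral_combine[of 0 "pi/2" pi ?g] integrable_continuous_real[OF cg] by simp
  have "(?g has_integral integral {pi/2..pi} ?g) (cbox (pi/2) pi)"
    by (simp, intro integrable_integral integrable_continuous_real continuous_on_subset[OF cg]) auto
  from has_integral_affinity[OF this, of "-1" pi]
  have "((\<lambda>t. ?g (pi - t)) has_integral integral {pi/2..pi} ?g) ((\<lambda>x. pi - x) ` {pi/2..pi})"
    by (simp add: algebra_simps)
  moreover have "(\<lambda>x. pi - x) ` {pi/2..pi} = {0..pi/2}"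
    by (auto simp: image_iff intro!: bexI[where x = "pi - _"])
  ultimately have refl: "((\<lambda>t. ?g (pi - t)) has_integral integral {pi/2..pi} ?g) {0..pi/2}" by simp
  have ig: "(?g has_integral integral {0..pi/2} ?g) {0..pi/2}"
    by (intro integrable_integral integrable_continuous_real continuous_on_subset[OF cg]) auto
  have sum: "((\<lambda>t. (1/2 - t/pi) * (f (pi - t) - f t)) has_integral integral {0..pi} ?g) {0..pi/2}"
    unfolding split by (rule has_integral_eq[OF _ has_integral_add[OF ig refl]]) (simp add: field_simps)
  \<comment> \<open>\<phi> may exceed pi / 2, where the folded integral ends.\<close>
  define m where "m = min \<phi> (pi/2)"
  have m: "0 \<le> m" "m \<le> pi/2" "m \<le> \<phi>" using \<phi> unfolding m_def by auto
  have fm: "(f has_integral integral {0..m} f) {0..m}"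
    using m \<phi> by (intro integrable_integral integrable_continuous_real continuous_on_subset[OF cont]) auto
  have "((\<lambda>t. - (1/2) * f t) has_integral - (1/2) * integral {0..m} f) {0..m}"
    using has_integral_mult_right[OF fm, of "-(1/2)"] by simp
  moreover have "((\<lambda>t. 0) has_integral 0) {m..pi/2}" by simp
  ultimately have step: "((\<lambda>t. if t \<le> m then - (1/2) * f t else 0) has_integral - (1/2) * integral {0..m} f + 0) {0..pi/2}"
  proof (intro has_integral_combine[of 0 m "pi/2"] m)
    show "((\<lambda>t. if t \<le> m then - (1/2) * f t else 0) has_integral - (1/2) * integral {0..m} f) {0..m}"
      if "((\<lambda>t. - (1/2) * f t) has_integral - (1/2) * integral {0..m} f) {0..m}"
      using that by (rule has_integral_eq[rotated]) auto
    show "((\<lambda>t. if t \<le> m then - (1/2) * f t else 0) has_integral 0) {m..pi/2}"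
      by (rule has_integral_spike_finite[of "{m}" _ _ "\<lambda>t. 0"]) auto
  qed
  have "- (1/2) * integral {0..m} f + 0 \<le> integral {0..pi} ?g"
  proof (rule has_integral_le[OF step sum])
    fix t assume t: "t \<in> {0..pi/2}"
    have c: "0 \<le> 1/2 - t/pi" "1/2 - t/pi \<le> 1/2" using t by (auto simp: field_simps)
    have nt: "0 \<le> f t" "0 \<le> f (pi - t)" using nn t by auto
    show "(if t \<le> m then - (1/2) * f t else 0) \<le> (1/2 - t/pi) * (f (pi - t) - f t)"
    proof (cases "t \<le> m")
      case True
      have "(1/2 - t/pi) * f t \<le> 1/2 * f t" using c nt by (intro mult_right_mono) auto
      moreover have "0 \<le> (1/2 - t/pi) * f (pi - t)" using c nt by simp
      moreover have "(1/2 - t/pi) * (f (pi - t) - f t) = (1/2 - t/pi) * f (pi - t) - (1/2 - t/pi) * f t"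
        by (rule right_diff_distrib)
      ultimately have "- (1/2) * f t \<le> (1/2 - t/pi) * (f (pi - t) - f t)" by linarith
      then show ?thesis using True by simp
    next
      case False
      then have "f t \<le> f (pi - t)" using le[of t] t unfolding m_def by auto
      then show ?thesis using False c by simp
    qed
  qed
  moreover have "integral {0..m} f \<le> integral {0..\<phi>} f"
    using m \<phi> nn by (intro integral_subset_le integrable_continuous_real continuous_on_subset[OF cont]) auto
  ultimately show ?thesis by simp
qed

definition hs :: "complex set \<Rightarrow> real \<Rightarrow> real" where
  "hs K t = (SUP p\<in>K. p \<bullet> nrm t)"

text \<open>For \<open>x\<close> in \<open>K\<close> this is the distance of \<open>x\<close> from
  the support line with the direction \<open>t\<close>.\<close>

definition ds :: "complex set \<Rightarrow> complex \<Rightarrow> real \<Rightarrow> real" where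
  "ds K x t = hs K t - x \<bullet> nrm t"

text \<open>An antiderivative of the support function. By Cauchy's formula \<open>2 * pi * crad K\<close> is the perimeter
  of \<open>K\<close>, and for support points \<open>x\<close>, \<open>y\<close> in the directions \<open>t \<le> t'\<close> the difference \<open>arcpos K y t' - arcpos K x t\<close>
  is the length of the boundary arc from \<open>x\<close> to \<open>y\<close>.\<close>

definition hint :: "complex set \<Rightarrow> real \<Rightarrow> real" where
  "hint K = (SOME S. \<forall>t. (S has_real_derivative hs K t) (at t))"

definition crad :: "complex set \<Rightarrow> real" where
  "crad K = (hint K (2 * pi) - hint K 0) / (2 * pi)"

definition arcpos :: "complex set \<Rightarrow> complex \<Rightarrow> real \<Rightarrow> real" where
  "arcpos K x t = x \<bullet> cis t + hint K t"

text \<open>Subtracting the mean growth makes the boundary position periodic in the angle; it then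
  depends on the support line and not on the lift of its direction.\<close>

definition pot :: "complex set \<Rightarrow> complex \<Rightarrow> real \<Rightarrow> real" where
  "pot K x t = arcpos K x t - crad K * t"

definition supp :: "complex set \<Rightarrow> complex \<Rightarrow> real \<Rightarrow> bool" where
  "supp K x t \<longleftrightarrow> x \<in> K \<and> ds K x t = 0"

lemma nrm_2pi [simp]: "nrm (t + 2 * pi) = nrm t" by (simp add: nrm_def complex_eq_iff)
lemma nrm_pi [simp]: "nrm (t + pi) = - nrm t" by (simp add: nrm_def complex_eq_iff)
lemma hs_2pi [simp]: "hs K (t + 2 * pi) = hs K t" by (simp add: hs_def)
lemma ds_2pi [simp]: "ds K x (t + 2 * pi) = ds K x t" by (simp add: ds_def)
lemma supp_2pi [simp]: "supp K x (t + 2 * pi) = supp K x t" by (simp add: supp_def)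

lemma (in -) constant_of_zero_deriv:
  fixes f :: "real \<Rightarrow> real"
  assumes "\<And>t. (f has_real_derivative 0) (at t)"
  shows "f a = f b"
  using DERIV_const_ratio_const[of a b f 0] assms by (cases "a = b") auto

locale convex_body =
  fixes K :: "complex set"
  assumes comp: "compact K" and conv: "convex K" and ne: "K \<noteq> {}"
begin

lemma hs_upper: "p \<in> K \<Longrightarrow> p \<bullet> nrm t \<le> hs K t"
  unfolding hs_def
  by (intro cSUP_upper bounded_imp_bdd_above compact_imp_bounded compact_continuous_image comp continuous_intros) auto

lemma hs_attained: "\<exists>p\<in>K. hs K t = p \<bullet> nrm t"
proof -
  have "continuous_on K (\<lambda>p. p \<bullet> nrm t)" by (intro continuous_intros)
  from continuous_attains_sup[OF comp ne this] obtain p where p: "p \<in> K" "\<And>q. q \<in> K \<Longrightarrow> q \<bullet> nrm t \<le> p \<bullet> nrm t" by auto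
  have "hs K t \<le> p \<bullet> nrm t" unfolding hs_def using p ne by (intro cSUP_least) auto
  then show ?thesis using p hs_upper[of p t] by (intro bexI[of _ p]) auto
qed

lemma ds_nonneg: "x \<in> K \<Longrightarrow> 0 \<le> ds K x t"
  using hs_upper by (simp add: ds_def)

definition B where "B = (SOME b. b > 0 \<and> (\<forall>p\<in>K. norm p \<le> b))"

lemma B: "B > 0" "p \<in> K \<Longrightarrow> norm p \<le> B"
proof -
  have "\<exists>b. b > 0 \<and> (\<forall>p\<in>K. norm p \<le> b)" using compact_imp_bounded[OF comp] bounded_pos by metis
  then have "B > 0 \<and> (\<forall>p\<in>K. norm p \<le> B)" unfolding B_def by (rule someI_ex)
  then show "B > 0" "p \<in> K \<Longrightarrow> norm p \<le> B" by auto
qed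

lemma hs_lipschitz: "\<bar>hs K s - hs K t\<bar> \<le> 2 * B * \<bar>s - t\<bar>"
proof -
  have "hs K s - hs K t \<le> 2 * B * \<bar>s - t\<bar>" for s t
  proof -
    obtain p where p: "p \<in> K" "hs K s = p \<bullet> nrm s" using hs_attained by blast
    have "hs K s - hs K t \<le> p \<bullet> nrm s - p \<bullet> nrm t" using p hs_upper[of p t] by simp
    also have "\<dots> \<le> 2 * norm p * \<bar>s - t\<bar>" using inner_nrm_lipschitz[of p s t] by linarith
    also have "\<dots> \<le> 2 * B * \<bar>s - t\<bar>" using B(2)[OF p(1)] by (intro mult_right_mono) auto
    finally show ?thesis .
  qed
  from this[of s t] this[of t s] show ?thesis by (simp add: abs_le_iff abs_minus_commute)
qed

lemma ds_lipschitz: "x \<in> K \<Longrightarrow> \<bar>ds K x s - ds K x t\<bar> \<le> 4 * B * \<bar>s - t\<bar>"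
proof -
  assume x: "x \<in> K"
  have "\<bar>x \<bullet> nrm s - x \<bullet> nrm t\<bar> \<le> 2 * B * \<bar>s - t\<bar>"
    using inner_nrm_lipschitz[of x s t] B(2)[OF x] by (smt (verit) mult_right_mono abs_ge_zero)
  then show ?thesis using hs_lipschitz[of s t] unfolding ds_def by linarith
qed

lemma continuous_hs: "continuous_on UNIV (hs K)"
proof (rule continuous_on_iff[THEN iffD2], intro ballI allI impI)
  fix t e :: real assume e: "e > 0"
  show "\<exists>d>0. \<forall>s\<in>UNIV. dist s t < d \<longrightarrow> dist (hs K s) (hs K t) < e"
  proof (intro exI[of _ "e / (2 * B)"] conjI ballI impI)
    show "e / (2 * B) > 0" using e B by simp
    fix s assume "dist s t < e / (2 * B)"
    then have "2 * B * \<bar>s - t\<bar> < e" using B(1) by (simp add: dist_real_def field_simps)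
    then show "dist (hs K s) (hs K t) < e" using hs_lipschitz[of s t] by (simp add: dist_real_def)
  qed
qed

lemma continuous_ds: "continuous_on A (ds K x)"
  unfolding ds_def nrm_def
  by (intro continuous_intros continuous_on_subset[OF continuous_hs]) (auto simp: cis_conv_exp intro!: continuous_intros)

lemma (in -) antideriv:
  assumes "continuous_on UNIV (f :: real \<Rightarrow> real)"
  shows "\<exists>F. \<forall>t. (F has_real_derivative f t) (at t)"
proof -
  have "\<exists>F. \<forall>x :: real. -\<infinity> < ereal x \<longrightarrow> ereal x < \<infinity> \<longrightarrow> (F has_vector_derivative f x) (at x)"
    by (rule einterval_antiderivative) (use assms in \<open>auto simp: continuous_on_eq_continuous_at\<close>)
  then show ?thesis by (auto simp: has_real_derivative_iff_has_vector_derivative)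
qed

lemma hint_deriv: "(hint K has_real_derivative hs K t) (at t)"
proof -
  have "\<forall>t. (hint K has_real_derivative hs K t) (at t)"
    unfolding hint_def by (rule someI_ex[OF antideriv[OF continuous_hs]])
  then show ?thesis by blast
qed

lemma hint_2pi: "hint K (t + 2 * pi) = hint K t + 2 * pi * crad K"
proof -
  have "((\<lambda>t. hint K (t + 2 * pi) - hint K t) has_real_derivative 0) (at t)" for t
    by (auto intro!: derivative_eq_intros DERIV_chain2[OF hint_deriv] hint_deriv)
  from constant_of_zero_deriv[OF this, of t 0]
  have "hint K (t + 2 * pi) - hint K t = hint K (2 * pi) - hint K 0" by simp
  moreover have "2 * pi * crad K = hint K (2 * pi) - hint K 0" by (simp add: crad_def)
  ultimately show ?thesis by linarith
qed

text \<open>\<open>cis t\<close> has the derivative \<open>- nrm t\<close>. Boundary arcs are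
  thereby integrals of one nonnegative function, the distance from the rotating support
  line.\<close>

lemma arcpos_deriv: "(arcpos K x has_real_derivative ds K x t) (at t)"
proof -
  have 1: "arcpos K x = (\<lambda>t. Re x * cos t + Im x * sin t + hint K t)"
    by (simp add: arcpos_def inner_cis fun_eq_iff)
  show ?thesis unfolding 1 ds_def inner_nrm
    by (auto intro!: derivative_eq_intros hint_deriv)
qed

lemma arcpos_mono: "x \<in> K \<Longrightarrow> s \<le> t \<Longrightarrow> arcpos K x s \<le> arcpos K x t"
  by (rule DERIV_nonneg_imp_nondecreasing) (use arcpos_deriv ds_nonneg in blast)+

lemma arcpos_2pi: "arcpos K x (t + 2 * pi) = arcpos K x t + 2 * pi * crad K"
proof -
  have "cis (t + 2 * pi) = cis t" by (simp add: complex_eq_iff)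
  then show ?thesis unfolding arcpos_def hint_2pi by simp
qed

lemma pot_2pi [simp]: "pot K x (t + 2 * pi) = pot K x t"
  unfolding pot_def arcpos_2pi by (simp add: algebra_simps)

lemma has_integral_ds: "a \<le> b \<Longrightarrow> (ds K x has_integral (arcpos K x b - arcpos K x a)) {a..b}"
  by (rule fundamental_theorem_of_calculus)
    (use arcpos_deriv in \<open>auto simp: has_real_derivative_iff_has_vector_derivative intro: has_vector_derivative_at_within\<close>)

text \<open>Trigonometric convexity of the support function: a single point contributes a sinusoid,
  for which equality holds, and the point attaining the support at \<open>t2\<close> is dominated at
  \<open>t1\<close> and \<open>t3\<close>.\<close>

lemma ds_sublinear:
  assumes "t1 \<le> t2" "t2 \<le> t3" "t3 - t1 \<le> pi"
  shows "ds K x t2 * sin (t3 - t1) \<le> ds K x t1 * sin (t3 - t2) + ds K x t3 * sin (t2 - t1)"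
proof -
  obtain p where p: "p \<in> K" "hs K t2 = p \<bullet> nrm t2" using hs_attained by blast
  define q where "q = p - x"
  have id: "(q \<bullet> nrm t2) * sin (t3 - t1) = (q \<bullet> nrm t1) * sin (t3 - t2) + (q \<bullet> nrm t3) * sin (t2 - t1)"
  proof -
    have a: "sin t2 * sin (t3 - t1) = sin t1 * sin (t3 - t2) + sin t3 * sin (t2 - t1)"
      by (simp add: sin_diff algebra_simps)
    have b: "cos t2 * sin (t3 - t1) = cos t1 * sin (t3 - t2) + cos t3 * sin (t2 - t1)"
      by (simp add: sin_diff algebra_simps)
    have "(q \<bullet> nrm t2) * sin (t3 - t1) = Re q * (sin t2 * sin (t3 - t1)) - Im q * (cos t2 * sin (t3 - t1))"
      by (simp add: inner_nrm algebra_simps)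
    then show ?thesis unfolding a b by (simp add: inner_nrm algebra_simps)
  qed
  have "ds K x t2 = q \<bullet> nrm t2" using p by (simp add: ds_def q_def inner_diff_left)
  moreover have "q \<bullet> nrm t1 \<le> ds K x t1" "q \<bullet> nrm t3 \<le> ds K x t3"
    using hs_upper[OF p(1)] by (auto simp: ds_def q_def inner_diff_left)
  moreover have "0 \<le> sin (t3 - t2)" "0 \<le> sin (t2 - t1)" using assms by (auto intro!: sin_ge_zero)
  ultimately show ?thesis using id by (simp add: add_mono mult_right_mono)
qed

lemma sin_le_of_sum_le_pi: "0 \<le> a \<Longrightarrow> a \<le> b \<Longrightarrow> a + b \<le> pi \<Longrightarrow> sin a \<le> sin (b :: real)"
proof -
  assume a: "0 \<le> a" "a \<le> b" "a + b \<le> pi"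
  have "sin b - sin a = 2 * sin ((b - a) / 2) * cos ((b + a) / 2)" by (simp add: sin_diff_sin)
  moreover have "0 \<le> sin ((b - a) / 2)" using a by (intro sin_ge_zero) auto
  moreover have "0 \<le> cos ((b + a) / 2)" using a by (intro cos_ge_zero) auto
  ultimately show "sin a \<le> sin b" by (smt (verit) mult_nonneg_nonneg)
qed

text \<open>The distance vanishes at the support angle \<theta>. Of two positions on the same side
  of \<theta> that are mirror images about \<omega> - pi / 2, trigonometric convexity makes the
  farther one have the larger distance. This is the monotonicity condition of
  \<open>integral_weighted_ge\<close>.\<close>

lemma ds_reflect_back:
  assumes "x \<in> K" "ds K x \<theta> = 0" "0 \<le> \<phi>" "\<phi> \<le> t" "t \<le> pi / 2" "\<theta> = \<omega> - \<phi>"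
  shows "ds K x (\<omega> - t) \<le> ds K x (\<omega> - (pi - t))"
proof (cases "t = \<phi>")
  case True
  then show ?thesis using assms ds_nonneg by simp
next
  case False
  have "ds K x (\<omega> - t) * sin (\<theta> - (\<omega> - (pi - t))) \<le> ds K x (\<omega> - (pi - t)) * sin (\<theta> - (\<omega> - t)) + ds K x \<theta> * sin (\<omega> - t - (\<omega> - (pi - t)))"
    by (rule ds_sublinear) (use assms in auto)
  then have 1: "ds K x (\<omega> - t) * sin (pi - t - \<phi>) \<le> ds K x (\<omega> - (pi - t)) * sin (t - \<phi>)"
    using assms by (simp add: algebra_simps)
  have "sin (t - \<phi>) \<le> sin (pi - t - \<phi>)" using assms by (intro sin_le_of_sum_le_pi) auto
  then have "ds K x (\<omega> - (pi - t)) * sin (t - \<phi>) \<le> ds K x (\<omega> - (pi - t)) * sin (pi - t - \<phi>)"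
    using ds_nonneg[OF assms(1)] by (intro mult_left_mono) auto
  with 1 have "ds K x (\<omega> - t) * sin (pi - t - \<phi>) \<le> ds K x (\<omega> - (pi - t)) * sin (pi - t - \<phi>)" by linarith
  moreover have "0 < sin (pi - t - \<phi>)" using assms False by (intro sin_gt_zero) auto
  ultimately show ?thesis by simp
qed

lemma ds_reflect_forw:
  assumes "x \<in> K" "ds K x \<theta> = 0" "0 \<le> \<phi>" "\<phi> \<le> t" "t \<le> pi / 2" "\<theta> = \<omega> + \<phi>"
  shows "ds K x (\<omega> + t) \<le> ds K x (\<omega> + (pi - t))"
proof (cases "t = \<phi>")
  case True
  then show ?thesis using assms ds_nonneg by simp
next
  case False
  have "ds K x (\<omega> + t) * sin ((\<omega> + (pi - t)) - \<theta>) \<le> ds K x \<theta> * sin ((\<omega> + (pi - t)) - (\<omega> + t)) + ds K x (\<omega> + (pi - t)) * sin ((\<omega> + t) - \<theta>)"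
    by (rule ds_sublinear) (use assms in auto)
  then have 1: "ds K x (\<omega> + t) * sin (pi - t - \<phi>) \<le> ds K x (\<omega> + (pi - t)) * sin (t - \<phi>)"
    using assms by (simp add: algebra_simps)
  have "sin (t - \<phi>) \<le> sin (pi - t - \<phi>)" using assms by (intro sin_le_of_sum_le_pi) auto
  then have "ds K x (\<omega> + (pi - t)) * sin (t - \<phi>) \<le> ds K x (\<omega> + (pi - t)) * sin (pi - t - \<phi>)"
    using ds_nonneg[OF assms(1)] by (intro mult_left_mono) auto
  with 1 have "ds K x (\<omega> + t) * sin (pi - t - \<phi>) \<le> ds K x (\<omega> + (pi - t)) * sin (pi - t - \<phi>)" by linarith
  moreover have "0 < sin (pi - t - \<phi>)" using assms False by (intro sin_gt_zero) auto
  ultimately show ?thesis by simp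
qed

end

subsection \<open>Chords of a convex body\<close>

lemma cis_eqE:
  assumes "cis a = cis b"
  obtains k :: int where "a = b + 2 * pi * real_of_int k"
proof -
  have "sin a = sin b \<and> cos a = cos b" using assms by (metis cis.sel)
  then show ?thesis using that sin_cos_eq_iff[of a b] by blast
qed

lemma deriv_shift:
  assumes "\<And>u. (f has_real_derivative f' u) (at u)"
  shows "((\<lambda>t. f (w + t)) has_real_derivative f' (w + t)) (at t)"
    "((\<lambda>t. f (w - t)) has_real_derivative - f' (w - t)) (at t)"
proof -
  have 1: "((\<lambda>t. w + t) has_real_derivative 1) (at t)" by (auto intro!: derivative_eq_intros)
  have 2: "((\<lambda>t. w - t) has_real_derivative - 1) (at t)" by (auto intro!: derivative_eq_intros)
  show "((\<lambda>t. f (w + t)) has_real_derivative f' (w + t)) (at t)" using DERIV_chain2[OF assms 1] by simp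
  show "((\<lambda>t. f (w - t)) has_real_derivative - f' (w - t)) (at t)" using DERIV_chain2[OF assms 2] by simp
qed

lemma inner_of_real_cis: "(of_real r * cis w) \<bullet> cis w = r"
proof -
  have "cis w \<bullet> cis w = 1" using norm_cis[of w] by (simp only: norm_eq_1)
  then show ?thesis by (simp add: scaleR_conv_of_real[symmetric])
qed

text \<open>A curve that touches the boundary of \<open>K\<close> at a point with support angle \<open>t\<close> has there the direction
  \<open>sdir s t\<close>, where \<open>s\<close> tells whether it runs counterclockwise. Its potential is \<open>spot K s x t\<close>; the reflection
  at the mean value of \<open>pot\<close> accounts for the change of the sense.\<close>

definition sdir :: "bool \<Rightarrow> real \<Rightarrow> complex" where
  "sdir s t = (if s then cis t else - cis t)"

lemma sdir_nz [simp]: "sdir s t \<noteq> 0" by (simp add: sdir_def)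

definition hint2 :: "complex set \<Rightarrow> real \<Rightarrow> real" where
  "hint2 K = (SOME H. \<forall>t. (H has_real_derivative hint K t - crad K * t) (at t))"

text \<open>This is the mean of \<open>pot K x\<close> over a period, for every \<open>x\<close>,
  because \<open>x \<bullet> cis t\<close> has the mean 0.\<close>

definition pmean :: "complex set \<Rightarrow> real" where
  "pmean K = (hint2 K pi - hint2 K (- pi)) / (2 * pi)"

definition spot :: "complex set \<Rightarrow> bool \<Rightarrow> complex \<Rightarrow> real \<Rightarrow> real" where
  "spot K s x t = (if s then pot K x t else 2 * pmean K - pot K x t)"

context convex_body
begin

lemma pot_cis_cong:
  assumes "cis a = cis b"
  shows "pot K x a = pot K x b"
proof -
  have n: "pot K x (t + 2 * pi * real n) = pot K x t" for t and n :: nat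
  proof (induction n)
    case (Suc n)
    have "pot K x (t + 2 * pi * real (Suc n)) = pot K x ((t + 2 * pi * real n) + 2 * pi)" by (simp add: algebra_simps)
    then show ?case using Suc pot_2pi by simp
  qed simp
  obtain k :: int where k: "a = b + 2 * pi * real_of_int k" using cis_eqE[OF assms] by blast
  show ?thesis
  proof (cases "k \<ge> 0")
    case True then show ?thesis using k n[of b "nat k"] by simp
  next
    case False
    then have "b = a + 2 * pi * real (nat (- k))" using k by simp
    then show ?thesis using n[of a "nat (- k)"] by simp
  qed
qed

lemma ds_cis_cong: "cis a = cis b \<Longrightarrow> ds K x a = ds K x b"
  by (simp add: ds_def hs_def nrm_def)

lemma supp_cis_cong: "cis a = cis b \<Longrightarrow> supp K x a \<longleftrightarrow> supp K x b"
  using ds_cis_cong[of a b x] by (auto simp: supp_def)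

text \<open>\<open>K\<close> lies to the left of the support line at \<open>x\<close>, so every
  chord leaves \<open>x\<close> to the left. With this lift the angle is a plain difference.\<close>

lemma lift_out:
  assumes "supp K x \<theta>" "y \<in> K" "y \<noteq> x"
  obtains \<omega> where "\<theta> \<le> \<omega>" "\<omega> \<le> \<theta> + pi" "y - x = of_real (norm (y - x)) * cis \<omega>"
    "ang (cis \<theta>) (y - x) = \<omega> - \<theta>"
proof -
  define z where "z = (y - x) / cis \<theta>"
  have "(y - x) \<bullet> nrm \<theta> \<le> 0"
    using assms hs_upper[of y \<theta>] by (auto simp: supp_def ds_def inner_diff_left)
  moreover have "Im z = - ((y - x) \<bullet> nrm \<theta>)"
    by (simp add: z_def inner_nrm Im_divide algebra_simps power2_eq_square[symmetric])
  ultimately have "0 \<le> Arg z" by (simp add: Arg_less_0)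
  moreover have "Arg z \<le> pi" using Arg_bounded by auto
  moreover have "z = of_real (norm z) * cis (Arg z)" by (metis rcis_cmod_Arg rcis_def)
  then have "y - x = of_real (norm (y - x)) * cis (\<theta> + Arg z)"
    by (simp add: z_def norm_divide cis_mult[symmetric] field_simps)
  moreover have "ang (cis \<theta>) (y - x) = Arg z" using \<open>0 \<le> Arg z\<close> by (simp add: ang_def z_def)
  ultimately show ?thesis using that[of "\<theta> + Arg z"] by simp
qed

text \<open>The end tangent is lifted relative to the chord and not to the start tangent; the whole
  boundary arc from \<open>x\<close> to \<open>y\<close> then has an angle between 0 and 2 *
  pi.\<close>

lemma lift_in:
  assumes "supp K y \<theta>" "x \<in> K" "y \<noteq> x" "y - x = of_real (norm (y - x)) * cis \<omega>"
  obtains \<theta>' where "\<omega> \<le> \<theta>'" "\<theta>' \<le> \<omega> + pi" "cis \<theta>' = cis \<theta>"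
    "ang (y - x) (cis \<theta>) = \<theta>' - \<omega>"
proof -
  define z where "z = cis \<theta> / (y - x)"
  have nz: "y - x \<noteq> 0" using assms by simp
  have "(x - y) \<bullet> nrm \<theta> \<le> 0"
    using assms hs_upper[of x \<theta>] by (auto simp: supp_def ds_def inner_diff_left)
  moreover have "Im z = - ((x - y) \<bullet> nrm \<theta>) / (norm (y - x))\<^sup>2"
    unfolding z_def cmod_power2 by (simp add: inner_nrm Im_divide diff_divide_distrib[symmetric] algebra_simps)
  ultimately have "0 \<le> Arg z" by (simp add: Arg_less_0 divide_nonpos_nonneg)
  moreover have "Arg z \<le> pi" using Arg_bounded by auto
  moreover have "cis (\<omega> + Arg z) = cis \<theta>"
  proof -
    have "z = of_real (norm z) * cis (Arg z)" by (metis rcis_cmod_Arg rcis_def)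
    then have "cis \<theta> = (y - x) * (of_real (norm z) * cis (Arg z))" using nz by (simp add: z_def field_simps)
    also have "\<dots> = of_real (norm (y - x)) * cis \<omega> * (of_real (norm z) * cis (Arg z))" using assms(4) by simp
    also have "\<dots> = of_real (norm (y - x) * norm z) * cis (\<omega> + Arg z)" by (simp add: cis_mult[symmetric])
    also have "norm (y - x) * norm z = 1" using nz by (simp add: z_def norm_divide)
    finally show ?thesis by simp
  qed
  moreover have "ang (y - x) (cis \<theta>) = Arg z" using \<open>0 \<le> Arg z\<close> by (simp add: ang_def z_def)
  ultimately show ?thesis using that[of "\<omega> + Arg z"] by simp
qed

section \<open>Weighted averages of the distance from a rotating support line\<close>

lemma hint2_deriv: "(hint2 K has_real_derivative hint K t - crad K * t) (at t)"
proof -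
  have "continuous_on UNIV (\<lambda>t. hint K t - crad K * t)"
    by (intro continuous_intros DERIV_continuous_on[OF has_field_derivative_at_within[OF hint_deriv]])
  then have "\<forall>t. (hint2 K has_real_derivative hint K t - crad K * t) (at t)"
    unfolding hint2_def by (rule someI_ex[OF antideriv])
  then show ?thesis by blast
qed

lemma hint2_window: "hint2 K (\<omega> + pi) - hint2 K (\<omega> - pi) = 2 * pi * pmean K"
proof -
  have g: "hint K (\<omega> + pi) - crad K * (\<omega> + pi) = hint K (\<omega> - pi) - crad K * (\<omega> - pi)" for \<omega>
    using hint_2pi[of "\<omega> - pi"] by (simp add: algebra_simps)
  have d1: "((\<lambda>\<omega>. hint2 K (\<omega> + pi)) has_real_derivative hint K (t + pi) - crad K * (t + pi)) (at t)" for t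
    using hint2_deriv[of "t + pi"] by (simp only: DERIV_shift)
  have d2: "((\<lambda>\<omega>. hint2 K (\<omega> - pi)) has_real_derivative hint K (t - pi) - crad K * (t - pi)) (at t)" for t
    using hint2_deriv[of "t + - pi"] unfolding DERIV_shift by simp
  have "((\<lambda>\<omega>. hint2 K (\<omega> + pi) - hint2 K (\<omega> - pi)) has_real_derivative 0) (at t)" for t
    using DERIV_diff[OF d1 d2, of t] g[of t] by simp
  from constant_of_zero_deriv[OF this, of \<omega> 0] show ?thesis by (simp add: pmean_def)
qed

text \<open>An antiderivative of \<open>arcpos K x\<close>; only its first summand contains
  \<open>x\<close>, so that the contributions of two different points can be joined.\<close>

definition aint :: "complex \<Rightarrow> real \<Rightarrow> real" where
  "aint x t = x \<bullet> nrm t + hint2 K t + crad K * t\<^sup>2 / 2"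

lemma aint_deriv: "(aint x has_real_derivative arcpos K x t) (at t)"
proof -
  have 1: "aint x = (\<lambda>t. Re x * sin t - Im x * cos t + hint2 K t + crad K * t\<^sup>2 / 2)"
    by (simp add: aint_def inner_nrm fun_eq_iff)
  show ?thesis unfolding 1 arcpos_def inner_cis
    by (auto intro!: derivative_eq_intros hint2_deriv)
qed

lemma weighted_back:
  "((\<lambda>t. (t / pi - 1/2) * ds K x (\<omega> - t)) has_integral
    ((aint x \<omega> - aint x (\<omega> - pi)) / pi - (arcpos K x (\<omega> - pi) + arcpos K x \<omega>) / 2)) {0..pi}"
proof -
  define F where "F t = - (t / pi - 1/2) * arcpos K x (\<omega> - t) - aint x (\<omega> - t) / pi" for t
  have "(F has_vector_derivative ((t / pi - 1/2) * ds K x (\<omega> - t))) (at t within {0..pi})" for t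
  proof -
    have "(F has_real_derivative ((t / pi - 1/2) * ds K x (\<omega> - t))) (at t)"
      unfolding F_def
      by ((rule deriv_shift[OF arcpos_deriv] deriv_shift[OF aint_deriv] derivative_eq_intros refl | simp)+, simp add: field_simps)
    then show ?thesis by (simp add: has_real_derivative_iff_has_vector_derivative has_vector_derivative_at_within)
  qed
  then have "((\<lambda>t. (t / pi - 1/2) * ds K x (\<omega> - t)) has_integral (F pi - F 0)) {0..pi}"
    by (intro fundamental_theorem_of_calculus) auto
  moreover have "F pi - F 0 = (aint x \<omega> - aint x (\<omega> - pi)) / pi - (arcpos K x (\<omega> - pi) + arcpos K x \<omega>) / 2"
    by (simp add: F_def field_simps)
  ultimately show ?thesis by simp
qed

lemma weighted_forw:
  "((\<lambda>t. (t / pi - 1/2) * ds K x (\<omega> + t)) has_integral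
    ((arcpos K x (\<omega> + pi) + arcpos K x \<omega>) / 2 - (aint x (\<omega> + pi) - aint x \<omega>) / pi)) {0..pi}"
proof -
  define F where "F t = (t / pi - 1/2) * arcpos K x (\<omega> + t) - aint x (\<omega> + t) / pi" for t
  have "(F has_vector_derivative ((t / pi - 1/2) * ds K x (\<omega> + t))) (at t within {0..pi})" for t
  proof -
    have "(F has_real_derivative ((t / pi - 1/2) * ds K x (\<omega> + t))) (at t)"
    proof -
      have 1: "((\<lambda>t. t / pi - 1/2) has_real_derivative 1 / pi) (at t)" by (auto intro!: derivative_eq_intros)
      have 2: "((\<lambda>t. arcpos K x (\<omega> + t)) has_real_derivative ds K x (\<omega> + t)) (at t)"
        by (rule deriv_shift(1)[OF arcpos_deriv])
      have 3: "((\<lambda>t. aint x (\<omega> + t)) has_real_derivative arcpos K x (\<omega> + t)) (at t)"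
        by (rule deriv_shift(1)[OF aint_deriv])
      show ?thesis unfolding F_def
        by (rule DERIV_cong[OF DERIV_diff[OF DERIV_mult[OF 1 2] DERIV_cdivide[OF 3, of pi]]]) (simp add: field_simps)
    qed
    then show ?thesis by (simp add: has_real_derivative_iff_has_vector_derivative has_vector_derivative_at_within)
  qed
  then have "((\<lambda>t. (t / pi - 1/2) * ds K x (\<omega> + t)) has_integral (F pi - F 0)) {0..pi}"
    by (intro fundamental_theorem_of_calculus) auto
  moreover have "F pi - F 0 = (arcpos K x (\<omega> + pi) + arcpos K x \<omega>) / 2 - (aint x (\<omega> + pi) - aint x \<omega>) / pi"
    by (simp add: F_def field_simps)
  ultimately show ?thesis by simp
qed

lemma continuous_ds_comp: "continuous_on S f \<Longrightarrow> continuous_on S (\<lambda>t. ds K x (f t))"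
  by (rule continuous_on_compose2[OF continuous_ds[of UNIV]]) auto

lemma has_integral_ds_back:
  "0 \<le> b \<Longrightarrow> ((\<lambda>t. ds K x (\<omega> - t)) has_integral (arcpos K x \<omega> - arcpos K x (\<omega> - b))) {0..b}"
proof -
  assume b: "0 \<le> b"
  have "((\<lambda>t. - arcpos K x (\<omega> - t)) has_vector_derivative ds K x (\<omega> - t)) (at t within {0..b})" for t
    unfolding has_real_derivative_iff_has_vector_derivative[symmetric]
    by (rule has_field_derivative_at_within) (auto intro!: derivative_eq_intros deriv_shift(2)[OF arcpos_deriv])
  then have "((\<lambda>t. ds K x (\<omega> - t)) has_integral (- arcpos K x (\<omega> - b) - - arcpos K x (\<omega> - 0))) {0..b}"
    by (intro fundamental_theorem_of_calculus b)
  then show ?thesis by simp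
qed

lemma has_integral_ds_forw:
  "0 \<le> b \<Longrightarrow> ((\<lambda>t. ds K x (\<omega> + t)) has_integral (arcpos K x (\<omega> + b) - arcpos K x \<omega>)) {0..b}"
proof -
  assume b: "0 \<le> b"
  have "((\<lambda>t. arcpos K x (\<omega> + t)) has_vector_derivative ds K x (\<omega> + t)) (at t within {0..b})" for t
    unfolding has_real_derivative_iff_has_vector_derivative[symmetric]
    by (rule has_field_derivative_at_within) (rule deriv_shift(1)[OF arcpos_deriv])
  then have "((\<lambda>t. ds K x (\<omega> + t)) has_integral (arcpos K x (\<omega> + b) - arcpos K x (\<omega> + 0))) {0..b}"
    by (intro fundamental_theorem_of_calculus b)
  then show ?thesis by simp
qed

text \<open>The weighted integral can lose at most half of the arc between \<theta> and \<omega>.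
  Adding the whole arc leaves one half, and this half later pays for a change of the sense.\<close>

lemma back_slack:
  assumes "supp K x \<theta>" "\<theta> \<le> \<omega>" "\<omega> \<le> \<theta> + pi"
  shows "(aint x \<omega> - aint x (\<omega> - pi)) / pi - (arcpos K x (\<omega> - pi) + arcpos K x \<omega>) / 2
    + (arcpos K x \<omega> - arcpos K x \<theta>) \<ge> integral {0..\<omega> - \<theta>} (\<lambda>t. ds K x (\<omega> - t)) / 2"
proof -
  have x: "x \<in> K" "ds K x \<theta> = 0" using assms by (auto simp: supp_def)
  have "integral {0..pi} (\<lambda>t. (t / pi - 1/2) * ds K x (\<omega> - t)) \<ge> - (1/2) * integral {0..\<omega> - \<theta>} (\<lambda>t. ds K x (\<omega> - t))"
  proof (rule integral_weighted_ge)
    show "ds K x (\<omega> - t) \<le> ds K x (\<omega> - (pi - t))" if "\<omega> - \<theta> \<le> t" "t \<le> pi / 2" for t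
      using ds_reflect_back[OF x, of "\<omega> - \<theta>" t \<omega>] that assms by simp
  qed (use assms x ds_nonneg in \<open>auto intro!: continuous_ds_comp continuous_intros\<close>)
  moreover have "integral {0..\<omega> - \<theta>} (\<lambda>t. ds K x (\<omega> - t)) = arcpos K x \<omega> - arcpos K x \<theta>"
    using has_integral_ds_back[of "\<omega> - \<theta>" x \<omega>] assms by (simp add: integral_unique)
  ultimately show ?thesis unfolding integral_unique[OF weighted_back[of x \<omega>]] by linarith
qed

lemma forw_slack:
  assumes "supp K x \<theta>" "\<omega> \<le> \<theta>" "\<theta> \<le> \<omega> + pi"
  shows "0 \<le> (arcpos K x (\<omega> + pi) + arcpos K x \<omega>) / 2 - (aint x (\<omega> + pi) - aint x \<omega>) / pi
    + (arcpos K x \<theta> - arcpos K x \<omega>)"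
proof -
  have x: "x \<in> K" "ds K x \<theta> = 0" using assms by (auto simp: supp_def)
  have "integral {0..pi} (\<lambda>t. (t / pi - 1/2) * ds K x (\<omega> + t)) \<ge> - (1/2) * integral {0..\<theta> - \<omega>} (\<lambda>t. ds K x (\<omega> + t))"
  proof (rule integral_weighted_ge)
    show "ds K x (\<omega> + t) \<le> ds K x (\<omega> + (pi - t))" if "\<theta> - \<omega> \<le> t" "t \<le> pi / 2" for t
      using ds_reflect_forw[OF x, of "\<theta> - \<omega>" t \<omega>] that assms by simp
  qed (use assms x ds_nonneg in \<open>auto intro!: continuous_ds_comp continuous_intros\<close>)
  moreover have "integral {0..\<theta> - \<omega>} (\<lambda>t. ds K x (\<omega> + t)) = arcpos K x \<theta> - arcpos K x \<omega>"
    using has_integral_ds_forw[of "\<theta> - \<omega>" x \<omega>] assms by (simp add: integral_unique)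
  moreover have "arcpos K x \<omega> \<le> arcpos K x \<theta>" using arcpos_mono x assms by simp
  ultimately show ?thesis unfolding integral_unique[OF weighted_forw[of x \<omega>]] by linarith
qed

text \<open>Here \<open>x\<close> is left with the tangent direction \<open>\<theta>\<close> and \<open>y\<close> is reached with the tangent direction \<open>\<theta>'\<close>;
  the chord from \<open>x\<close> to \<open>y\<close> has the direction \<open>\<omega>\<close>.\<close>

lemma chord_pp:
  assumes "x \<in> K" "y \<in> K" "y - x = of_real (norm (y - x)) * cis \<omega>" "\<theta> \<le> \<omega>" "\<omega> \<le> \<theta>'"
  shows "norm (y - x) \<le> arcpos K y \<theta>' - arcpos K x \<theta>"
proof -
  have "(y - x) \<bullet> cis \<omega> = norm (y - x)" by (subst assms(3)) (rule inner_of_real_cis)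
  then have "arcpos K y \<omega> - arcpos K x \<omega> = norm (y - x)" by (simp add: arcpos_def inner_diff_left)
  then show ?thesis using arcpos_mono assms by (smt (verit))
qed

lemma chord_nrm:
  assumes "y - x = of_real (norm (y - x)) * cis \<omega>"
  shows "y \<bullet> nrm \<omega> = x \<bullet> nrm \<omega>" "y \<bullet> cis \<omega> = x \<bullet> cis \<omega> + norm (y - x)"
proof -
  have "(y - x) \<bullet> nrm \<omega> = 0" by (subst assms) (simp add: inner_nrm)
  then show "y \<bullet> nrm \<omega> = x \<bullet> nrm \<omega>" by (simp add: inner_diff_left)
  have "(y - x) \<bullet> cis \<omega> = norm (y - x)" by (subst assms) (rule inner_of_real_cis)
  then show "y \<bullet> cis \<omega> = x \<bullet> cis \<omega> + norm (y - x)" by (simp add: inner_diff_left)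
qed

text \<open>The end points of a chord have the same component normal to it. The half period before
  \<omega>, taken at \<open>x\<close>, and the one after it, taken at \<open>y\<close>, therefore
  join to a full period, whose integral depends on \<omega> only through the mean growth.\<close>

lemma aint_window:
  assumes "y \<bullet> nrm \<omega> = x \<bullet> nrm \<omega>"
  shows "(aint x \<omega> - aint x (\<omega> - pi)) / pi + (aint y (\<omega> + pi) - aint y \<omega>) / pi = 2 * pmean K + 2 * crad K * \<omega>"
proof -
  have m: "nrm (\<omega> - pi) = - nrm \<omega>" "nrm (\<omega> + pi) = - nrm \<omega>" by (simp_all add: nrm_def complex_eq_iff)
  have "aint x \<omega> - aint x (\<omega> - pi) + (aint y (\<omega> + pi) - aint y \<omega>) = hint2 K (\<omega> + pi) - hint2 K (\<omega> - pi) + 2 * crad K * \<omega> * pi"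
    unfolding aint_def m using assms by (simp add: power2_eq_square field_simps)
  also have "\<dots> = pi * (2 * pmean K + 2 * crad K * \<omega>)" unfolding hint2_window by (simp add: algebra_simps)
  finally show ?thesis by (simp add: add_divide_distrib[symmetric])
qed

lemma arcpos_pi: "arcpos K x (\<omega> + pi) = - (x \<bullet> cis \<omega>) + hint K (\<omega> + pi)"
    "arcpos K x (\<omega> - pi) = - (x \<bullet> cis \<omega>) + hint K (\<omega> - pi)"
    "hint K (\<omega> + pi) = hint K (\<omega> - pi) + 2 * pi * crad K"
proof -
  have "\<omega> - pi + 2 * pi = \<omega> + pi" by simp
  then show "hint K (\<omega> + pi) = hint K (\<omega> - pi) + 2 * pi * crad K" using hint_2pi[of "\<omega> - pi"] by (simp only:)
qed (simp_all add: arcpos_def inner_cis)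

text \<open>The chord leaves \<open>x\<close> counterclockwise and reaches \<open>y\<close>
  clockwise, so no boundary arc bounds it. Instead the slack inequalities of \<open>x\<close> at
  \<omega> and of \<open>y\<close> at \<omega> + pi are added; the remaining integrals are kept as
  the cost of the change.\<close>

lemma chord_pm:
  assumes "supp K x \<theta>" "supp K y \<theta>'" "y - x = of_real (norm (y - x)) * cis \<omega>"
    "\<theta> \<le> \<omega>" "\<omega> \<le> \<theta> + pi" "\<omega> \<le> \<theta>'" "\<theta>' \<le> \<omega> + pi"
  shows "norm (y - x) - crad K * ((\<omega> - \<theta>) + (pi - (\<theta>' - \<omega>))) + pot K x \<theta> + pot K y \<theta>'
    + (integral {0..\<omega> - \<theta>} (\<lambda>t. ds K x (\<omega> - t)) + integral {0..\<omega> + pi - \<theta>'} (\<lambda>t. ds K y (\<omega> + pi - t))) / 2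
    \<le> 2 * pmean K"
proof -
  note n = chord_nrm[OF assms(3)]
  have 1: "(aint x \<omega> - aint x (\<omega> - pi)) / pi - (arcpos K x (\<omega> - pi) + arcpos K x \<omega>) / 2
    + (arcpos K x \<omega> - arcpos K x \<theta>) \<ge> integral {0..\<omega> - \<theta>} (\<lambda>t. ds K x (\<omega> - t)) / 2"
    by (rule back_slack) fact+
  have 2: "(aint y (\<omega> + pi) - aint y \<omega>) / pi - (arcpos K y \<omega> + arcpos K y (\<omega> + pi)) / 2
    + (arcpos K y (\<omega> + pi) - arcpos K y \<theta>') \<ge> integral {0..\<omega> + pi - \<theta>'} (\<lambda>t. ds K y (\<omega> + pi - t)) / 2"
    using back_slack[OF assms(2), of "\<omega> + pi"] assms by simp
  have 3: "arcpos K x \<omega> = x \<bullet> cis \<omega> + hint K \<omega>" "arcpos K y \<omega> = x \<bullet> cis \<omega> + norm (y - x) + hint K \<omega>"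
    "arcpos K x (\<omega> - pi) = - (x \<bullet> cis \<omega>) + hint K (\<omega> - pi)"
    "arcpos K y (\<omega> + pi) = - (x \<bullet> cis \<omega>) - norm (y - x) + hint K (\<omega> - pi) + 2 * pi * crad K"
    using arcpos_pi n by (simp_all add: arcpos_def)
  show ?thesis using 1 2 aint_window[OF n(1)] unfolding 3 pot_def by (simp add: algebra_simps add_divide_distrib diff_divide_distrib)
qed

text \<open>The opposite change of sense: the support lines are now followed forwards, from \<omega>
  - pi at \<open>x\<close> and from \<omega> at \<open>y\<close>.\<close>

lemma chord_mp:
  assumes "supp K x \<theta>" "supp K y \<theta>'" "y - x = of_real (norm (y - x)) * cis \<omega>"
    "\<theta> \<le> \<omega>" "\<omega> \<le> \<theta> + pi" "\<omega> \<le> \<theta>'" "\<theta>' \<le> \<omega> + pi"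
  shows "norm (y - x) - crad K * ((pi - (\<omega> - \<theta>)) + (\<theta>' - \<omega>)) + 2 * pmean K \<le> pot K x \<theta> + pot K y \<theta>'"
proof -
  note n = chord_nrm[OF assms(3)]
  have 1: "0 \<le> (arcpos K x \<omega> + arcpos K x (\<omega> - pi)) / 2 - (aint x \<omega> - aint x (\<omega> - pi)) / pi
    + (arcpos K x \<theta> - arcpos K x (\<omega> - pi))"
    using forw_slack[OF assms(1), of "\<omega> - pi"] assms by simp
  have 2: "0 \<le> (arcpos K y (\<omega> + pi) + arcpos K y \<omega>) / 2 - (aint y (\<omega> + pi) - aint y \<omega>) / pi
    + (arcpos K y \<theta>' - arcpos K y \<omega>)"
    by (rule forw_slack) fact+
  have 3: "arcpos K x \<omega> = x \<bullet> cis \<omega> + hint K \<omega>" "arcpos K y \<omega> = x \<bullet> cis \<omega> + norm (y - x) + hint K \<omega>"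
    "arcpos K x (\<omega> - pi) = - (x \<bullet> cis \<omega>) + hint K (\<omega> - pi)"
    "arcpos K y (\<omega> + pi) = - (x \<bullet> cis \<omega>) - norm (y - x) + hint K (\<omega> - pi) + 2 * pi * crad K"
    using arcpos_pi n by (simp_all add: arcpos_def)
  show ?thesis using 1 2 aint_window[OF n(1)] unfolding 3 pot_def by (simp add: algebra_simps add_divide_distrib diff_divide_distrib)
qed

text \<open>The cost of a change of the sense of rotation along a chord, if \<open>K\<close> contains a disc of radius \<open>\<rho>\<close>.\<close>

definition wgap :: "real \<Rightarrow> real" where
  "wgap \<rho> = \<rho>\<^sup>2 / (24 * B)"

text \<open>The arc from \<theta> to \<omega> may be shorter than \<epsilon>. On the missing piece
  the distance is small, since it vanishes at \<theta> and is Lipschitz.\<close>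

lemma ds_integral_trunc:
  assumes "supp K x \<theta>" "\<theta> \<le> \<omega>" "0 < \<epsilon>"
  shows "integral {0..\<epsilon>} (\<lambda>t. ds K x (\<omega> - t)) - 4 * B * \<epsilon>\<^sup>2 \<le> integral {0..\<omega> - \<theta>} (\<lambda>t. ds K x (\<omega> - t))"
proof -
  have x: "x \<in> K" "ds K x \<theta> = 0" using assms by (auto simp: supp_def)
  have i: "integral {0..b} (\<lambda>t. ds K x (\<omega> - t)) = arcpos K x \<omega> - arcpos K x (\<omega> - b)" if "0 \<le> b" for b
    using has_integral_ds_back[OF that] by (simp add: integral_unique)
  have "arcpos K x \<theta> - arcpos K x (\<omega> - \<epsilon>) \<le> 4 * B * \<epsilon>\<^sup>2"
  proof (cases "\<theta> \<le> \<omega> - \<epsilon>")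
    case True
    then show ?thesis using arcpos_mono[OF x(1) True] B by (smt (verit) mult_nonneg_nonneg zero_le_power2)
  next
    case False
    have "(ds K x has_integral arcpos K x \<theta> - arcpos K x (\<omega> - \<epsilon>)) {\<omega> - \<epsilon>..\<theta>}" using False by (intro has_integral_ds) auto
    moreover have "((\<lambda>t. 4 * B * \<epsilon>) has_integral (4 * B * \<epsilon>) * (\<theta> - (\<omega> - \<epsilon>))) {\<omega> - \<epsilon>..\<theta>}"
      using has_integral_const_real[of "4 * B * \<epsilon>" "\<omega> - \<epsilon>" \<theta>] False by (simp add: mult.commute)
    ultimately have "arcpos K x \<theta> - arcpos K x (\<omega> - \<epsilon>) \<le> (4 * B * \<epsilon>) * (\<theta> - (\<omega> - \<epsilon>))"
    proof (rule has_integral_le)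
      fix t assume t: "t \<in> {\<omega> - \<epsilon>..\<theta>}"
      have "ds K x t \<le> 4 * B * \<bar>t - \<theta>\<bar>" using ds_lipschitz[OF x(1), of t \<theta>] x(2) by simp
      also have "\<dots> \<le> 4 * B * \<epsilon>" using t assms B by (intro mult_left_mono) auto
      finally show "ds K x t \<le> 4 * B * \<epsilon>" .
    qed
    also have "\<dots> \<le> (4 * B * \<epsilon>) * \<epsilon>" using assms B by (intro mult_left_mono) auto
    finally show ?thesis by (simp add: power2_eq_square)
  qed
  then show ?thesis using i[of \<epsilon>] i[of "\<omega> - \<theta>"] assms by simp
qed

lemma wgap_slack:
  assumes ball: "cball z \<rho> \<subseteq> K" and \<rho>: "0 < \<rho>"
    and "supp K x \<theta>" "supp K y \<theta>'" "y - x = of_real (norm (y - x)) * cis \<omega>"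
    "\<theta> \<le> \<omega>" "\<omega> \<le> \<theta> + pi" "\<omega> \<le> \<theta>'" "\<theta>' \<le> \<omega> + pi"
  shows "wgap \<rho> \<le> (integral {0..\<omega> - \<theta>} (\<lambda>t. ds K x (\<omega> - t)) + integral {0..\<omega> + pi - \<theta>'} (\<lambda>t. ds K y (\<omega> + pi - t))) / 2"
proof -
  \<comment> \<open>This value maximizes
    \<open>\<epsilon> * (2 * \<rho> - 12 * B * \<epsilon>)\<close>: of the width
    \<open>2 * \<rho>\<close> over the interval, \<open>4 * B * \<epsilon>\<close> is reserved for
    the chord and as much for each of the two truncations.\<close>
  define \<epsilon> where "\<epsilon> = \<rho> / (12 * B)"
  have \<epsilon>: "0 < \<epsilon>" using \<rho> B by (simp add: \<epsilon>_def)
  have xy: "x \<in> K" "y \<in> K" using assms by (auto simp: supp_def)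
  have width: "2 * \<rho> \<le> hs K t + hs K (t + pi)" for t
  proof -
    have "z + of_real \<rho> * nrm t \<in> K" "z - of_real \<rho> * nrm t \<in> K"
      using ball \<rho> by (auto simp: dist_norm norm_mult intro!: subsetD[OF ball])
    then have "(z + of_real \<rho> * nrm t) \<bullet> nrm t \<le> hs K t" "(z - of_real \<rho> * nrm t) \<bullet> nrm (t + pi) \<le> hs K (t + pi)"
      using hs_upper by blast+
    moreover have "(of_real \<rho> * nrm t) \<bullet> nrm t = \<rho>"
      using norm_nrm[of t] by (simp add: scaleR_conv_of_real[symmetric] dot_square_norm)
    ultimately show ?thesis by (simp add: inner_add_left inner_diff_left)
  qed
  \<comment> \<open>The two support lines are parallel, so the distances add up to the width of
    \<open>K\<close> except for a small contribution of the chord. They cannot both be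
    small.\<close>
  have sum: "2 * \<rho> - 4 * B * \<epsilon> \<le> ds K x (\<omega> - t) + ds K y (\<omega> + pi - t)" if t: "t \<in> {0..\<epsilon>}" for t
  proof -
    have "ds K x (\<omega> - t) + ds K y (\<omega> + pi - t) = hs K (\<omega> - t) + hs K (\<omega> - t + pi) + (y - x) \<bullet> nrm (\<omega> - t)"
      using nrm_pi[of "\<omega> - t"] by (simp add: ds_def inner_diff_left algebra_simps)
    moreover have "(y - x) \<bullet> nrm (\<omega> - t) = - norm (y - x) * sin t"
    proof -
      have "cis \<omega> \<bullet> nrm (\<omega> - t) = sin (\<omega> - t - \<omega>)"
        unfolding inner_nrm sin_diff[of "\<omega> - t" \<omega>] by (simp add: mult.commute)
      then have "(norm (y - x) *\<^sub>R cis \<omega>) \<bullet> nrm (\<omega> - t) = - norm (y - x) * sin t"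
        by (simp only: inner_scaleR_left) simp
      then show ?thesis using assms(5) by (simp add: scaleR_conv_of_real)
    qed
    moreover have "norm (y - x) * sin t \<le> (2 * B) * \<epsilon>"
    proof -
      have "sin t \<le> \<epsilon>" using t sin_x_le_x[of t] by auto
      moreover have "norm (y - x) \<le> 2 * B" using norm_triangle_ineq4[of y x] B(2)[OF xy(1)] B(2)[OF xy(2)] by linarith
      ultimately show ?thesis using \<epsilon> by (smt (verit) mult_left_mono mult_right_mono norm_ge_zero)
    qed
    moreover have "2 * B * \<epsilon> \<le> 4 * B * \<epsilon>" using B(1) \<epsilon> by simp
    ultimately show ?thesis using width[of "\<omega> - t"] by linarith
  qed
  have int: "(\<lambda>t. ds K u (v - t)) integrable_on {0..\<epsilon>}" for u v
    by (intro integrable_continuous_real continuous_ds_comp continuous_intros)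
  have "\<epsilon> * (2 * \<rho> - 4 * B * \<epsilon>) \<le> integral {0..\<epsilon>} (\<lambda>t. ds K x (\<omega> - t) + ds K y (\<omega> + pi - t))"
  proof -
    have "integral {0..\<epsilon>} (\<lambda>t. 2 * \<rho> - 4 * B * \<epsilon>) \<le> integral {0..\<epsilon>} (\<lambda>t. ds K x (\<omega> - t) + ds K y (\<omega> + pi - t))"
      using sum by (intro integral_le integrable_add int) auto
    then show ?thesis using \<epsilon> by simp
  qed
  also have "\<dots> = integral {0..\<epsilon>} (\<lambda>t. ds K x (\<omega> - t)) + integral {0..\<epsilon>} (\<lambda>t. ds K y (\<omega> + pi - t))"
    by (intro Henstock_Kurzweil_Integration.integral_add int)
  finally have 1: "\<epsilon> * (2 * \<rho> - 4 * B * \<epsilon>) \<le> \<dots>" .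
  have 2: "integral {0..\<epsilon>} (\<lambda>t. ds K x (\<omega> - t)) - 4 * B * \<epsilon>\<^sup>2 \<le> integral {0..\<omega> - \<theta>} (\<lambda>t. ds K x (\<omega> - t))"
    by (rule ds_integral_trunc) fact+
  have 3: "integral {0..\<epsilon>} (\<lambda>t. ds K y (\<omega> + pi - t)) - 4 * B * \<epsilon>\<^sup>2 \<le> integral {0..\<omega> + pi - \<theta>'} (\<lambda>t. ds K y (\<omega> + pi - t))"
    using assms \<epsilon> by (intro ds_integral_trunc) auto
  have "2 * wgap \<rho> = \<epsilon> * (2 * \<rho> - 12 * B * \<epsilon>)" using B by (simp add: \<epsilon>_def wgap_def power2_eq_square field_simps)
  also have "\<dots> = \<epsilon> * (2 * \<rho> - 4 * B * \<epsilon>) - 8 * B * \<epsilon>\<^sup>2" by (simp add: power2_eq_square algebra_simps)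
  finally have 4: "2 * wgap \<rho> = \<epsilon> * (2 * \<rho> - 4 * B * \<epsilon>) - 8 * B * \<epsilon>\<^sup>2" .
  define E q where "E = \<epsilon> * (2 * \<rho> - 4 * B * \<epsilon>)" and "q = 4 * B * \<epsilon>\<^sup>2"
  have "8 * B * \<epsilon>\<^sup>2 = 2 * q" by (simp add: q_def)
  then have "2 * wgap \<rho> = E - 2 * q" using 4 by (simp add: E_def)
  moreover have "E \<le> integral {0..\<epsilon>} (\<lambda>t. ds K x (\<omega> - t)) + integral {0..\<epsilon>} (\<lambda>t. ds K y (\<omega> + pi - t))"
    using 1 by (simp add: E_def)
  moreover have "integral {0..\<epsilon>} (\<lambda>t. ds K x (\<omega> - t)) \<le> integral {0..\<omega> - \<theta>} (\<lambda>t. ds K x (\<omega> - t)) + q"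
    using 2 by (simp add: q_def)
  moreover have "integral {0..\<epsilon>} (\<lambda>t. ds K y (\<omega> + pi - t)) \<le> integral {0..\<omega> + pi - \<theta>'} (\<lambda>t. ds K y (\<omega> + pi - t)) + q"
    using 3 by (simp add: q_def)
  ultimately have "2 * wgap \<rho> \<le> integral {0..\<omega> - \<theta>} (\<lambda>t. ds K x (\<omega> - t)) + integral {0..\<omega> + pi - \<theta>'} (\<lambda>t. ds K y (\<omega> + pi - t))"
    by (smt (verit))
  then show ?thesis by (simp add: field_simps)
qed

text \<open>All four combinations of senses in one statement. It suffices to charge \<gamma> for the
  change from counterclockwise to clockwise: a closed path that changes its sense at all makes such
  a change somewhere.\<close>

lemma edge_bound:
  assumes x: "supp K x \<theta>" and y: "supp K y \<theta>'" and "x \<noteq> y"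
    and \<gamma>: "\<gamma> = 0 \<or> (\<exists>z \<rho>. 0 < \<rho> \<and> cball z \<rho> \<subseteq> K \<and> \<gamma> = wgap \<rho>)"
  shows "norm (y - x) - crad K * (ang (sdir s \<theta>) (y - x) + ang (y - x) (sdir s' \<theta>'))
    \<le> spot K s' y \<theta>' - spot K s x \<theta> - (if s \<and> \<not> s' then \<gamma> else 0)"
proof -
  have xy: "x \<in> K" "y \<in> K" using x y by (auto simp: supp_def)
  obtain \<omega> where \<omega>: "\<theta> \<le> \<omega>" "\<omega> \<le> \<theta> + pi" "y - x = of_real (norm (y - x)) * cis \<omega>"
    "ang (cis \<theta>) (y - x) = \<omega> - \<theta>" using lift_out[OF x xy(2)] \<open>x \<noteq> y\<close> by metis
  obtain \<theta>2 where \<theta>2: "\<omega> \<le> \<theta>2" "\<theta>2 \<le> \<omega> + pi" "cis \<theta>2 = cis \<theta>'" "ang (y - x) (cis \<theta>') = \<theta>2 - \<omega>"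
    using lift_in[OF y xy(1) _ \<omega>(3)] \<open>x \<noteq> y\<close> by metis
  have y2: "supp K y \<theta>2" using y supp_cis_cong \<theta>2(3) by blast
  have p2: "pot K y \<theta>' = pot K y \<theta>2" using pot_cis_cong \<theta>2(3) by metis
  have nz: "y - x \<noteq> 0" using \<open>x \<noteq> y\<close> by simp
  have m1: "ang (- cis \<theta>) (y - x) = pi - (\<omega> - \<theta>)" using ang_minus1[of "cis \<theta>" "y - x"] nz \<omega>(4) by simp
  have m2: "ang (y - x) (- cis \<theta>') = pi - (\<theta>2 - \<omega>)" using ang_minus[of "y - x" "cis \<theta>'"] nz \<theta>2(4) by simp
  consider "s" "s'" | "s" "\<not> s'" | "\<not> s" "s'" | "\<not> s" "\<not> s'" by blast
  then show ?thesis
  proof cases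
    case 1
    have "norm (y - x) \<le> arcpos K y \<theta>2 - arcpos K x \<theta>" by (rule chord_pp) fact+
    then have "norm (y - x) - crad K * ((\<omega> - \<theta>) + (\<theta>2 - \<omega>)) \<le> pot K y \<theta>2 - pot K x \<theta>"
      by (simp add: pot_def algebra_simps)
    then show ?thesis using 1 \<omega>(4) \<theta>2(4) p2 by (simp add: spot_def sdir_def)
  next
    case 2
    let ?I = "(integral {0..\<omega> - \<theta>} (\<lambda>t. ds K x (\<omega> - t)) + integral {0..\<omega> + pi - \<theta>2} (\<lambda>t. ds K y (\<omega> + pi - t))) / 2"
    have "norm (y - x) - crad K * ((\<omega> - \<theta>) + (pi - (\<theta>2 - \<omega>))) + pot K x \<theta> + pot K y \<theta>2 + ?I \<le> 2 * pmean K"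
      by (rule chord_pm) fact+
    moreover have "\<gamma> \<le> ?I"
      using \<gamma>
    proof
      assume "\<gamma> = 0"
      have "0 \<le> integral {0..\<omega> - \<theta>} (\<lambda>t. ds K x (\<omega> - t))" "0 \<le> integral {0..\<omega> + pi - \<theta>2} (\<lambda>t. ds K y (\<omega> + pi - t))"
        using ds_nonneg xy by (auto intro!: integral_nonneg integrable_continuous_real continuous_ds_comp continuous_intros)
      then show ?thesis using \<open>\<gamma> = 0\<close> by simp
    next
      assume "\<exists>z \<rho>. 0 < \<rho> \<and> cball z \<rho> \<subseteq> K \<and> \<gamma> = wgap \<rho>"
      then show ?thesis using wgap_slack[OF _ _ x y2 \<omega>(3) \<omega>(1,2) \<theta>2(1,2)] by blast
    qed
    ultimately have "norm (y - x) - crad K * ((\<omega> - \<theta>) + (pi - (\<theta>2 - \<omega>))) \<le> 2 * pmean K - pot K y \<theta>2 - pot K x \<theta> - \<gamma>"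
      by linarith
    then show ?thesis using 2 \<omega>(4) m2 p2 by (simp add: spot_def sdir_def)
  next
    case 3
    have "norm (y - x) - crad K * ((pi - (\<omega> - \<theta>)) + (\<theta>2 - \<omega>)) + 2 * pmean K \<le> pot K x \<theta> + pot K y \<theta>2"
      by (rule chord_mp) fact+
    then show ?thesis using 3 \<theta>2(4) m1 p2 by (simp add: spot_def sdir_def)
  next
    case 4
    \<comment> \<open>A chord that is clockwise at both ends is read backwards, as a
      counterclockwise chord of the complementary boundary arc.\<close>
    have c: "x - y = of_real (norm (x - y)) * cis (\<omega> + pi)"
    proof -
      have "cis (\<omega> + pi) = - cis \<omega>" by (simp add: complex_eq_iff)
      then show ?thesis using \<omega>(3) by (metis minus_diff_eq mult_minus_right norm_minus_commute)
    qed
    have "norm (x - y) \<le> arcpos K x (\<theta> + 2 * pi) - arcpos K y \<theta>2"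
      by (rule chord_pp[OF xy(2,1) c]) (use \<omega> \<theta>2 in auto)
    then have "norm (y - x) \<le> arcpos K x \<theta> + 2 * pi * crad K - arcpos K y \<theta>2"
      by (simp only: arcpos_2pi norm_minus_commute)
    then have "norm (y - x) - crad K * ((pi - (\<omega> - \<theta>)) + (pi - (\<theta>2 - \<omega>))) \<le> pot K x \<theta> - pot K y \<theta>2"
      by (simp add: pot_def algebra_simps)
    then show ?thesis using 4 m1 m2 p2 by (simp add: spot_def sdir_def)
  qed
qed

end

subsection \<open>Paths in a convex body\<close>

text \<open>The half-angle formula. It exhibits the excess of length as a multiple of
  \<open>tan\<close> of half the turning angle, which is convex between 0 and pi.\<close>

lemma norm_minus_Re:
  assumes "0 < Im z"
  shows "norm z - Re z = Im z * tan (Arg z / 2)"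
proof -
  define a where "a = Arg z / 2"
  have a: "0 < a" "a < pi / 2" using assms Arg_lt_pi[of z] by (auto simp: a_def)
  have nz: "z \<noteq> 0" using assms by auto
  have z: "Re z = norm z * cos (2 * a)" "Im z = norm z * sin (2 * a)"
    using nz by (simp_all add: a_def cos_Arg sin_Arg)
  have c: "cos a > 0" using a by (intro cos_gt_zero) auto
  have "1 - cos (2 * a) = sin (2 * a) * tan a"
    using c by (simp add: cos_double_sin sin_double tan_def power2_eq_square)
  then have "norm z * (1 - cos (2 * a)) = Im z * tan a" using z(2) by simp
  moreover have "norm z - Re z = norm z * (1 - cos (2 * a))" using z(1) by (simp add: algebra_simps)
  ultimately show ?thesis by (simp add: a_def)
qed

lemma tan_affine_le_max:
  fixes a b x y k m :: real
  assumes "0 < a" "a \<le> x" "x \<le> b" "b < pi" "0 \<le> y"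
  shows "y * tan (x / 2) + k * x + m \<le> max (y * tan (a / 2) + k * a + m) (y * tan (b / 2) + k * b + m)"
proof -
  have conv: "convex_on {a..b} (\<lambda>x. y * tan (x / 2) + k * x + m)"
  proof (rule f''_ge0_imp_convex[where f' = "\<lambda>x. y * (inverse ((cos (x / 2))\<^sup>2) / 2) + k"
        and f'' = "\<lambda>x. y * (sin (x / 2) / (2 * cos (x / 2) ^ 3))"])
    have c: "cos (x / 2) > 0 \<and> sin (x / 2) > 0" if "x \<in> {a..b}" for x
      using that assms by (auto intro!: cos_gt_zero sin_gt_zero)
    show "((\<lambda>x. y * tan (x / 2) + k * x + m) has_real_derivative y * (inverse ((cos (x / 2))\<^sup>2) / 2) + k) (at x)"
      if "x \<in> {a..b}" for x
      using c[OF that] by (auto intro!: derivative_eq_intros)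
    show "((\<lambda>x. y * (inverse ((cos (x / 2))\<^sup>2) / 2) + k) has_real_derivative y * (sin (x / 2) / (2 * cos (x / 2) ^ 3))) (at x)"
      if "x \<in> {a..b}" for x
      using c[OF that] by (auto intro!: derivative_eq_intros simp: field_simps eval_nat_numeral)
    show "0 \<le> y * (sin (x / 2) / (2 * cos (x / 2) ^ 3))" if "x \<in> {a..b}" for x
      using c[OF that] assms by simp
  qed simp
  show ?thesis using convex_on_le_max[OF conv, of x] assms by simp
qed

text \<open>\<open>z\<close> moves on a horizontal line; \<open>Arg z\<close> is the turning angle between \<open>z\<close> and the line. The length minus
  \<open>c\<close> times the turning is a convex function of this angle as long as it does not pass \<open>Arg d\<close>.\<close>

lemma slide_normalized:
  fixes d p p1 p2 :: complex
  assumes im: "Im p1 = Im p" "Im p2 = Im p" "0 < Im p" and ord: "Arg p1 \<le> Arg p" "Arg p \<le> Arg p2"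
    and d: "d \<noteq> 0" "Arg d \<le> Arg p1 \<or> Arg p2 \<le> Arg d" and c: "0 \<le> c"
  defines "J \<equiv> \<lambda>z. norm z - Re z - c * (ang d z + Arg z)"
  shows "J p \<le> J p1 \<or> J p \<le> J p2"
proof -
  define a where "a = Arg d"
  have ar: "0 < Arg p1" "Arg p1 < pi" "0 < Arg p" "Arg p < pi" "0 < Arg p2" "Arg p2 < pi"
    using im Arg_lt_pi[of p1] Arg_lt_pi[of p] Arg_lt_pi[of p2] by auto
  have a: "- pi < a" "a \<le> pi" using Arg_bounded by (auto simp: a_def)
  have angz: "ang d z = (if \<bar>Arg z - a\<bar> \<le> pi then \<bar>Arg z - a\<bar> else 2 * pi - \<bar>Arg z - a\<bar>)" if "0 < Im z" for z
  proof -
    have nz: "z \<noteq> 0" using that by auto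
    have zr: "z = of_real (norm z) * cis (Arg z)" by (metis rcis_cmod_Arg rcis_def)
    have dr: "d = of_real (norm d) * cis a" unfolding a_def by (metis rcis_cmod_Arg rcis_def)
    have A: "ang d z = \<bar>Arg (cis (Arg z - a))\<bar>"
      by (subst zr, subst dr) (use nz d in \<open>auto intro!: ang_polar\<close>)
    have z0: "0 < Arg z" "Arg z < pi" using that Arg_lt_pi[of z] by auto
    show ?thesis
    proof (cases "\<bar>Arg z - a\<bar> \<le> pi")
      case True then show ?thesis using A abs_Arg_cis by simp
    next
      case False
      then have g: "Arg z - a > pi" using a z0 by auto
      have "cis (Arg z - a) = cis (Arg z - a - 2 * pi)" by (simp add: complex_eq_iff cos_diff sin_diff)
      then have "ang d z = \<bar>Arg z - a - 2 * pi\<bar>" using A abs_Arg_cis[of "Arg z - a - 2 * pi"] g a z0 by simp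
      then show ?thesis using False g a z0 by auto
    qed
  qed
  have Jz: "J z = Im p * tan (Arg z / 2) - c * (ang d z + Arg z)" if "Im z = Im p" for z
    using norm_minus_Re[of z] that im by (simp add: J_def)
  show ?thesis
  proof (cases "Arg p2 \<le> a")
    \<comment> \<open>\<open>z\<close> points between the line and \<open>d\<close>, so the angles
      at its two ends add up to the constant \<open>a\<close> and only the convex length
      varies.\<close>
    case True
    have A: "ang d z = a - Arg z" if "Im z = Im p" "Arg z \<le> a" for z
      using angz[of z] that im a ar Arg_lt_pi[of z] by auto
    have "Im p * tan (Arg p / 2) + 0 * Arg p + (- c * a) \<le> max (Im p * tan (Arg p1 / 2) + 0 * Arg p1 + (- c * a)) (Im p * tan (Arg p2 / 2) + 0 * Arg p2 + (- c * a))"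
      by (rule tan_affine_le_max) (use ar ord im in auto)
    moreover have "J z = Im p * tan (Arg z / 2) + 0 * Arg z + (- c * a)" if "Im z = Im p" "Arg z \<le> a" for z
      using Jz[OF that(1)] A[OF that] by simp
    ultimately show ?thesis using True ord im unfolding le_max_iff_disj by auto
  next
    case False
    then have a1: "a \<le> Arg p1" using d by (auto simp: a_def)
    \<comment> \<open>Here \<open>ang d z\<close> is the smaller of two affine functions of
      \<open>Arg z\<close>, so that \<open>J\<close> is the larger of two convex functions. The one
      attained at \<open>p\<close> is estimated at the end points.\<close>
    have le1: "ang d z \<le> Arg z - a" "ang d z \<le> 2 * pi - (Arg z - a)" and or: "ang d z = Arg z - a \<or> ang d z = 2 * pi - (Arg z - a)"
      if "Im z = Im p" "a \<le> Arg z" for z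
      using angz[of z] that im a ar Arg_lt_pi[of z] by auto
    have ge: "- c * (2 * Arg z - a) \<le> - c * (ang d z + Arg z)" "- c * (2 * pi + a) \<le> - c * (ang d z + Arg z)"
      if "Im z = Im p" "a \<le> Arg z" for z
    proof -
      have "c * (ang d z + Arg z) \<le> c * (2 * Arg z - a)" "c * (ang d z + Arg z) \<le> c * (2 * pi + a)"
        using le1[OF that] c by (auto intro!: mult_left_mono)
      then show "- c * (2 * Arg z - a) \<le> - c * (ang d z + Arg z)" "- c * (2 * pi + a) \<le> - c * (ang d z + Arg z)"
        by simp_all
    qed
    have ap: "a \<le> Arg p" "a \<le> Arg p2" using a1 ord by auto
    from or[OF refl ap(1)] show ?thesis
    proof
      assume e: "ang d p = Arg p - a"
      have "Im p * tan (Arg p / 2) + (- 2 * c) * Arg p + c * a \<le> max (Im p * tan (Arg p1 / 2) + (- 2 * c) * Arg p1 + c * a) (Im p * tan (Arg p2 / 2) + (- 2 * c) * Arg p2 + c * a)"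
        by (rule tan_affine_le_max) (use ar ord im in auto)
      moreover have "J p = Im p * tan (Arg p / 2) + (- 2 * c) * Arg p + c * a" using Jz[of p] e by (simp add: algebra_simps)
      moreover have "Im p * tan (Arg p1 / 2) + (- 2 * c) * Arg p1 + c * a \<le> J p1"
        using Jz[of p1] ge(1)[of p1] im a1 by (simp add: algebra_simps)
      moreover have "Im p * tan (Arg p2 / 2) + (- 2 * c) * Arg p2 + c * a \<le> J p2"
        using Jz[of p2] ge(1)[of p2] im ap by (simp add: algebra_simps)
      ultimately show ?thesis unfolding le_max_iff_disj by linarith
    next
      assume e: "ang d p = 2 * pi - (Arg p - a)"
      have "Im p * tan (Arg p / 2) + 0 * Arg p + (- c * (2 * pi + a)) \<le> max (Im p * tan (Arg p1 / 2) + 0 * Arg p1 + (- c * (2 * pi + a))) (Im p * tan (Arg p2 / 2) + 0 * Arg p2 + (- c * (2 * pi + a)))"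
        by (rule tan_affine_le_max) (use ar ord im in auto)
      moreover have "J p = Im p * tan (Arg p / 2) + 0 * Arg p + (- c * (2 * pi + a))" using Jz[of p] e by (simp add: algebra_simps)
      moreover have "Im p * tan (Arg p1 / 2) + 0 * Arg p1 + (- c * (2 * pi + a)) \<le> J p1"
        using Jz[of p1] ge(2)[of p1] im a1 by simp
      moreover have "Im p * tan (Arg p2 / 2) + 0 * Arg p2 + (- c * (2 * pi + a)) \<le> J p2"
        using Jz[of p2] ge(2)[of p2] im ap by simp
      ultimately show ?thesis unfolding le_max_iff_disj by linarith
    qed
  qed
qed

lemma Arg_cot_mono:
  assumes "0 < Im p" "Im p = Im q" "Re q \<le> Re p"
  shows "Arg p \<le> Arg q"
proof -
  have nz: "p \<noteq> 0" "q \<noteq> 0" using assms by auto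
  have "0 < Arg p" "Arg p < pi" "0 < Arg q" "Arg q < pi" using assms Arg_lt_pi[of p] Arg_lt_pi[of q] by auto
  moreover have "0 \<le> sin (Arg q - Arg p)"
  proof -
    have "sin (Arg q - Arg p) = (Im q * Re p - Re q * Im p) / (norm p * norm q)"
      using nz by (simp add: sin_diff sin_Arg cos_Arg field_simps)
    moreover have "Im q * Re p - Re q * Im p = Im p * (Re p - Re q)" using assms by (simp add: algebra_simps)
    ultimately show ?thesis using assms by simp
  qed
  ultimately show ?thesis using sin_gt_zero[of "- (Arg q - Arg p)"] by (smt (verit) sin_minus)
qed

lemma on_line_Arg:
  assumes "0 < y" "0 < a" "a < pi"
  obtains q where "Im q = y" "Arg q = a" "q \<noteq> 0"
proof -
  have s: "sin a > 0" using assms by (intro sin_gt_zero) auto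
  have "Arg (of_real (y / sin a) * cis a) = a"
    using assms s Arg_unique'[of "y / sin a" a "of_real (y / sin a) * cis a"] by (auto simp: rcis_def)
  moreover have "Im (of_real (y / sin a) * cis a) = y" using s by simp
  ultimately show ?thesis using that[of "of_real (y / sin a) * cis a"] assms by force
qed

lemma Arg_eq_imp_scale:
  assumes "p \<noteq> 0" "q \<noteq> 0" "Arg p = Arg q"
  shows "\<exists>r>0. p = of_real r * q"
proof -
  have "p = of_real (norm p) * cis (Arg p)" "q = of_real (norm q) * cis (Arg q)" by (metis rcis_cmod_Arg rcis_def)+
  then have "p = of_real (norm p / norm q) * q" using assms
    by (metis (no_types, lifting) mult.assoc nonzero_eq_divide_eq norm_eq_zero of_real_eq_0_iff of_real_divide times_divide_eq_left)
  then show ?thesis using assms by (intro exI[of _ "norm p / norm q"]) auto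
qed

section \<open>Sliding an interior vertex of a path\<close>

context convex_body
begin

lemma crad_nonneg: "0 \<le> crad K"
proof -
  obtain p where "p \<in> K" using ne by blast
  then have "0 \<le> 2 * pi * crad K" using arcpos_mono[of p 0 "0 + 2 * pi"] arcpos_2pi[of p 0] by simp
  then show ?thesis using zero_le_mult_iff[of "2 * pi" "crad K"] pi_gt_zero by linarith
qed

text \<open>The vertex slides along its outgoing edge, whose direction is kept. Convexity pushes it
  to an end of its range: to \<open>b\<close>, where it disappears, or to the frontier. The range is
  divided at the point where the incoming edge becomes parallel to \<open>d\<close>, because the
  angle at \<open>a\<close> has a kink there that destroys convexity.\<close>

lemma slide:
  assumes K: "a \<in> K" "b \<in> K" "p \<in> interior K" and ne: "a \<noteq> p" "p \<noteq> b" and d: "d \<noteq> 0"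
  defines "J \<equiv> \<lambda>x. norm (x - a) + norm (b - x) - crad K * (ang d (x - a) + ang (x - a) (b - p))"
  obtains (front) q s where "q \<in> frontier K" "0 < s" "b - q = of_real s * (b - p)" "q \<noteq> a" "J p \<le> J q"
  | (merge) "a \<noteq> b" "J p \<le> norm (b - a) - crad K * (ang d (b - a) + ang (b - a) (b - p))"
  | (straight) q s r where "q \<in> K" "0 < s" "b - q = of_real s * (b - p)" "0 < r" "q - a = of_real r * d" "J p \<le> J q"
proof -
  define w where "w = b - p"
  have w: "w \<noteq> 0" using ne by (simp add: w_def)
  obtain \<tau> where \<tau>: "0 < \<tau>" "p + \<tau> *\<^sub>R (- w) \<in> frontier K"
    using ray_to_frontier[OF compact_imp_bounded[OF comp] K(3), of "- w"] w by auto
  define pt where "pt s = b - of_real s * w" for s :: real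
  define f where "f = pt (1 + \<tau>)"
  have f: "f \<in> frontier K" using \<tau>(2) by (simp add: f_def pt_def w_def scaleR_conv_of_real algebra_simps)
  have fK: "f \<in> K" using f compact_imp_closed[OF comp] frontier_subset_closed by blast
  have pp: "pt 1 = p" "pt 0 = b" by (simp_all add: pt_def w_def)
  have ptK: "pt s \<in> K" if "0 \<le> s" "s \<le> 1 + \<tau>" for s
  proof -
    define k where "k = s / (1 + \<tau>)"
    have k: "k * (1 + \<tau>) = s" using \<tau> by (simp add: k_def)
    have "(1 - k) *\<^sub>R b + k *\<^sub>R f = b - (k * (1 + \<tau>)) *\<^sub>R w"
      by (simp add: f_def pt_def scaleR_conv_of_real algebra_simps)
    then have "pt s = (1 - s / (1 + \<tau>)) *\<^sub>R b + (s / (1 + \<tau>)) *\<^sub>R f"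
      unfolding k by (simp add: pt_def k_def scaleR_conv_of_real)
    then show ?thesis using convexD_alt[OF conv K(2) fK, of "s / (1 + \<tau>)"] that \<tau> by simp
  qed
  \<comment> \<open>A reflection, if necessary, brings the normalized picture into the upper
    half-plane, where \<open>Arg\<close> is the turning angle.\<close>
  define N where "N z = (if 0 \<le> Im ((p - a) / w) then z else cnj z)" for z
  have Nang: "ang (N u) (N v) = ang u v" for u v by (simp add: N_def ang_cnj)
  have Nnorm: "norm (N u) = norm u" "Re (N u) = Re u" "\<bar>Arg (N u)\<bar> = \<bar>Arg u\<bar>" "N u = 0 \<longleftrightarrow> u = 0" for u
    by (auto simp: N_def Arg_cnj)
  have Nscale: "N (of_real r * u) = of_real r * N u" for r u by (simp add: N_def)
  have Ninj: "N u = N v \<longleftrightarrow> u = v" for u v by (auto simp: N_def)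
  define zb where "zb = (b - a) / w"
  define zz where "zz x = N ((x - a) / w)" for x
  define dd where "dd = N (d / w)"
  define c' where "c' = crad K / norm w"
  have c': "0 \<le> c'" using crad_nonneg by (simp add: c'_def)
  have dd: "dd \<noteq> 0" using d w by (simp add: dd_def Nnorm)
  define H where "H z = norm z - Re z - c' * (ang dd z + \<bar>Arg z\<bar>)" for z
  have zpt: "(pt s - a) / w = zb - of_real s" for s using w by (simp add: pt_def zb_def field_simps)
  have Rez: "Re (zz (pt s)) = Re zb - s" for s by (simp add: zz_def Nnorm zpt)
  have Imz: "Im (zz (pt s)) = \<bar>Im zb\<bar>" for s
  proof -
    have "Im ((p - a) / w) = Im zb" using zpt[of 1] pp by simp
    then show ?thesis by (simp add: zz_def zpt N_def)
  qed
  \<comment> \<open>In the normalized picture \<open>pt s\<close> moves along a horizontal line and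
    the outgoing edge has the length \<open>norm w * s\<close>. Up to a factor and a constant
    \<open>J\<close> is the functional of \<open>slide_normalized\<close>; the rescaling explains
    \<open>c'\<close>.\<close>
  have JH: "J (pt s) = norm w * H (zz (pt s)) + norm w * Re zb" if "0 \<le> s" for s
  proof -
    define z where "z = (pt s - a) / w"
    have za: "pt s - a = z * w" using w by (simp add: z_def)
    have 1: "norm (pt s - a) = norm w * norm (zz (pt s))" by (simp add: zz_def Nnorm za norm_mult w)
    have 2: "norm (b - pt s) = norm w * (Re zb - Re (zz (pt s)))" using that by (simp add: Rez) (simp add: pt_def norm_mult)
    have 3: "ang d (pt s - a) = ang dd (zz (pt s))"
      unfolding zz_def dd_def Nang using ang_mult_cancel[of "w" "d / w" "(pt s - a) / w"] w by simp
    have 4: "ang (pt s - a) (b - p) = \<bar>Arg (zz (pt s))\<bar>"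
      unfolding zz_def Nnorm w_def[symmetric] by (subst ang_sym) (simp add: ang_def)
    show ?thesis unfolding J_def H_def c'_def 1 2 3 4 using w by (simp add: field_simps)
  qed
  have Jle: "J (pt s) \<le> J (pt t)" if "H (zz (pt s)) \<le> H (zz (pt t))" "0 \<le> s" "0 \<le> t" for s t
    using JH that w by (simp add: mult_left_mono)
  have Jb: "J b = norm (b - a) - crad K * (ang d (b - a) + ang (b - a) (b - p))" by (simp add: J_def)
  have bpt: "b - pt s = of_real s * (b - p)" for s by (simp add: pt_def w_def)
  show ?thesis
  proof (cases "Im zb = 0")
    case True
    have zp: "(p - a) / w = of_real (Re zb - 1)" using zpt[of 1] pp True by (simp add: complex_eq_iff)
    have Reb: "Re zb \<noteq> 1" using zp ne w by auto
    show ?thesis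
    proof (cases "Re zb > 1")
      case True
      have pa: "p - a = of_real (Re zb - 1) * w" using zp w by (simp add: field_simps)
      have "zb = of_real (Re zb)" using \<open>Im zb = 0\<close> by (simp add: complex_eq_iff)
      then have "zb * w = of_real (Re zb) * w" by (rule arg_cong)
      then have ba: "b - a = of_real (Re zb) * w" using w by (simp add: zb_def)
      have ab: "a \<noteq> b" using ba w True by auto
      have "norm (p - a) + norm (b - p) = norm (b - a)"
        unfolding pa ba w_def[symmetric] using True by (simp only: norm_mult norm_of_real) (simp add: algebra_simps)
      moreover have "ang d (p - a) = ang d (b - a)" "ang (p - a) (b - p) = ang (b - a) (b - p)"
        unfolding pa ba using True by (simp_all only: ang_scale1 ang_scale2 diff_gt_0_iff_gt order.strict_trans[OF zero_less_one])
      ultimately show ?thesis using merge[OF ab] by (simp add: J_def)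
    next
      case False
      then have lt: "Re zb < 1" using Reb by simp
      have H1: "zz (pt s) = of_real (Re zb - s)" for s using Rez[of s] Imz[of s] \<open>Im zb = 0\<close> by (simp add: complex_eq_iff)
      have A: "Arg (of_real r) = pi" "ang dd (of_real r) = ang dd (- 1)" if "r < 0" for r
      proof -
        show "Arg (of_real r) = pi" using that Arg_of_real by auto
        have "ang dd (of_real (- r) * (- 1)) = ang dd (- 1)" by (rule ang_scale2) (use that in auto)
        then show "ang dd (of_real r) = ang dd (- 1)" by simp
      qed
      have "H (zz (pt 1)) \<le> H (zz (pt (1 + \<tau>)))"
        unfolding H1 H_def using A[of "Re zb - 1"] A[of "Re zb - (1 + \<tau>)"] lt \<tau>(1)
        by (simp del: of_real_diff of_real_add)
      then have "J p \<le> J f" using Jle[of 1 "1 + \<tau>"] \<tau> pp by (simp add: f_def)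
      moreover have "f \<noteq> a"
      proof
        assume "f = a"
        then have "Re (zz (pt (1 + \<tau>))) = 0" by (simp add: f_def zz_def N_def)
        then show False using Rez lt \<tau>(1) by simp
      qed
      ultimately show ?thesis using front[of f "1 + \<tau>"] f \<tau> bpt[of "1 + \<tau>"] by (simp add: f_def)
    qed
  next
    case False
    then have y: "0 < \<bar>Im zb\<bar>" by simp
    define p0 p1 p2 where "p0 = zz (pt 1)" and "p1 = zz (pt 0)" and "p2 = zz (pt (1 + \<tau>))"
    have im: "Im p0 = \<bar>Im zb\<bar>" "Im p1 = \<bar>Im zb\<bar>" "Im p2 = \<bar>Im zb\<bar>" by (simp_all add: p0_def p1_def p2_def Imz)
    have re: "Re p0 = Re zb - 1" "Re p1 = Re zb" "Re p2 = Re zb - (1 + \<tau>)" by (simp_all add: p0_def p1_def p2_def Rez)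
    have ord: "Arg p1 \<le> Arg p0" "Arg p0 \<le> Arg p2" using Arg_cot_mono im re y \<tau> by auto
    have HA: "H z = norm z - Re z - c' * (ang dd z + Arg z)" if "0 < Im z" for z
      using that Arg_lt_pi[of z] by (simp add: H_def)
    have nza: "pt s \<noteq> a" for s
    proof
      assume "pt s = a"
      then have "zz (pt s) = 0" by (simp add: zz_def N_def)
      then show False using Imz[of s] y by simp
    qed
    have toB: ?thesis if "H p0 \<le> H p1"
    proof -
      have "J p \<le> J b" using Jle[of 1 0] that pp by (simp add: p0_def p1_def)
      then show ?thesis using merge nza[of 0] pp Jb by simp
    qed
    have toF: ?thesis if "H p0 \<le> H p2"
    proof -
      have "J p \<le> J f" using Jle[of 1 "1 + \<tau>"] that pp \<tau> by (simp add: p0_def p2_def f_def)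
      then show ?thesis using front[of f "1 + \<tau>"] f \<tau> bpt[of "1 + \<tau>"] nza[of "1 + \<tau>"] by (simp add: f_def)
    qed
    show ?thesis
    proof (cases "Arg p1 < Arg dd \<and> Arg dd < Arg p2")
      case True
      have ad: "0 < Arg dd" "Arg dd < pi" using True im y Arg_lt_pi[of p1] Arg_lt_pi[of p2] by auto
      obtain q where q: "Im q = \<bar>Im zb\<bar>" "Arg q = Arg dd" "q \<noteq> 0" using on_line_Arg[OF y ad] by metis
      have "Re q < Re p1"
      proof (rule ccontr)
        assume "\<not> Re q < Re p1"
        then have "Arg q \<le> Arg p1" using Arg_cot_mono[of q p1] q im y by simp
        then show False using True q by simp
      qed
      moreover have "Re p2 < Re q"
      proof (rule ccontr)
        assume "\<not> Re p2 < Re q"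
        then have "Arg p2 \<le> Arg q" using Arg_cot_mono[of p2 q] q im y by simp
        then show False using True q by simp
      qed
      ultimately have s: "0 < Re zb - Re q" "Re zb - Re q < 1 + \<tau>" using re by auto
      define s where "s = Re zb - Re q"
      have zq: "zz (pt s) = q" using Rez[of s] Imz[of s] q by (simp add: complex_eq_iff s_def)
      obtain r where r: "0 < r" "q = of_real r * dd" using Arg_eq_imp_scale[OF q(3) dd q(2)] by blast
      have "N ((pt s - a) / w) = N (of_real r * (d / w))" using zq r by (simp only: zz_def dd_def Nscale)
      then have "(pt s - a) / w = of_real r * (d / w)" by (simp only: Ninj)
      then have sa: "pt s - a = of_real r * d" using w by (simp add: field_simps)
      have toQ: ?thesis if "H p0 \<le> H q"
      proof -
        have "J p \<le> J (pt s)" using Jle[of 1 s] that pp s by (simp add: p0_def zq s_def[symmetric])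
        moreover have "0 < s" "s \<le> 1 + \<tau>" using s by (auto simp: s_def)
        ultimately show ?thesis using straight[OF ptK[of s] _ bpt r(1) sa] by simp
      qed
      show ?thesis
      proof (cases "Arg dd \<le> Arg p0")
        case True
        have "H p0 \<le> H q \<or> H p0 \<le> H p2"
          using slide_normalized[of q p0 p2 dd c'] im q y ord True dd c' by (simp add: HA)
        then show ?thesis using toQ toF by blast
      next
        case False
        have "H p0 \<le> H p1 \<or> H p0 \<le> H q"
          using slide_normalized[of p1 p0 q dd c'] im q y ord False dd c' by (simp add: HA)
        then show ?thesis using toQ toB by blast
      qed
    next
      case False
      have "H p0 \<le> H p1 \<or> H p0 \<le> H p2"
        using slide_normalized[of p1 p0 p2 dd c'] im y ord False dd c' by (auto simp: HA)
      then show ?thesis using toF toB by blast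
    qed
  qed
qed

section \<open>Support lines at vertices, and the path inequality\<close>

lemma supp_not_interior: "supp K x t \<Longrightarrow> x \<notin> interior K"
proof
  assume s: "supp K x t" and "x \<in> interior K"
  then obtain e where e: "0 < e" "cball x e \<subseteq> K" using mem_interior_cball by blast
  then have "x + of_real e * nrm t \<in> K" by (intro subsetD[OF e(2)]) (simp add: dist_norm norm_mult)
  then have "(x + of_real e * nrm t) \<bullet> nrm t \<le> hs K t" by (rule hs_upper)
  moreover have "(of_real e * nrm t) \<bullet> nrm t = e"
    using norm_nrm[of t] by (simp add: scaleR_conv_of_real[symmetric] dot_square_norm)
  ultimately show False using s e by (simp add: supp_def ds_def inner_add_left)
qed

lemma supp_of_le:
  assumes "x \<in> K" "n \<noteq> 0" "\<And>y. y \<in> K \<Longrightarrow> y \<bullet> n \<le> x \<bullet> n"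
  shows "\<exists>t. supp K x t"
proof -
  define t where "t = Arg n + pi / 2"
  have "nrm t = cis (Arg n)" by (simp add: nrm_def t_def cis_mult[symmetric] cis_pi_half algebra_simps)
  then have n: "n = norm n *\<^sub>R nrm t" by (metis rcis_cmod_Arg rcis_def scaleR_conv_of_real)
  have le: "y \<bullet> nrm t \<le> x \<bullet> nrm t" if "y \<in> K" for y
  proof -
    have "y \<bullet> (norm n *\<^sub>R nrm t) \<le> x \<bullet> (norm n *\<^sub>R nrm t)" using assms(3)[OF that] n by metis
    then show ?thesis using assms(2) by simp
  qed
  have "hs K t \<le> x \<bullet> nrm t" unfolding hs_def using le ne by (intro cSUP_least) auto
  then show ?thesis using ds_nonneg[OF assms(1), of t] assms(1) by (auto simp: supp_def ds_def intro!: exI[of _ t])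
qed

lemma frontier_supp:
  assumes "x \<in> K" "x \<notin> interior K"
  shows "\<exists>t. supp K x t"
proof (cases "interior K = {}")
  \<comment> \<open>A body without interior lies on a line, and this line supports it at each of its
    points.\<close>
  case True
  obtain a b where "a \<noteq> 0" "K \<subseteq> {x. a \<bullet> x = b}" using empty_interior_subset_hyperplane[OF conv True] by blast
  then have "y \<bullet> a = b" if "y \<in> K" for y using that by (auto simp: inner_commute)
  then show ?thesis using supp_of_le[OF assms(1) \<open>a \<noteq> 0\<close>] assms by simp
next
  case False
  then have "x \<notin> rel_interior K" using assms rel_interior_nonempty_interior by metis
  then obtain a where "a \<noteq> 0" "\<And>y. y \<in> K \<Longrightarrow> a \<bullet> x \<le> a \<bullet> y"
    using supporting_hyperplane_rel_boundary[OF conv assms(1)] by metis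
  then show ?thesis using supp_of_le[OF assms(1), of "- a"] by (simp add: inner_commute)
qed

text \<open>\<open>p\<close> and \<open>q\<close> have arguments between 0 and pi. If these add up
  to at most pi, the path turns left through the direction of the support line; otherwise it turns
  right, through the opposite direction.\<close>

lemma split_sign:
  assumes "supp K y \<theta>" "x \<in> K" "z \<in> K" "x \<noteq> y" "z \<noteq> y"
  shows "\<exists>s. ang (y - x) (z - y) = ang (y - x) (sdir s \<theta>) + ang (sdir s \<theta>) (z - y)"
proof -
  define p q where "p = cis \<theta> / (y - x)" and "q = (z - y) / cis \<theta>"
  have nz: "y - x \<noteq> 0" "z - y \<noteq> 0" using assms by auto
  then have pq: "p \<noteq> 0" "q \<noteq> 0" by (auto simp: p_def q_def)
  have A: "(x - y) \<bullet> nrm \<theta> \<le> 0" "(z - y) \<bullet> nrm \<theta> \<le> 0"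
    using assms hs_upper[of x \<theta>] hs_upper[of z \<theta>] by (auto simp: supp_def ds_def inner_diff_left)
  have "Im p = - ((x - y) \<bullet> nrm \<theta>) / (norm (y - x))\<^sup>2"
    unfolding p_def cmod_power2 by (simp add: inner_nrm Im_divide diff_divide_distrib[symmetric] algebra_simps)
  then have p: "0 \<le> Arg p" using A by (simp add: Arg_less_0 divide_nonpos_nonneg)
  have "Im q = - ((z - y) \<bullet> nrm \<theta>)"
    by (simp add: q_def inner_nrm Im_divide algebra_simps power2_eq_square[symmetric])
  then have q: "0 \<le> Arg q" using A by (simp add: Arg_less_0)
  have a1: "ang (y - x) (cis \<theta>) = Arg p" "ang (cis \<theta>) (z - y) = Arg q"
    using p q by (simp_all add: ang_def p_def q_def)
  have a2: "ang (y - x) (- cis \<theta>) = pi - Arg p" "ang (- cis \<theta>) (z - y) = pi - Arg q"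
    using a1 ang_minus[of "y - x" "cis \<theta>"] ang_minus1[of "cis \<theta>" "z - y"] nz by auto
  have a3: "ang (y - x) (z - y) = \<bar>Arg (p * q)\<bar>" by (simp add: ang_def p_def q_def)
  have b: "Arg p \<le> pi" "Arg q \<le> pi" using Arg_bounded by auto
  show ?thesis
  proof (cases "Arg p + Arg q \<le> pi")
    case True
    then have "\<bar>Arg (p * q)\<bar> = Arg p + Arg q" using Arg_times'[OF pq] p q pi_gt_zero by auto
    then show ?thesis using a1 a3 by (intro exI[of _ True]) (simp add: sdir_def)
  next
    case False
    then have "\<bar>Arg (p * q)\<bar> = 2 * pi - (Arg p + Arg q)" using Arg_times'[OF pq] p q b by auto
    then show ?thesis using a2 a3 by (intro exI[of _ False]) (simp add: sdir_def)
  qed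
qed

definition isgap :: "real \<Rightarrow> bool" where
  "isgap \<gamma> \<longleftrightarrow> \<gamma> = 0 \<or> (\<exists>z \<rho>. 0 < \<rho> \<and> cball z \<rho> \<subseteq> K \<and> \<gamma> = wgap \<rho>)"

lemma isgap_nonneg: "isgap \<gamma> \<Longrightarrow> 0 \<le> \<gamma>"
  using B(1) by (auto simp: isgap_def wgap_def)

definition pathJ :: "complex \<Rightarrow> complex list \<Rightarrow> complex \<Rightarrow> real" where
  "pathJ d ps d' = plen ps - crad K * trn (d # edges ps @ [d'])"

text \<open>The turning at every inner vertex is split at a support direction, in the sense that the
  vertex prescribes; then the potentials telescope. If the sense is counterclockwise at the start
  and clockwise at the end, some edge makes this change and pays \<gamma>.\<close>

lemma inscribed_path:
  assumes "set ps \<subseteq> K - interior K" "distinct_adj ps" "2 \<le> length ps"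
    "supp K (hd ps) \<theta>" "supp K (last ps) \<theta>'" "isgap \<gamma>"
  shows "pathJ (sdir s \<theta>) ps (sdir s' \<theta>')
    \<le> spot K s' (last ps) \<theta>' - spot K s (hd ps) \<theta> - (if s \<and> \<not> s' then \<gamma> else 0)"
  using assms
proof (induction ps arbitrary: s \<theta>)
  case (Cons x ps)
  then obtain y qs where ps: "ps = y # qs" by (cases ps) auto
  have xy: "x \<noteq> y" using Cons.prems ps by simp
  show ?case
  proof (cases qs)
    case Nil
    have "norm (y - x) - crad K * (ang (sdir s \<theta>) (y - x) + ang (y - x) (sdir s' \<theta>'))
      \<le> spot K s' y \<theta>' - spot K s x \<theta> - (if s \<and> \<not> s' then \<gamma> else 0)"
      by (rule edge_bound) (use Cons.prems ps Nil xy in \<open>auto simp: isgap_def\<close>)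
    then show ?thesis using ps Nil by (simp add: pathJ_def dist_norm norm_minus_commute)
  next
    case (Cons z rs)
    have yz: "y \<noteq> z" using Cons.prems ps Cons by simp
    have yK: "y \<in> K" "y \<notin> interior K" "x \<in> K" "z \<in> K" using Cons.prems ps Cons by auto
    obtain \<theta>y where \<theta>y: "supp K y \<theta>y" using frontier_supp yK by blast
    obtain sy where sy: "ang (y - x) (z - y) = ang (y - x) (sdir sy \<theta>y) + ang (sdir sy \<theta>y) (z - y)"
      using split_sign[OF \<theta>y, of x z] yK xy yz by auto
    have IH: "pathJ (sdir sy \<theta>y) ps (sdir s' \<theta>')
      \<le> spot K s' (last ps) \<theta>' - spot K sy (hd ps) \<theta>y - (if sy \<and> \<not> s' then \<gamma> else 0)"
      by (rule Cons.IH) (use Cons.prems ps Cons \<theta>y in auto)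
    have "norm (y - x) - crad K * (ang (sdir s \<theta>) (y - x) + ang (y - x) (sdir sy \<theta>y))
      \<le> spot K sy y \<theta>y - spot K s x \<theta> - (if s \<and> \<not> sy then \<gamma> else 0)"
      by (rule edge_bound) (use Cons.prems xy \<theta>y in \<open>auto simp: isgap_def\<close>)
    moreover have "pathJ (sdir s \<theta>) (x # ps) (sdir s' \<theta>')
      = norm (y - x) - crad K * (ang (sdir s \<theta>) (y - x) + ang (y - x) (sdir sy \<theta>y)) + pathJ (sdir sy \<theta>y) ps (sdir s' \<theta>')"
      using ps Cons sy by (simp add: pathJ_def dist_norm norm_minus_commute algebra_simps)
    ultimately show ?thesis using IH ps isgap_nonneg[OF Cons.prems(6)] by (auto split: if_splits)
  qed
qed simp

text \<open>The measure counts interior vertices twice. Each outcome of \<open>slide\<close> lowers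
  it: a vertex reaches the frontier or disappears.\<close>

lemma path_bound:
  assumes "set ps \<subseteq> K" "distinct_adj ps" "2 \<le> length ps"
    "supp K (hd ps) \<theta>" "supp K (last ps) \<theta>'" "isgap \<gamma>"
  shows "pathJ (sdir s \<theta>) ps (sdir s' \<theta>')
    \<le> spot K s' (last ps) \<theta>' - spot K s (hd ps) \<theta> - (if s \<and> \<not> s' then \<gamma> else 0)"
  using assms
proof (induction "length ps + length (filter (\<lambda>p. p \<in> interior K) ps)" arbitrary: ps rule: less_induct)
  case less
  let ?R = "\<lambda>ps. spot K s' (last ps) \<theta>' - spot K s (hd ps) \<theta> - (if s \<and> \<not> s' then \<gamma> else 0)"
  show ?case
  proof (cases "\<exists>p\<in>set ps. p \<in> interior K")
    case False
    then have "set ps \<subseteq> K - interior K" using less.prems(1) by auto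
    then show ?thesis by (rule inscribed_path) fact+
  next
    case True
    then obtain p us vs where ps0: "ps = us @ p # vs" and pint: "p \<in> interior K" by (meson split_list)
    have "us \<noteq> []" using less.prems(4) supp_not_interior pint ps0 by (cases us) auto
    then obtain pre a where us: "us = pre @ [a]" by (cases us rule: rev_cases) auto
    have "vs \<noteq> []" using less.prems(5) supp_not_interior pint ps0 by (cases vs) auto
    then obtain b post where vs: "vs = b # post" by (cases vs) auto
    have ps: "ps = pre @ a # p # b # post" using ps0 us vs by simp
    define D0 where "D0 = sdir s \<theta> # edges (pre @ [a])"
    define D3 where "D3 = edges (b # post) @ [sdir s' \<theta>']"
    define d where "d = last D0"
    have eds: "edges (pre @ a # X @ b # post) = edges (pre @ [a]) @ edges (a # X @ [b]) @ edges (b # post)" for X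
      using edges_split[of pre a "X @ b # post"] edges_split[of "a # X" b post] by simp
    have nz: "0 \<notin> set (edges ps)" using less.prems(2) distinct_adj_edges by blast
    have ap: "a \<noteq> p" "p \<noteq> b" using nz unfolding ps using eds[of "[p]"] by auto
    have nzD: "0 \<notin> set D0" "0 \<notin> set D3" using nz unfolding ps D0_def D3_def using eds[of "[p]"] by (auto simp: sdir_def)
    have neD: "D0 \<noteq> []" "D3 \<noteq> []" by (auto simp: D0_def D3_def)
    have d: "d \<noteq> 0" using nzD neD by (metis d_def last_in_set)
    have h3: "hd D3 \<noteq> 0" using nzD neD by (metis hd_in_set)
    have KK: "a \<in> K" "b \<in> K" using less.prems(1) ps by auto
    have trn2: "trn (sdir s \<theta> # edges (pre @ a # q # b # post) @ [sdir s' \<theta>']) =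
      trn D0 + ang d (q - a) + ang (q - a) (b - q) + ang (b - q) (hd D3) + trn D3" for q
    proof -
      have "sdir s \<theta> # edges (pre @ a # q # b # post) @ [sdir s' \<theta>'] = D0 @ [q - a, b - q] @ D3"
        using eds[of "[q]"] by (simp add: D0_def D3_def)
      then show ?thesis using neD trn_append[of D0 "[q - a, b - q] @ D3"] trn_append[of "[q - a, b - q]" D3] by (simp add: d_def)
    qed
    have trn1: "trn (sdir s \<theta> # edges (pre @ a # b # post) @ [sdir s' \<theta>']) =
      trn D0 + ang d (b - a) + ang (b - a) (hd D3) + trn D3"
    proof -
      have "sdir s \<theta> # edges (pre @ a # b # post) @ [sdir s' \<theta>'] = D0 @ [b - a] @ D3"
        using eds[of "[]"] by (simp add: D0_def D3_def)
      then show ?thesis using neD trn_append[of D0 "[b - a] @ D3"] trn_append[of "[b - a]" D3] by (simp add: d_def)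
    qed
    have len2: "plen (pre @ a # q # b # post) = plen (pre @ [a]) + norm (q - a) + norm (b - q) + plen (b # post)" for q
      using plen_split[of pre a "q # b # post"] by (simp add: dist_norm norm_minus_commute)
    have len1: "plen (pre @ a # b # post) = plen (pre @ [a]) + norm (b - a) + plen (b # post)"
      using plen_split[of pre a "b # post"] by (simp add: dist_norm norm_minus_commute)
    define J where "J x = norm (x - a) + norm (b - x) - crad K * (ang d (x - a) + ang (x - a) (b - p))" for x
    define C where "C = plen (pre @ [a]) + plen (b # post) - crad K * (trn D0 + ang (b - p) (hd D3) + trn D3)"
    have JJ: "pathJ (sdir s \<theta>) (pre @ a # q # b # post) (sdir s' \<theta>') = C + J q"
      if "b - q = of_real r * (b - p)" "0 < r" for q r
    proof -
      have "ang (q - a) (b - q) = ang (q - a) (b - p)" "ang (b - q) (hd D3) = ang (b - p) (hd D3)"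
        unfolding that(1) using that(2) by (simp_all only: ang_scale1 ang_scale2)
      then show ?thesis unfolding pathJ_def trn2 len2 C_def J_def by (simp add: algebra_simps)
    qed
    have Jp: "pathJ (sdir s \<theta>) ps (sdir s' \<theta>') = C + J p" using JJ[of p 1] ps by simp
    have intK: "interior K \<subseteq> K" by (rule interior_subset)
    have ends: "hd (pre @ a # q # b # post) = hd ps" "last (pre @ a # q # b # post) = last ps" for q
      by (simp_all add: ps hd_append)
    have moved: "pathJ (sdir s \<theta>) ps (sdir s' \<theta>') \<le> ?R ps"
      if q: "q \<in> K" "q \<notin> interior K" "q \<noteq> a" "0 < r" "b - q = of_real r * (b - p)" "J p \<le> J q" for q r
    proof -
      let ?qs = "pre @ a # q # b # post"
      have qb: "q \<noteq> b" using q ap by auto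
      have "pathJ (sdir s \<theta>) ?qs (sdir s' \<theta>') \<le> ?R ?qs"
      proof (rule less.hyps)
        show "length ?qs + length (filter (\<lambda>p. p \<in> interior K) ?qs) < length ps + length (filter (\<lambda>p. p \<in> interior K) ps)"
          using q pint by (simp add: ps)
        show "distinct_adj ?qs" using nz qb q unfolding distinct_adj_edges ps using eds[of "[q]"] eds[of "[p]"] by auto
        show "set ?qs \<subseteq> K" using less.prems(1) q(1) by (auto simp: ps)
        show "2 \<le> length ?qs" by simp
        show "supp K (hd ?qs) \<theta>" using less.prems(4) by (simp only: ends)
        show "supp K (last ?qs) \<theta>'" using less.prems(5) by (simp only: ends)
        show "isgap \<gamma>" by fact
      qed
      then show ?thesis using JJ[OF q(5,4)] Jp q(6) ends by simp
    qed
    have cr: "0 \<le> crad K" by (rule crad_nonneg)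
    show ?thesis
    proof (rule slide[OF KK pint ap d])
      fix q r assume "q \<in> frontier K" "0 < r" "b - q = of_real r * (b - p)" "q \<noteq> a"
        "norm (p - a) + norm (b - p) - crad K * (ang d (p - a) + ang (p - a) (b - p))
        \<le> norm (q - a) + norm (b - q) - crad K * (ang d (q - a) + ang (q - a) (b - p))"
      moreover have "q \<in> K" "q \<notin> interior K" using calculation(1) compact_imp_closed[OF comp] by (auto simp: frontier_def)
      ultimately show ?thesis using moved[of q r] by (simp add: J_def)
    next
      assume ab: "a \<noteq> b" and le: "norm (p - a) + norm (b - p) - crad K * (ang d (p - a) + ang (p - a) (b - p))
        \<le> norm (b - a) - crad K * (ang d (b - a) + ang (b - a) (b - p))"
      let ?qs = "pre @ a # b # post"
      have e1: "hd ?qs = hd ps" "last ?qs = last ps" by (simp_all add: ps hd_append)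
      have "pathJ (sdir s \<theta>) ?qs (sdir s' \<theta>') \<le> ?R ?qs"
      proof (rule less.hyps)
        show "length ?qs + length (filter (\<lambda>p. p \<in> interior K) ?qs) < length ps + length (filter (\<lambda>p. p \<in> interior K) ps)"
          by (simp add: ps)
        show "distinct_adj ?qs" using nz ab unfolding distinct_adj_edges ps using eds[of "[]"] eds[of "[p]"] by auto
        show "set ?qs \<subseteq> K" using less.prems(1)  by (auto simp: ps)
        show "2 \<le> length ?qs" by simp
        show "supp K (hd ?qs) \<theta>" using less.prems(4) by (simp only: e1)
        show "supp K (last ?qs) \<theta>'" using less.prems(5) by (simp only: e1)
        show "isgap \<gamma>" by fact
      qed
      moreover have "C + J p \<le> pathJ (sdir s \<theta>) ?qs (sdir s' \<theta>')"
      proof -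
        have "ang (b - a) (hd D3) \<le> ang (b - a) (b - p) + ang (b - p) (hd D3)"
          using ang_triangle[of "b - a" "b - p" "hd D3"] ab ap h3 by auto
        from mult_left_mono[OF this cr]
        show ?thesis unfolding pathJ_def trn1 len1 C_def J_def using le by (simp add: algebra_simps)
      qed
      ultimately show ?thesis using Jp e1 by simp
    next
      fix q r k assume q: "q \<in> K" "0 < r" "b - q = of_real r * (b - p)" "0 < k" "q - a = of_real k * d" and
        le: "norm (p - a) + norm (b - p) - crad K * (ang d (p - a) + ang (p - a) (b - p))
        \<le> norm (q - a) + norm (b - q) - crad K * (ang d (q - a) + ang (q - a) (b - p))"
      have qa: "q \<noteq> a" using q d by auto
      show ?thesis
      proof (cases "q \<in> interior K")
        case False
        then show ?thesis using moved[of q r] q qa le by (simp add: J_def)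
      next
        \<comment> \<open>\<open>q\<close> itself may be no better than \<open>p\<close>, but the
          path now runs straight through \<open>a\<close>, so this vertex is dropped
          instead.\<close>
        case True
        show ?thesis
        proof (cases pre rule: rev_cases)
          \<comment> \<open>At the start of the path \<open>d\<close> is a support direction;
            \<open>q\<close> then lies on the support line and is not interior.\<close>
          case Nil
          then have dT: "d = sdir s \<theta>" "hd ps = a" by (simp_all add: d_def D0_def ps)
          have "(q - a) \<bullet> nrm \<theta> = 0" unfolding q(5) dT(1)
            by (simp add: sdir_def inner_nrm algebra_simps)
          then have "supp K q \<theta>" using less.prems(4) q(1) dT(2) by (simp add: supp_def ds_def inner_diff_left)
          then show ?thesis using True supp_not_interior by blast
        next
          case (snoc pre0 a0)
          let ?qs = "pre0 @ a0 # q # b # post"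
          have psn: "ps = pre0 @ a0 # a # p # b # post" using ps snoc by simp
          define D00 where "D00 = sdir s \<theta> # edges (pre0 @ [a0])"
          have D0: "D0 = D00 @ [a - a0]" using snoc edges_append[of "pre0 @ [a0]" "[a]"] by (simp add: D0_def D00_def)
          have da: "d = a - a0" by (simp add: d_def D0)
          have qa0: "q - a0 = of_real (1 + k) * d" 
          proof -
            have "q - a0 = (q - a) + d" by (simp add: da)
            then show ?thesis using q(5) by (simp add: algebra_simps)
          qed
          have qne: "q \<noteq> a0" using qa0 d q(4) by (metis add_pos_pos eq_iff_diff_eq_0 less_irrefl mult_eq_0_iff of_real_eq_0_iff zero_less_one)
          have qb: "q \<noteq> b" using q ap by auto
          have e1: "hd ?qs = hd ps" "last ?qs = last ps" by (simp_all add: psn hd_append)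
          have edq: "edges ?qs = edges (pre0 @ [a0]) @ [q - a0, b - q] @ edges (b # post)"
            using edges_split[of pre0 a0 "q # b # post"] by simp
          have edp: "edges ps = edges (pre0 @ [a0]) @ [a - a0, p - a, b - p] @ edges (b # post)"
            unfolding psn using edges_split[of pre0 a0 "a # p # b # post"] by simp
          have "pathJ (sdir s \<theta>) ?qs (sdir s' \<theta>') \<le> ?R ?qs"
          proof (rule less.hyps)
            show "length ?qs + length (filter (\<lambda>p. p \<in> interior K) ?qs) < length ps + length (filter (\<lambda>p. p \<in> interior K) ps)"
              using pint by (simp add: psn)
            show "distinct_adj ?qs" using nz qb qne unfolding distinct_adj_edges edq edp by auto
            show "set ?qs \<subseteq> K" using less.prems(1) q(1) by (auto simp: psn)
            show "2 \<le> length ?qs" by simp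
            show "supp K (hd ?qs) \<theta>" using less.prems(4) by (simp only: e1)
            show "supp K (last ?qs) \<theta>'" using less.prems(5) by (simp only: e1)
            show "isgap \<gamma>" by fact
          qed
          moreover have "pathJ (sdir s \<theta>) ?qs (sdir s' \<theta>') = C + J q"
          proof -
            have n1: "norm (q - a0) = norm (a - a0) + norm (q - a)"
              unfolding qa0 q(5) da[symmetric] using q(4) by (simp only: norm_mult norm_of_real) (simp add: algebra_simps)
            have n2: "plen ?qs = plen (pre @ [a]) + norm (q - a) + norm (b - q) + plen (b # post)"
              using plen_split[of pre0 a0 "q # b # post"] plen_split[of pre0 a0 "[a]"] n1
              by (simp add: snoc dist_norm norm_minus_commute)
            have dn: "D00 \<noteq> []" by (simp add: D00_def)
            have n3: "trn (sdir s \<theta> # edges ?qs @ [sdir s' \<theta>']) = trn D0 + ang (q - a) (b - p) + ang (b - p) (hd D3) + trn D3"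
            proof -
              have "sdir s \<theta> # edges ?qs @ [sdir s' \<theta>'] = D00 @ [q - a0, b - q] @ D3"
                unfolding edq by (simp add: D00_def D3_def)
              then have "trn (sdir s \<theta> # edges ?qs @ [sdir s' \<theta>']) = trn D00 + ang (last D00) (q - a0) + ang (q - a0) (b - q) + ang (b - q) (hd D3) + trn D3"
                using neD dn trn_append[of D00 "[q - a0, b - q] @ D3"] trn_append[of "[q - a0, b - q]" D3] by simp
              moreover have "ang (last D00) (q - a0) = ang (last D00) d" unfolding qa0 using q(4) by (intro ang_scale2) auto
              moreover have "ang (q - a0) (b - q) = ang d (b - p)" unfolding qa0 q(3) using q(2,4) by (simp add: ang_scale1 ang_scale2 del: of_real_add)
              moreover have "ang (q - a) (b - p) = ang d (b - p)" unfolding q(5) using q(4) by (rule ang_scale1)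
              moreover have "ang (b - q) (hd D3) = ang (b - p) (hd D3)" unfolding q(3) using q(2) by (rule ang_scale1)
              moreover have "trn D0 = trn D00 + ang (last D00) d" unfolding D0 da using trn_snoc[OF dn] by simp
              ultimately show ?thesis by simp
            qed
            have "ang d (q - a) = 0" unfolding q(5) using q(4) d by (simp add: ang_scale2)
            then show ?thesis unfolding pathJ_def n2 n3 C_def J_def by (simp add: algebra_simps)
          qed
          ultimately show ?thesis using Jp le e1 by (simp add: J_def)
        qed
      qed
    qed
  qed
qed

end

subsection \<open>Closed curves in a convex body\<close>

lemma edges_join:
  assumes "ps \<noteq> []" "qs \<noteq> []" "last ps = hd qs"
  shows "edges (ps @ tl qs) = edges ps @ edges qs"
proof -
  obtain q qs' where q: "qs = q # qs'" using assms by (cases qs) auto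
  show ?thesis
  proof (cases qs')
    case Nil then show ?thesis using q by simp
  next
    case (Cons r rs)
    then show ?thesis using edges_append[OF assms(1), of qs'] assms q by simp
  qed
qed

lemma ctrn_rotate:
  assumes "us \<noteq> []" "vs \<noteq> []"
  shows "ctrn (us @ vs) = ctrn (vs @ us)"
proof -
  have "ctrn (us @ vs) = trn ([last vs] @ us @ vs)" using assms by (simp add: ctrn_def)
  moreover have "ctrn (vs @ us) = trn ([last us] @ vs @ us)" using assms by (simp add: ctrn_def)
  ultimately show ?thesis
    using trn_append[of "[last vs]" "us @ vs"] trn_append[of us vs] trn_append[of "[last us]" "vs @ us"] trn_append[of vs us] assms
    by (simp add: hd_append)
qed

lemma edges_Nil_iff: "edges ps = [] \<longleftrightarrow> length ps \<le> 1"
  by (induction ps rule: edges.induct) auto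

lemma hd_edges: "2 \<le> length ps \<Longrightarrow> hd (edges ps) = ps ! 1 - hd ps"
  by (cases ps; cases "tl ps") auto

lemma last_edges: "2 \<le> length ps \<Longrightarrow> last (edges ps) = last ps - last (butlast ps)"
proof -
  assume l: "2 \<le> length ps"
  then obtain qs q where q: "ps = qs @ [q]" by (cases ps rule: rev_cases) auto
  then have "qs \<noteq> []" using l by auto
  then show ?thesis using edges_append[of qs "[q]"] q by simp
qed

lemma sorted_split:
  assumes "sorted_wrt (<) (ts :: real list)" "s \<in> set ts"
  shows "ts = filter (\<lambda>t. t < s) ts @ s # filter (\<lambda>t. s < t) ts"
proof -
  obtain us vs where ts: "ts = us @ s # vs" using assms(2) by (meson split_list)
  have a: "\<forall>u\<in>set us. u < s" and b: "\<forall>v\<in>set vs. s < v" using assms(1) unfolding ts by (auto simp: sorted_wrt_append)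
  have "filter (\<lambda>t. t < s) us = us" "filter (\<lambda>t. t < s) vs = []" "filter (\<lambda>t. s < t) us = []" "filter (\<lambda>t. s < t) vs = vs"
    using a b by (auto simp: filter_id_conv filter_empty_conv)
  then show ?thesis unfolding ts by simp
qed

lemma sorted_last:
  assumes "sorted_wrt (<) xs" "m \<in> set xs" "\<And>x. x \<in> set xs \<Longrightarrow> x \<le> (m::real)"
  shows "last xs = m"
proof -
  obtain us vs where xs: "xs = us @ m # vs" using assms(2) by (meson split_list)
  have "vs = []"
  proof (rule ccontr)
    assume "vs \<noteq> []"
    then have "hd vs \<in> set vs" by simp
    moreover have "\<forall>v\<in>set vs. m < v" using assms(1) unfolding xs by (auto simp: sorted_wrt_append)
    ultimately show False using assms(3)[of "hd vs"] unfolding xs by force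
  qed
  then show ?thesis using xs by simp
qed

lemma sorted_hd:
  assumes "sorted_wrt (<) xs" "m \<in> set xs" "\<And>x. x \<in> set xs \<Longrightarrow> (m::real) \<le> x"
  shows "hd xs = m"
  using assms by (cases xs) force+

text \<open>The interface between curves and polygons: inscribed polygons with prescribed nodes come
  arbitrarily close to the length \<Lambda>, and none turns by more than \<open>W\<close>. It is
  instantiated with the full rotation for \<Gamma> and with 2 * pi for \<Gamma>1.\<close>

locale tcurve =
  fixes c :: "real \<Rightarrow> complex" and \<Lambda> W :: real
  assumes pos: "0 < \<Lambda>" and closed: "c 0 = c \<Lambda>"
    and lip: "\<And>s t. 0 \<le> s \<Longrightarrow> s \<le> \<Lambda> \<Longrightarrow> 0 \<le> t \<Longrightarrow> t \<le> \<Lambda> \<Longrightarrow> dist (c s) (c t) \<le> \<bar>s - t\<bar>"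
    and rect: "\<And>F \<delta>. finite F \<Longrightarrow> F \<subseteq> {0..\<Lambda>} \<Longrightarrow> 0 < \<delta> \<Longrightarrow>
      \<exists>ts. sorted_wrt (<) ts \<and> set ts \<subseteq> {0..\<Lambda>} \<and> insert 0 (insert \<Lambda> F) \<subseteq> set ts \<and> \<Lambda> - \<delta> \<le> plen (map c ts)"
    and turn: "\<And>ts. sorted_wrt (<) ts \<Longrightarrow> set ts \<subseteq> {0..\<Lambda>} \<Longrightarrow> {0, \<Lambda>} \<subseteq> set ts \<Longrightarrow>
      edges (remdups_adj (map c ts)) \<noteq> [] \<Longrightarrow> ctrn (edges (remdups_adj (map c ts))) \<le> W"
begin

definition nodes :: "real list \<Rightarrow> bool" where
  "nodes ts \<longleftrightarrow> sorted_wrt (<) ts \<and> set ts \<subseteq> {0..\<Lambda>} \<and> {0, \<Lambda>} \<subseteq> set ts"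

definition E :: "real list \<Rightarrow> complex list" where
  "E ts = edges (remdups_adj (map c ts))"

lemma E_filter: "E ts = filter (\<lambda>e. e \<noteq> 0) (edges (map c ts))"
  by (simp add: E_def edges_remdups_adj)

lemma E_split: "E (us @ s # vs) = E (us @ [s]) @ E (s # vs)"
  using edges_split[of "map c us" "c s" "map c vs"] by (simp add: E_filter)

lemma plen_E: "plen (map c ts) = sum_list (map norm (E ts))"
proof -
  have "sum_list (map norm es) = sum_list (map norm (filter (\<lambda>e. e \<noteq> 0) es))" for es :: "complex list"
    by (induction es) auto
  then show ?thesis by (simp add: plen_edges E_filter)
qed

lemma plen_le: "sorted_wrt (<) ts \<Longrightarrow> set ts \<subseteq> {0..\<Lambda>} \<Longrightarrow> ts \<noteq> [] \<Longrightarrow> plen (map c ts) \<le> last ts - hd ts"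
proof (induction ts)
  case (Cons t ts)
  show ?case
  proof (cases ts)
    case (Cons u us)
    have "plen (map c ts) \<le> last ts - hd ts" using Cons.IH Cons.prems Cons by auto
    moreover have "dist (c t) (c u) \<le> u - t" using lip[of t u] Cons.prems Cons by auto
    ultimately show ?thesis using Cons by simp
  qed simp
qed simp

text \<open>The inscribed closed polygon with nodes \<open>ts\<close> is read cyclically from the node \<open>s\<close>.\<close>

definition bef where "bef ts s = filter (\<lambda>t. t < (s::real)) ts"
definition aft where "aft ts s = filter (\<lambda>t. (s::real) < t) ts"
definition rot where "rot ts s = E (s # aft ts s) @ E (bef ts s @ [s])"
definition loop where "loop ts s = remdups_adj (map c (s # aft ts s) @ tl (map c (bef ts s @ [s])))"

lemma nodes_split:
  assumes "nodes ts" "s \<in> set ts"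
  shows "ts = bef ts s @ s # aft ts s" "last (s # aft ts s) = \<Lambda>" "hd (bef ts s @ [s]) = 0"
proof -
  have so: "sorted_wrt (<) ts" and sub: "set ts \<subseteq> {0..\<Lambda>}" and mem: "0 \<in> set ts" "\<Lambda> \<in> set ts"
    using assms by (auto simp: nodes_def)
  show ts: "ts = bef ts s @ s # aft ts s" unfolding bef_def aft_def by (rule sorted_split) fact+
  have so2: "sorted_wrt (<) (s # aft ts s)" "sorted_wrt (<) (bef ts s @ [s])"
    using so by (auto simp: aft_def bef_def sorted_wrt_filter sorted_wrt_append)
  show "last (s # aft ts s) = \<Lambda>"
    by (rule sorted_last[OF so2(1)]) (use mem sub assms in \<open>auto simp: aft_def\<close>)
  show "hd (bef ts s @ [s]) = 0"
    by (rule sorted_hd[OF so2(2)]) (use mem sub assms in \<open>auto simp: bef_def\<close>)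
qed

lemma rot_perm:
  assumes "nodes ts" "s \<in> set ts"
  shows "E ts = E (bef ts s @ [s]) @ E (s # aft ts s)"
  using nodes_split(1)[OF assms] E_split by metis

lemma ctrn_rot:
  assumes "nodes ts" "s \<in> set ts"
  shows "ctrn (rot ts s) = ctrn (E ts)"
proof (cases "E (bef ts s @ [s]) = [] \<or> E (s # aft ts s) = []")
  case True
  then show ?thesis using rot_perm[OF assms] by (auto simp: rot_def)
next
  case False
  then show ?thesis using rot_perm[OF assms] ctrn_rotate by (simp add: rot_def)
qed

text \<open>For \<open>s' = s\<close> this is the whole loop, for \<open>s < s'\<close> the part of
  the curve that passes through the base point.\<close>

lemma wrap_edges:
  assumes "nodes ts" "s \<in> set ts" "s' \<in> set ts"
  shows "edges (remdups_adj (map c (s' # aft ts s') @ tl (map c (bef ts s @ [s])))) = E (s' # aft ts s') @ E (bef ts s @ [s])"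
proof -
  have "last (map c (s' # aft ts s')) = c \<Lambda>" using nodes_split(2)[OF assms(1,3)] last_map[of "s' # aft ts s'" c] by simp
  moreover have "hd (map c (bef ts s @ [s])) = c 0" using nodes_split(3)[OF assms(1,2)] hd_map[of "bef ts s @ [s]" c] by simp
  ultimately have "edges (map c (s' # aft ts s') @ tl (map c (bef ts s @ [s]))) = edges (map c (s' # aft ts s')) @ edges (map c (bef ts s @ [s]))"
    using closed by (intro edges_join) auto
  then show ?thesis by (simp only: edges_remdups_adj E_filter filter_append)
qed

lemma wrap_ends:
  assumes "nodes ts" "s \<in> set ts" "s' \<in> set ts"
  defines "P \<equiv> remdups_adj (map c (s' # aft ts s') @ tl (map c (bef ts s @ [s])))"
  shows "hd P = c s'" "last P = c s" "set P \<subseteq> c ` ({s'..\<Lambda>} \<union> {0..s})" "P \<noteq> []" "distinct_adj P"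
    "c ` (set ts \<inter> ({s'..\<Lambda>} \<union> {0..s})) \<subseteq> set P"
proof -
  show "hd P = c s'" by (simp add: P_def)
  have l: "last (map c (s' # aft ts s')) = c \<Lambda>" using nodes_split(2)[OF assms(1,3)] last_map[of "s' # aft ts s'" c] by simp
  have b: "bef ts s = [] \<Longrightarrow> s = 0" using nodes_split(3)[OF assms(1,2)] by simp
  have "last (map c (s' # aft ts s') @ tl (map c (bef ts s @ [s]))) = c s"
  proof (cases "bef ts s")
    case Nil
    then show ?thesis using l b closed by simp
  qed auto
  then show "last P = c s" by (simp add: P_def)
  have sub: "set ts \<subseteq> {0..\<Lambda>}" using assms by (auto simp: nodes_def)
  show "set P \<subseteq> c ` ({s'..\<Lambda>} \<union> {0..s})" 
  proof -
    have tl: "set (tl xs) \<subseteq> set xs" for xs :: "complex list" by (cases xs) auto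
    have "set P \<subseteq> set (map c (s' # aft ts s')) \<union> set (map c (bef ts s @ [s]))"
      using tl[of "map c (bef ts s @ [s])"] by (auto simp: P_def)
    also have "\<dots> = c ` (set (s' # aft ts s') \<union> set (bef ts s @ [s]))" by (simp only: set_map image_Un)
    also have "\<dots> \<subseteq> c ` ({s'..\<Lambda>} \<union> {0..s})"
      by (rule image_mono) (use sub assms(2,3) in \<open>auto simp: aft_def bef_def\<close>)
    finally show ?thesis .
  qed
  show "P \<noteq> []" by (simp add: P_def)
  show "distinct_adj P" by (simp add: P_def)
  have "c ` set (bef ts s @ [s]) \<subseteq> set P"
  proof -
    have "c (hd (bef ts s @ [s])) = last (map c (s' # aft ts s'))" using l closed nodes_split(3)[OF assms(1,2)] by simp
    moreover have "last (map c (s' # aft ts s')) \<in> set (map c (s' # aft ts s'))" by (rule last_in_set) simp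
    moreover have "set (map c (bef ts s @ [s])) \<subseteq> insert (c (hd (bef ts s @ [s]))) (set (tl (map c (bef ts s @ [s]))))"
      by (cases "bef ts s") auto
    ultimately show ?thesis unfolding P_def by auto
  qed
  moreover have "c ` set (s' # aft ts s') \<subseteq> set P" by (auto simp: P_def)
  moreover have "set ts \<inter> ({s'..\<Lambda>} \<union> {0..s}) \<subseteq> set (s' # aft ts s') \<union> set (bef ts s @ [s])"
    by (auto simp: aft_def bef_def)
  ultimately show "c ` (set ts \<inter> ({s'..\<Lambda>} \<union> {0..s})) \<subseteq> set P" by blast
qed

lemma edges_loop: "nodes ts \<Longrightarrow> s \<in> set ts \<Longrightarrow> edges (loop ts s) = rot ts s"
  unfolding loop_def rot_def by (rule wrap_edges)

lemma rot_nz: "0 \<notin> set (rot ts s)"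
  by (auto simp: rot_def E_filter)

text \<open>The direction of the support line fits between the incoming and the outgoing edge at \<open>c s\<close>.\<close>

definition valid :: "real list \<Rightarrow> real \<Rightarrow> real \<Rightarrow> bool \<Rightarrow> bool" where
  "valid ts s \<theta> a \<longleftrightarrow> ang (last (rot ts s)) (hd (rot ts s))
     = ang (last (rot ts s)) (sdir a \<theta>) + ang (sdir a \<theta>) (hd (rot ts s))"

lemma plen_rot: "nodes ts \<Longrightarrow> s \<in> set ts \<Longrightarrow> plen (map c ts) = sum_list (map norm (rot ts s))"
  using rot_perm[of ts s] by (simp add: plen_E rot_def)

lemma nodes_turn: "nodes ts \<Longrightarrow> E ts \<noteq> [] \<Longrightarrow> ctrn (E ts) \<le> W"
  using turn[of ts] by (auto simp: nodes_def E_def)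

lemma rect': "finite F \<Longrightarrow> F \<subseteq> {0..\<Lambda>} \<Longrightarrow> 0 < \<delta> \<Longrightarrow> \<exists>ts. nodes ts \<and> F \<subseteq> set ts \<and> \<Lambda> - \<delta> \<le> plen (map c ts)"
  using rect[of F \<delta>] by (auto simp: nodes_def)

end

section \<open>The length bound, and the constant sense of rotation of optimal curves\<close>

locale tcurve_in = tcurve c \<Lambda> W + convex_body K for c \<Lambda> W K +
  assumes image: "c ` {0..\<Lambda>} \<subseteq> K"
begin

lemma valid_exists:
  assumes "nodes ts" "s \<in> set ts" "supp K (c s) \<theta>" "rot ts s \<noteq> []"
  shows "\<exists>a. valid ts s \<theta> a"
proof -
  let ?P = "loop ts s"
  have e: "edges ?P = rot ts s" by (rule edges_loop) fact+
  have l: "2 \<le> length ?P" using e assms(4) edges_Nil_iff[of ?P] by simp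
  note w = wrap_ends[OF assms(1,2,2), folded loop_def]
  have sub: "{s..\<Lambda>} \<union> {0..s} \<subseteq> {0..\<Lambda>}" using assms(1,2) by (auto simp: nodes_def)
  then have PK: "set ?P \<subseteq> K" using w(3) image by blast
  obtain qs q where q0: "?P = qs @ [q]" using l by (cases ?P rule: rev_cases) auto
  then have q: "?P = qs @ [q]" "qs \<noteq> []" using l by auto
  have h: "hd (rot ts s) = ?P ! 1 - c s" "last (rot ts s) = c s - last (butlast ?P)"
    using hd_edges[OF l] last_edges[OF l] e w by simp_all
  have "last (butlast ?P) \<in> K" using PK q by (auto simp: q(1))
  moreover have "?P ! 1 \<in> K" using PK l by auto
  moreover have "last (rot ts s) \<noteq> 0" "hd (rot ts s) \<noteq> 0" using rot_nz assms(4) by (metis last_in_set, metis hd_in_set)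
  ultimately show ?thesis using split_sign[OF assms(3), of "last (butlast ?P)" "?P ! 1"] unfolding valid_def h by auto
qed

text \<open>The polygon is opened at a point of contact. By \<open>valid\<close> its turning as a
  path between two copies of the same tangent is the cyclic turning, and both ends have the same
  potential.\<close>

lemma length_le:
  assumes "t0 \<in> {0..\<Lambda>}" "supp K (c t0) \<theta>"
  shows "\<Lambda> \<le> crad K * W"
proof (rule field_le_epsilon)
  fix e :: real assume e: "0 < e"
  \<comment> \<open>An error below \<Lambda> guarantees that the polygon has a nonzero edge.\<close>
  define \<delta> where "\<delta> = min e (\<Lambda> / 2)"
  have \<delta>: "0 < \<delta>" "\<delta> \<le> e" "\<delta> < \<Lambda>" using e pos by (auto simp: \<delta>_def)
  obtain ts where ts: "nodes ts" "t0 \<in> set ts" "\<Lambda> - \<delta> \<le> plen (map c ts)" using rect'[of "{t0}" \<delta>] assms \<delta> by auto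
  have ne: "rot ts t0 \<noteq> []" using plen_rot[OF ts(1,2)] ts(3) \<delta> by auto
  then have neE: "E ts \<noteq> []" using rot_perm[OF ts(1,2)] by (auto simp: rot_def)
  obtain a where a: "valid ts t0 \<theta> a" using valid_exists[OF ts(1,2) assms(2) ne] by blast
  let ?P = "loop ts t0"
  have ed: "edges ?P = rot ts t0" by (rule edges_loop) fact+
  note w = wrap_ends[OF ts(1,2,2), folded loop_def]
  have PK: "set ?P \<subseteq> K" using w(3) image assms by force
  have l: "2 \<le> length ?P" using ed ne edges_Nil_iff[of ?P] by simp
  have "pathJ (sdir a \<theta>) ?P (sdir a \<theta>) \<le> spot K a (last ?P) \<theta> - spot K a (hd ?P) \<theta> - (if a \<and> \<not> a then 0 else 0)"
    by (rule path_bound) (use PK l w assms in \<open>auto simp: isgap_def\<close>)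
  then have "pathJ (sdir a \<theta>) ?P (sdir a \<theta>) \<le> 0" using w by simp
  moreover have "trn (sdir a \<theta> # rot ts t0 @ [sdir a \<theta>]) = ctrn (rot ts t0)"
    using ne trn_Cons[of "rot ts t0 @ [sdir a \<theta>]" "sdir a \<theta>"] trn_snoc[OF ne, of "sdir a \<theta>"] trn_Cons[OF ne, of "last (rot ts t0)"] a
    by (simp add: ctrn_def valid_def)
  moreover have "plen ?P = plen (map c ts)" using plen_rot[OF ts(1,2)] ed by (simp add: plen_edges)
  ultimately have "plen (map c ts) \<le> crad K * ctrn (E ts)" using ed ctrn_rot[OF ts(1,2)] by (simp add: pathJ_def)
  also have "\<dots> \<le> crad K * W" using nodes_turn[OF ts(1) neE] crad_nonneg by (intro mult_left_mono)
  finally show "\<Lambda> \<le> crad K * W + e" using ts(3) \<delta> by linarith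
qed

text \<open>\<open>P\<close> and \<open>Q\<close> are inscribed into the two parts into which \<open>c s\<close> and \<open>c s'\<close> divide the closed curve, and both
  attain the bound for paths up to \<open>\<delta>\<close>.\<close>

definition tight :: "bool \<Rightarrow> real \<Rightarrow> real \<Rightarrow> real \<Rightarrow> real \<Rightarrow> real \<Rightarrow> real set \<Rightarrow> bool" where
  "tight a s s' \<theta> \<theta>' \<delta> R \<longleftrightarrow> (\<exists>P Q.
     set P \<subseteq> c ` {s..s'} \<and> c ` (R \<inter> {s..s'}) \<subseteq> set P \<and> hd P = c s \<and> last P = c s' \<and> distinct_adj P \<and> 2 \<le> length P
     \<and> plen P \<le> s' - s \<and> pathJ (sdir a \<theta>) P (sdir a \<theta>') \<ge> spot K a (c s') \<theta>' - spot K a (c s) \<theta> - \<delta>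
     \<and> set Q \<subseteq> c ` ({s'..\<Lambda>} \<union> {0..s}) \<and> c ` (R \<inter> ({s'..\<Lambda>} \<union> {0..s})) \<subseteq> set Q \<and> hd Q = c s' \<and> last Q = c s
     \<and> distinct_adj Q \<and> 2 \<le> length Q
     \<and> plen Q \<le> \<Lambda> - (s' - s) \<and> pathJ (sdir a \<theta>') Q (sdir a \<theta>) \<ge> spot K a (c s) \<theta> - spot K a (c s') \<theta>' - \<delta>)"

text \<open>Two contacts cut the polygon into two paths whose bounds add up to zero. If the senses
  differed, exactly one of the paths would have to pay \<gamma>, which exceeds the total error
  \<delta>. Since the sum is almost zero, each path almost attains its own bound.\<close>

lemma same_sign:
  assumes ts: "nodes ts" "\<Lambda> - \<delta> \<le> plen (map c ts)" and s: "s \<in> set ts" "s' \<in> set ts" "s < s'"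
    and supp: "supp K (c s) \<theta>" "supp K (c s') \<theta>'" and opt: "\<Lambda> = crad K * W"
    and \<gamma>: "isgap \<gamma>" "\<delta> < \<gamma>" and \<delta>: "\<delta> < s' - s" "\<delta> < \<Lambda> - (s' - s)"
    and v: "valid ts s \<theta> a" "valid ts s' \<theta>' a'"
  shows "a = a' \<and> tight a s s' \<theta> \<theta>' \<delta> (set ts) \<and> rot ts s \<noteq> []"
proof -
  have so: "sorted_wrt (<) ts" and sub: "set ts \<subseteq> {0..\<Lambda>}" using ts by (auto simp: nodes_def)
  define mid where "mid = filter (\<lambda>t. s < t \<and> t < s') ts"
  define P where "P = remdups_adj (map c (s # mid @ [s']))"
  define Q where "Q = remdups_adj (map c (s' # aft ts s') @ tl (map c (bef ts s @ [s])))"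
  note wQ = wrap_ends[OF ts(1) s(1,2), folded Q_def]
  have aft_s: "aft ts s = mid @ s' # aft ts s'"
  proof -
    have "sorted_wrt (<) (aft ts s)" "s' \<in> set (aft ts s)" using so s by (auto simp: aft_def sorted_wrt_filter)
    from sorted_split[OF this] show ?thesis
      by (simp add: aft_def mid_def conj_commute) (metis (no_types, lifting) filter_cong order.strict_trans s(3))
  qed
  have bef_s': "bef ts s' = bef ts s @ s # mid"
  proof -
    have "sorted_wrt (<) (bef ts s')" "s \<in> set (bef ts s')" using so s by (auto simp: bef_def sorted_wrt_filter)
    from sorted_split[OF this] show ?thesis
      by (simp add: bef_def mid_def conj_commute) (metis (no_types, lifting) filter_cong order.strict_trans s(3))
  qed
  have eP: "edges P = E (s # mid @ [s'])" by (simp add: P_def E_def)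
  have eQ: "edges Q = E (s' # aft ts s') @ E (bef ts s @ [s])" unfolding Q_def by (rule wrap_edges) fact+
  have r1: "rot ts s = edges P @ edges Q"
    unfolding rot_def eP eQ aft_s using E_split[of "s # mid" s' "aft ts s'"] by simp
  have r2: "rot ts s' = edges Q @ edges P"
    unfolding rot_def eP eQ bef_s' using E_split[of "bef ts s" s "mid @ [s']"] by simp
  have len: "plen (map c ts) = plen P + plen Q" using plen_rot[OF ts(1) s(1)] r1 by (simp add: plen_edges)
  have lP: "plen P \<le> s' - s"
  proof -
    have "plen P = plen (map c (s # mid @ [s']))" using plen_E[of "s # mid @ [s']"] eP by (simp add: plen_edges[of P])
    also have "\<dots> \<le> last (s # mid @ [s']) - hd (s # mid @ [s'])"
    proof (rule plen_le)
      show "sorted_wrt (<) (s # mid @ [s'])" using so s by (auto simp: mid_def sorted_wrt_append sorted_wrt_filter)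
      show "set (s # mid @ [s']) \<subseteq> {0..\<Lambda>}" using sub s by (auto simp: mid_def)
    qed simp
    finally show ?thesis by simp
  qed
  have lQ: "plen Q \<le> \<Lambda> - (s' - s)"
  proof -
    have "plen Q = plen (map c (s' # aft ts s')) + plen (map c (bef ts s @ [s]))"
      unfolding plen_edges[of Q] eQ plen_E by simp
    moreover have "plen (map c (s' # aft ts s')) \<le> last (s' # aft ts s') - hd (s' # aft ts s')"
      by (rule plen_le) (use so sub s in \<open>auto simp: aft_def sorted_wrt_filter\<close>)
    moreover have "plen (map c (bef ts s @ [s])) \<le> last (bef ts s @ [s]) - hd (bef ts s @ [s])"
      by (rule plen_le) (use so sub s in \<open>auto simp: bef_def sorted_wrt_filter sorted_wrt_append\<close>)
    ultimately show ?thesis using nodes_split(2)[OF ts(1) s(2)] nodes_split(3)[OF ts(1) s(1)] by simp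
  qed
  \<comment> \<open>\<delta> is smaller than the parameter length of either part, so that neither
    part collapses to a point.\<close>
  have neP: "edges P \<noteq> []" using len lQ ts(2) \<delta> by (auto simp: plen_edges[of P])
  have neQ: "edges Q \<noteq> []" using len lP ts(2) \<delta> by (auto simp: plen_edges[of Q])
  have sP: "set P = c ` set (s # mid @ [s'])" by (simp only: P_def remdups_adj_set set_map)
  have P: "set P \<subseteq> c ` {s..s'}" "hd P = c s" "last P = c s'" "distinct_adj P" "2 \<le> length P"
    using sP s edges_Nil_iff[of P] neP by (auto simp: mid_def P_def)
  have Rsub: "c ` (set ts \<inter> {s..s'}) \<subseteq> set P" unfolding sP by (rule image_mono) (auto simp: mid_def)
  have lenQ: "2 \<le> length Q" using edges_Nil_iff[of Q] neQ by simp
  have s01: "0 \<le> s" "s' \<le> \<Lambda>" using sub s by auto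
  have PK: "set P \<subseteq> K" "set Q \<subseteq> K" using P(1) wQ(3) image s01 s(3) by force+
  have tot: "trn (sdir a \<theta> # edges P @ [sdir a' \<theta>']) + trn (sdir a' \<theta>' # edges Q @ [sdir a \<theta>]) = ctrn (rot ts s)"
  proof -
    have "ctrn (rot ts s) = ang (last (edges Q)) (hd (edges P)) + trn (edges P @ edges Q)"
      using neP neQ r1 trn_Cons[of "rot ts s" "last (rot ts s)"] by (simp add: ctrn_def)
    also have "\<dots> = ang (last (edges Q)) (sdir a \<theta>) + ang (sdir a \<theta>) (hd (edges P)) + trn (edges P) + (ang (last (edges P)) (sdir a' \<theta>') + ang (sdir a' \<theta>') (hd (edges Q))) + trn (edges Q)"
      using v neP neQ unfolding valid_def r1 r2 by (simp add: trn_append)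
    finally show ?thesis
      using trn_Cons[of "edges P @ [sdir a' \<theta>']" "sdir a \<theta>"] trn_snoc[OF neP] trn_Cons[of "edges Q @ [sdir a \<theta>]" "sdir a' \<theta>'"] trn_snoc[OF neQ] neP neQ
      by simp
  qed
  have "E ts \<noteq> []" using rot_perm[OF ts(1) s(1)] r1 neP by (auto simp: rot_def)
  then have "ctrn (rot ts s) \<le> W" using nodes_turn[OF ts(1)] ctrn_rot[OF ts(1) s(1)] by simp
  from mult_left_mono[OF this crad_nonneg]
  have "pathJ (sdir a \<theta>) P (sdir a' \<theta>') + pathJ (sdir a' \<theta>') Q (sdir a \<theta>) \<ge> plen P + plen Q - crad K * W"
    unfolding pathJ_def tot[symmetric] by (simp add: algebra_simps)
  then have ge: "pathJ (sdir a \<theta>) P (sdir a' \<theta>') + pathJ (sdir a' \<theta>') Q (sdir a \<theta>) \<ge> - \<delta>"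
    using len ts(2) opt by linarith
  have b1: "pathJ (sdir a \<theta>) P (sdir a' \<theta>') \<le> spot K a' (last P) \<theta>' - spot K a (hd P) \<theta> - (if a \<and> \<not> a' then \<gamma> else 0)"
    by (rule path_bound) (use P PK supp \<gamma> in auto)
  have b2: "pathJ (sdir a' \<theta>') Q (sdir a \<theta>) \<le> spot K a (last Q) \<theta> - spot K a' (hd Q) \<theta>' - (if a' \<and> \<not> a then \<gamma> else 0)"
    by (rule path_bound) (use wQ PK lenQ supp \<gamma> in auto)
  have g0: "0 \<le> \<gamma>" using isgap_nonneg \<gamma> by blast
  have aa: "a = a'" using b1 b2 ge \<gamma>(2) P wQ by (auto split: if_splits)
  have sub2: "{s'..\<Lambda>} \<union> {0..s} = {0..s} \<union> {s'..\<Lambda>}" by auto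
  have "tight a s s' \<theta> \<theta>' \<delta> (set ts)"
    unfolding tight_def
    by (rule exI[of _ P], rule exI[of _ Q]) (use P Rsub lP wQ lenQ lQ b1 b2 ge aa in auto)
  then show ?thesis using aa r1 neP by simp
qed

lemma tight_mono: "tight a s s' \<theta> \<theta>' \<delta> R \<Longrightarrow> \<delta> \<le> \<delta>' \<Longrightarrow> R' \<subseteq> R \<Longrightarrow> tight a s s' \<theta> \<theta>' \<delta>' R'"
  unfolding tight_def
proof (elim exE)
  fix P Q
  assume le: "\<delta> \<le> \<delta>'" "R' \<subseteq> R"
  assume "set P \<subseteq> c ` {s..s'} \<and> c ` (R \<inter> {s..s'}) \<subseteq> set P \<and> hd P = c s \<and> last P = c s' \<and> distinct_adj P \<and> 2 \<le> length P
     \<and> plen P \<le> s' - s \<and> pathJ (sdir a \<theta>) P (sdir a \<theta>') \<ge> spot K a (c s') \<theta>' - spot K a (c s) \<theta> - \<delta>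
     \<and> set Q \<subseteq> c ` ({s'..\<Lambda>} \<union> {0..s}) \<and> c ` (R \<inter> ({s'..\<Lambda>} \<union> {0..s})) \<subseteq> set Q \<and> hd Q = c s' \<and> last Q = c s
     \<and> distinct_adj Q \<and> 2 \<le> length Q
     \<and> plen Q \<le> \<Lambda> - (s' - s) \<and> pathJ (sdir a \<theta>') Q (sdir a \<theta>) \<ge> spot K a (c s) \<theta> - spot K a (c s') \<theta>' - \<delta>"
  moreover have "c ` (R' \<inter> {s..s'}) \<subseteq> c ` (R \<inter> {s..s'})" "c ` (R' \<inter> ({s'..\<Lambda>} \<union> {0..s})) \<subseteq> c ` (R \<inter> ({s'..\<Lambda>} \<union> {0..s}))"
    using le by auto
  ultimately show "\<exists>P Q. set P \<subseteq> c ` {s..s'} \<and> c ` (R' \<inter> {s..s'}) \<subseteq> set P \<and> hd P = c s \<and> last P = c s' \<and> distinct_adj P \<and> 2 \<le> length P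
     \<and> plen P \<le> s' - s \<and> pathJ (sdir a \<theta>) P (sdir a \<theta>') \<ge> spot K a (c s') \<theta>' - spot K a (c s) \<theta> - \<delta>'
     \<and> set Q \<subseteq> c ` ({s'..\<Lambda>} \<union> {0..s}) \<and> c ` (R' \<inter> ({s'..\<Lambda>} \<union> {0..s})) \<subseteq> set Q \<and> hd Q = c s' \<and> last Q = c s
     \<and> distinct_adj Q \<and> 2 \<le> length Q
     \<and> plen Q \<le> \<Lambda> - (s' - s) \<and> pathJ (sdir a \<theta>') Q (sdir a \<theta>) \<ge> spot K a (c s) \<theta> - spot K a (c s') \<theta>' - \<delta>'"
    using le by (intro exI[of _ P] exI[of _ Q] conjI) (elim conjE; (assumption | linarith | rule order_trans; assumption))+
qed

text \<open>The pair of \<open>0\<close> and \<Lambda> is excluded: it is a single point of the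
  closed curve and leaves no second part.\<close>

definition contacts :: "real \<Rightarrow> real \<Rightarrow> real \<Rightarrow> real \<Rightarrow> bool" where
  "contacts s s' \<theta> \<theta>' \<longleftrightarrow> 0 \<le> s \<and> s < s' \<and> s' \<le> \<Lambda> \<and> \<not> (s = 0 \<and> s' = \<Lambda>) \<and> supp K (c s) \<theta> \<and> supp K (c s') \<theta>'"

text \<open>An optimal curve touches the boundary of \<open>K\<close> always in the same sense of rotation \<open>a\<close>.\<close>

lemma orientation:
  assumes opt: "\<Lambda> = crad K * W" and int: "interior K \<noteq> {}"
  shows "\<exists>a. \<forall>s s' \<theta> \<theta>' \<delta> R. contacts s s' \<theta> \<theta>' \<longrightarrow> 0 < \<delta> \<longrightarrow> finite R \<longrightarrow> R \<subseteq> {0..\<Lambda>} \<longrightarrow> tight a s s' \<theta> \<theta>' \<delta> R"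
proof (rule ccontr)
  assume "\<not> ?thesis"
  \<comment> \<open>Each of the two senses would fail at some pair of contacts. All four contacts
    are made nodes of one polygon, on which \<open>same_sign\<close> forces a common sense.\<close>
  then have "\<forall>a. \<exists>s s' \<theta> \<theta>' \<delta> R. contacts s s' \<theta> \<theta>' \<and> 0 < \<delta> \<and> finite R \<and> R \<subseteq> {0..\<Lambda>} \<and> \<not> tight a s s' \<theta> \<theta>' \<delta> R" by blast
  then obtain s1 s1' \<theta>1 \<theta>1' \<delta>1 R1 s2 s2' \<theta>2 \<theta>2' \<delta>2 R2 where
    1: "contacts s1 s1' \<theta>1 \<theta>1'" "0 < \<delta>1" "finite R1" "R1 \<subseteq> {0..\<Lambda>}" "\<not> tight True s1 s1' \<theta>1 \<theta>1' \<delta>1 R1" and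
    2: "contacts s2 s2' \<theta>2 \<theta>2'" "0 < \<delta>2" "finite R2" "R2 \<subseteq> {0..\<Lambda>}" "\<not> tight False s2 s2' \<theta>2 \<theta>2' \<delta>2 R2"
    by metis
  obtain z where "z \<in> interior K" using int by blast
  then obtain \<rho> where \<rho>: "0 < \<rho>" "cball z \<rho> \<subseteq> K" using mem_interior_cball by blast
  define \<gamma> where "\<gamma> = wgap \<rho>"
  have \<gamma>: "isgap \<gamma>" "0 < \<gamma>" using \<rho> B(1) by (auto simp: isgap_def \<gamma>_def wgap_def)
  define F where "F = {s1, s1', s2, s2'}"
  \<comment> \<open>The quantities below which \<delta> has to stay: the distances between the
    contacts in both directions around the curve, the penalty and the two given errors.\<close>
  define D where "D = {\<bar>s - s'\<bar> |s s'. s \<in> F \<and> s' \<in> F \<and> s \<noteq> s'} \<union> {\<Lambda> - \<bar>s - s'\<bar> |s s'. s \<in> F \<and> s' \<in> F \<and> \<bar>s - s'\<bar> < \<Lambda>} \<union> {\<gamma>, \<delta>1, \<delta>2}"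
  have "D \<subseteq> (\<lambda>(s, s'). \<bar>s - s'\<bar>) ` (F \<times> F) \<union> (\<lambda>(s, s'). \<Lambda> - \<bar>s - s'\<bar>) ` (F \<times> F) \<union> {\<gamma>, \<delta>1, \<delta>2}" by (auto simp: D_def)
  then have fD: "finite D" by (rule finite_subset) (auto simp: F_def)
  have posD: "\<forall>d\<in>D. 0 < d" using \<gamma> 1 2 by (auto simp: D_def)
  define \<delta> where "\<delta> = Min D / 2"
  have \<delta>: "0 < \<delta>" "d \<in> D \<Longrightarrow> \<delta> < d" for d
  proof -
    have "Min D \<in> D" using fD by (intro Min_in) (auto simp: D_def)
    then show "0 < \<delta>" using posD by (auto simp: \<delta>_def)
    then show "d \<in> D \<Longrightarrow> \<delta> < d" using Min_le[OF fD, of d] by (auto simp: \<delta>_def)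
  qed
  have FF: "F \<subseteq> {0..\<Lambda>}" using 1(1) 2(1) by (auto simp: F_def contacts_def)
  obtain ts where ts: "nodes ts" "R1 \<union> R2 \<union> F \<subseteq> set ts" "\<Lambda> - \<delta> \<le> plen (map c ts)"
    using rect'[of "R1 \<union> R2 \<union> F" \<delta>] 1 2 FF \<delta>(1) by (auto simp: F_def)
  have Fts: "F \<subseteq> set ts" using ts by auto
  have same: "a = a' \<and> tight a s s' \<theta> \<theta>' \<delta> (set ts)"
    if "s \<in> F" "s' \<in> F" "contacts s s' \<theta> \<theta>'" "valid ts s \<theta> a" "valid ts s' \<theta>' a'" for s s' \<theta> \<theta>' a a'
  proof -
    have c: "s < s'" "supp K (c s) \<theta>" "supp K (c s') \<theta>'" "\<bar>s - s'\<bar> < \<Lambda>"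
      using that(3) by (auto simp: contacts_def)
    have "\<bar>s - s'\<bar> \<in> D" unfolding D_def using that(1,2) c(1) by (intro UnI1 CollectI exI[of _ s] exI[of _ s']) auto
    moreover have "\<Lambda> - \<bar>s - s'\<bar> \<in> D" unfolding D_def using that(1,2) c(4)
      by (intro UnI1[OF UnI2] CollectI exI[of _ s] exI[of _ s']) auto
    ultimately have "\<delta> < s' - s" "\<delta> < \<Lambda> - (s' - s)" using \<delta>(2) c(1) by fastforce+
    moreover have "\<delta> < \<gamma>" using \<delta>(2) by (auto simp: D_def)
    ultimately show ?thesis
      using same_sign[OF ts(1,3) _ _ c(1) c(2,3) opt \<gamma>(1) _ _ _ that(4,5)] that Fts by blast
  qed
  have ner: "rot ts s \<noteq> []" if "s \<in> F" for s
  proof -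
    have "\<delta> < \<Lambda>"
    proof -
      have "\<bar>s1 - s1'\<bar> \<in> D" unfolding D_def using 1(1)
        by (intro UnI1 CollectI exI[of _ s1] exI[of _ s1']) (auto simp: F_def contacts_def)
      then show ?thesis using \<delta>(2)[of "\<bar>s1 - s1'\<bar>"] 1(1) by (auto simp: contacts_def)
    qed
    then show ?thesis using plen_rot[OF ts(1), of s] that Fts ts(3) by auto
  qed
  have ex: "\<exists>a. valid ts s \<theta> a" if "s \<in> F" "supp K (c s) \<theta>" for s \<theta>
    using valid_exists[OF ts(1) _ that(2) ner] that Fts by blast
  obtain a1 a1' a2 a2' where v: "valid ts s1 \<theta>1 a1" "valid ts s1' \<theta>1' a1'" "valid ts s2 \<theta>2 a2" "valid ts s2' \<theta>2' a2'"
    using ex[of s1 \<theta>1] ex[of s1' \<theta>1'] ex[of s2 \<theta>2] ex[of s2' \<theta>2'] 1(1) 2(1) by (auto simp: F_def contacts_def)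
  have inF: "s1 \<in> F" "s1' \<in> F" "s2 \<in> F" "s2' \<in> F" by (auto simp: F_def)
  have e1: "a1 = a1'" "tight a1 s1 s1' \<theta>1 \<theta>1' \<delta> (set ts)" using same[OF inF(1,2) 1(1) v(1,2)] by auto
  have e2: "a2 = a2'" "tight a2 s2 s2' \<theta>2 \<theta>2' \<delta> (set ts)" using same[OF inF(3,4) 2(1) v(3,4)] by auto
  have "a1 = a2"
  proof (cases s1 s2 rule: linorder_cases)
    case less
    then have "contacts s1 s2 \<theta>1 \<theta>2" using 1(1) 2(1) by (auto simp: contacts_def)
    then show ?thesis using same[OF inF(1,3) _ v(1,3)] by blast
  next
    case greater
    then have "contacts s2 s1 \<theta>2 \<theta>1" using 1(1) 2(1) by (auto simp: contacts_def)
    then show ?thesis using same[OF inF(3,1) _ v(3,1)] by blast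
  next
    case equal
    then have "contacts s1 s2' \<theta>1 \<theta>2'" using 1(1) 2(1) by (auto simp: contacts_def)
    then show ?thesis using same[OF inF(1,4) _ v(1,4)] e2 by blast
  qed
  have d: "\<delta> \<le> \<delta>1" "\<delta> \<le> \<delta>2" using \<delta>(2)[of \<delta>1] \<delta>(2)[of \<delta>2] by (auto simp: D_def)
  have R: "R1 \<subseteq> set ts" "R2 \<subseteq> set ts" using ts by auto
  have t1: "tight a1 s1 s1' \<theta>1 \<theta>1' \<delta>1 R1" by (rule tight_mono[OF e1(2) d(1) R(1)])
  have t2: "tight a2 s2 s2' \<theta>2 \<theta>2' \<delta>2 R2" by (rule tight_mono[OF e2(2) d(2) R(2)])
  show False using t1 t2 1(5) 2(5) \<open>a1 = a2\<close> by (cases a1) auto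
qed

end

subsection \<open>Optimal curves\<close>

lemma trn_rev: "trn (rev us) = trn us"
proof (induction us rule: trn.induct)
  case (1 u v us)
  then show ?case using trn_snoc[of "rev (v # us)" u] by (simp add: ang_sym)
qed auto

lemma trn_map_uminus: "trn (map uminus us) = trn us"
  by (induction us rule: trn.induct) (auto simp: ang_minus_minus)

lemma edges_rev: "edges (rev ps) = rev (map uminus (edges ps))"
proof (induction ps rule: edges.induct)
  case (1 x y ps)
  then show ?case using edges_append[of "rev (y # ps)" "[x]"] by simp
qed auto

lemma plen_rev: "plen (rev ps) = plen ps"
  by (simp add: plen_edges edges_rev rev_map[symmetric] sum_list_rev comp_def)

lemma trn_merge_ctx:
  assumes "0 \<notin> set us" "0 \<notin> set g" "0 \<notin> set ws" "us \<noteq> []" "ws \<noteq> []" "sum_list g \<noteq> 0"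
  shows "trn (us @ sum_list g # ws) \<le> trn (us @ g @ ws)"
proof -
  have g: "g \<noteq> []" using assms by auto
  have "last us \<noteq> 0" "hd ws \<noteq> 0" using assms by (metis last_in_set, metis hd_in_set)
  from trn_merge[OF assms(2,6) this]
  have "ang (last us) (sum_list g) + ang (sum_list g) (hd ws) \<le> ang (last us) (hd g) + trn g + ang (last g) (hd ws)"
    using trn_Cons[of "g @ [hd ws]" "last us"] trn_snoc[OF g, of "hd ws"] g by simp
  moreover have "trn (us @ g @ ws) = trn us + ang (last us) (hd g) + (trn g + ang (last g) (hd ws) + trn ws)"
    using trn_append[of us "g @ ws"] trn_append[of g ws] assms g by simp
  moreover have "trn (us @ sum_list g # ws) = trn us + ang (last us) (sum_list g) + (ang (sum_list g) (hd ws) + trn ws)"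
    using trn_append[of us "sum_list g # ws"] trn_Cons[of ws] assms by simp
  ultimately show ?thesis by linarith
qed

lemma trn_path_via:
  assumes "distinct_adj P" "r \<in> set P" "r \<noteq> hd P" "r \<noteq> last P" "d \<noteq> 0" "d' \<noteq> 0"
  shows "ang d (r - hd P) + ang (r - hd P) (last P - r) + ang (last P - r) d' \<le> trn (d # edges P @ [d'])"
proof -
  obtain us vs where P: "P = us @ r # vs" using assms(2) by (meson split_list)
  have ne: "us \<noteq> []" "vs \<noteq> []" using assms P by auto
  define e1 e2 where "e1 = edges (us @ [r])" and "e2 = edges (r # vs)"
  have eP: "edges P = e1 @ e2" unfolding P e1_def e2_def by (rule edges_split)
  have s: "sum_list e1 = r - hd P" "sum_list e2 = last P - r"
    using sum_edges[of "us @ [r]"] sum_edges[of "r # vs"] ne by (auto simp: e1_def e2_def P)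
  have nz: "0 \<notin> set e1" "0 \<notin> set e2" using assms(1) eP distinct_adj_edges by auto
  have s0: "sum_list e1 \<noteq> 0" "sum_list e2 \<noteq> 0" using s assms by auto
  have "trn ([d] @ sum_list e1 # e2 @ [d']) \<le> trn ([d] @ e1 @ e2 @ [d'])"
    by (rule trn_merge_ctx) (use nz s0 assms in auto)
  moreover have "trn ([d, sum_list e1] @ sum_list e2 # [d']) \<le> trn ([d, sum_list e1] @ e2 @ [d'])"
    by (rule trn_merge_ctx) (use nz s0 assms in auto)
  ultimately show ?thesis by (simp add: eP s)
qed

lemma trn_path:
  assumes "distinct_adj P" "hd P \<noteq> last P" "P \<noteq> []" "d \<noteq> 0" "d' \<noteq> 0"
  shows "ang d (last P - hd P) + ang (last P - hd P) d' \<le> trn (d # edges P @ [d'])"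
  using trn_merge[of "edges P" d d'] sum_edges[of P] assms distinct_adj_edges by auto

section \<open>Comparison of nested convex bodies\<close>

context convex_body
begin

lemma pathJ_rev: "pathJ (- d') (rev P) (- d) = pathJ d P d'"
proof -
  have "- d' # edges (rev P) @ [- d] = rev (map uminus (d # edges P @ [d']))" by (simp add: edges_rev)
  then show ?thesis by (simp only: pathJ_def plen_rev trn_rev trn_map_uminus)
qed

lemma sub_mono:
  assumes "convex_body K2" "K2 \<subseteq> K"
  shows "hs K2 t \<le> hs K t"
proof -
  interpret k: convex_body K2 by fact
  show ?thesis using k.hs_attained[of t] hs_upper assms(2) by fastforce
qed

lemma sub_hint_mono:
  assumes "convex_body K2" "K2 \<subseteq> K" "s \<le> t"
  shows "hint K s - hint K2 s \<le> hint K t - hint K2 t"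
proof -
  interpret k: convex_body K2 by fact
  have d: "((\<lambda>t. hint K t - hint K2 t) has_real_derivative hs K t - hs K2 t) (at t)" for t
    by (intro DERIV_diff hint_deriv k.hint_deriv)
  show ?thesis
    by (rule DERIV_nonneg_imp_nondecreasing[OF assms(3), of "\<lambda>t. hint K t - hint K2 t"])
      (use d sub_mono[OF assms(1,2)] in \<open>auto intro!: exI\<close>)
qed

text \<open>The difference of the antiderivatives is nondecreasing. Without gain from
  \<open>s\<close> to \<open>t\<close> it is constant, so its derivative cannot be positive; only
  increments to the right are compared, hence \<open>u < t\<close>.\<close>

lemma hs_eq_of_hint_const:
  assumes "convex_body K2" "K2 \<subseteq> K" "s < t" "hint K t - hint K2 t \<le> hint K s - hint K2 s" "s \<le> u" "u < t"
  shows "hs K2 u = hs K u"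
proof (rule ccontr)
  interpret k: convex_body K2 by fact
  let ?f = "\<lambda>t. hint K t - hint K2 t"
  assume "hs K2 u \<noteq> hs K u"
  then have "0 < hs K u - hs K2 u" using sub_mono[OF assms(1,2), of u] by simp
  moreover have "(?f has_real_derivative hs K u - hs K2 u) (at u)" by (intro DERIV_diff hint_deriv k.hint_deriv)
  ultimately obtain d where d: "d > 0" "\<And>h. 0 < h \<Longrightarrow> h < d \<Longrightarrow> ?f u < ?f (u + h)"
    using DERIV_pos_inc_right by blast
  define h where "h = min (d / 2) (t - u)"
  have h: "0 < h" "h < d" "u + h \<le> t" using d assms by (auto simp: h_def min_def)
  have "?f s \<le> ?f u" "?f (u + h) \<le> ?f t" using sub_hint_mono[OF assms(1,2)] assms h by auto
  then show False using d(2)[OF h(1,2)] assms(4) by linarith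
qed

lemma crad_mono:
  assumes "convex_body K2" "K2 \<subseteq> K"
  shows "crad K2 \<le> crad K"
  using sub_hint_mono[OF assms, of 0 "2 * pi"] unfolding crad_def by (auto intro!: divide_right_mono)

lemma separated:
  assumes "convex_body K2" "p \<notin> K2"
  shows "\<exists>t. hs K2 t < p \<bullet> nrm t"
proof -
  interpret k: convex_body K2 by fact
  obtain a b where ab: "a \<bullet> p < b" "\<forall>x\<in>K2. b < a \<bullet> x"
    using separating_hyperplane_closed_point[OF k.conv compact_imp_closed[OF k.comp] assms(2)] by auto
  have a0: "a \<noteq> 0" using ab k.ne by auto
  define t where "t = Arg (- a) + pi / 2"
  have "nrm t = cis (Arg (- a))" by (simp add: nrm_def t_def cis_mult[symmetric] cis_pi_half algebra_simps)
  then have n: "- a = norm a *\<^sub>R nrm t" by (metis rcis_cmod_Arg rcis_def scaleR_conv_of_real norm_minus_cancel)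
  obtain q where q: "q \<in> K2" "hs K2 t = q \<bullet> nrm t" using k.hs_attained by blast
  have "a \<bullet> p < a \<bullet> q" using ab q by force
  then have "q \<bullet> (- a) < p \<bullet> (- a)" by (simp add: inner_commute)
  then have "q \<bullet> nrm t < p \<bullet> nrm t" unfolding n using a0 by simp
  then show ?thesis using q(2) by (intro exI[of _ t]) simp
qed

text \<open>A missing point is separated from \<open>K2\<close> in some direction \<open>t\<close>.
  Equal means over the period that starts at \<open>t\<close> would make the support functions agree
  there.\<close>

lemma crad_strict:
  assumes "convex_body K2" "K2 \<subseteq> K" "crad K \<le> crad K2"
  shows "K2 = K"
proof (rule ccontr)
  interpret k: convex_body K2 by fact
  assume "K2 \<noteq> K"
  then obtain p where p: "p \<in> K" "p \<notin> K2" using assms by blast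
  obtain t where t: "hs K2 t < p \<bullet> nrm t" using separated[OF assms(1) p(2)] by blast
  have "hint K (t + 2 * pi) - hint K2 (t + 2 * pi) \<le> hint K t - hint K2 t"
    using assms(3) unfolding hint_2pi k.hint_2pi by (simp add: mult_left_mono)
  then have "hs K2 t = hs K t" by (rule hs_eq_of_hint_const[OF assms(1,2), rotated]) auto
  then show False using t hs_upper[OF p(1), of t] by simp
qed

lemma supp_sub:
  assumes "convex_body K2" "K2 \<subseteq> K" "supp K x t" "x \<in> K2"
  shows "supp K2 x t"
proof -
  interpret k: convex_body K2 by fact
  show ?thesis using sub_mono[OF assms(1,2), of t] k.ds_nonneg[OF assms(4), of t] assms(3,4)
    by (simp add: supp_def ds_def)
qed

lemma hull_supp:
  assumes "compact A" "A \<noteq> {}"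
  shows "\<exists>p\<in>A. hs (convex hull A) t = p \<bullet> nrm t"
proof -
  have "continuous_on A (\<lambda>p. p \<bullet> nrm t)" by (intro continuous_intros)
  from continuous_attains_sup[OF assms this] obtain p where p: "p \<in> A" "\<And>q. q \<in> A \<Longrightarrow> q \<bullet> nrm t \<le> p \<bullet> nrm t" by auto
  have "convex hull A \<subseteq> {q. nrm t \<bullet> q \<le> nrm t \<bullet> p}"
    using p by (intro hull_minimal convex_halfspace_le) (auto simp: inner_commute)
  then have le: "q \<bullet> nrm t \<le> p \<bullet> nrm t" if "q \<in> convex hull A" for q using that by (auto simp: inner_commute)
  have "hs (convex hull A) t \<le> p \<bullet> nrm t" unfolding hs_def using le assms(2) by (intro cSUP_least) auto
  moreover have "p \<bullet> nrm t \<le> hs (convex hull A) t" unfolding hs_def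
    using le hull_inc[OF p(1)] by (intro cSUP_upper) (auto intro!: bdd_aboveI2)
  ultimately show ?thesis using p by (intro bexI[of _ p]) auto
qed

text \<open>By Krein and Milman \<open>K\<close> is spanned by its extreme points, which belong to
  \<open>A\<close> and are not interior. Two of them span only a segment.\<close>

lemma hull_two_contacts:
  assumes "convex hull A = K" "A - interior K \<subseteq> {x, y}" "interior K \<noteq> {}"
  shows False
proof -
  have "{e. e extreme_point_of K} \<subseteq> {x, y}"
    using extreme_point_of_convex_hull[of _ A] extreme_point_not_in_interior[of _ K] assms by blast
  then have "K \<subseteq> convex hull {x, y}" using Krein_Milman_Minkowski[OF comp conv] hull_mono by metis
  then have "interior K \<subseteq> interior (closed_segment x y)" by (simp add: interior_mono segment_convex_hull)
  then show False using assms(3) interior_closed_segment_ge2[of x y] by auto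
qed

lemma chord_zero:
  assumes "ds K x t = 0" "ds K y t = 0" "y - x = of_real (norm (y - x)) * cis \<omega>" "y \<noteq> x" "t \<le> \<omega>" "\<omega> \<le> t + pi"
  shows "\<omega> = t \<or> \<omega> = t + pi"
proof -
  have "(y - x) \<bullet> nrm t = 0" using assms by (simp add: ds_def inner_diff_left)
  moreover have "(norm (y - x) *\<^sub>R cis \<omega>) \<bullet> nrm t = norm (y - x) * (cis \<omega> \<bullet> nrm t)" by simp
  moreover have "cis \<omega> \<bullet> nrm t = - sin (\<omega> - t)" unfolding inner_nrm by (simp add: sin_diff mult.commute)
  ultimately have "sin (\<omega> - t) = 0" using assms(3,4) by (simp add: scaleR_conv_of_real)
  moreover have "0 < sin (\<omega> - t)" if "t < \<omega>" "\<omega> < t + pi" using that by (intro sin_gt_zero) auto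
  ultimately show ?thesis using assms(5,6) by force
qed

text \<open>An optimal curve has no excursion \<open>A\<close> into the interior of \<open>K\<close>: otherwise the smaller body \<open>convex hull A\<close>,
  having a smaller perimeter, would give a better bound for the excursion.\<close>

lemma no_excursion:
  assumes A: "compact A" "A \<subseteq> K" "x \<in> A" "y \<in> A" "x \<notin> interior K" "y \<notin> interior K"
    and Axy: "A - interior K \<subseteq> {x, y}" and r: "r \<in> A" "r \<in> interior K"
    and paths: "\<And>\<theta> \<theta>' \<delta>. supp K x \<theta> \<Longrightarrow> supp K y \<theta>' \<Longrightarrow> 0 < \<delta> \<Longrightarrow> \<exists>P. set P \<subseteq> A \<and> r \<in> set P \<and> hd P = x \<and> last P = y
      \<and> distinct_adj P \<and> 2 \<le> length P \<and> pathJ (cis \<theta>) P (cis \<theta>') \<ge> pot K y \<theta>' - pot K x \<theta> - \<delta>"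
  shows False
proof -
  define K2 where "K2 = convex hull A"
  have cb: "convex_body K2" unfolding K2_def
    by unfold_locales (use A in \<open>auto intro: compact_convex_hull simp: convex_hull_eq_empty\<close>)
  interpret k: convex_body K2 by (rule cb)
  have sub: "K2 \<subseteq> K" unfolding K2_def using A conv by (intro hull_minimal)
  have AK2: "A \<subseteq> K2" unfolding K2_def by (rule hull_subset)
  have intne: "interior K \<noteq> {}" using r by blast
  have "K2 \<noteq> K" using hull_two_contacts[OF _ Axy intne] unfolding K2_def by blast
  then have cc: "crad K2 < crad K" using crad_strict[OF cb sub] by (meson not_le)
  have xy: "x \<in> K" "y \<in> K" "x \<in> K2" "y \<in> K2" using A AK2 by auto
  have rne: "r \<noteq> x" "r \<noteq> y" using r A by auto
  \<comment> \<open>The path almost attains its bound in \<open>K\<close> and obeys the path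
    inequality in \<open>K2\<close>. Subtraction leaves its turning \<open>V\<close>, multiplied by
    the difference of the two values of \<open>crad\<close>.\<close>
  have key: "\<exists>V. (crad K - crad K2) * V \<le> (pot K2 y \<theta>' - pot K2 x \<theta>) - (pot K y \<theta>' - pot K x \<theta>) + \<delta>
     \<and> ang (cis \<theta>) (r - x) + ang (r - x) (y - r) \<le> V \<and> (x \<noteq> y \<longrightarrow> ang (cis \<theta>) (y - x) + ang (y - x) (cis \<theta>') \<le> V)"
    if s: "supp K x \<theta>" "supp K y \<theta>'" "0 < \<delta>" for \<theta> \<theta>' \<delta>
  proof -
    obtain P where P: "set P \<subseteq> A" "r \<in> set P" "hd P = x" "last P = y" "distinct_adj P" "2 \<le> length P"
      "pathJ (cis \<theta>) P (cis \<theta>') \<ge> pot K y \<theta>' - pot K x \<theta> - \<delta>" using paths[OF s] by blast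
    have "k.pathJ (sdir True \<theta>) P (sdir True \<theta>') \<le> spot K2 True (last P) \<theta>' - spot K2 True (hd P) \<theta> - (if True \<and> \<not> True then 0 else 0)"
      by (rule k.path_bound) (use P AK2 s supp_sub[OF cb sub] xy in \<open>auto simp: k.isgap_def\<close>)
    then have 1: "k.pathJ (cis \<theta>) P (cis \<theta>') \<le> pot K2 y \<theta>' - pot K2 x \<theta>" using P by (simp add: sdir_def spot_def)
    define V where "V = trn (cis \<theta> # edges P @ [cis \<theta>'])"
    have "(crad K - crad K2) * V = k.pathJ (cis \<theta>) P (cis \<theta>') - pathJ (cis \<theta>) P (cis \<theta>')"
      by (simp add: pathJ_def k.pathJ_def V_def algebra_simps)
    then have "(crad K - crad K2) * V \<le> (pot K2 y \<theta>' - pot K2 x \<theta>) - (pot K y \<theta>' - pot K x \<theta>) + \<delta>"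
      using 1 P(7) by linarith
    moreover have "ang (cis \<theta>) (r - x) + ang (r - x) (y - r) \<le> V"
      using trn_path_via[OF P(5,2), of "cis \<theta>" "cis \<theta>'"] rne P(3,4) ang_bounds(1)[of "y - r" "cis \<theta>'"] by (simp add: V_def)
    moreover have "ang (cis \<theta>) (y - x) + ang (y - x) (cis \<theta>') \<le> V" if "x \<noteq> y"
    proof -
      have "P \<noteq> []" using P(6) by auto
      then show ?thesis using trn_path[OF P(5), of "cis \<theta>" "cis \<theta>'"] that P(3,4) by (simp add: V_def)
    qed
    ultimately show ?thesis by blast
  qed
  have small: False if "0 < v" "\<And>\<delta>. 0 < \<delta> \<Longrightarrow> (crad K - crad K2) * v \<le> \<delta>" for v
    using that(2)[of "(crad K - crad K2) * v / 2"] that(1) cc by (simp add: field_simps)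
  obtain \<theta>x where \<theta>x: "supp K x \<theta>x" using frontier_supp xy A by blast
  obtain \<theta>y where \<theta>y: "supp K y \<theta>y" using frontier_supp xy A by blast
  show False
  proof (cases "x = y")
    \<comment> \<open>A path that returns from \<open>r\<close> to its start turns by at least pi,
      while the potentials cancel.\<close>
    case True
    show False
    proof (rule small[OF pi_gt_zero])
      fix \<delta> :: real assume "0 < \<delta>"
      then obtain V where V: "(crad K - crad K2) * V \<le> \<delta>" "ang (cis \<theta>x) (r - x) + ang (r - x) (x - r) \<le> V"
        using key[OF \<theta>x, of \<theta>x \<delta>] \<theta>x True by auto
      have "ang (r - x) (- (r - x)) = pi" using ang_minus[of "r - x" "r - x"] rne by simp
      then have "pi \<le> V" using V(2) ang_bounds(1)[of "cis \<theta>x" "r - x"] by simp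
      then have "(crad K - crad K2) * pi \<le> (crad K - crad K2) * V" using cc by (intro mult_left_mono) auto
      then show "(crad K - crad K2) * pi \<le> \<delta>" using V by linarith
    qed
  next
    case False
    \<comment> \<open>The turning is at least \<theta>2 - \<theta>. Hence the nondecreasing
      difference \<open>hint K - hint K2\<close> has no gain from \<theta> to \<theta>2, and the
      bodies have the same support function in between.\<close>
    have lifted: "\<exists>\<omega> \<theta>2. \<theta> \<le> \<omega> \<and> \<omega> \<le> \<theta> + pi \<and> y - x = of_real (norm (y - x)) * cis \<omega> \<and> \<omega> \<le> \<theta>2 \<and> \<theta>2 \<le> \<omega> + pi
       \<and> cis \<theta>2 = cis \<theta>' \<and> hint K \<theta>2 - hint K2 \<theta>2 \<le> hint K \<theta> - hint K2 \<theta>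
       \<and> (\<forall>\<delta>>0. \<exists>V. ang (cis \<theta>) (r - x) \<le> V \<and> (crad K - crad K2) * V \<le> (crad K - crad K2) * (\<theta>2 - \<theta>) + \<delta>)"
      if s: "supp K x \<theta>" "supp K y \<theta>'" for \<theta> \<theta>'
    proof -
      obtain \<omega> where \<omega>: "\<theta> \<le> \<omega>" "\<omega> \<le> \<theta> + pi" "y - x = of_real (norm (y - x)) * cis \<omega>"
        "ang (cis \<theta>) (y - x) = \<omega> - \<theta>" using lift_out[OF s(1) xy(2)] False by metis
      obtain \<theta>2 where \<theta>2: "\<omega> \<le> \<theta>2" "\<theta>2 \<le> \<omega> + pi" "cis \<theta>2 = cis \<theta>'" "ang (y - x) (cis \<theta>') = \<theta>2 - \<omega>"
        using lift_in[OF s(2) xy(1) _ \<omega>(3)] False by metis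
      have "pot K y \<theta>' = pot K y \<theta>2" "pot K2 y \<theta>' = pot K2 y \<theta>2" using pot_cis_cong k.pot_cis_cong \<theta>2(3) by metis+
      then have diff: "(pot K2 y \<theta>' - pot K2 x \<theta>) - (pot K y \<theta>' - pot K x \<theta>)
        = (hint K \<theta> - hint K2 \<theta>) - (hint K \<theta>2 - hint K2 \<theta>2) + (crad K - crad K2) * (\<theta>2 - \<theta>)"
        by (simp add: pot_def arcpos_def algebra_simps)
      have all: "\<exists>V. (crad K - crad K2) * V \<le> (hint K \<theta> - hint K2 \<theta>) - (hint K \<theta>2 - hint K2 \<theta>2) + (crad K - crad K2) * (\<theta>2 - \<theta>) + \<delta>
        \<and> ang (cis \<theta>) (r - x) \<le> V \<and> \<theta>2 - \<theta> \<le> V" if "0 < \<delta>" for \<delta>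
        using key[OF s that] False \<omega>(4) \<theta>2(4) ang_bounds(1)[of "r - x" "y - r"] unfolding diff by force
      have h1: "hint K \<theta>2 - hint K2 \<theta>2 \<le> hint K \<theta> - hint K2 \<theta>"
      proof (rule field_le_epsilon)
        fix \<delta> :: real assume "0 < \<delta>"
        then obtain V where V: "(crad K - crad K2) * V \<le> (hint K \<theta> - hint K2 \<theta>) - (hint K \<theta>2 - hint K2 \<theta>2) + (crad K - crad K2) * (\<theta>2 - \<theta>) + \<delta>"
          "\<theta>2 - \<theta> \<le> V" using all by blast
        have "(crad K - crad K2) * (\<theta>2 - \<theta>) \<le> (crad K - crad K2) * V" using V(2) cc by (intro mult_left_mono) auto
        then show "hint K \<theta>2 - hint K2 \<theta>2 \<le> hint K \<theta> - hint K2 \<theta> + \<delta>" using V(1) by linarith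
      qed
      have h2: "hint K \<theta> - hint K2 \<theta> \<le> hint K \<theta>2 - hint K2 \<theta>2" using sub_hint_mono[OF cb sub, of \<theta> \<theta>2] \<omega> \<theta>2 by simp
      have "\<exists>V. ang (cis \<theta>) (r - x) \<le> V \<and> (crad K - crad K2) * V \<le> (crad K - crad K2) * (\<theta>2 - \<theta>) + \<delta>" if "0 < \<delta>" for \<delta>
        using all[OF that] h2 by force
      then show ?thesis using \<omega> \<theta>2 h1 by blast
    qed
    obtain \<omega> \<theta>2 where L: "\<theta>x \<le> \<omega>" "\<omega> \<le> \<theta>2" "cis \<theta>2 = cis \<theta>y" "hint K \<theta>2 - hint K2 \<theta>2 \<le> hint K \<theta>x - hint K2 \<theta>x"
      using lifted[OF \<theta>x \<theta>y] by blast
    have y2: "ds K y \<theta>2 = 0" using \<theta>y ds_cis_cong[OF L(3)] by (simp add: supp_def)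
    \<comment> \<open>A support point of the hull can be found in \<open>A\<close> itself; where the
      support functions agree it is also a contact with \<open>K\<close>, that is, \<open>x\<close>
      or \<open>y\<close>.\<close>
    have cover: "ds K x t = 0 \<or> ds K y t = 0" if t: "\<theta>x \<le> t" "t \<le> \<theta>2" for t
    proof (cases "t = \<theta>2")
      case False
      then have "hs K2 t = hs K t" using hs_eq_of_hint_const[OF cb sub _ L(4)] t by simp
      moreover obtain p where p: "p \<in> A" "hs K2 t = p \<bullet> nrm t" using hull_supp[OF A(1), of t] A(3) by (auto simp: K2_def)
      ultimately have "supp K p t" using A(2) by (auto simp: supp_def ds_def)
      then have "p \<in> {x, y}" using supp_not_interior Axy p by blast
      then show ?thesis using \<open>supp K p t\<close> by (auto simp: supp_def)
    qed (use y2 in simp)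
    \<comment> \<open>The angles of contact at \<open>x\<close> and at \<open>y\<close> are closed
      sets covering an interval, and each contains one of its ends. By connectedness some line
      supports \<open>K\<close> at both points.\<close>
    have "\<exists>t. ds K x t = 0 \<and> ds K y t = 0"
    proof (rule ccontr)
      assume no: "\<nexists>t. ds K x t = 0 \<and> ds K y t = 0"
      define C D where "C = {t \<in> {\<theta>x..\<theta>2}. ds K x t = 0}" and "D = {t \<in> {\<theta>x..\<theta>2}. ds K y t = 0}"
      have cl: "closed C" "closed D" unfolding C_def D_def
        by (rule continuous_closed_preimage_constant[OF continuous_ds closed_atLeastAtMost])+
      have "u \<in> C \<union> D" if "u \<in> {\<theta>x..\<theta>2}" for u using cover[of u] that by (auto simp: C_def D_def)
      then have sub: "{\<theta>x..\<theta>2} \<subseteq> C \<union> D" by blast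
      have dis: "C \<inter> D \<inter> {\<theta>x..\<theta>2} = {}" using no by (auto simp: C_def D_def)
      have "\<theta>x \<in> C \<inter> {\<theta>x..\<theta>2}" "\<theta>2 \<in> D \<inter> {\<theta>x..\<theta>2}" using \<theta>x y2 L by (auto simp: C_def D_def supp_def)
      then have nem: "C \<inter> {\<theta>x..\<theta>2} \<noteq> {}" "D \<inter> {\<theta>x..\<theta>2} \<noteq> {}" by blast+
      have "\<not> connected {\<theta>x..\<theta>2}" unfolding connected_closed not_not
        by (rule exI[of _ C], rule exI[of _ D]) (intro conjI cl sub dis nem)
      then show False using connected_Icc by blast
    qed
    then obtain t where t: "ds K x t = 0" "ds K y t = 0" by blast
    then have st: "supp K x t" "supp K y t" using xy by (auto simp: supp_def)
    obtain \<omega>1 \<theta>3 where M: "t \<le> \<omega>1" "\<omega>1 \<le> t + pi" "y - x = of_real (norm (y - x)) * cis \<omega>1" "\<omega>1 \<le> \<theta>3" "\<theta>3 \<le> \<omega>1 + pi"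
       "cis \<theta>3 = cis t" "hint K \<theta>3 - hint K2 \<theta>3 \<le> hint K t - hint K2 t"
       "\<forall>\<delta>>0. \<exists>V. ang (cis t) (r - x) \<le> V \<and> (crad K - crad K2) * V \<le> (crad K - crad K2) * (\<theta>3 - t) + \<delta>"
      using lifted[OF st] by blast
    obtain n :: int where n: "\<theta>3 = t + 2 * pi * real_of_int n" using cis_eqE[OF M(6)] by blast
    \<comment> \<open>The chord lies on the common support line. If it has the direction of that
      line, no turning is free to reach \<open>r\<close>, which is off the line. If it has the
      opposite direction, the comparison extends over a whole period and contradicts the strict
      inequality of \<open>crad\<close>.\<close>
    have "\<omega>1 = t \<or> \<omega>1 = t + pi" using chord_zero[OF t M(3) _ M(1,2)] False by auto
    then show False
    proof
      assume w: "\<omega>1 = t"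
      have "real_of_int n * (2 * pi) < 1 * (2 * pi)" "0 * (2 * pi) \<le> real_of_int n * (2 * pi)"
        using n M(4,5) w pi_gt_zero by (auto simp: mult.commute)
      then have "n = 0" using pi_gt_zero by (simp add: mult_less_cancel_right zero_le_mult_iff)
      then have \<theta>3: "\<theta>3 = t" using n by simp
      have "0 < ang (cis t) (r - x)"
      proof (rule ccontr)
        assume "\<not> ?thesis"
        then have a0: "ang (cis t) (r - x) = 0" using ang_bounds(1)[of "cis t" "r - x"] by simp
        obtain \<omega>r where o: "r - x = of_real (norm (r - x)) * cis \<omega>r" "ang (cis t) (r - x) = \<omega>r - t"
          using lift_out[OF st(1), of r] r A(2) rne by blast
        then have "(norm (r - x) *\<^sub>R cis t) \<bullet> nrm t = (r - x) \<bullet> nrm t" using a0 by (simp add: scaleR_conv_of_real)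
        moreover have "cis t \<bullet> nrm t = 0" by (simp add: inner_nrm)
        ultimately have "supp K r t" using st r A(2) by (auto simp: supp_def ds_def inner_diff_left)
        then show False using supp_not_interior r by blast
      qed
      then show False
      proof (rule small)
        fix \<delta> :: real assume "0 < \<delta>"
        then obtain V where "ang (cis t) (r - x) \<le> V" "(crad K - crad K2) * V \<le> \<delta>" using M(8) \<theta>3 by force
        moreover have "(crad K - crad K2) * ang (cis t) (r - x) \<le> (crad K - crad K2) * V" using calculation cc by (intro mult_left_mono) auto
        ultimately show "(crad K - crad K2) * ang (cis t) (r - x) \<le> \<delta>" by linarith
      qed
    next
      assume w: "\<omega>1 = t + pi"
      have "0 < real_of_int n * (2 * pi)" "real_of_int n * (2 * pi) \<le> 1 * (2 * pi)"
        using n M(4,5) w pi_gt_zero by (auto simp: mult.commute)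
      then have "n = 1" using pi_gt_zero by (simp add: zero_less_mult_iff mult_le_cancel_right)
      then have "\<theta>3 = t + 2 * pi" using n by simp
      then have "2 * pi * crad K \<le> 2 * pi * crad K2" using M(7) hint_2pi[of t] k.hint_2pi[of t] by simp
      then show False using cc by simp
    qed
  qed
qed

end

context convex_body
begin

text \<open>A clockwise excursion is read backwards: this exchanges the ends and reverses all
  directions.\<close>

lemma no_excursion_signed:
  assumes A: "compact A" "A \<subseteq> K" "x \<in> A" "y \<in> A" "x \<notin> interior K" "y \<notin> interior K"
    and Axy: "A - interior K \<subseteq> {x, y}" and r: "r \<in> A" "r \<in> interior K"
    and paths: "\<And>\<theta> \<theta>' \<delta>. supp K x \<theta> \<Longrightarrow> supp K y \<theta>' \<Longrightarrow> 0 < \<delta> \<Longrightarrow> \<exists>P. set P \<subseteq> A \<and> r \<in> set P \<and> hd P = x \<and> last P = y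
      \<and> distinct_adj P \<and> 2 \<le> length P \<and> pathJ (sdir a \<theta>) P (sdir a \<theta>') \<ge> spot K a y \<theta>' - spot K a x \<theta> - \<delta>"
  shows False
proof (cases a)
  case True
  show False
    by (rule no_excursion[OF A Axy r]) (use paths True in \<open>simp add: sdir_def spot_def\<close>)
next
  case False
  show False
  proof (rule no_excursion[OF A(1,2,4,3,6,5) _ r])
    show "A - interior K \<subseteq> {y, x}" using Axy by blast
    fix \<theta>' \<theta> \<delta> :: real assume "supp K y \<theta>'" "supp K x \<theta>" "0 < \<delta>"
    then obtain P where P: "set P \<subseteq> A" "r \<in> set P" "hd P = x" "last P = y" "distinct_adj P" "2 \<le> length P"
      "pathJ (- cis \<theta>) P (- cis \<theta>') \<ge> spot K a y \<theta>' - spot K a x \<theta> - \<delta>"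
      using paths[of \<theta> \<theta>' \<delta>] False by (auto simp: sdir_def)
    have "pathJ (cis \<theta>') (rev P) (cis \<theta>) = pathJ (- cis \<theta>) P (- cis \<theta>')" using pathJ_rev[of "- cis \<theta>'" P "- cis \<theta>"] by simp
    then have "pathJ (cis \<theta>') (rev P) (cis \<theta>) \<ge> pot K x \<theta> - pot K y \<theta>' - \<delta>" using P(7) False by (simp add: spot_def)
    then show "\<exists>P. set P \<subseteq> A \<and> r \<in> set P \<and> hd P = y \<and> last P = x
      \<and> distinct_adj P \<and> 2 \<le> length P \<and> pathJ (cis \<theta>') P (cis \<theta>) \<ge> pot K x \<theta> - pot K y \<theta>' - \<delta>"
      using P by (intro exI[of _ "rev P"]) (auto simp: hd_rev last_rev)
  qed
qed

end

section \<open>Optimal curves run on the boundary and cover its arcs\<close>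

context tcurve_in
begin

lemma cont: "continuous_on {0..\<Lambda>} c"
  unfolding continuous_on_iff
proof (intro ballI allI impI)
  fix t e :: real assume "t \<in> {0..\<Lambda>}" "e > 0"
  then show "\<exists>d>0. \<forall>s\<in>{0..\<Lambda>}. dist s t < d \<longrightarrow> dist (c s) (c t) < e"
    using lip by (intro exI[of _ e]) (force simp: dist_real_def)
qed

lemma compact_arc: "S \<subseteq> {0..\<Lambda>} \<Longrightarrow> compact S \<Longrightarrow> compact (c ` S)"
  by (meson cont compact_continuous_image continuous_on_subset)

text \<open>A parameter without contact belongs to a gap between two contact parameters, and the
  curve over this gap is an excursion. There are at least two contact points, since the contacts
  span \<open>K\<close>.\<close>

lemma on_boundary:
  assumes hull: "convex hull (c ` {0..\<Lambda>}) = K" and int: "interior K \<noteq> {}"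
    and tight: "\<And>s s' \<theta> \<theta>' \<delta> R. contacts s s' \<theta> \<theta>' \<Longrightarrow> 0 < \<delta> \<Longrightarrow> finite R \<Longrightarrow> R \<subseteq> {0..\<Lambda>} \<Longrightarrow> tight a s s' \<theta> \<theta>' \<delta> R"
    and t: "t \<in> {0..\<Lambda>}"
  shows "c t \<notin> interior K"
proof
  assume ct: "c t \<in> interior K"
  define Z where "Z = {s \<in> {0..\<Lambda>}. c s \<in> - interior K}"
  have "Z = {0..\<Lambda>} \<inter> c -` (- interior K)" by (auto simp: Z_def)
  then have clZ: "closed Z" using continuous_closed_preimage[OF cont, of "- interior K"] by (simp add: closed_Compl)
  have Zsub: "Z \<subseteq> {0..\<Lambda>}" by (auto simp: Z_def)
  have many: "\<exists>s\<in>Z. c s \<noteq> x" for x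
  proof (rule ccontr)
    assume "\<not> ?thesis"
    then have "c ` {0..\<Lambda>} - interior K \<subseteq> {x, x}" by (auto simp: Z_def)
    then show False using hull_two_contacts[OF hull _ int] by blast
  qed
  then have neZ: "Z \<noteq> {}" by blast
  have arc: False
    if s: "s \<in> Z" "s' \<in> Z" "s < s'" "\<not> (s = 0 \<and> s' = \<Lambda>)" and S: "S = {s..s'} \<or> S = {s'..\<Lambda>} \<union> {0..s}" and tS: "t \<in> S"
      and free: "S \<inter> Z \<subseteq> {s, s'}" for s s' S
  proof -
    have sb: "0 \<le> s" "s \<le> \<Lambda>" "0 \<le> s'" "s' \<le> \<Lambda>" using s(1,2) Zsub by auto
    have Ssub: "S \<subseteq> {0..\<Lambda>}" "s \<in> S" "s' \<in> S" using S s(3) sb by auto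
    have inK: "c s \<in> K" "c s' \<in> K" using image Zsub s by auto
    have comp: "compact (c ` S)" using S Ssub by (intro compact_arc) auto
    have sub: "c ` S \<subseteq> K" using image Ssub by blast
    have fr: "c s \<notin> interior K" "c s' \<notin> interior K" using s by (auto simp: Z_def)
    have "c ` S - interior K \<subseteq> c ` (S \<inter> Z)" using Ssub by (auto simp: Z_def)
    also have "\<dots> \<subseteq> {c s, c s'}" using free by blast
    finally have two: "c ` S - interior K \<subseteq> {c s, c s'}" .
    have tt: "tight a s s' \<theta> \<theta>' \<delta> {t}" if "supp K (c s) \<theta>" "supp K (c s') \<theta>'" "0 < \<delta>" for \<theta> \<theta>' \<delta>
      by (rule tight) (use that s Zsub t in \<open>auto simp: contacts_def\<close>)
    from S show False
    proof
      assume S1: "S = {s..s'}"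
      show False
      proof (rule no_excursion_signed[OF comp sub _ _ fr two _ ct])
        fix \<theta> \<theta>' \<delta> :: real assume "supp K (c s) \<theta>" "supp K (c s') \<theta>'" "0 < \<delta>"
        from tt[OF this] show "\<exists>P. set P \<subseteq> c ` S \<and> c t \<in> set P \<and> hd P = c s \<and> last P = c s'
          \<and> distinct_adj P \<and> 2 \<le> length P \<and> pathJ (sdir a \<theta>) P (sdir a \<theta>') \<ge> spot K a (c s') \<theta>' - spot K a (c s) \<theta> - \<delta>"
          unfolding tight_def using tS S1 by blast
      qed (use Ssub tS in auto)
    next
      assume S2: "S = {s'..\<Lambda>} \<union> {0..s}"
      show False
      proof (rule no_excursion_signed[OF comp sub _ _ fr(2,1) _ _ ct])
        show "c ` S - interior K \<subseteq> {c s', c s}" using two by blast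
        fix \<theta>' \<theta> \<delta> :: real assume "supp K (c s') \<theta>'" "supp K (c s) \<theta>" "0 < \<delta>"
        from tt[OF this(2,1,3)] show "\<exists>P. set P \<subseteq> c ` S \<and> c t \<in> set P \<and> hd P = c s' \<and> last P = c s
          \<and> distinct_adj P \<and> 2 \<le> length P \<and> pathJ (sdir a \<theta>') P (sdir a \<theta>) \<ge> spot K a (c s) \<theta> - spot K a (c s') \<theta>' - \<delta>"
          unfolding tight_def using tS S2 by blast
      qed (use Ssub tS in auto)
    qed
  qed
  have tZ: "t \<notin> Z" using ct by (auto simp: Z_def)
  have cpt: "compact Z" using clZ Zsub by (meson bounded_closed_interval bounded_subset compact_eq_bounded_closed)
  show False
  proof (cases "(\<exists>s\<in>Z. s < t) \<and> (\<exists>s\<in>Z. t < s)")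
    case True
    define A B where "A = Z \<inter> {..t}" and "B = Z \<inter> {t..}"
    have "compact A" "A \<noteq> {}" "compact B" "B \<noteq> {}" using True cpt by (auto simp: A_def B_def intro: compact_Int_closed less_imp_le)
    then obtain s s' where s: "s \<in> A" "\<forall>u\<in>A. u \<le> s" and s': "s' \<in> B" "\<forall>u\<in>B. s' \<le> u"
      using compact_attains_sup[of A] compact_attains_inf[of B] by metis
    have lt: "s < t" "t < s'" using s s' tZ by (auto simp: A_def B_def order.order_iff_strict)
    have free: "{s..s'} \<inter> Z \<subseteq> {s, s'}"
    proof
      fix u assume u: "u \<in> {s..s'} \<inter> Z"
      then have "u \<le> s \<or> s' \<le> u" using s(2) s'(2) by (cases "u \<le> t") (auto simp: A_def B_def)
      then show "u \<in> {s, s'}" using u by auto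
    qed
    have "\<not> (s = 0 \<and> s' = \<Lambda>)"
    proof
      assume e: "s = 0 \<and> s' = \<Lambda>"
      then have "Z \<subseteq> {0, \<Lambda>}" using free Zsub by blast
      then show False using many[of "c 0"] closed by auto
    qed
    then show False using arc[of s s' "{s..s'}"] s s' lt free by (auto simp: A_def B_def)
  next
    \<comment> \<open>\<open>t\<close> precedes the first contact or follows the last one; the gap
      contains the base point.\<close>
    case False
    obtain s s' where s: "s \<in> Z" "\<forall>u\<in>Z. s \<le> u" and s': "s' \<in> Z" "\<forall>u\<in>Z. u \<le> s'"
      using compact_attains_inf[OF cpt neZ] compact_attains_sup[OF cpt neZ] by metis
    have ne: "s < s'"
    proof -
      obtain u where "u \<in> Z" "c u \<noteq> c s" using many by blast
      then show ?thesis using s s' by (metis order.order_iff_strict order.trans order_antisym)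
    qed
    have tt: "t < s \<or> s' < t" using False s s' tZ by (metis linorder_neqE_linordered_idom)
    then have "\<not> (s = 0 \<and> s' = \<Lambda>)" using t by auto
    moreover have "({s'..\<Lambda>} \<union> {0..s}) \<inter> Z \<subseteq> {s, s'}" using s s' by (auto simp: order_antisym)
    ultimately show False using arc[of s s' "{s'..\<Lambda>} \<union> {0..s}"] s s' ne tt t by auto
  qed
qed

text \<open>By \<open>trn_path\<close> an almost extremal path turns at least as much as its chord
  does between the two tangents. Near equality in the path inequality then makes its length almost
  as large as the boundary arc, and the length is at most the elapsed parameter. The other part
  yields the statement for the complementary arc.\<close>

lemma arc_le:
  assumes tight: "\<And>\<delta>. 0 < \<delta> \<Longrightarrow> tight a s s' \<theta> \<theta>' \<delta> {}"
    and x: "supp K (c s) \<theta>" and y: "supp K (c s') \<theta>'" and ne: "c s \<noteq> c s'"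
    and \<omega>: "c s' - c s = of_real (norm (c s' - c s)) * cis \<omega>" "\<theta> \<le> \<omega>" "\<omega> \<le> \<theta> + pi" "\<omega> \<le> \<theta>'" "\<theta>' \<le> \<omega> + pi"
  defines "A \<equiv> arcpos K (c s') \<theta>' - arcpos K (c s) \<theta>"
  shows "if a then A \<le> s' - s \<and> 2 * pi * crad K - A \<le> \<Lambda> - (s' - s)
    else 2 * pi * crad K - A \<le> s' - s \<and> A \<le> \<Lambda> - (s' - s)"
proof -
  define x y e where "x = c s" and "y = c s'" and "e = y - x"
  have e0: "e \<noteq> 0" "norm e > 0" using ne by (auto simp: e_def x_def y_def)
  have er: "e = of_real (norm e) * cis \<omega>" using \<omega>(1) by (simp add: e_def x_def y_def)
  have a1: "ang (cis \<theta>) e = \<omega> - \<theta>" using ang_polar_eq[of 1 "norm e" \<omega> \<theta>] e0 \<omega> er by simp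
  have a2: "ang e (cis \<theta>') = \<theta>' - \<omega>" using ang_polar_eq[of "norm e" 1 \<theta>' \<omega>] e0 \<omega> er by simp
  have all: "ang (sdir a \<theta>) e = (if a then \<omega> - \<theta> else pi - (\<omega> - \<theta>))" "ang e (sdir a \<theta>') = (if a then \<theta>' - \<omega> else pi - (\<theta>' - \<omega>))"
    "ang (sdir a \<theta>') (- e) = (if a then pi - (\<theta>' - \<omega>) else \<theta>' - \<omega>)" "ang (- e) (sdir a \<theta>) = (if a then pi - (\<omega> - \<theta>) else \<omega> - \<theta>)"
  proof -
    show 1: "ang (sdir a \<theta>) e = (if a then \<omega> - \<theta> else pi - (\<omega> - \<theta>))" using a1 ang_minus1[of "cis \<theta>" e] e0 by (simp add: sdir_def)
    show 2: "ang e (sdir a \<theta>') = (if a then \<theta>' - \<omega> else pi - (\<theta>' - \<omega>))" using a2 ang_minus[of e "cis \<theta>'"] e0 by (simp add: sdir_def)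
    show "ang (sdir a \<theta>') (- e) = (if a then pi - (\<theta>' - \<omega>) else \<theta>' - \<omega>)"
      using 2 ang_minus[of "sdir a \<theta>'" e] e0 by (simp add: ang_sym)
    show "ang (- e) (sdir a \<theta>) = (if a then pi - (\<omega> - \<theta>) else \<omega> - \<theta>)"
      using 1 ang_minus1[of e "sdir a \<theta>"] e0 by (simp add: ang_sym)
  qed
  have main: "(if a then A \<le> s' - s + \<delta> \<and> 2 * pi * crad K - A \<le> \<Lambda> - (s' - s) + \<delta>
    else 2 * pi * crad K - A \<le> s' - s + \<delta> \<and> A \<le> \<Lambda> - (s' - s) + \<delta>)" if "0 < \<delta>" for \<delta>
  proof -
    from tight[OF that] obtain P Q where P: "hd P = x" "last P = y" "distinct_adj P" "2 \<le> length P" "plen P \<le> s' - s"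
      "pathJ (sdir a \<theta>) P (sdir a \<theta>') \<ge> spot K a y \<theta>' - spot K a x \<theta> - \<delta>" and
      Q: "hd Q = y" "last Q = x" "distinct_adj Q" "2 \<le> length Q" "plen Q \<le> \<Lambda> - (s' - s)"
      "pathJ (sdir a \<theta>') Q (sdir a \<theta>) \<ge> spot K a x \<theta> - spot K a y \<theta>' - \<delta>"
      unfolding tight_def x_def y_def by blast
    have ne': "P \<noteq> []" "Q \<noteq> []" "hd P \<noteq> last P" "hd Q \<noteq> last Q" using P Q e0 by (auto simp: e_def)
    have "ang (sdir a \<theta>) e + ang e (sdir a \<theta>') \<le> trn (sdir a \<theta> # edges P @ [sdir a \<theta>'])"
      using trn_path[OF P(3) ne'(3,1), of "sdir a \<theta>" "sdir a \<theta>'"] P by (simp add: e_def)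
    from mult_left_mono[OF this crad_nonneg]
    have 1: "crad K * (ang (sdir a \<theta>) e + ang e (sdir a \<theta>')) \<le> s' - s - (spot K a y \<theta>' - spot K a x \<theta>) + \<delta>"
      using P(5,6) by (simp add: pathJ_def)
    have "ang (sdir a \<theta>') (- e) + ang (- e) (sdir a \<theta>) \<le> trn (sdir a \<theta>' # edges Q @ [sdir a \<theta>])"
      using trn_path[OF Q(3) ne'(4,2), of "sdir a \<theta>'" "sdir a \<theta>"] Q by (simp add: e_def)
    from mult_left_mono[OF this crad_nonneg]
    have 2: "crad K * (ang (sdir a \<theta>') (- e) + ang (- e) (sdir a \<theta>)) \<le> \<Lambda> - (s' - s) - (spot K a x \<theta> - spot K a y \<theta>') + \<delta>"
      using Q(5,6) by (simp add: pathJ_def)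
    have A: "A = pot K y \<theta>' - pot K x \<theta> + crad K * (\<theta>' - \<theta>)" by (simp add: A_def pot_def x_def y_def algebra_simps)
    show ?thesis
    proof (cases a)
      case True
      show ?thesis using 1 2 unfolding all A using True by (simp add: spot_def algebra_simps)
    next
      case False
      show ?thesis using 1 2 unfolding all A using False by (simp add: spot_def algebra_simps)
    qed
  qed
  show ?thesis
  proof (cases a)
    case True
    have "A \<le> s' - s" "2 * pi * crad K - A \<le> \<Lambda> - (s' - s)" by (rule field_le_epsilon, use main True in simp)+
    then show ?thesis using True by simp
  next
    case False
    have "2 * pi * crad K - A \<le> s' - s" "A \<le> \<Lambda> - (s' - s)" by (rule field_le_epsilon, use main False in simp)+
    then show ?thesis using False by simp
  qed
qed

theorem optimal_curve:
  assumes opt: "\<Lambda> = crad K * W" and hull: "convex hull (c ` {0..\<Lambda>}) = K" and int: "interior K \<noteq> {}"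
  shows "\<exists>a. \<forall>s s' \<theta> \<theta>' \<omega>. 0 \<le> s \<longrightarrow> s < s' \<longrightarrow> s' \<le> \<Lambda> \<longrightarrow> supp K (c s) \<theta> \<longrightarrow> supp K (c s') \<theta>' \<longrightarrow> c s \<noteq> c s' \<longrightarrow>
    c s' - c s = of_real (norm (c s' - c s)) * cis \<omega> \<longrightarrow> \<theta> \<le> \<omega> \<longrightarrow> \<omega> \<le> \<theta> + pi \<longrightarrow> \<omega> \<le> \<theta>' \<longrightarrow> \<theta>' \<le> \<omega> + pi \<longrightarrow>
    (if a then arcpos K (c s') \<theta>' - arcpos K (c s) \<theta> \<le> s' - s \<and> 2 * pi * crad K - (arcpos K (c s') \<theta>' - arcpos K (c s) \<theta>) \<le> \<Lambda> - (s' - s)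
    else 2 * pi * crad K - (arcpos K (c s') \<theta>' - arcpos K (c s) \<theta>) \<le> s' - s \<and> arcpos K (c s') \<theta>' - arcpos K (c s) \<theta> \<le> \<Lambda> - (s' - s))"
    and "\<And>t. t \<in> {0..\<Lambda>} \<Longrightarrow> c t \<notin> interior K"
proof -
  obtain a where a: "\<And>s s' \<theta> \<theta>' \<delta> R. contacts s s' \<theta> \<theta>' \<Longrightarrow> 0 < \<delta> \<Longrightarrow> finite R \<Longrightarrow> R \<subseteq> {0..\<Lambda>} \<Longrightarrow> tight a s s' \<theta> \<theta>' \<delta> R"
    using orientation[OF opt int] by metis
  show "\<And>t. t \<in> {0..\<Lambda>} \<Longrightarrow> c t \<notin> interior K" using on_boundary[OF hull int a] by blast
  show "\<exists>a. \<forall>s s' \<theta> \<theta>' \<omega>. 0 \<le> s \<longrightarrow> s < s' \<longrightarrow> s' \<le> \<Lambda> \<longrightarrow> supp K (c s) \<theta> \<longrightarrow> supp K (c s') \<theta>' \<longrightarrow> c s \<noteq> c s' \<longrightarrow>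
    c s' - c s = of_real (norm (c s' - c s)) * cis \<omega> \<longrightarrow> \<theta> \<le> \<omega> \<longrightarrow> \<omega> \<le> \<theta> + pi \<longrightarrow> \<omega> \<le> \<theta>' \<longrightarrow> \<theta>' \<le> \<omega> + pi \<longrightarrow>
    (if a then arcpos K (c s') \<theta>' - arcpos K (c s) \<theta> \<le> s' - s \<and> 2 * pi * crad K - (arcpos K (c s') \<theta>' - arcpos K (c s) \<theta>) \<le> \<Lambda> - (s' - s)
    else 2 * pi * crad K - (arcpos K (c s') \<theta>' - arcpos K (c s) \<theta>) \<le> s' - s \<and> arcpos K (c s') \<theta>' - arcpos K (c s) \<theta> \<le> \<Lambda> - (s' - s))"
  proof (intro exI[of _ a] allI impI)
    fix s s' \<theta> \<theta>' \<omega> :: real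
    assume h: "0 \<le> s" "s < s'" "s' \<le> \<Lambda>" "supp K (c s) \<theta>" "supp K (c s') \<theta>'" "c s \<noteq> c s'"
      "c s' - c s = of_real (norm (c s' - c s)) * cis \<omega>" "\<theta> \<le> \<omega>" "\<omega> \<le> \<theta> + pi" "\<omega> \<le> \<theta>'" "\<theta>' \<le> \<omega> + pi"
    have "contacts s s' \<theta> \<theta>'" using h closed by (auto simp: contacts_def)
    then show "if a then arcpos K (c s') \<theta>' - arcpos K (c s) \<theta> \<le> s' - s \<and> 2 * pi * crad K - (arcpos K (c s') \<theta>' - arcpos K (c s) \<theta>) \<le> \<Lambda> - (s' - s)
    else 2 * pi * crad K - (arcpos K (c s') \<theta>' - arcpos K (c s) \<theta>) \<le> s' - s \<and> arcpos K (c s') \<theta>' - arcpos K (c s) \<theta> \<le> \<Lambda> - (s' - s)"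
      by (intro arc_le a) (use h in auto)
  qed
qed

end

subsection \<open>Curves parametrized by arc length\<close>

lemma plen_nth: "plen ps = (\<Sum>i<length ps - 1. dist (ps ! i) (ps ! Suc i))"
proof (induction ps rule: plen.induct)
  case (1 x y ps)
  have "(\<Sum>i<Suc (length ps). dist ((x # y # ps) ! i) ((x # y # ps) ! Suc i))
    = dist x y + (\<Sum>i<length ps. dist ((y # ps) ! i) ((y # ps) ! Suc i))"
    by (subst sum.lessThan_Suc_shift) simp
  then show ?case using 1 by simp
qed auto

lemma trn_nth: "trn us = (\<Sum>i<length us - 1. ang (us ! i) (us ! Suc i))"
proof (induction us rule: trn.induct)
  case (1 x y ps)
  have "(\<Sum>i<Suc (length ps). ang ((x # y # ps) ! i) ((x # y # ps) ! Suc i))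
    = ang x y + (\<Sum>i<length ps. ang ((y # ps) ! i) ((y # ps) ! Suc i))"
    by (subst sum.lessThan_Suc_shift) simp
  then show ?case using 1 by simp
qed auto

lemma subdivision_list:
  assumes "subdivision D n t"
  shows "sorted_wrt (<) (map t [0..<Suc n])" "set (map t [0..<Suc n]) \<subseteq> D"
proof -
  have st: "i < j \<Longrightarrow> j \<le> n \<Longrightarrow> t i < t j" for i j
  proof (induction j)
    case (Suc j)
    have "t j < t (Suc j)" using assms Suc.prems by (auto simp: subdivision_def)
    then show ?case using Suc by (cases "i = j") auto
  qed simp
  show "sorted_wrt (<) (map t [0..<Suc n])"
    unfolding sorted_wrt_map sorted_wrt_iff_nth_less by (auto simp del: upt_Suc intro: st)
  show "set (map t [0..<Suc n]) \<subseteq> D" using assms by (auto simp: subdivision_def)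
qed

lemma list_subdivision:
  assumes "sorted_wrt (<) ts" "set ts \<subseteq> D" "ts \<noteq> []"
  shows "subdivision D (length ts - 1) (\<lambda>i. ts ! i)"
  unfolding subdivision_def
proof (intro conjI allI impI)
  fix i assume "i \<le> length ts - 1"
  then have "i < length ts" using assms(3) by (cases ts) auto
  then show "ts ! i \<in> D" using assms(2) by auto
next
  fix i assume "i < length ts - 1"
  then show "ts ! i < ts ! Suc i" using assms(1) by (auto simp: sorted_wrt_iff_nth_less)
qed

lemma chord_sums_list:
  "chord_sums c a b = {plen (map c ts) | ts. sorted_wrt (<) ts \<and> set ts \<subseteq> {a..b} \<and> ts \<noteq> []}"
proof (intro equalityI subsetI)
  fix x assume "x \<in> chord_sums c a b"
  then obtain n t where x: "x = (\<Sum>i=1..n. dist (c (t i)) (c (t (i - 1))))" and s: "subdivision {a..b} n t"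
    by (auto simp: chord_sums_def)
  have "x = plen (map c (map t [0..<Suc n]))"
    unfolding x plen_nth using sum.atLeast1_atMost_eq[of "\<lambda>i. dist (c (t i)) (c (t (i - 1)))" n]
    by (simp add: dist_commute nth_append del: upt_Suc)
  then show "x \<in> {plen (map c ts) | ts. sorted_wrt (<) ts \<and> set ts \<subseteq> {a..b} \<and> ts \<noteq> []}"
    using subdivision_list[OF s] by (intro CollectI exI[of _ "map t [0..<Suc n]"]) (simp del: upt_Suc)
next
  fix x assume "x \<in> {plen (map c ts) | ts. sorted_wrt (<) ts \<and> set ts \<subseteq> {a..b} \<and> ts \<noteq> []}"
  then obtain ts where ts: "x = plen (map c ts)" "sorted_wrt (<) ts" "set ts \<subseteq> {a..b}" "ts \<noteq> []" by blast
  let ?n = "length ts - 1"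
  have "(\<Sum>i=1..?n. dist (c (ts ! i)) (c (ts ! (i - 1)))) = (\<Sum>i<?n. dist (c (ts ! Suc i)) (c (ts ! i)))"
    using sum.atLeast1_atMost_eq[of "\<lambda>i. dist (c (ts ! i)) (c (ts ! (i - 1)))" ?n] by simp
  also have "\<dots> = x" unfolding ts(1) plen_nth by (intro sum.cong) (auto simp: dist_commute)
  finally have "x = (\<Sum>i=1..?n. dist (c (ts ! i)) (c (ts ! (i - 1))))" by simp
  then show "x \<in> chord_sums c a b" using list_subdivision[OF ts(2-4)] unfolding chord_sums_def by blast
qed

lemma plen_insort: "plen (map c ts) \<le> plen (map c (insort x ts))"
proof (induction ts)
  case (Cons t ts)
  show ?case
  proof (cases ts)
    case (Cons u us)
    then show ?thesis using Cons.IH dist_triangle[of "c t" "c u" "c x"] by (cases "x \<le> t"; cases "x \<le> u") auto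
  qed auto
qed simp

lemma plen_superset:
  assumes "finite B" "A \<subseteq> B"
  shows "plen (map c (sorted_list_of_set A)) \<le> plen (map c (sorted_list_of_set B))"
proof -
  have "finite D \<Longrightarrow> finite A \<Longrightarrow> plen (map c (sorted_list_of_set A)) \<le> plen (map c (sorted_list_of_set (A \<union> D)))" for D
  proof (induction D rule: finite_induct)
    case (insert x D)
    then show ?case
    proof (cases "x \<in> A")
      case True
      then show ?thesis using insert by (simp add: insert_absorb)
    next
      case False
      then have "sorted_list_of_set (A \<union> insert x D) = insort x (sorted_list_of_set (A \<union> D))"
        using insert by simp
      then show ?thesis using insert plen_insort[of c "sorted_list_of_set (A \<union> D)" x] by simp
    qed
  qed simp
  from this[of B] show ?thesis using assms finite_subset by (metis sup.absorb2)
qed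

lemma sorted_wrt_less_list: "sorted_wrt (<) (ts :: real list) \<Longrightarrow> sorted_list_of_set (set ts) = ts"
  by (simp add: sorted_list_of_set.idem_if_sorted_distinct strict_sorted_iff)

lemma closed_curve_plen:
  assumes "closed_curve c L" "s \<in> {0..L}"
  shows "sorted_wrt (<) ts \<Longrightarrow> set ts \<subseteq> {0..s} \<Longrightarrow> plen (map c ts) \<le> s"
    and "0 < \<delta> \<Longrightarrow> \<exists>ts. sorted_wrt (<) ts \<and> set ts \<subseteq> {0..s} \<and> s - \<delta> < plen (map c ts)"
proof -
  have h: "bdd_above (chord_sums c 0 s)" "Sup (chord_sums c 0 s) = s"
    using assms by (auto simp: closed_curve_def has_arc_length_def)
  show "plen (map c ts) \<le> s" if "sorted_wrt (<) ts" "set ts \<subseteq> {0..s}"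
  proof (cases "ts = []")
    case False
    then have "plen (map c ts) \<in> chord_sums c 0 s" using that by (auto simp: chord_sums_list)
    then show ?thesis using cSup_upper[OF _ h(1)] h(2) by simp
  qed (use assms in auto)
  have ne: "chord_sums c 0 s \<noteq> {}" using assms by (auto simp: chord_sums_list intro!: exI[of _ "[0]"])
  assume "0 < \<delta>"
  then have "s - \<delta> < Sup (chord_sums c 0 s)" using h by simp
  then obtain x where "x \<in> chord_sums c 0 s" "s - \<delta> < x" using less_cSupD[OF ne] by blast
  then show "\<exists>ts. sorted_wrt (<) ts \<and> set ts \<subseteq> {0..s} \<and> s - \<delta> < plen (map c ts)"
    by (auto simp: chord_sums_list)
qed

lemma closed_curve_refine:
  assumes "closed_curve c L" "s \<in> {0..L}" "finite F" "F \<subseteq> {0..s}" "0 < \<delta>"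
  shows "\<exists>ts. sorted_wrt (<) ts \<and> set ts \<subseteq> {0..s} \<and> F \<subseteq> set ts \<and> s - \<delta> < plen (map c ts)"
proof -
  obtain ts where ts: "sorted_wrt (<) ts" "set ts \<subseteq> {0..s}" "s - \<delta> < plen (map c ts)"
    using closed_curve_plen(2)[OF assms(1,2,5)] by blast
  let ?ts = "sorted_list_of_set (set ts \<union> F)"
  have "plen (map c ts) \<le> plen (map c ?ts)"
    using plen_superset[of "set ts \<union> F" "set ts" c] sorted_wrt_less_list[OF ts(1)] assms(3) by simp
  then show ?thesis using ts assms by (intro exI[of _ ?ts]) auto
qed

text \<open>A polygon on \<open>{0..s}\<close> of length almost \<open>s\<close> is prolonged by the
  chord to \<open>c t\<close>; its length remains at most \<open>t\<close>.\<close>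

lemma closed_curve_lipschitz:
  assumes "closed_curve c L" "0 \<le> s" "s \<le> L" "0 \<le> t" "t \<le> L"
  shows "dist (c s) (c t) \<le> \<bar>s - t\<bar>"
proof -
  have *: "dist (c s) (c t) \<le> t - s" if "0 \<le> s" "s < t" "t \<le> L" for s t
  proof (rule field_le_epsilon)
    fix e :: real assume "0 < e"
    have "s \<in> {0..L}" "finite {s}" "{s} \<subseteq> {0..s}" using that by auto
    from closed_curve_refine[OF assms(1) this \<open>0 < e\<close>]
    obtain ts where ts: "sorted_wrt (<) ts" "set ts \<subseteq> {0..s}" "s \<in> set ts" "s - e < plen (map c ts)"
      by auto
    have l: "last ts = s" by (rule sorted_last[OF ts(1,3)]) (use ts(2) in auto)
    have "plen (map c (ts @ [t])) = plen (map c ts) + dist (c s) (c t)"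
    proof -
      obtain us where us: "ts = us @ [s]" using l ts(3) by (metis append_butlast_last_id empty_iff list.set(1))
      then show ?thesis using plen_split[of "map c us" "c s" "[c t]"] by simp
    qed
    moreover have "plen (map c (ts @ [t])) \<le> t"
      by (rule closed_curve_plen(1)[OF assms(1)]) (use that ts in \<open>auto simp: sorted_wrt_append\<close>)
    ultimately show "dist (c s) (c t) \<le> t - s + e" using ts by linarith
  qed
  show ?thesis using *[of s t] *[of t s] assms by (cases s t rule: linorder_cases) (auto simp: dist_commute)
qed

lemma closed_curve_continuous:
  assumes "closed_curve c L"
  shows "continuous_on {0..L} c"
proof (rule continuous_onI)
  fix x e :: real assume "x \<in> {0..L}" "0 < e"
  then show "\<exists>d>0. \<forall>y\<in>{0..L}. dist y x < d \<longrightarrow> dist (c y) (c x) \<le> e"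
    using closed_curve_lipschitz[OF assms] by (intro exI[of _ e]) (fastforce simp: dist_real_def)
qed

lemma tcurve_intro:
  assumes "closed_curve c L"
    and "\<And>ts. sorted_wrt (<) ts \<Longrightarrow> set ts \<subseteq> {0..L} \<Longrightarrow> {0, L} \<subseteq> set ts \<Longrightarrow>
      edges (remdups_adj (map c ts)) \<noteq> [] \<Longrightarrow> ctrn (edges (remdups_adj (map c ts))) \<le> W"
  shows "tcurve c L W"
proof
  show "0 < L" "c 0 = c L" using assms(1) by (auto simp: closed_curve_def)
  fix F \<delta> assume "finite F" "F \<subseteq> {0..L}" "0 < (\<delta>::real)"
  then obtain ts where "sorted_wrt (<) ts" "set ts \<subseteq> {0..L}" "insert 0 (insert L F) \<subseteq> set ts" "L - \<delta> < plen (map c ts)"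
    using closed_curve_refine[OF assms(1), of L "insert 0 (insert L F)" \<delta>] \<open>0 < L\<close> by auto
  then show "\<exists>ts. sorted_wrt (<) ts \<and> set ts \<subseteq> {0..L} \<and> insert 0 (insert L F) \<subseteq> set ts \<and> L - \<delta> \<le> plen (map c ts)"
    by (intro exI[of _ ts]) auto
qed (use assms closed_curve_lipschitz in auto)

text \<open>The polygon on \<open>{0..b}\<close> has at most the length \<open>a\<close> before the
  node \<open>a\<close>, so that almost all of \<open>b - a\<close> is left for the rest.\<close>

lemma closed_curve_segment:
  assumes c: "closed_curve c L" and ab: "0 \<le> a" "a < b" "b \<le> L" and \<delta>: "0 < \<delta>"
  shows "\<exists>ts. sorted_wrt (<) ts \<and> set ts \<subseteq> {a..b} \<and> hd ts = a \<and> last ts = b \<and> 2 \<le> length ts \<and> b - a - \<delta> < plen (map c ts)"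
proof -
  obtain ts where ts: "sorted_wrt (<) ts" "set ts \<subseteq> {0..b}" "{a, b} \<subseteq> set ts" "b - \<delta> < plen (map c ts)"
    using closed_curve_refine[OF c, of b "{a, b}" \<delta>] ab \<delta> by auto
  define us vs where "us = filter (\<lambda>t. t < a) ts" and "vs = filter (\<lambda>t. a < t) ts"
  have sp: "ts = us @ a # vs" unfolding us_def vs_def by (rule sorted_split) (use ts in auto)
  have "plen (map c (us @ [a])) \<le> a"
    by (rule closed_curve_plen(1)[OF c]) (use ts ab in \<open>auto simp: us_def sorted_wrt_append sorted_wrt_filter\<close>)
  then have len: "b - a - \<delta> < plen (map c (a # vs))"
    using ts(4) plen_split[of "map c us" "c a" "map c vs"] sp by simp
  have so: "sorted_wrt (<) (a # vs)" using ts(1) by (auto simp: vs_def sorted_wrt_filter)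
  have bv: "b \<in> set vs" using ts(3) ab by (auto simp: vs_def)
  have "last (a # vs) = b"
    by (rule sorted_last[OF so]) (use bv ts(2) ab in \<open>auto simp: vs_def\<close>)
  moreover have "set (a # vs) \<subseteq> {a..b}" using ts(2) ab by (auto simp: vs_def)
  moreover have "2 \<le> length (a # vs)" using bv by (cases vs) auto
  ultimately show ?thesis using so len by (intro exI[of _ "a # vs"]) simp
qed

subsection \<open>Monotonicity with a countable exceptional set\<close>

text \<open>A small tilt makes all derivatives negative, and a level \<open>y\<close> is chosen
  outside the countable image of \<open>E\<close>. At the last parameter where the tilted function
  is at most \<open>y\<close> the derivative exists, and being negative it carries the function
  below \<open>y\<close> a little longer.\<close>

lemma nonincreasing_countable:
  fixes f :: "real \<Rightarrow> real"
  assumes "a \<le> b" and cont: "continuous_on {a..b} f" and E: "countable E"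
    and der: "\<And>x. a < x \<Longrightarrow> x < b \<Longrightarrow> x \<notin> E \<Longrightarrow> \<exists>D\<le>0. (f has_real_derivative D) (at x)"
  shows "f b \<le> f a"
proof (rule ccontr)
  assume "\<not> ?thesis"
  then have lt: "f a < f b" "a < b" using assms(1) by (auto simp: order.order_iff_strict)
  define e where "e = (f b - f a) / (2 * (b - a))"
  have e: "0 < e" using lt by (simp add: e_def)
  define g where "g x = f x - e * (x - a)" for x
  have "e * (b - a) = (f b - f a) / 2" using lt by (simp add: e_def field_simps)
  then have gab: "g a < g b" using lt by (simp add: g_def)
  have cg: "continuous_on {a..b} g" unfolding g_def by (intro continuous_intros cont)
  have "uncountable {g a<..<g b}" using gab by (simp add: uncountable_open_interval)
  then have "uncountable ({g a<..<g b} - g ` E)" using E by (simp add: uncountable_minus_countable)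
  then obtain y where y: "g a < y" "y < g b" "y \<notin> g ` E" by (metis DiffE countable_empty equals0I greaterThanLessThan_iff)
  define S where "S = {a..b} \<inter> g -` {..y}"
  have "closed S" unfolding S_def by (rule continuous_closed_preimage[OF cg]) auto
  moreover have "bounded S" unfolding S_def by (rule bounded_subset[OF bounded_closed_interval]) auto
  ultimately have "compact S" by (simp add: compact_eq_bounded_closed)
  moreover have "a \<in> S" using y lt by (auto simp: S_def)
  ultimately obtain x where x: "x \<in> S" "\<And>u. u \<in> S \<Longrightarrow> u \<le> x" using compact_attains_sup[of S] by auto
  have xab: "a \<le> x" "x \<le> b" "g x \<le> y" using x by (auto simp: S_def)
  have gx: "g x = y"
  proof (rule ccontr)
    assume "g x \<noteq> y"
    then have "g x < y" using xab by simp
    then obtain u where u: "x \<le> u" "u \<le> b" "g u = y"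
      using IVT'[of g x y b] xab y continuous_on_subset[OF cg, of "{x..b}"] by auto
    then have "u \<in> S" using xab by (auto simp: S_def)
    then show False using x(2)[of u] u \<open>g x < y\<close> by simp
  qed
  have x': "a < x" "x < b" "x \<notin> E" using gx y xab by (auto simp: order.order_iff_strict)
  obtain D where D: "D \<le> 0" "(f has_real_derivative D) (at x)" using der[OF x'] by blast
  have "(g has_real_derivative D - e) (at x)" unfolding g_def using D(2) by (auto intro!: derivative_eq_intros)
  moreover have "D - e < 0" using D e by simp
  ultimately obtain d where d: "0 < d" "\<And>h. 0 < h \<Longrightarrow> h < d \<Longrightarrow> g (x + h) < g x" using DERIV_neg_dec_right by blast
  define h where "h = min (d / 2) (b - x)"
  have h: "0 < h" "h < d" "x + h \<le> b" using d x' by (auto simp: h_def min_def)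
  have "x + h \<in> S" using d(2)[OF h(1,2)] gx h xab by (auto simp: S_def)
  then show False using x(2) h by fastforce
qed

subsection \<open>Curves of bounded rotation\<close>

text \<open>A cyclic rotation puts the group \<open>g\<close> between two neighbours, so that
  merging inside an open path applies.\<close>

lemma ctrn_merge1:
  assumes "0 \<notin> set us" "0 \<notin> set g" "0 \<notin> set ws" "sum_list g \<noteq> 0"
  shows "ctrn (us @ sum_list g # ws) \<le> ctrn (us @ g @ ws)"
proof (cases "ws @ us = []")
  case True
  then show ?thesis using assms by (simp add: ctrn_def trn_nonneg)
next
  case False
  define zs where "zs = ws @ us"
  have z: "zs \<noteq> []" "0 \<notin> set zs" using False assms by (auto simp: zs_def)
  have g: "g \<noteq> []" using assms(4) by auto
  have "ctrn (us @ sum_list g # ws) = ctrn ([sum_list g] @ zs)"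
    using ctrn_rotate[of us "sum_list g # ws"] by (cases "us = []") (auto simp: zs_def)
  also have "\<dots> = trn ([last zs] @ sum_list g # zs)" using z by (simp add: ctrn_def)
  also have "\<dots> \<le> trn ([last zs] @ g @ zs)"
  proof (rule trn_merge_ctx)
    show "0 \<notin> set [last zs]" using z last_in_set[of zs] by (metis empty_iff list.set(1) set_ConsD)
  qed (use z assms in auto)
  also have "\<dots> = ctrn (g @ zs)" using z by (simp add: ctrn_def)
  also have "\<dots> = ctrn (us @ g @ ws)"
    using ctrn_rotate[of us "g @ ws"] g by (cases "us = []") (auto simp: zs_def)
  finally show ?thesis .
qed

lemma ctrn_merge:
  assumes "0 \<notin> set us" "\<And>g. g \<in> set gs \<Longrightarrow> 0 \<notin> set g \<and> sum_list g \<noteq> 0"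
  shows "ctrn (us @ map sum_list gs) \<le> ctrn (us @ concat gs)"
  using assms
proof (induction gs arbitrary: us)
  case (Cons g gs)
  have g: "0 \<notin> set g" "sum_list g \<noteq> 0" using Cons.prems(2)[of g] by auto
  have "0 \<notin> set (map sum_list gs)" using Cons.prems(2) by fastforce
  then have "ctrn (us @ sum_list g # map sum_list gs) \<le> ctrn (us @ g @ map sum_list gs)"
    using ctrn_merge1[of us g "map sum_list gs"] g Cons.prems(1) by blast
  also have "\<dots> \<le> ctrn ((us @ g) @ concat gs)"
    using Cons.IH[of "us @ g"] Cons.prems g by auto
  finally show ?case by simp
qed simp

lemma trn_map_scale:
  assumes "\<And>p. p \<in> set ps \<Longrightarrow> 0 < w p"
  shows "trn (map (\<lambda>p. w p *\<^sub>R f p) ps) = trn (map f ps)"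
  using assms by (induction ps rule: induct_list012) (auto simp: ang_scale1 ang_scale2 scaleR_conv_of_real)

lemma ctrn_map_scale:
  assumes "\<And>p. p \<in> set ps \<Longrightarrow> 0 < w p" "ps \<noteq> []"
  shows "ctrn (map (\<lambda>p. w p *\<^sub>R f p) ps) = ctrn (map f ps)"
proof -
  have "trn (map (\<lambda>p. w p *\<^sub>R f p) (last ps # ps)) = trn (map f (last ps # ps))"
    by (rule trn_map_scale) (metis assms last_in_set set_ConsD)
  then show ?thesis using assms(2) by (simp add: ctrn_def last_map)
qed

lemma tendsto_trn:
  assumes "\<And>p. p \<in> set ps \<Longrightarrow> ((\<lambda>n. f n p) \<longlongrightarrow> g p) F" "\<And>p. p \<in> set ps \<Longrightarrow> g p \<noteq> 0"
  shows "((\<lambda>n. trn (map (f n) ps)) \<longlongrightarrow> trn (map g ps)) F"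
  using assms by (induction ps rule: induct_list012) (auto intro!: tendsto_intros tendsto_ang)

lemma tendsto_ctrn:
  assumes "\<And>p. p \<in> set ps \<Longrightarrow> ((\<lambda>n. f n p) \<longlongrightarrow> g p) F" "\<And>p. p \<in> set ps \<Longrightarrow> g p \<noteq> 0" "ps \<noteq> []"
  shows "((\<lambda>n. ctrn (map (f n) ps)) \<longlongrightarrow> ctrn (map g ps)) F"
proof -
  have "((\<lambda>n. trn (map (f n) (last ps # ps))) \<longlongrightarrow> trn (map g (last ps # ps))) F"
    by (rule tendsto_trn) (metis assms last_in_set set_ConsD)+
  then show ?thesis using assms(3) by (simp add: ctrn_def last_map)
qed

lemma edges_zip: "edges (map c ts) = map (\<lambda>(a, b). c b - c a) (zip ts (tl ts))"
  by (induction ts rule: induct_list012) auto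

lemma sorted_zip:
  assumes "sorted_wrt (<) (ts :: real list)"
  shows "sorted_wrt (\<lambda>p q. snd p \<le> fst q) (zip ts (tl ts))"
    and "(a, b) \<in> set (zip ts (tl ts)) \<Longrightarrow> a < b \<and> a \<in> set ts \<and> b \<in> set ts"
proof -
  have "sorted_wrt (\<lambda>p q. snd p \<le> fst q) (zip ts (tl ts)) \<and>
    (\<forall>(a, b) \<in> set (zip ts (tl ts)). a < b \<and> a \<in> set ts \<and> b \<in> set ts)"
    using assms
  proof (induction ts rule: induct_list012)
    case (3 x y zs)
    then have IH: "sorted_wrt (\<lambda>p q. snd p \<le> fst q) (zip (y # zs) (tl (y # zs)))"
      "\<And>a b. (a, b) \<in> set (zip (y # zs) (tl (y # zs))) \<Longrightarrow> a < b \<and> a \<in> set (y # zs) \<and> b \<in> set (y # zs)"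
      by auto
    have "y \<le> fst q" if "q \<in> set (zip (y # zs) zs)" for q
      using IH(2)[of "fst q" "snd q"] that 3(3) by auto
    then show ?case using IH 3(3) by auto
  qed auto
  then show "sorted_wrt (\<lambda>p q. snd p \<le> fst q) (zip ts (tl ts))"
    "(a, b) \<in> set (zip ts (tl ts)) \<Longrightarrow> a < b \<and> a \<in> set ts \<and> b \<in> set ts" by auto
qed

text \<open>Intervals that are disjoint but not necessarily adjacent: this form permits the omission
  of zero chords, and for convex curves it also covers difference quotients over short
  intervals.\<close>

lemma tcurve_intro_intervals:
  assumes c: "closed_curve c L"
    and W: "\<And>qs. sorted_wrt (\<lambda>p q. snd p \<le> fst q) qs \<Longrightarrow> qs \<noteq> [] \<Longrightarrow>
      (\<And>a b. (a, b) \<in> set qs \<Longrightarrow> 0 \<le> a \<and> a < b \<and> b \<le> L \<and> c a \<noteq> c b) \<Longrightarrow>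
      ctrn (map (\<lambda>(a, b). c b - c a) qs) \<le> W"
  shows "tcurve c L W"
proof (rule tcurve_intro[OF c])
  fix ts assume ts: "sorted_wrt (<) ts" "set ts \<subseteq> {0..L}" "edges (remdups_adj (map c ts)) \<noteq> []"
  define qs where "qs = filter (\<lambda>(a, b). c a \<noteq> c b) (zip ts (tl ts))"
  have eq: "edges (remdups_adj (map c ts)) = map (\<lambda>(a, b). c b - c a) qs"
    unfolding edges_remdups_adj edges_zip qs_def filter_map o_def
    by (intro arg_cong[where f = "map _"] filter_cong) auto
  have "sorted_wrt (\<lambda>p q. snd p \<le> fst q) qs" unfolding qs_def
    by (intro sorted_wrt_filter sorted_zip ts)
  moreover have "0 \<le> a \<and> a < b \<and> b \<le> L \<and> c a \<noteq> c b" if "(a, b) \<in> set qs" for a b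
    using that sorted_zip(2)[OF ts(1), of a b] ts(2) by (auto simp: qs_def)
  moreover have "qs \<noteq> []" using ts(3) eq by auto
  ultimately show "ctrn (edges (remdups_adj (map c ts))) \<le> W" unfolding eq using W by blast
qed

lemma plen_lipschitz_bound:
  assumes "sorted_wrt (<) ts" "ts \<noteq> []" "set ts \<subseteq> {a..b}"
    and "\<And>s t. a \<le> s \<Longrightarrow> s < t \<Longrightarrow> t \<le> b \<Longrightarrow> dist (c s) (c t) \<le> q * (t - s)"
  shows "plen (map c ts) \<le> q * (last ts - hd ts)"
  using assms(1-3)
proof (induction ts rule: induct_list012)
  case (3 x y zs)
  have "dist (c x) (c y) \<le> q * (y - x)" using 3 by (intro assms(4)) auto
  then show ?case using 3 by (auto simp: algebra_simps)
qed auto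

lemma variation_sum_ctrn:
  assumes "\<And>i. i \<le> n \<Longrightarrow> norm (f (t i)) = 1"
  shows "(\<Sum>i=1..n. circle_dist (f (t i)) (f (t (i - 1)))) + circle_dist (f (t n)) (f (t 0)) =
    ctrn (map f (map t [0..<Suc n]))"
proof -
  let ?us = "map f (map t [0..<Suc n])"
  have nt: "?us ! i = f (t i)" if "i \<le> n" for i using that nth_map_upt[of i "Suc n" 0 "f \<circ> t"] by (simp del: upt_Suc)
  have "(\<Sum>i=1..n. circle_dist (f (t i)) (f (t (i - 1)))) = (\<Sum>i<n. circle_dist (f (t (Suc i))) (f (t i)))"
    using sum.atLeast1_atMost_eq[of "\<lambda>i. circle_dist (f (t i)) (f (t (i - 1)))" n] by simp
  also have "\<dots> = trn ?us" unfolding trn_nth circle_dist_def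
    by (intro sum.cong) (use assms nt in \<open>auto simp: ang_arccos inner_commute simp del: upt_Suc\<close>)
  finally have 1: "(\<Sum>i=1..n. circle_dist (f (t i)) (f (t (i - 1)))) = trn ?us" .
  have "hd ?us = f (t 0)" using hd_conv_nth[of ?us] nt[of 0] by (simp del: upt_Suc map_map)
  moreover have "last ?us = f (t n)" "?us \<noteq> []" by simp_all
  ultimately have "ctrn ?us = ang (f (t n)) (f (t 0)) + trn ?us" unfolding ctrn_def by (metis trn_Cons)
  moreover have "circle_dist (f (t n)) (f (t 0)) = ang (f (t n)) (f (t 0))"
    using ang_arccos[OF assms[of n] assms[of 0]] by (simp add: circle_dist_def)
  ultimately show ?thesis unfolding 1 by simp
qed

section \<open>From the variation of the velocity to the turning of inscribed polygons\<close>

locale bv1_curve =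
  fixes \<Gamma> :: "real \<Rightarrow> complex" and L :: real and E :: "real set"
  assumes cc: "closed_curve \<Gamma> L" and ctble: "countable E"
    and E: "\<And>s. s \<in> {0..L} \<Longrightarrow> s \<notin> E \<Longrightarrow> s \<in> velocity_dom \<Gamma> L \<and> continuous (at s within velocity_dom \<Gamma> L) (velocity \<Gamma> L)"
    and bdd: "bdd_above (variation_sums (velocity \<Gamma> L) (velocity_dom \<Gamma> L))"
begin

abbreviation "v \<equiv> velocity \<Gamma> L"

lemma vel: 
  assumes "0 < s" "s < L" "s \<notin> E"
  shows "(\<Gamma> has_vector_derivative v s) (at s)"
proof -
  have "\<Gamma> differentiable (at s within {0..L})" using E[of s] assms by (auto simp: velocity_dom_def)
  then show ?thesis unfolding velocity_def using assms
    by (simp add: vector_derivative_works at_within_Icc_at)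
qed

text \<open>A mean value theorem for plane curves. Otherwise a line separates the difference
  quotient from all velocities, and \<open>nonincreasing_countable\<close> applied to the
  corresponding component contradicts this.\<close>

lemma chord_hull:
  assumes "0 \<le> a" "a < b" "b \<le> L"
  shows "(\<Gamma> b - \<Gamma> a) /\<^sub>R (b - a) \<in> closure (convex hull (v ` ({a<..<b} - E)))"
proof (rule ccontr)
  let ?S = "closure (convex hull (v ` ({a<..<b} - E)))" and ?z = "(\<Gamma> b - \<Gamma> a) /\<^sub>R (b - a)"
  assume "?z \<notin> ?S"
  then obtain n d where n: "n \<bullet> ?z < d" "\<forall>x\<in>?S. n \<bullet> x > d"
    using separating_hyperplane_closed_point[of ?S ?z] convex_closure[OF convex_convex_hull] by blast
  have "d * b - n \<bullet> \<Gamma> b \<le> d * a - n \<bullet> \<Gamma> a"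
  proof (rule nonincreasing_countable[where f = "\<lambda>t. d * t - n \<bullet> \<Gamma> t", OF _ _ ctble])
    show "continuous_on {a..b} (\<lambda>t. d * t - n \<bullet> \<Gamma> t)"
      using assms by (intro continuous_intros continuous_on_subset[OF closed_curve_continuous[OF cc]]) auto
    fix t assume t: "a < t" "t < b" "t \<notin> E"
    have "v t \<in> ?S" using t by (intro subsetD[OF closure_subset] hull_inc) auto
    then have "d - n \<bullet> v t \<le> 0" using n by fastforce
    moreover have "((\<lambda>t. n \<bullet> \<Gamma> t) has_real_derivative n \<bullet> v t) (at t)"
      unfolding has_real_derivative_iff_has_vector_derivative
      by (rule bounded_linear.has_vector_derivative[OF bounded_linear_inner_right vel]) (use t assms in auto)
    then have "((\<lambda>t. d * t - n \<bullet> \<Gamma> t) has_real_derivative d - n \<bullet> v t) (at t)"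
      by (auto intro!: derivative_eq_intros)
    ultimately show "\<exists>D\<le>0. ((\<lambda>t. d * t - n \<bullet> \<Gamma> t) has_real_derivative D) (at t)" by blast
  qed (use assms in auto)
  moreover have "(b - a) * (n \<bullet> ?z) = n \<bullet> (\<Gamma> b - \<Gamma> a)" using assms by simp
  ultimately have "d * (b - a) \<le> (b - a) * (n \<bullet> ?z)" by (simp add: inner_diff_right algebra_simps)
  then show False using n(1) assms by (simp add: mult.commute)
qed

text \<open>The Lipschitz bound gives speed at most 1. A smaller speed would persist nearby by
  continuity of the velocity and make a piece of the curve shorter than its parameter
  interval.\<close>

lemma norm_velocity:
  assumes "0 < s" "s < L" "s \<notin> E"
  shows "norm (v s) = 1"
proof (rule antisym)
  show "norm (v s) \<le> 1"
  proof (rule field_le_epsilon)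
    fix e :: real assume "0 < e"
    then obtain d where d: "0 < d" "\<And>y. norm (y - s) < d \<Longrightarrow> norm (\<Gamma> y - \<Gamma> s - (y - s) *\<^sub>R v s) \<le> e * norm (y - s)"
      using vel[OF assms] unfolding has_vector_derivative_def has_derivative_at_alt by blast
    define h where "h = min (d / 2) (L - s)"
    have h: "0 < h" "h < d" "s + h \<le> L" using d assms by (auto simp: h_def min_def)
    have "norm (h *\<^sub>R v s) \<le> norm (\<Gamma> (s + h) - \<Gamma> s) + norm (\<Gamma> (s + h) - \<Gamma> s - h *\<^sub>R v s)"
      by (metis norm_triangle_sub norm_minus_commute add.commute)
    also have "\<dots> \<le> h + e * h"
      using d(2)[of "s + h"] closed_curve_lipschitz[OF cc, of "s + h" s] h assms by (auto simp: dist_norm)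
    finally have "h * norm (v s) \<le> h * (1 + e)" using h by (simp add: algebra_simps)
    then show "norm (v s) \<le> 1 + e" using h by simp
  qed
  show "1 \<le> norm (v s)"
  proof (rule ccontr)
    assume "\<not> ?thesis"
    then obtain q where q: "norm (v s) < q" "q < 1" using dense[of "norm (v s)" 1] by auto
    have "continuous (at s within velocity_dom \<Gamma> L) v" using E[of s] assms by auto
    then obtain d where d: "0 < d" "\<And>r. r \<in> velocity_dom \<Gamma> L \<Longrightarrow> dist r s < d \<Longrightarrow> dist (v r) (v s) < q - norm (v s)"
      using q(1) unfolding continuous_within_eps_delta by (metis diff_gt_0_iff_gt)
    define b where "b = min (s + d / 2) L"
    have b: "s < b" "b \<le> L" "b < s + d" using d assms by (auto simp: b_def)
    have lq: "dist (\<Gamma> t) (\<Gamma> t') \<le> q * (t' - t)" if "s \<le> t" "t < t'" "t' \<le> b" for t t'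
    proof -
      have "norm (v r) \<le> q" if "r \<in> {t<..<t'} - E" for r
      proof -
        have "r \<in> velocity_dom \<Gamma> L" using E[of r] that \<open>s \<le> t\<close> \<open>t' \<le> b\<close> b assms by auto
        then have "dist (v r) (v s) < q - norm (v s)"
          using d(2)[of r] that \<open>s \<le> t\<close> \<open>t' \<le> b\<close> b by (auto simp: dist_real_def)
        then show ?thesis using norm_triangle_sub[of "v r" "v s"] by (simp add: dist_norm)
      qed
      then have "convex hull (v ` ({t<..<t'} - E)) \<subseteq> cball 0 q" by (intro hull_minimal) auto
      then have "closure (convex hull (v ` ({t<..<t'} - E))) \<subseteq> cball 0 q" by (intro closure_minimal) auto
      then have "norm ((\<Gamma> t' - \<Gamma> t) /\<^sub>R (t' - t)) \<le> q" using chord_hull[of t t'] that assms b by auto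
      then have "norm (\<Gamma> t' - \<Gamma> t) / (t' - t) \<le> q" using that by (simp only: norm_scaleR) (simp add: divide_inverse_commute)
      then show ?thesis using that by (simp add: dist_norm norm_minus_commute divide_simps mult.commute split: if_splits)
    qed
    have "0 < (1 - q) * (b - s)" using q b by simp
    then obtain ts where ts: "sorted_wrt (<) ts" "set ts \<subseteq> {s..b}" "hd ts = s" "last ts = b" "2 \<le> length ts"
      "b - s - (1 - q) * (b - s) < plen (map \<Gamma> ts)"
      using closed_curve_segment[OF cc, of s b "(1 - q) * (b - s)"] assms b by auto
    have "plen (map \<Gamma> ts) \<le> q * (b - s)"
    proof -
      have "ts \<noteq> []" using ts(5) by auto
      from plen_lipschitz_bound[OF ts(1) this ts(2) lq] show ?thesis unfolding ts(3,4) .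
    qed
    then show False using ts(6) by (simp add: algebra_simps)
  qed
qed

text \<open>A chord is almost a positive combination of velocities at finitely many inner
  parameters, and a sum may be arranged in increasing order of these parameters.\<close>

lemma chord_approx:
  assumes "0 \<le> a" "a < b" "b \<le> L" "0 < e"
  shows "\<exists>ps. sorted_wrt (<) (map snd ps) \<and> (\<forall>p\<in>set ps. 0 < fst p \<and> a < snd p \<and> snd p < b \<and> snd p \<notin> E) \<and>
    dist (sum_list (map (\<lambda>p. fst p *\<^sub>R v (snd p)) ps)) (\<Gamma> b - \<Gamma> a) < e"
proof -
  let ?G = "{a<..<b} - E"
  have "0 < e / (b - a)" using assms by simp
  then obtain y where y: "y \<in> convex hull (v ` ?G)" "dist y ((\<Gamma> b - \<Gamma> a) /\<^sub>R (b - a)) < e / (b - a)"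
    using chord_hull[OF assms(1-3)] unfolding closure_approachable by blast
  obtain S u where S: "finite S" "S \<subseteq> v ` ?G" "\<forall>x\<in>S. 0 \<le> u x" "(\<Sum>x\<in>S. u x *\<^sub>R x) = y"
    using y(1) unfolding convex_hull_explicit by auto
  define S' where "S' = {x \<in> S. u x \<noteq> 0}"
  \<comment> \<open>One parameter is selected for each velocity with nonzero weight, so that all
    weights that remain are positive.\<close>
  obtain R where R: "R \<subseteq> ?G" "inj_on v R" "S' = v ` R"
    using subset_image_inj[of S' v ?G] S(2) by (auto simp: S'_def)
  have "finite (v ` R)" using S(1) unfolding R(3)[symmetric] S'_def by simp
  then have fR: "finite R" using R(2) by (rule finite_imageD)
  define ps where "ps = map (\<lambda>r. ((b - a) * u (v r), r)) (sorted_list_of_set R)"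
  have "sum_list (map (\<lambda>p. fst p *\<^sub>R v (snd p)) ps) = (\<Sum>r\<in>R. ((b - a) * u (v r)) *\<^sub>R v r)"
    using fR by (simp add: ps_def o_def sum_list_distinct_conv_sum_set)
  also have "\<dots> = (\<Sum>x\<in>S'. ((b - a) * u x) *\<^sub>R x)" unfolding R(3) by (simp add: sum.reindex[OF R(2)])
  also have "\<dots> = (\<Sum>x\<in>S. ((b - a) * u x) *\<^sub>R x)"
    by (rule sum.mono_neutral_left) (use S(1) in \<open>auto simp: S'_def\<close>)
  also have "\<dots> = (b - a) *\<^sub>R y" unfolding S(4)[symmetric] by (simp add: scaleR_sum_right)
  finally have s: "sum_list (map (\<lambda>p. fst p *\<^sub>R v (snd p)) ps) = (b - a) *\<^sub>R y" .
  have "(b - a) *\<^sub>R y - (\<Gamma> b - \<Gamma> a) = (b - a) *\<^sub>R (y - (\<Gamma> b - \<Gamma> a) /\<^sub>R (b - a))"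
    using assms by (simp add: scaleR_diff_right)
  then have "dist ((b - a) *\<^sub>R y) (\<Gamma> b - \<Gamma> a) = (b - a) * dist y ((\<Gamma> b - \<Gamma> a) /\<^sub>R (b - a))"
    using assms by (simp add: dist_norm)
  also have "\<dots> < e" using y(2) assms by (simp add: field_simps)
  finally have "dist (sum_list (map (\<lambda>p. fst p *\<^sub>R v (snd p)) ps)) (\<Gamma> b - \<Gamma> a) < e" unfolding s .
  moreover have "map snd ps = sorted_list_of_set R" by (simp add: ps_def o_def)
  moreover have "\<forall>p\<in>set ps. 0 < fst p \<and> a < snd p \<and> snd p < b \<and> snd p \<notin> E"
  proof
    fix p assume "p \<in> set ps"
    then obtain r where r: "r \<in> R" "p = ((b - a) * u (v r), r)" using fR by (auto simp: ps_def)
    then have "v r \<in> S'" using R by auto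
    then have "0 < u (v r)" using S(3) by (auto simp: S'_def order.order_iff_strict)
    then show "0 < fst p \<and> a < snd p \<and> snd p < b \<and> snd p \<notin> E" using r R assms by auto
  qed
  ultimately show ?thesis by (intro exI[of _ ps]) simp
qed

lemma ctrn_le_rotation:
  assumes "sorted_wrt (<) rs" "rs \<noteq> []" "\<And>r. r \<in> set rs \<Longrightarrow> 0 < r \<and> r < L \<and> r \<notin> E"
  shows "ctrn (map v rs) \<le> full_rotation \<Gamma> L"
proof -
  let ?n = "length rs - 1"
  have n: "norm (v (rs ! i)) = 1" if "i \<le> ?n" for i
  proof -
    have "i < length rs" using that assms(2) by (cases rs) auto
    then have "rs ! i \<in> set rs" by simp
    then show ?thesis using norm_velocity assms(3) by blast
  qed
  have "map (\<lambda>i. rs ! i) [0..<Suc ?n] = rs" using map_nth[of rs] assms(2) by simp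
  then have "(\<Sum>i=1..?n. circle_dist (v (rs ! i)) (v (rs ! (i - 1)))) + circle_dist (v (rs ! ?n)) (v (rs ! 0)) = ctrn (map v rs)"
    using variation_sum_ctrn[of ?n v "\<lambda>i. rs ! i", OF n] by simp
  moreover have "subdivision (velocity_dom \<Gamma> L) ?n (\<lambda>i. rs ! i)"
    by (rule list_subdivision) (use assms E in force)+
  ultimately have "ctrn (map v rs) \<in> variation_sums v (velocity_dom \<Gamma> L)"
    unfolding variation_sums_def by (intro CollectI exI[of _ ?n] exI[of _ "\<lambda>i. rs ! i"]) simp
  then show ?thesis unfolding full_rotation_def variation_def using bdd by (rule cSup_upper)
qed

lemma sorted_concat_intervals:
  assumes "sorted_wrt (\<lambda>p q. snd p \<le> fst q) qs"
    "\<And>q. q \<in> set qs \<Longrightarrow> sorted_wrt (<) (g q) \<and> (\<forall>r\<in>set (g q). fst q < r \<and> r < snd q)"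
  shows "sorted_wrt (<) (concat (map g qs) :: real list)"
  using assms
proof (induction qs)
  case (Cons q qs)
  have "x < y" if "x \<in> set (g q)" "y \<in> set (g q')" "q' \<in> set qs" for x y q'
  proof -
    have "x < snd q" "fst q' < y" "snd q \<le> fst q'" using that Cons.prems by auto
    then show ?thesis by simp
  qed
  then show ?case using Cons by (auto simp: sorted_wrt_append)
qed simp

text \<open>Every chord is approximated by a sum of velocities. Resolving the sums into their terms
  does not decrease the turning, and the velocities, being ordered, compete in the definition of the
  full rotation. The claim follows in the limit.\<close>

lemma tcurve: "tcurve \<Gamma> L (full_rotation \<Gamma> L)"
proof (rule tcurve_intro_intervals[OF cc])
  fix qs :: "(real \<times> real) list"
  assume qs: "sorted_wrt (\<lambda>p q. snd p \<le> fst q) qs" "qs \<noteq> []"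
    and q: "\<And>a b. (a, b) \<in> set qs \<Longrightarrow> 0 \<le> a \<and> a < b \<and> b \<le> L \<and> \<Gamma> a \<noteq> \<Gamma> b"
  define ed where "ed = (\<lambda>(a, b). \<Gamma> b - \<Gamma> a)"
  define sm where "sm ps = sum_list (map (\<lambda>p. fst p *\<^sub>R v (snd p)) ps)" for ps
  have "\<exists>ps. sorted_wrt (<) (map snd ps) \<and> (\<forall>p\<in>set ps. 0 < fst p \<and> fst q < snd p \<and> snd p < snd q \<and> snd p \<notin> E) \<and>
    dist (sm ps) (ed q) < 1 / Suc n" if "q \<in> set qs" for n q
    using chord_approx[of "fst q" "snd q" "1 / Suc n"] q[of "fst q" "snd q"] that
    unfolding sm_def ed_def by (simp add: case_prod_beta)
  then have "\<forall>n q. \<exists>ps. q \<in> set qs \<longrightarrow> sorted_wrt (<) (map snd ps) \<and> (\<forall>p\<in>set ps. 0 < fst p \<and> fst q < snd p \<and> snd p < snd q \<and> snd p \<notin> E) \<and>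
    dist (sm ps) (ed q) < 1 / Suc n" by blast
  then obtain P where "\<forall>n q. q \<in> set qs \<longrightarrow> sorted_wrt (<) (map snd (P n q)) \<and> (\<forall>p\<in>set (P n q). 0 < fst p \<and> fst q < snd p \<and> snd p < snd q \<and> snd p \<notin> E) \<and>
    dist (sm (P n q)) (ed q) < 1 / Suc n" unfolding choice_iff by blast
  then have P: "\<And>n q. q \<in> set qs \<Longrightarrow> sorted_wrt (<) (map snd (P n q))"
      "\<And>n q p. q \<in> set qs \<Longrightarrow> p \<in> set (P n q) \<Longrightarrow> 0 < fst p \<and> fst q < snd p \<and> snd p < snd q \<and> snd p \<notin> E"
      "\<And>n q. q \<in> set qs \<Longrightarrow> dist (sm (P n q)) (ed q) < 1 / Suc n"
    by blast+
  have lim: "(\<lambda>n. sm (P n q)) \<longlonglongrightarrow> ed q" if "q \<in> set qs" for q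
    unfolding LIMSEQ_iff_nz dist_norm[symmetric]
  proof (intro allI impI)
    fix e :: real assume "0 < e"
    then obtain N where N: "0 < N" "1 / real N < e"
      using real_arch_inverse[of e] by (metis gr0I inverse_eq_divide)
    have "dist (sm (P n q)) (ed q) < e" if "N \<le> n" for n
    proof -
      have "1 / real (Suc n) \<le> 1 / real N" using that N by (intro divide_left_mono) auto
      then show ?thesis using P(3)[OF \<open>q \<in> set qs\<close>, of n] N by linarith
    qed
    then show "\<exists>N>0. \<forall>n\<ge>N. dist (sm (P n q)) (ed q) < e" using N by blast
  qed
  have ne: "ed q \<noteq> 0" if "q \<in> set qs" for q using q[of "fst q" "snd q"] that by (auto simp: ed_def case_prod_beta)
  have tend: "(\<lambda>n. ctrn (map (\<lambda>q. sm (P n q)) qs)) \<longlonglongrightarrow> ctrn (map ed qs)"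
    by (rule tendsto_ctrn) (use lim ne qs in auto)
  have "\<forall>\<^sub>F n in sequentially. \<forall>q\<in>set qs. sm (P n q) \<noteq> 0"
    by (intro eventually_ball_finite ballI tendsto_imp_eventually_ne[OF lim ne]) auto
  then have "\<forall>\<^sub>F n in sequentially. ctrn (map (\<lambda>q. sm (P n q)) qs) \<le> full_rotation \<Gamma> L"
  proof eventually_elim
    case (elim n)
    let ?g = "\<lambda>q. map (\<lambda>p. fst p *\<^sub>R v (snd p)) (P n q)"
    let ?all = "concat (map (P n) qs)"
    have in0: "0 < snd p \<and> snd p < L \<and> snd p \<notin> E \<and> 0 < fst p" if "q \<in> set qs" "p \<in> set (P n q)" for p q
      using P(2)[OF that] q[of "fst q" "snd q"] that(1) by auto
    have nz: "0 \<notin> set (?g q)" if "q \<in> set qs" for q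
    proof
      assume "0 \<in> set (?g q)"
      then obtain p where p: "p \<in> set (P n q)" "fst p *\<^sub>R v (snd p) = 0" by auto
      then show False using in0[OF that p(1)] norm_velocity[of "snd p"] by auto
    qed
    have "map (\<lambda>q. sm (P n q)) qs = [] @ map sum_list (map ?g qs)" by (simp add: sm_def o_def)
    then have "ctrn (map (\<lambda>q. sm (P n q)) qs) = ctrn ([] @ map sum_list (map ?g qs))" by (simp only:)
    also have "\<dots> \<le> ctrn ([] @ concat (map ?g qs))"
      by (rule ctrn_merge) (use nz elim in \<open>auto simp: sm_def\<close>)
    also have "concat (map ?g qs) = map (\<lambda>p. fst p *\<^sub>R v (snd p)) ?all" by (simp add: map_concat o_def)
    also have "ctrn ([] @ \<dots>) = ctrn (map (\<lambda>p. v (snd p)) ?all)"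
    proof -
      have "?all \<noteq> []" using qs(2) elim by (cases qs) (auto simp: sm_def)
      then show ?thesis using in0 by (simp only: append_Nil) (rule ctrn_map_scale, auto)
    qed
    also have "map (\<lambda>p. v (snd p)) ?all = map v (concat (map (\<lambda>q. map snd (P n q)) qs))" by (simp add: map_concat o_def)
    also have "ctrn \<dots> \<le> full_rotation \<Gamma> L"
    proof (rule ctrn_le_rotation)
      show "sorted_wrt (<) (concat (map (\<lambda>q. map snd (P n q)) qs))"
        by (rule sorted_concat_intervals[OF qs(1)]) (use P in auto)
      show "concat (map (\<lambda>q. map snd (P n q)) qs) \<noteq> []" using qs(2) elim by (cases qs) (auto simp: sm_def)
    qed (use in0 in auto)
    finally show ?case .
  qed
  then have "ctrn (map ed qs) \<le> full_rotation \<Gamma> L" by (rule tendsto_upperbound[OF tend]) simp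
  then show "ctrn (map (\<lambda>(a, b). \<Gamma> b - \<Gamma> a) qs) \<le> full_rotation \<Gamma> L" by (simp add: ed_def)
qed

end

lemma BV1_tcurve:
  assumes "closed_curve \<Gamma> L" "BV1 \<Gamma> L"
  shows "tcurve \<Gamma> L (full_rotation \<Gamma> L)"
proof -
  obtain E where "bv1_curve \<Gamma> L E" using assms unfolding BV1_def bv1_curve_def by blast
  then show ?thesis by (rule bv1_curve.tcurve)
qed

subsection \<open>Convex curves in polar coordinates\<close>

lemma tendsto_difference_quotient:
  fixes f :: "real \<Rightarrow> complex"
  assumes "(f has_vector_derivative v) (at x within S)"
  shows "((\<lambda>y. (f y - f x) /\<^sub>R (y - x)) \<longlongrightarrow> v) (at x within S)"
proof (rule tendstoI)
  fix e :: real assume "0 < e"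
  then obtain d where d: "0 < d" "\<And>y. y \<in> S \<Longrightarrow> norm (y - x) < d \<Longrightarrow> norm (f y - f x - (y - x) *\<^sub>R v) \<le> e / 2 * norm (y - x)"
    using assms unfolding has_vector_derivative_def has_derivative_within_alt by (meson half_gt_zero)
  have "dist ((f y - f x) /\<^sub>R (y - x)) v < e" if y: "y \<in> S" "y \<noteq> x" "dist y x < d" for y
  proof -
    have "(f y - f x) /\<^sub>R (y - x) - v = (f y - f x - (y - x) *\<^sub>R v) /\<^sub>R (y - x)"
      using y by (simp add: scaleR_diff_right)
    then have "dist ((f y - f x) /\<^sub>R (y - x)) v = norm (f y - f x - (y - x) *\<^sub>R v) / \<bar>y - x\<bar>"
      by (simp only: dist_norm norm_scaleR) (simp add: divide_inverse_commute)
    also have "\<dots> \<le> e / 2"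
      using d(2)[of y] y by (simp add: dist_norm divide_simps mult.commute)
    finally show ?thesis using \<open>0 < e\<close> by simp
  qed
  then show "\<forall>\<^sub>F y in at x within S. dist ((f y - f x) /\<^sub>R (y - x)) v < e"
    unfolding eventually_at using d(1) by blast
qed

lemma unit_derivative:
  fixes c :: "real \<Rightarrow> complex"
  assumes "(c has_vector_derivative v) (at s within S)"
    and "\<And>t. t \<in> S \<Longrightarrow> norm (c t - c s) \<le> \<bar>t - s\<bar>"
    and "\<And>e d. 0 < e \<Longrightarrow> 0 < d \<Longrightarrow> \<exists>t\<in>S. t \<noteq> s \<and> \<bar>t - s\<bar> < d \<and> (1 - e) * \<bar>t - s\<bar> \<le> norm (c t - c s)"
  shows "norm v = 1"
proof (rule ccontr)
  assume "norm v \<noteq> 1"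
  define e where "e = \<bar>norm v - 1\<bar> / 2"
  have e: "0 < e" using \<open>norm v \<noteq> 1\<close> by (simp add: e_def)
  from tendstoD[OF tendsto_difference_quotient[OF assms(1)] e]
  obtain d where d: "0 < d" "\<And>t. t \<in> S \<Longrightarrow> t \<noteq> s \<Longrightarrow> dist t s < d \<Longrightarrow> dist ((c t - c s) /\<^sub>R (t - s)) v < e"
    unfolding eventually_at by blast
  obtain t where t: "t \<in> S" "t \<noteq> s" "\<bar>t - s\<bar> < d" "(1 - e) * \<bar>t - s\<bar> \<le> norm (c t - c s)"
    using assms(3)[OF e d(1)] by blast
  define q where "q = norm ((c t - c s) /\<^sub>R (t - s))"
  have "q = norm (c t - c s) / \<bar>t - s\<bar>" by (simp add: q_def divide_inverse_commute)
  then have "1 - e \<le> q" "q \<le> 1" using t assms(2)[OF t(1)] by (simp_all add: pos_le_divide_eq pos_divide_le_eq)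
  moreover have "\<bar>q - norm v\<bar> < e"
    using d(2)[of t] t norm_triangle_ineq3[of "(c t - c s) /\<^sub>R (t - s)" v] by (simp add: q_def dist_norm)
  moreover have "norm v = 1 + 2 * e \<or> norm v = 1 - 2 * e" by (auto simp: e_def abs_if)
  ultimately show False using e by linarith
qed

lemma sum_trn_cis:
  assumes "sorted_wrt (\<le>) ws" "ws \<noteq> []"
  shows "trn (map cis ws) \<le> last ws - hd ws"
  using assms
proof (induction ws rule: induct_list012)
  case (3 x y zs)
  have "ang (cis x) (cis y) \<le> y - x"
    using abs_Arg_cis_le[of "y - x"] 3(3) by (simp add: ang_def cis_divide)
  then show ?case using 3 by auto
qed auto

text \<open>The closing angle is measured forwards, from \<open>last ws\<close> to
  \<open>hd ws + 2 * pi\<close>; then all increments add up to one full turn.\<close>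

lemma ctrn_cis:
  assumes "sorted_wrt (\<le>) ws" "ws \<noteq> []" "\<And>w. w \<in> set ws \<Longrightarrow> a \<le> w \<and> w \<le> a + 2 * pi"
  shows "ctrn (map cis ws) \<le> 2 * pi"
proof -
  have le: "hd ws \<le> last ws" using assms(1,2) by (cases ws) auto
  have r: "last ws - hd ws \<le> 2 * pi" using assms(3)[of "hd ws"] assms(3)[of "last ws"] assms(2) by simp
  have "cis (hd ws) / cis (last ws) = cis (hd ws + 2 * pi - last ws)"
    by (simp add: cis_divide[symmetric] cis_mult[symmetric])
  then have "ang (cis (last ws)) (cis (hd ws)) \<le> hd ws + 2 * pi - last ws"
    using abs_Arg_cis_le[of "hd ws + 2 * pi - last ws"] r by (simp add: ang_def)
  then show ?thesis using sum_trn_cis[OF assms(1,2)] assms(2)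
    by (simp add: ctrn_def trn_Cons last_map hd_map)
qed

lemma norm_cis_diff: "norm (cis a - cis b) \<le> 2 * \<bar>a - b\<bar>"
proof -
  have "cos a - cos b = sin (a + pi / 2) - sin (b + pi / 2)" by (simp add: sin_add)
  then have "\<bar>cos a - cos b\<bar> \<le> \<bar>a - b\<bar>" using abs_sin_diff[of "a + pi / 2" "b + pi / 2"] by simp
  then show ?thesis using cmod_le[of "cis a - cis b"] abs_sin_diff[of a b] by simp
qed

lemma inner_cis_nrm: "cis a \<bullet> nrm t = sin (t - a)"
  by (simp add: inner_nrm sin_diff)

lemma inner_cis_cis: "cis a \<bullet> cis t = cos (a - t)"
  by (simp add: inner_complex_def cos_diff)

text \<open>A counterclockwise convex curve in polar coordinates around an interior point \<open>z\<close>, together with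
  angles \<open>\<theta>\<close> of support lines; since \<open>z\<close> lies to the left of the support line, \<open>\<theta> - \<phi>\<close> lies between
  \<open>0\<close> and \<open>pi\<close>.\<close>

locale star_curve = convex_body K for K +
  fixes c :: "real \<Rightarrow> complex" and L :: real and z :: complex and r \<phi> \<theta> :: "real \<Rightarrow> real"
  assumes cc: "closed_curve c L"
    and polar: "\<And>t. 0 \<le> t \<Longrightarrow> t \<le> L \<Longrightarrow> c t = z + of_real (r t) * cis (\<phi> t) \<and> 0 < r t"
    and phi_mono: "\<And>s t. 0 \<le> s \<Longrightarrow> s < t \<Longrightarrow> t \<le> L \<Longrightarrow> \<phi> s < \<phi> t"
    and phi_per: "\<phi> L = \<phi> 0 + 2 * pi"
    and theta: "\<And>t. 0 \<le> t \<Longrightarrow> t \<le> L \<Longrightarrow> supp K (c t) (\<theta> t) \<and> \<phi> t < \<theta> t \<and> \<theta> t < \<phi> t + pi"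
    and theta_per: "\<theta> L = \<theta> 0 + 2 * pi"
begin

lemma L_pos: "0 < L" using cc by (simp add: closed_curve_def)

lemma support:
  assumes "0 \<le> s" "s \<le> L" "0 \<le> t" "t \<le> L"
  shows "r t * sin (\<theta> s - \<phi> t) \<le> r s * sin (\<theta> s - \<phi> s)" "(c t - c s) \<bullet> nrm (\<theta> s) \<le> 0"
proof -
  have "c t \<in> K" "ds K (c s) (\<theta> s) = 0" using theta[of s] theta[of t] assms by (auto simp: supp_def)
  then show *: "(c t - c s) \<bullet> nrm (\<theta> s) \<le> 0"
    using hs_upper[of "c t" "\<theta> s"] by (simp add: ds_def inner_diff_left)
  have "c t - c s = r t *\<^sub>R cis (\<phi> t) - r s *\<^sub>R cis (\<phi> s)"
    using polar[of s] polar[of t] assms by (simp add: scaleR_conv_of_real)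
  then show "r t * sin (\<theta> s - \<phi> t) \<le> r s * sin (\<theta> s - \<phi> s)"
    using * by (simp add: inner_diff_left inner_cis_nrm)
qed

text \<open>Each of the two points is to the left of the support line at the other. In the product
  of these inequalities the radii cancel, and the product formulas leave \<open>sin (\<theta> s -
  \<theta> t) * sin (\<phi> t - \<phi> s) \<le> 0\<close>, although both factors are positive if
  \<theta> decreases.\<close>

lemma theta_mono:
  assumes "0 \<le> s" "s \<le> t" "t \<le> L"
  shows "\<theta> s \<le> \<theta> t"
proof (rule ccontr)
  assume "\<not> ?thesis"
  then have lt: "\<theta> t < \<theta> s" "s < t" using assms by (auto simp: order.order_iff_strict)
  have f: "\<phi> s < \<phi> t" using phi_mono assms lt by auto
  have a: "\<phi> t < \<theta> t" "\<theta> s < \<phi> s + pi" "\<theta> t < \<phi> t + pi" "\<phi> s < \<theta> s" using theta[of s] theta[of t] assms by auto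
  have rp: "0 < r s" "0 < r t" using polar assms by auto
  have p: "0 < sin (\<theta> s - \<phi> t)" "0 < sin (\<theta> s - \<phi> s)" "0 < sin (\<theta> t - \<phi> s)" "0 < sin (\<theta> t - \<phi> t)"
    by (rule sin_gt_zero; use a f lt in linarith)+
  have "(r t * sin (\<theta> s - \<phi> t)) * (r s * sin (\<theta> t - \<phi> s)) \<le> (r s * sin (\<theta> s - \<phi> s)) * (r t * sin (\<theta> t - \<phi> t))"
    by (intro mult_mono support) (use assms p rp in auto)
  then have "(r s * r t) * (sin (\<theta> s - \<phi> t) * sin (\<theta> t - \<phi> s)) \<le> (r s * r t) * (sin (\<theta> s - \<phi> s) * sin (\<theta> t - \<phi> t))"
    by (simp add: mult_ac)
  then have "sin (\<theta> s - \<phi> t) * sin (\<theta> t - \<phi> s) \<le> sin (\<theta> s - \<phi> s) * sin (\<theta> t - \<phi> t)"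
    using rp by (simp add: mult_le_cancel_left_pos)
  then have "cos ((\<theta> s - \<theta> t) - (\<phi> t - \<phi> s)) \<le> cos ((\<theta> s - \<theta> t) + (\<phi> t - \<phi> s))"
    by (simp add: sin_times_sin add_divide_distrib diff_divide_distrib) (simp add: algebra_simps)
  then have "sin (\<theta> s - \<theta> t) * sin (\<phi> t - \<phi> s) \<le> 0" by (simp add: cos_add cos_diff)
  moreover have "0 < sin (\<theta> s - \<theta> t)" "0 < sin (\<phi> t - \<phi> s)"
    by (rule sin_gt_zero; use a f lt in linarith)+
  ultimately show False by (simp add: mult_le_0_iff)
qed

text \<open>The chord lies to the left of both support lines. Besides the asserted interval this
  leaves only a chord running backwards on a common support line, which contradicts the growth of
  the polar angle \<phi>.\<close>

lemma chord_direction: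
  assumes "0 \<le> s" "s < t" "t \<le> L" "0 < s \<or> t < L"
  shows "\<exists>w. \<theta> s \<le> w \<and> w \<le> \<theta> t \<and> c t - c s = norm (c t - c s) *\<^sub>R cis w"
proof (cases "c t = c s")
  case True
  then show ?thesis using theta_mono[of s t] assms by auto
next
  case False
  define k where "k = norm (c t - c s)"
  have k: "0 < k" using False by (simp add: k_def)
  define w where "w = \<theta> s + Arg2pi ((c t - c s) / cis (\<theta> s))"
  have w: "c t - c s = k *\<^sub>R cis w" "\<theta> s \<le> w" "w < \<theta> s + 2 * pi"
  proof -
    have "(c t - c s) / cis (\<theta> s) = of_real k * cis (Arg2pi ((c t - c s) / cis (\<theta> s)))"
      using Arg2pi_eq[of "(c t - c s) / cis (\<theta> s)"] by (simp add: k_def norm_divide cis_conv_exp)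
    then have "c t - c s = of_real k * (cis (Arg2pi ((c t - c s) / cis (\<theta> s))) * cis (\<theta> s))" by (simp add: field_simps)
    then show "c t - c s = k *\<^sub>R cis w" by (simp add: w_def cis_mult scaleR_conv_of_real add.commute)
  qed (auto simp: w_def Arg2pi_ge_0 Arg2pi_lt_2pi)
  have s1: "0 \<le> sin (w - \<theta> s)"
    using support(2)[of s t] assms k unfolding w(1) by (simp add: inner_cis_nrm sin_diff mult_le_0_iff mult.commute)
  have "- (c t - c s) \<bullet> nrm (\<theta> t) \<le> 0" using support(2)[of t s] assms by simp
  then have s2: "0 \<le> sin (\<theta> t - w)" using k unfolding w(1) by (simp add: inner_cis_nrm zero_le_mult_iff)
  have w1: "w \<le> \<theta> s + pi"
  proof (rule ccontr)
    assume "\<not> ?thesis"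
    then have "0 < sin (w - \<theta> s - pi)" using w by (intro sin_gt_zero) auto
    then show False using s1 by (simp add: sin_diff)
  qed
  have th: "\<theta> s \<le> \<theta> t" "\<theta> t \<le> \<theta> s + 2 * pi"
    using theta_mono[of s t] theta_mono[of t L] theta_mono[of 0 s] theta_per assms by auto
  have "w \<le> \<theta> t"
  proof (rule ccontr)
    assume n: "\<not> ?thesis"
    have "w - \<theta> t = pi"
    proof (rule ccontr)
      assume "w - \<theta> t \<noteq> pi"
      then have "0 < sin (w - \<theta> t)" using n w1 th by (intro sin_gt_zero) auto
      then show False using s2 sin_minus[of "w - \<theta> t"] by simp
    qed
    then have e: "\<theta> t = \<theta> s" "w = \<theta> s + pi" using w1 th by auto
    have a: "\<phi> t < \<theta> t" "\<theta> s < \<phi> s + pi" "\<phi> s < \<theta> s" using theta[of s] theta[of t] assms by auto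
    have f: "\<phi> s < \<phi> t" using phi_mono assms by auto
    have "c t - c s = r t *\<^sub>R cis (\<phi> t) - r s *\<^sub>R cis (\<phi> s)"
      using polar[of s] polar[of t] assms by (simp add: scaleR_conv_of_real)
    then have "r t *\<^sub>R cis (\<phi> t) - r s *\<^sub>R cis (\<phi> s) = k *\<^sub>R cis w" using w(1) by simp
    then have "(r t *\<^sub>R cis (\<phi> t) - r s *\<^sub>R cis (\<phi> s)) \<bullet> nrm (\<phi> s) = (k *\<^sub>R cis w) \<bullet> nrm (\<phi> s)" by simp
    then have "r t * sin (\<phi> s - \<phi> t) = k * sin (\<phi> s - \<theta> s - pi)"
      by (simp add: inner_diff_left inner_cis_nrm e algebra_simps)
    then have "r t * sin (\<phi> t - \<phi> s) = - k * sin (\<theta> s - \<phi> s)"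
      using sin_minus[of "\<phi> t - \<phi> s"] sin_minus[of "\<theta> s - \<phi> s"] by (simp add: sin_diff[of _ pi])
    moreover have "0 < sin (\<phi> t - \<phi> s)" "0 < sin (\<theta> s - \<phi> s)"
      by (rule sin_gt_zero; use a e f in linarith)+
    moreover have "0 < r t" using polar assms by auto
    ultimately have A: "0 < sin (\<phi> t - \<phi> s)" "0 < sin (\<theta> s - \<phi> s)" "0 < r t"
      "r t * sin (\<phi> t - \<phi> s) = - k * sin (\<theta> s - \<phi> s)" by auto
    have "0 < r t * sin (\<phi> t - \<phi> s)" using A(3,1) by (rule mult_pos_pos)
    moreover have "0 < k * sin (\<theta> s - \<phi> s)" using k A(2) by (rule mult_pos_pos)
    ultimately show False using A(4) by (smt (verit) minus_mult_left)
  qed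
  then show ?thesis using w unfolding k_def by blast
qed

text \<open>Chord directions over successive intervals are interlaced with the angles \<theta>; they
  increase and stay within one full turn.\<close>

lemma turn_le:
  assumes "sorted_wrt (\<lambda>p q. snd p \<le> fst q) qs" "qs \<noteq> []"
    and q: "\<And>a b. (a, b) \<in> set qs \<Longrightarrow> 0 \<le> a \<and> a < b \<and> b \<le> L \<and> c a \<noteq> c b"
  shows "ctrn (map (\<lambda>(a, b). c b - c a) qs) \<le> 2 * pi"
proof -
  have c0L: "c 0 = c L" using cc by (simp add: closed_curve_def)
  have q': "0 \<le> fst p \<and> fst p < snd p \<and> snd p \<le> L \<and> c (fst p) \<noteq> c (snd p)" if "p \<in> set qs" for p
    using q[of "fst p" "snd p"] that by simp
  have "\<exists>w. \<theta> (fst p) \<le> w \<and> w \<le> \<theta> (snd p) \<and> c (snd p) - c (fst p) = norm (c (snd p) - c (fst p)) *\<^sub>R cis w"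
    if "p \<in> set qs" for p
  proof (rule chord_direction)
    show "0 < fst p \<or> snd p < L" using q'[OF that] c0L by (metis order.order_iff_strict)
  qed (use q'[OF that] in auto)
  then obtain w where w: "\<And>p. p \<in> set qs \<Longrightarrow> \<theta> (fst p) \<le> w p \<and> w p \<le> \<theta> (snd p) \<and>
      c (snd p) - c (fst p) = norm (c (snd p) - c (fst p)) *\<^sub>R cis (w p)" by metis
  have "map (\<lambda>(a, b). c b - c a) qs = map (\<lambda>p. norm (c (snd p) - c (fst p)) *\<^sub>R cis (w p)) qs"
    by (rule map_cong) (use w in \<open>auto simp: case_prod_beta\<close>)
  moreover have "ctrn (map (\<lambda>p. norm (c (snd p) - c (fst p)) *\<^sub>R cis (w p)) qs) = ctrn (map (\<lambda>p. cis (w p)) qs)"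
    by (rule ctrn_map_scale) (use q' assms(2) in fastforce)+
  ultimately have "ctrn (map (\<lambda>(a, b). c b - c a) qs) = ctrn (map (\<lambda>p. cis (w p)) qs)" by (simp only:)
  also have "map (\<lambda>p. cis (w p)) qs = map cis (map w qs)" by simp
  also have "ctrn \<dots> \<le> 2 * pi"
  proof (rule ctrn_cis[where a = "\<theta> 0"])
    have "sorted_wrt (\<lambda>p q. w p \<le> w q) qs"
    proof (rule sorted_wrt_mono_rel[OF _ assms(1)])
      fix p q assume "p \<in> set qs" "q \<in> set qs" "snd p \<le> fst q"
      then show "w p \<le> w q" using w[of p] w[of q] q'[of p] q'[of q] theta_mono[of "snd p" "fst q"] by auto
    qed
    then show "sorted_wrt (\<le>) (map w qs)" by (simp add: sorted_wrt_map)
    fix x assume "x \<in> set (map w qs)"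
    then obtain p where p: "p \<in> set qs" "x = w p" by auto
    show "\<theta> 0 \<le> x \<and> x \<le> \<theta> 0 + 2 * pi"
      using w[OF p(1)] q'[OF p(1)] theta_mono[of 0 "fst p"] theta_mono[of "snd p" L] theta_per p(2) by auto
  qed (use assms in auto)
  finally show ?thesis .
qed

text \<open>Every edge of an inscribed polygon deviates from \<open>cis (\<theta> a)\<close> by an
  angle of at most \<open>h\<close>. The projections to this direction telescope and keep the
  fraction \<open>cos h\<close> of the length.\<close>

lemma chord_length:
  assumes "0 \<le> a" "a < b" "b \<le> L" "0 < a \<or> b < L" "\<theta> b - \<theta> a \<le> h" "h < pi / 2"
  shows "cos h * (b - a) \<le> norm (c b - c a)"
proof -
  have h0: "0 \<le> h" using theta_mono[of a b] assms by auto
  have ch: "0 < cos h" using h0 assms(6) by (intro cos_gt_zero_pi) auto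
  have edge: "cos h * dist (c x) (c y) \<le> (c y - c x) \<bullet> cis (\<theta> a)" if xy: "a \<le> x" "x < y" "y \<le> b" for x y
  proof -
    obtain w where w: "\<theta> x \<le> w" "w \<le> \<theta> y" "c y - c x = norm (c y - c x) *\<^sub>R cis w"
      using chord_direction[of x y] xy assms by auto
    have "0 \<le> w - \<theta> a" "w - \<theta> a \<le> h" using w theta_mono[of a x] theta_mono[of y b] xy assms by auto
    then have "cos h \<le> cos (w - \<theta> a)" using assms(6) by (intro cos_monotone_0_pi_le) auto
    moreover have "(c y - c x) \<bullet> cis (\<theta> a) = norm (c y - c x) * cos (w - \<theta> a)"
      by (subst w(3)) (simp add: inner_cis_cis)
    moreover have "dist (c x) (c y) = norm (c y - c x)" by (simp add: dist_norm norm_minus_commute)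
    ultimately show ?thesis by (simp only:) (simp only: mult.commute[of "norm _"] mult_right_mono norm_ge_zero)
  qed
  have poly: "cos h * plen (map c ts) \<le> (c (last ts) - c (hd ts)) \<bullet> cis (\<theta> a)"
    if "sorted_wrt (<) ts" "set ts \<subseteq> {a..b}" "ts \<noteq> []" for ts
    using that
  proof (induction ts rule: induct_list012)
    case (3 x y zs)
    have "cos h * dist (c x) (c y) \<le> (c y - c x) \<bullet> cis (\<theta> a)" using 3 by (intro edge) auto
    then show ?case using 3 by (auto simp: inner_diff_left algebra_simps)
  qed auto
  show ?thesis
  proof (rule field_le_epsilon)
    fix e :: real assume "0 < e"
    then obtain ts where ts: "sorted_wrt (<) ts" "set ts \<subseteq> {a..b}" "hd ts = a" "last ts = b" "2 \<le> length ts"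
        "b - a - e < plen (map c ts)"
      using closed_curve_segment[OF cc assms(1-3), of e] by blast
    have "cos h * (b - a - e) \<le> cos h * plen (map c ts)" using ts ch by (intro mult_left_mono) auto
    also have "\<dots> \<le> (c b - c a) \<bullet> cis (\<theta> a)" using poly[OF ts(1,2)] ts(3-5) by force
    also have "\<dots> \<le> norm (c b - c a)" using norm_cauchy_schwarz[of "c b - c a" "cis (\<theta> a)"] by simp
    finally have "cos h * (b - a) \<le> norm (c b - c a) + cos h * e" by (simp add: algebra_simps)
    moreover have "cos h * e \<le> e" using \<open>0 < e\<close> by simp
    ultimately show "cos h * (b - a) \<le> norm (c b - c a) + e" by linarith
  qed
qed

text \<open>In the constant 3 the loss of length contributes 1, by \<open>1 - cos h \<le> h\<close>,
  and the deviation of the direction contributes 2, by \<open>norm_cis_diff\<close>.\<close>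

lemma chord_tangent:
  assumes "0 \<le> a" "a < b" "b \<le> L" "0 < a \<or> b < L" "\<theta> a \<le> p" "p \<le> \<theta> b" "\<theta> b - \<theta> a \<le> h" "h < pi / 2"
  shows "norm (c b - c a - (b - a) *\<^sub>R cis p) \<le> 3 * h * (b - a)"
proof -
  let ?k = "norm (c b - c a)"
  have h0: "0 \<le> h" using theta_mono[of a b] assms by auto
  obtain w where w: "\<theta> a \<le> w" "w \<le> \<theta> b" "c b - c a = ?k *\<^sub>R cis w"
    using chord_direction[OF assms(1-4)] by blast
  have "cos 0 - cos h \<le> h" using abs_sin_diff[of "pi / 2" "h + pi / 2"] h0 by (simp add: sin_add)
  then have "(1 - h) * (b - a) \<le> cos h * (b - a)" using assms by (intro mult_right_mono) auto
  then have l: "(1 - h) * (b - a) \<le> ?k" using chord_length[of a b h] assms by linarith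
  have u: "?k \<le> b - a" using closed_curve_lipschitz[OF cc, of b a] assms by (simp add: dist_norm)
  have "c b - c a - (b - a) *\<^sub>R cis p = (?k - (b - a)) *\<^sub>R cis w + (b - a) *\<^sub>R (cis w - cis p)"
    by (subst w(3)) (simp add: algebra_simps)
  then have "norm (c b - c a - (b - a) *\<^sub>R cis p) \<le> norm ((?k - (b - a)) *\<^sub>R cis w) + norm ((b - a) *\<^sub>R (cis w - cis p))"
    by (simp only: norm_triangle_ineq)
  also have "\<dots> = ((b - a) - ?k) + (b - a) * norm (cis w - cis p)" using u assms by simp
  also have "\<dots> \<le> h * (b - a) + (b - a) * (2 * h)"
  proof (intro add_mono mult_left_mono)
    have "\<bar>w - p\<bar> \<le> h" using w(1,2) assms by auto
    then show "norm (cis w - cis p) \<le> 2 * h" using norm_cis_diff[of w p] by (smt (verit))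
  qed (use l assms in \<open>auto simp: algebra_simps\<close>)
  finally show ?thesis by (simp add: algebra_simps)
qed

text \<open>\<theta> may jump at \<open>s\<close>, but on a short interval to the right of
  \<open>s\<close> it stays within \<open>h\<close> of its infimum there. The chord estimate is
  applied from a point \<open>s'\<close> beyond \<open>s\<close>, and \<open>s'\<close> then
  approaches \<open>s\<close>.\<close>

lemma right_speed:
  assumes "0 \<le> s" "s < L" "0 < e"
  shows "\<exists>t0>s. t0 \<le> L \<and> (\<forall>t. s < t \<longrightarrow> t \<le> t0 \<longrightarrow> (1 - e) * (t - s) \<le> norm (c t - c s))"
proof -
  define h where "h = min e 1 / 2"
  have h: "0 < h" "h < pi / 2" "h \<le> e" using assms pi_gt3 by (auto simp: h_def)
  define m where "m = (INF t\<in>{s<..L}. \<theta> t)"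
  have bd: "bdd_below (\<theta> ` {s<..L})" using theta_mono[of s] assms by (intro bdd_belowI2[of _ "\<theta> s"]) auto
  have ml: "m \<le> \<theta> t" if "s < t" "t \<le> L" for t unfolding m_def using bd that by (intro cINF_lower) auto
  have "\<exists>t\<in>{s<..L}. \<theta> t < m + h"
    using cINF_less_iff[OF _ bd, of "m + h"] h assms by (auto simp: m_def)
  then obtain t0 where t0: "s < t0" "t0 \<le> L" "\<theta> t0 < m + h" by auto
  have ch: "1 - h \<le> cos h" using abs_sin_diff[of "pi / 2" "h + pi / 2"] h by (simp add: sin_add)
  have "(1 - e) * (t - s) \<le> norm (c t - c s)" if t: "s < t" "t \<le> t0" for t
  proof (rule field_le_epsilon)
    fix d :: real assume "0 < d"
    define s' where "s' = s + min (d / 2) ((t - s) / 2)"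
    have s': "s < s'" "s' < t" "s' - s \<le> d / 2" using \<open>0 < d\<close> t by (auto simp: s'_def min_def field_simps)
    have "cos h * (t - s') \<le> norm (c t - c s')"
      by (rule chord_length) (use s' t t0 assms h ml[of s'] theta_mono[of t t0] in auto)
    moreover have "norm (c t - c s') \<le> norm (c t - c s) + (s' - s)"
      using closed_curve_lipschitz[OF cc, of s s'] dist_triangle[of "c t" "c s'" "c s"] s' t t0 assms by (simp add: dist_norm)
    moreover have "(1 - h) * (t - s') \<le> cos h * (t - s')" using ch s' by (intro mult_right_mono) auto
    moreover have "(1 - e) * (t - s') \<le> (1 - h) * (t - s')" using h s' by (intro mult_right_mono) auto
    moreover have "(1 - e) * (t - s) = (1 - e) * (t - s') + (1 - e) * (s' - s)" by (simp add: algebra_simps)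
    moreover have "(1 - e) * (s' - s) \<le> 1 * (s' - s)" using assms s' by (intro mult_right_mono) auto
    ultimately show "(1 - e) * (t - s) \<le> norm (c t - c s) + d" using s' by (smt (verit) field_sum_of_halves)
  qed
  then show ?thesis using t0 by blast
qed

lemma left_speed:
  assumes "0 < s" "s \<le> L" "0 < e"
  shows "\<exists>t0<s. 0 \<le> t0 \<and> (\<forall>t. t0 \<le> t \<longrightarrow> t < s \<longrightarrow> (1 - e) * (s - t) \<le> norm (c t - c s))"
proof -
  define h where "h = min e 1 / 2"
  have h: "0 < h" "h < pi / 2" "h \<le> e" using assms pi_gt3 by (auto simp: h_def)
  define m where "m = (SUP t\<in>{0..<s}. \<theta> t)"
  have bd: "bdd_above (\<theta> ` {0..<s})" using theta_mono[of _ s] assms by (intro bdd_aboveI2[of _ _ "\<theta> s"]) auto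
  have ml: "\<theta> t \<le> m" if "0 \<le> t" "t < s" for t unfolding m_def using bd that by (intro cSUP_upper) auto
  have "\<exists>t\<in>{0..<s}. m - h < \<theta> t"
    using less_cSUP_iff[OF _ bd, of "m - h"] h assms by (auto simp: m_def)
  then obtain t0 where t0: "t0 < s" "0 \<le> t0" "m - h < \<theta> t0" by auto
  have ch: "1 - h \<le> cos h" using abs_sin_diff[of "pi / 2" "h + pi / 2"] h by (simp add: sin_add)
  have "(1 - e) * (s - t) \<le> norm (c t - c s)" if t: "t0 \<le> t" "t < s" for t
  proof (rule field_le_epsilon)
    fix d :: real assume "0 < d"
    define s' where "s' = s - min (d / 2) ((s - t) / 2)"
    have s': "s' < s" "t < s'" "s - s' \<le> d / 2" using \<open>0 < d\<close> t by (auto simp: s'_def min_def field_simps)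
    have "cos h * (s' - t) \<le> norm (c s' - c t)"
      by (rule chord_length) (use s' t t0 assms h ml[of s'] theta_mono[of t0 t] in auto)
    moreover have "norm (c s' - c t) \<le> norm (c t - c s) + (s - s')"
      using closed_curve_lipschitz[OF cc, of s s'] dist_triangle[of "c s'" "c t" "c s"] s' t t0 assms
      by (simp add: dist_norm norm_minus_commute)
    moreover have "(1 - h) * (s' - t) \<le> cos h * (s' - t)" using ch s' by (intro mult_right_mono) auto
    moreover have "(1 - e) * (s' - t) \<le> (1 - h) * (s' - t)" using h s' by (intro mult_right_mono) auto
    moreover have "(1 - e) * (s - t) = (1 - e) * (s' - t) + (1 - e) * (s - s')" by (simp add: algebra_simps)
    moreover have "(1 - e) * (s - s') \<le> 1 * (s - s')" using assms s' by (intro mult_right_mono) auto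
    ultimately show "(1 - e) * (s - t) \<le> norm (c t - c s) + d" using s' by (smt (verit) field_sum_of_halves)
  qed
  then show ?thesis using t0 by blast
qed

lemma speed:
  assumes "s \<in> {0..L}" "0 < e" "0 < d"
  shows "\<exists>t\<in>{0..L}. t \<noteq> s \<and> \<bar>t - s\<bar> < d \<and> (1 - e) * \<bar>t - s\<bar> \<le> norm (c t - c s)"
proof (cases "s < L")
  case True
  then obtain t0 where t0: "s < t0" "t0 \<le> L" "\<And>t. s < t \<Longrightarrow> t \<le> t0 \<Longrightarrow> (1 - e) * (t - s) \<le> norm (c t - c s)"
    using right_speed[of s e] assms by auto
  define t where "t = min t0 (s + d / 2)"
  have "s < t" "t \<le> t0" "t - s < d" using t0 assms by (auto simp: t_def)
  then show ?thesis using t0 assms by (intro bexI[of _ t]) auto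
next
  case False
  then have "0 < s" "s \<le> L" using assms L_pos by auto
  then obtain t0 where t0: "t0 < s" "0 \<le> t0" "\<And>t. t0 \<le> t \<Longrightarrow> t < s \<Longrightarrow> (1 - e) * (s - t) \<le> norm (c t - c s)"
    using left_speed[of s e] assms by auto
  define t where "t = max t0 (s - d / 2)"
  have "t < s" "t0 \<le> t" "s - t < d" using t0 assms by (auto simp: t_def)
  then show ?thesis using t0 assms by (intro bexI[of _ t]) auto
qed

text \<open>The monotone function \<theta> has at most countably many discontinuities, and where it
  is continuous the chord estimate yields the derivative \<open>cis (\<theta> s)\<close>. Such a
  point ensures that the supremum defining the full rotation of a convex curve is not taken over the
  empty set.\<close>

lemma differentiable_point: "\<exists>s. 0 < s \<and> s < L \<and> c differentiable (at s)"
proof -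
  have "mono_on {0<..<L} \<theta>" by (intro mono_onI theta_mono) auto
  then have "countable {a\<in>{0<..<L}. \<not> isCont \<theta> a}" by (intro mono_on_ctble_discont_open) auto
  moreover have "uncountable {0<..<L}" using L_pos by (simp add: uncountable_open_interval)
  ultimately obtain s where s: "0 < s" "s < L" "isCont \<theta> s"
    by (metis (no_types, lifting) countable_subset greaterThanLessThan_iff mem_Collect_eq subsetI)
  have "(c has_derivative (\<lambda>x. x *\<^sub>R cis (\<theta> s))) (at s)" unfolding has_derivative_at_alt
  proof (intro conjI allI impI)
    show "bounded_linear (\<lambda>x. x *\<^sub>R cis (\<theta> s))" by (rule bounded_linear_scaleR_left)
    fix e :: real assume e: "0 < e"
    define h where "h = min (e / 3) 1"
    have h: "0 < h" "h < pi / 2" "3 * h \<le> e" using e pi_gt3 by (auto simp: h_def min_def)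
    obtain d where d: "0 < d" "\<And>t. \<bar>t - s\<bar> < d \<Longrightarrow> \<bar>\<theta> t - \<theta> s\<bar> < h"
      using s(3) h(1) unfolding continuous_at_eps_delta dist_real_def by blast
    define d' where "d' = min d (min s (L - s))"
    have "norm (c y - c s - (y - s) *\<^sub>R cis (\<theta> s)) \<le> e * norm (y - s)" if y: "norm (y - s) < d'" for y
    proof -
      have y': "\<bar>y - s\<bar> < d" "0 < y" "y < L" using y s by (auto simp: d'_def)
      consider "y = s" | "s < y" | "y < s" by linarith
      then have "norm (c y - c s - (y - s) *\<^sub>R cis (\<theta> s)) \<le> 3 * h * \<bar>y - s\<bar>"
      proof cases
        case 2
        have "norm (c y - c s - (y - s) *\<^sub>R cis (\<theta> s)) \<le> 3 * h * (y - s)"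
          by (rule chord_tangent) (use s y' 2 h d(2)[of y] theta_mono[of s y] in auto)
        then show ?thesis using 2 by simp
      next
        case 3
        have "norm (c s - c y - (s - y) *\<^sub>R cis (\<theta> s)) \<le> 3 * h * (s - y)"
          by (rule chord_tangent) (use s y' 3 h d(2)[of y] theta_mono[of y s] in auto)
        moreover have "c y - c s - (y - s) *\<^sub>R cis (\<theta> s) = - (c s - c y - (s - y) *\<^sub>R cis (\<theta> s))" by (simp add: algebra_simps)
        ultimately show ?thesis using 3 by (simp only: norm_minus_cancel) simp
      qed simp
      also have "\<dots> \<le> e * norm (y - s)" using h by (simp add: mult_right_mono)
      finally show ?thesis .
    qed
    moreover have "0 < d'" using d s by (simp add: d'_def)
    ultimately show "\<exists>d>0. \<forall>y. norm (y - s) < d \<longrightarrow> norm (c y - c s - (y - s) *\<^sub>R cis (\<theta> s)) \<le> e * norm (y - s)" by blast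
  qed
  then show ?thesis using s unfolding differentiable_def by blast
qed

end

subsection \<open>The region bounded by a convex curve\<close>

lemma convex_closed_curve_region:
  assumes c: "convex_closed_curve c L"
  defines "K \<equiv> closed_region c L"
  shows "convex_body K" "interior K \<noteq> {}" "c ` {0..L} \<subseteq> K" "\<And>t. t \<in> {0..L} \<Longrightarrow> c t \<notin> interior K"
    "K - interior K \<subseteq> c ` {0..L}" "K = convex hull (c ` {0..L})"
proof -
  have cc: "closed_curve c L" and inj: "inj_on c {0..<L}" and conv: "convex K"
    using c by (auto simp: convex_closed_curve_def K_def)
  have L: "0 < L" "c 0 = c L" using cc by (auto simp: closed_curve_def)
  define p where "p = c \<circ> (*) L"
  note cont = closed_curve_continuous[OF cc]
  have im: "(*) L ` {0..1} = {0..L}" using L by (simp add: image_mult_atLeastAtMost)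
  have pi: "path_image p = c ` {0..L}" unfolding path_image_def p_def image_comp[symmetric] im ..
  have "path p" unfolding path_def p_def by (intro continuous_on_compose) (use cont im in \<open>auto intro!: continuous_intros\<close>)
  moreover have "loop_free p" unfolding loop_free_def
  proof (intro ballI impI)
    fix x y :: real assume xy: "x \<in> {0..1}" "y \<in> {0..1}" "p x = p y"
    define \<rho> where "\<rho> x = (if x = 1 then 0 else x)" for x :: real
    have "c (L * \<rho> x) = c (L * \<rho> y)" using xy L by (auto simp: p_def \<rho>_def)
    moreover have "L * \<rho> x \<in> {0..<L}" "L * \<rho> y \<in> {0..<L}" using xy L by (auto simp: \<rho>_def mult_less_cancel_left1)
    ultimately have "L * \<rho> x = L * \<rho> y" using inj by (metis inj_onD)
    then show "x = y \<or> x = 0 \<and> y = 1 \<or> x = 1 \<and> y = 0" using L by (auto simp: \<rho>_def split: if_splits)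
  qed
  ultimately have sp: "simple_path p" by (simp add: simple_path_def)
  have "pathfinish p = pathstart p" using L by (simp add: pathfinish_def pathstart_def p_def)
  note J = Jordan_inside_outside[OF sp this, unfolded pi]
  let ?C = "c ` {0..L}" and ?I = "inside (c ` {0..L})"
  have K: "K = ?C \<union> ?I" by (simp add: K_def closed_region_def)
  have compC: "compact ?C" by (intro compact_continuous_image cont) auto
  have "closure ?I = ?I \<union> frontier ?I" by (simp add: closure_Un_frontier)
  then have "K = closure ?I" using J K by auto
  then have "closed K" by simp
  moreover have "bounded K" using K J compC by (simp add: compact_imp_bounded)
  ultimately have "compact K" by (simp add: compact_eq_bounded_closed)
  then show "convex_body K" using conv K J by unfold_locales auto
  have int: "?I \<subseteq> interior K" using J K by (intro interior_maximal) auto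
  then show "interior K \<noteq> {}" using J by auto
  show "?C \<subseteq> K" by (auto simp: K)
  \<comment> \<open>By the Jordan curve theorem the curve also bounds the outside, which therefore
    meets every neighbourhood of \<open>c t\<close>.\<close>
  show "c t \<notin> interior K" if "t \<in> {0..L}" for t
  proof
    assume "c t \<in> interior K"
    moreover have "c t \<in> closure (outside ?C)" using J that by (auto simp: frontier_def)
    ultimately have "interior K \<inter> outside ?C \<noteq> {}" using open_Int_closure_eq_empty[of "interior K" "outside ?C"] by auto
    then show False using J K interior_subset[of K] by blast
  qed
  show "K - interior K \<subseteq> ?C" using int K by auto
  show "K = convex hull ?C"
  proof
    have hC: "?C \<subseteq> convex hull ?C" by (rule hull_subset)
    \<comment> \<open>The complement of a convex set containing the curve belongs to the
      outside.\<close>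
    have "?I \<subseteq> convex hull ?C"
    proof
      fix x assume "x \<in> ?I"
      then have "x \<notin> outside ?C" using J by blast
      then show "x \<in> convex hull ?C" using outside_subset_convex[OF convex_convex_hull hC] by blast
    qed
    then show "K \<subseteq> convex hull ?C" using hC K by simp
    show "convex hull ?C \<subseteq> K" using conv K by (intro hull_minimal) auto
  qed
qed

text \<open>Injectivity is given on the half-open interval only. At \<open>L\<close> continuity
  takes over: a value \<open>f L\<close> below \<open>f y1\<close> would force \<open>f\<close> to
  take the value \<open>f y1\<close> once more.\<close>

lemma increasing_of_injective:
  fixes f :: "real \<Rightarrow> real"
  assumes cont: "continuous_on {0..L} f" and inj: "inj_on f {0..<L}" and L: "0 < L" and up: "f 0 < f (L / 2)"
    and st: "0 \<le> s" "s < t" "t \<le> L"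
  shows "f s < f t"
proof -
  have tri: "f 0 < f x \<and> f x < f y \<or> f y < f x \<and> f x < f 0" if "0 < x" "x < y" "y < L" for x y
    by (rule continuous_inj_imp_mono) (use that in \<open>auto intro: continuous_on_subset[OF cont] inj_on_subset[OF inj]\<close>)
  have pos: "f 0 < f x" if x: "0 < x" "x < L" for x
    using tri[of x "L / 2"] tri[of "L / 2" x] up x by (cases x "L / 2" rule: linorder_cases) auto
  have *: "f s < f t" if "0 \<le> s" "s < t" "t < L" for s t
    using tri[of s t] pos[of s] pos[of t] that by (cases "s = 0") auto
  show ?thesis
  proof (cases "t < L")
    case True
    then show ?thesis using * st by auto
  next
    case False
    then have t: "t = L" using st by simp
    define y1 y2 where "y1 = (s + L) / 2" and "y2 = (y1 + L) / 2"
    have y: "s < y1" "y1 < y2" "y2 < L" using st t by (auto simp: y1_def y2_def field_simps)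
    have "f y1 \<le> f L"
    proof (rule ccontr)
      assume "\<not> ?thesis"
      then have "f L \<le> f y1" "f y1 \<le> f y2" "f L \<noteq> f y1" using *[of y1 y2] y st by auto
      moreover have "continuous_on {y2..L} f" using y st by (intro continuous_on_subset[OF cont]) auto
      ultimately obtain w where w: "y2 \<le> w" "w \<le> L" "f w = f y1" using IVT2'[of f L "f y1" y2] y by auto
      then have "w < L" using \<open>f L \<noteq> f y1\<close> by (metis order.order_iff_strict)
      then show False using *[of y1 w] w y st by auto
    qed
    then show ?thesis using *[of s y1] y st t by auto
  qed
qed

text \<open>Of two curve points on the same ray from \<open>z\<close> the nearer one would lie
  strictly between an interior point and a point of \<open>K\<close>, hence in the interior.\<close>

lemma (in convex_body) ray_injective:
  fixes c :: "real \<Rightarrow> complex"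
  assumes inj: "inj_on c {0..<L}" and z: "z \<in> interior K"
    and cK: "\<And>t. t \<in> {0..L} \<Longrightarrow> c t \<in> K" "\<And>t. t \<in> {0..L} \<Longrightarrow> c t \<notin> interior K"
    and polar: "\<And>t. 0 \<le> t \<Longrightarrow> t \<le> L \<Longrightarrow> c t = z + of_real (r t) * cis (\<phi> t) \<and> 0 < r t"
    and st: "0 \<le> s" "s < L" "0 \<le> t" "t < L" "cis (\<phi> s) = cis (\<phi> t)"
  shows "s = t"
proof -
  have far: "r t \<le> r s" if "0 \<le> s" "s \<le> L" "0 \<le> t" "t \<le> L" "cis (\<phi> s) = cis (\<phi> t)" for s t
  proof (rule ccontr)
    assume "\<not> ?thesis"
    then have lt: "r s < r t" by simp
    have p: "0 < r s" "0 < r t" using polar that by auto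
    have "c s = (1 - r s / r t) *\<^sub>R z + (r s / r t) *\<^sub>R c t"
      using polar[of s] polar[of t] that p by (simp add: scaleR_conv_of_real algebra_simps)
    moreover have "z \<noteq> c t" using polar[of t] that p by auto
    ultimately have "c s \<in> open_segment z (c t)"
      using lt p by (auto simp: in_segment intro!: exI[of _ "r s / r t"])
    moreover have "open_segment z (c t) \<subseteq> interior K"
      using cK(1)[of t] that by (intro in_interior_closure_convex_segment conv z) (auto intro: closure_subset[THEN subsetD])
    ultimately show False using cK(2)[of s] that by auto
  qed
  have le: "s \<le> L" "t \<le> L" using st by auto
  have "r s = r t" using far[OF st(1) le(1) st(3) le(2) st(5)] far[OF st(3) le(2) st(1) le(1) st(5)[symmetric]] by simp
  then have "c s = c t" using polar[of s] polar[of t] st by simp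
  then show ?thesis using inj st by (auto simp: inj_on_def)
qed

text \<open>The polar angle gains exactly one turn: it increases, and a gain of two turns would
  bring the curve back to the ray through \<open>c 0\<close> before the parameter
  \<open>L\<close>.\<close>

lemma (in convex_body) star_curve_exists:
  assumes cc: "closed_curve c L" and inj: "inj_on c {0..<L}" and z: "z \<in> interior K"
    and cK: "\<And>t. t \<in> {0..L} \<Longrightarrow> c t \<in> K" "\<And>t. t \<in> {0..L} \<Longrightarrow> c t \<notin> interior K"
    and polar: "\<And>t. 0 \<le> t \<Longrightarrow> t \<le> L \<Longrightarrow> c t = z + of_real (r t) * cis (\<phi> t) \<and> 0 < r t"
    and cont: "continuous_on {0..L} \<phi>" and up: "\<phi> 0 < \<phi> (L / 2)"
  shows "\<exists>\<theta>. star_curve K c L z r \<phi> \<theta>"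
proof -
  have L: "0 < L" "c 0 = c L" using cc by (auto simp: closed_curve_def)
  note ray = ray_injective[OF inj z cK polar]
  have "inj_on \<phi> {0..<L}" using ray by (intro inj_onI) auto
  note mono = increasing_of_injective[OF cont this L(1) up]
  have "cis (\<phi> L) = cis (\<phi> 0)"
  proof -
    have "of_real (r 0) * cis (\<phi> 0) = of_real (r L) * cis (\<phi> L)" using polar[of 0] polar[of L] L by simp
    moreover have "r 0 = r L"
      using arg_cong[OF calculation, of norm] polar[of 0] polar[of L] L by (simp add: norm_mult)
    ultimately show ?thesis using polar[of L] L by auto
  qed
  then obtain k :: int where k: "\<phi> L = \<phi> 0 + 2 * pi * real_of_int k" using cis_eqE by blast
  have "0 < k"
  proof (rule ccontr)
    assume "\<not> ?thesis"
    then have "2 * pi * real_of_int k \<le> 0" by (intro mult_nonneg_nonpos) auto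
    then show False using mono[of 0 L] L k by simp
  qed
  have "k < 2"
  proof (rule ccontr)
    assume "\<not> ?thesis"
    then have "2 * pi * 2 \<le> 2 * pi * real_of_int k" by (intro mult_left_mono) auto
    then have "\<phi> 0 \<le> \<phi> 0 + 2 * pi" "\<phi> 0 + 2 * pi \<le> \<phi> L" using k pi_gt_zero by auto
    then obtain w where w: "0 \<le> w" "w \<le> L" "\<phi> w = \<phi> 0 + 2 * pi" using IVT'[of \<phi> 0 "\<phi> 0 + 2 * pi" L] cont L by auto
    have "w < L" using w k \<open>2 * pi * 2 \<le> 2 * pi * real_of_int k\<close> pi_gt_zero by (cases "w = L") auto
    moreover have "cis (\<phi> w) = cis (\<phi> 0)" unfolding w(3) by (simp add: cis_mult[symmetric])
    ultimately show False using ray[of w 0] w L pi_gt_zero by auto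
  qed
  then have per: "\<phi> L = \<phi> 0 + 2 * pi" using k \<open>0 < k\<close> by simp
  have angle: "\<exists>\<theta>. supp K (c t) \<theta> \<and> \<phi> t < \<theta> \<and> \<theta> < \<phi> t + pi" if t: "0 \<le> t" "t \<le> L" for t
  proof -
    obtain \<theta>0 where s0: "supp K (c t) \<theta>0" using frontier_supp[of "c t"] cK[of t] t by auto
    \<comment> \<open>The support angle is shifted into the period that starts at
      \<open>\<phi> t\<close>. As \<open>z\<close> lies strictly to the left of the support line, it
      falls into the first half.\<close>
    define n where "n = \<lfloor>(\<theta>0 - \<phi> t) / (2 * pi)\<rfloor>"
    define \<theta> where "\<theta> = \<theta>0 - 2 * pi * real_of_int n"
    have "cis \<theta> = cis \<theta>0" unfolding \<theta>_def by (metis add.commute cis_multiple_2pi[of n] cis_divide div_by_1 Ints_of_int)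
    then have s: "supp K (c t) \<theta>" using supp_cis_cong s0 by blast
    have "real_of_int n \<le> (\<theta>0 - \<phi> t) / (2 * pi)" "(\<theta>0 - \<phi> t) / (2 * pi) < real_of_int n + 1"
      unfolding n_def by linarith+
    then have b: "\<phi> t \<le> \<theta>" "\<theta> < \<phi> t + 2 * pi" by (simp_all add: \<theta>_def field_simps)
    have "\<not> supp K z \<theta>" using supp_not_interior z by blast
    moreover have "z \<in> K" using z interior_subset by blast
    ultimately have "ds K z \<theta> > 0" using ds_nonneg[of z \<theta>] by (auto simp: supp_def order.order_iff_strict)
    then have "0 < (c t - z) \<bullet> nrm \<theta>" using s by (simp add: supp_def ds_def inner_diff_left)
    moreover have "c t - z = r t *\<^sub>R cis (\<phi> t)" using polar[OF t] by (simp add: scaleR_conv_of_real)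
    ultimately have sp: "0 < sin (\<theta> - \<phi> t)" using polar[OF t] by (simp add: inner_cis_nrm zero_less_mult_iff)
    then have "\<theta> \<noteq> \<phi> t" by auto
    moreover have "\<theta> < \<phi> t + pi"
    proof (rule ccontr)
      assume "\<not> ?thesis"
      then have "0 \<le> sin (\<theta> - \<phi> t - pi)" using b by (intro sin_ge_zero) auto
      then show False using sp by (simp add: sin_diff[of _ pi])
    qed
    ultimately show ?thesis using s b by (intro exI[of _ \<theta>]) auto
  qed
  then obtain g where g: "\<And>t. 0 \<le> t \<Longrightarrow> t \<le> L \<Longrightarrow> supp K (c t) (g t) \<and> \<phi> t < g t \<and> g t < \<phi> t + pi" by metis
  \<comment> \<open>The angles are chosen independently at each parameter; the value at
    \<open>L\<close> is replaced by the one that agrees with the choice at 0.\<close>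
  define \<theta> where "\<theta> t = (if t = L then g 0 + 2 * pi else g t)" for t
  have "supp K (c L) (g 0 + 2 * pi)"
    using g[of 0] L supp_cis_cong[of "g 0 + 2 * pi" "g 0"] by (simp add: cis_mult[symmetric])
  then have "supp K (c t) (\<theta> t) \<and> \<phi> t < \<theta> t \<and> \<theta> t < \<phi> t + pi" if "0 \<le> t" "t \<le> L" for t
    using g[of t] g[of 0] that L per by (auto simp: \<theta>_def)
  then have "star_curve K c L z r \<phi> \<theta>"
    by unfold_locales (use cc polar mono per L in \<open>auto simp: \<theta>_def\<close>)
  then show ?thesis by blast
qed

section \<open>Reduction of clockwise convex curves to counterclockwise ones\<close>

lemma convex_body_cnj:
  assumes "convex_body K"
  shows "convex_body (cnj ` K)" "interior (cnj ` K) = cnj ` interior K"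
proof -
  interpret convex_body K by fact
  have lin: "linear cnj" by (rule bounded_linear.linear[OF bounded_linear_cnj])
  show "convex_body (cnj ` K)"
    by unfold_locales (use comp conv ne lin in \<open>auto intro!: compact_continuous_image continuous_intros convex_linear_image\<close>)
  show "interior (cnj ` K) = cnj ` interior K"
    by (rule interior_injective_linear_image[OF lin]) (auto intro: injI)
qed

lemma closed_curve_cnj: "closed_curve (cnj \<circ> c) L = closed_curve c L"
proof -
  have "dist (cnj x) (cnj y) = dist x y" for x y by (simp add: dist_norm complex_cnj_diff[symmetric] del: complex_cnj_diff)
  then show ?thesis by (simp add: closed_curve_def has_arc_length_def chord_sums_def)
qed

lemma trn_cnj: "trn (map cnj us) = trn us"
  by (induction us rule: induct_list012) (auto simp: ang_cnj)

lemma ctrn_cnj: "us \<noteq> [] \<Longrightarrow> ctrn (map cnj us) = ctrn us"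
  using trn_cnj[of "last us # us"] by (simp add: ctrn_def last_map)

text \<open>Unlike the angle functions of \<^locale>\<open>star_curve\<close> these properties do not depend on the orientation.\<close>

definition tame_curve :: "(real \<Rightarrow> complex) \<Rightarrow> real \<Rightarrow> bool" where
  "tame_curve c L \<longleftrightarrow>
    (\<forall>qs. sorted_wrt (\<lambda>p q. snd p \<le> fst q) qs \<longrightarrow> qs \<noteq> [] \<longrightarrow>
      (\<forall>(a, b)\<in>set qs. 0 \<le> a \<and> a < b \<and> b \<le> L \<and> c a \<noteq> c b) \<longrightarrow> ctrn (map (\<lambda>(a, b). c b - c a) qs) \<le> 2 * pi) \<and>
    (\<forall>s\<in>{0..L}. \<forall>e>0. \<forall>d>0. \<exists>t\<in>{0..L}. t \<noteq> s \<and> \<bar>t - s\<bar> < d \<and> (1 - e) * \<bar>t - s\<bar> \<le> norm (c t - c s)) \<and>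
    (\<exists>s. 0 < s \<and> s < L \<and> c differentiable (at s))"

lemma (in star_curve) tame: "tame_curve c L"
  unfolding tame_curve_def
proof (intro conjI allI impI ballI)
  fix qs :: "(real \<times> real) list"
  assume qs: "sorted_wrt (\<lambda>p q. snd p \<le> fst q) qs" "qs \<noteq> []" "\<forall>(a, b)\<in>set qs. 0 \<le> a \<and> a < b \<and> b \<le> L \<and> c a \<noteq> c b"
  show "ctrn (map (\<lambda>(a, b). c b - c a) qs) \<le> 2 * pi"
  proof (rule turn_le[OF qs(1,2)])
    fix a b assume "(a, b) \<in> set qs"
    from bspec[OF qs(3) this] show "0 \<le> a \<and> a < b \<and> b \<le> L \<and> c a \<noteq> c b" by simp
  qed
qed (rule speed differentiable_point; assumption)+

lemma tame_curve_cnj: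
  assumes "tame_curve (cnj \<circ> c) L"
  shows "tame_curve c L"
  unfolding tame_curve_def
proof (intro conjI allI impI ballI)
  fix qs :: "(real \<times> real) list"
  assume qs: "sorted_wrt (\<lambda>p q. snd p \<le> fst q) qs" "qs \<noteq> []" "\<forall>(a, b)\<in>set qs. 0 \<le> a \<and> a < b \<and> b \<le> L \<and> c a \<noteq> c b"
  have "ctrn (map (\<lambda>(a, b). c b - c a) qs) = ctrn (map cnj (map (\<lambda>(a, b). c b - c a) qs))"
    using ctrn_cnj[of "map (\<lambda>(a, b). c b - c a) qs"] qs(2) by simp
  also have "map cnj (map (\<lambda>(a, b). c b - c a) qs) = map (\<lambda>(a, b). (cnj \<circ> c) b - (cnj \<circ> c) a) qs" by auto
  also have "ctrn \<dots> \<le> 2 * pi" using assms qs unfolding tame_curve_def by (simp add: case_prod_beta)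
  finally show "ctrn (map (\<lambda>(a, b). c b - c a) qs) \<le> 2 * pi" .
next
  fix s e d :: real assume s: "s \<in> {0..L}" "0 < e" "0 < d"
  have n: "norm ((cnj \<circ> c) t - (cnj \<circ> c) s) = norm (c t - c s)" for t
    by (metis comp_apply complex_cnj_diff complex_mod_cnj)
  show "\<exists>t\<in>{0..L}. t \<noteq> s \<and> \<bar>t - s\<bar> < d \<and> (1 - e) * \<bar>t - s\<bar> \<le> norm (c t - c s)"
    using assms[unfolded tame_curve_def, THEN conjunct2, THEN conjunct1, rule_format, OF s] unfolding n .
next
  obtain s where s: "0 < s" "s < L" "(cnj \<circ> c) differentiable (at s)" using assms by (auto simp: tame_curve_def)
  obtain D where D: "((cnj \<circ> c) has_derivative D) (at s)" using s(3) by (auto simp: differentiable_def)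
  have "(cnj \<circ> (cnj \<circ> c) has_derivative cnj \<circ> D) (at s)"
    using bounded_linear.has_derivative[OF bounded_linear_cnj D] by (simp add: o_def)
  then have "c differentiable (at s)" by (auto simp: differentiable_def o_def)
  then show "\<exists>s. 0 < s \<and> s < L \<and> c differentiable (at s)" using s by blast
qed

text \<open>A continuous logarithm of \<open>c t - z\<close> on the parameter interval provides
  polar coordinates. Comparison of the angles at 0 and \<open>L / 2\<close> reveals the orientation,
  and a clockwise curve is reflected by conjugation.\<close>

lemma convex_curve_tame:
  assumes "convex_closed_curve c L"
  shows "tame_curve c L"
proof -
  define K where "K = closed_region c L"
  note R = convex_closed_curve_region[OF assms, folded K_def]
  have cc: "closed_curve c L" and inj: "inj_on c {0..<L}" using assms by (auto simp: convex_closed_curve_def)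
  have L: "0 < L" using cc by (auto simp: closed_curve_def)
  obtain z where z: "z \<in> interior K" using R(2) by blast
  have "continuous_on {0..L} (\<lambda>t. c t - z)" by (intro continuous_intros closed_curve_continuous[OF cc])
  moreover have "contractible {0..L}" using L by (intro convex_imp_contractible) auto
  moreover have "c t - z \<noteq> 0" if "t \<in> {0..L}" for t using R(4)[OF that] z by auto
  ultimately obtain g where g: "continuous_on {0..L} g" "\<And>t. t \<in> {0..L} \<Longrightarrow> c t - z = exp (g t)"
    using continuous_logarithm_on_contractible[of "{0..L}" "\<lambda>t. c t - z"] by metis
  define r \<phi> where "r t = exp (Re (g t))" and "\<phi> t = Im (g t)" for t
  have polar: "c t = z + of_real (r t) * cis (\<phi> t) \<and> 0 < r t" if "0 \<le> t" "t \<le> L" for t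
    using g(2)[of t] that exp_eq_polar[of "g t"] by (simp add: r_def \<phi>_def diff_eq_eq add.commute exp_of_real)
  have cphi: "continuous_on {0..L} \<phi>" unfolding \<phi>_def by (intro continuous_intros g)
  show ?thesis
  proof (cases "\<phi> 0 < \<phi> (L / 2)")
    case True
    then obtain \<theta> where "star_curve K c L z r \<phi> \<theta>"
      using convex_body.star_curve_exists[OF R(1) cc inj z _ R(4) polar cphi] R(3) by blast
    then show ?thesis by (rule star_curve.tame)
  next
    case False
    have cK: "c t \<in> K" if "t \<in> {0..L}" for t using R(3) that by blast
    have "\<phi> 0 \<noteq> \<phi> (L / 2)" using convex_body.ray_injective[OF R(1) inj z cK R(4) polar, of 0 "L / 2"] L by auto
    then have up: "- \<phi> 0 < - \<phi> (L / 2)" using False by simp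
    let ?c = "cnj \<circ> c" and ?K = "cnj ` K"
    have "inj_on ?c {0..<L}" using inj by (auto simp: inj_on_def)
    moreover have "cnj z \<in> interior ?K" using z convex_body_cnj(2)[OF R(1)] by auto
    moreover have "?c t \<in> ?K" "?c t \<notin> interior ?K" if "t \<in> {0..L}" for t
    proof -
      show "?c t \<in> ?K" using cK[OF that] by simp
      show "?c t \<notin> interior ?K" using R(4)[OF that] unfolding convex_body_cnj(2)[OF R(1)] by auto
    qed
    moreover have "?c t = cnj z + of_real (r t) * cis (- \<phi> t) \<and> 0 < r t" if "0 \<le> t" "t \<le> L" for t
      using polar[OF that] by (simp add: cis_cnj)
    moreover have "continuous_on {0..L} (\<lambda>t. - \<phi> t)" using cphi by (intro continuous_intros)
    moreover have "closed_curve ?c L" using cc closed_curve_cnj by blast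
    ultimately obtain \<theta> where "star_curve ?K ?c L (cnj z) r (\<lambda>t. - \<phi> t) \<theta>"
      using convex_body.star_curve_exists[OF convex_body_cnj(1)[OF R(1)], of ?c L "cnj z" r "\<lambda>t. - \<phi> t"] up by blast
    then have "tame_curve ?c L" by (rule star_curve.tame)
    then show ?thesis by (rule tame_curve_cnj)
  qed
qed

section \<open>The full rotation of a convex curve\<close>

context
  fixes c :: "real \<Rightarrow> complex" and L :: real
  assumes conv_c: "convex_closed_curve c L"
begin

lemma convex_curve_closed: "closed_curve c L"
  using conv_c by (simp add: convex_closed_curve_def)

lemma convex_curve_turn:
  assumes "sorted_wrt (\<lambda>p q. snd p \<le> fst q) qs" "qs \<noteq> []"
    and "\<And>a b. (a, b) \<in> set qs \<Longrightarrow> 0 \<le> a \<and> a < b \<and> b \<le> L \<and> c a \<noteq> c b"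
  shows "ctrn (map (\<lambda>(a, b). c b - c a) qs) \<le> 2 * pi"
proof -
  have "\<forall>(a, b)\<in>set qs. 0 \<le> a \<and> a < b \<and> b \<le> L \<and> c a \<noteq> c b" using assms(3) by blast
  then show ?thesis
    using convex_curve_tame[OF conv_c, unfolded tame_curve_def, THEN conjunct1, THEN spec, THEN mp, THEN mp, THEN mp, OF assms(1,2)] by blast
qed

lemma convex_curve_tcurve: "tcurve c L (2 * pi)"
  by (rule tcurve_intro_intervals[OF convex_curve_closed]) (rule convex_curve_turn)

lemma velocity_quotient:
  assumes "s \<in> velocity_dom c L"
  shows "((\<lambda>y. (c y - c s) /\<^sub>R (y - s)) \<longlongrightarrow> velocity c L s) (at s within {0..L})"
  using assms unfolding velocity_dom_def velocity_def
  by (intro tendsto_difference_quotient) (simp add: vector_derivative_works)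

lemma convex_curve_speed:
  assumes "s \<in> velocity_dom c L"
  shows "norm (velocity c L s) = 1"
proof (rule unit_derivative)
  show "(c has_vector_derivative velocity c L s) (at s within {0..L})"
    using assms unfolding velocity_dom_def velocity_def by (simp add: vector_derivative_works)
  have s: "s \<in> {0..L}" using assms by (simp add: velocity_dom_def)
  show "norm (c t - c s) \<le> \<bar>t - s\<bar>" if "t \<in> {0..L}" for t
    using closed_curve_lipschitz[OF convex_curve_closed, of t s] s that by (simp add: dist_norm)
  show "\<exists>t\<in>{0..L}. t \<noteq> s \<and> \<bar>t - s\<bar> < d \<and> (1 - e) * \<bar>t - s\<bar> \<le> norm (c t - c s)" if "0 < e" "0 < d" for e d
    by (rule convex_curve_tame[OF conv_c, unfolded tame_curve_def, THEN conjunct2, THEN conjunct1, rule_format]) fact+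
qed

text \<open>Velocities are limits of chords over intervals of length \<open>h k\<close>, which turn
  by at most 2 * pi. Each interval is laid to the right of its parameter, at \<open>L\<close> to the
  left; the condition with the factor 2 keeps the intervals disjoint.\<close>

lemma velocity_turn:
  assumes rs: "sorted_wrt (<) rs" "rs \<noteq> []" "set rs \<subseteq> velocity_dom c L"
  shows "ctrn (map (velocity c L) rs) \<le> 2 * pi"
proof -
  have L: "0 < L" using convex_curve_closed by (simp add: closed_curve_def)
  define h where "h k = 1 / real (Suc k)" for k
  have h: "0 < h k" for k by (simp add: h_def)
  have h0: "h \<longlonglongrightarrow> 0" unfolding h_def by (rule LIMSEQ_Suc[OF lim_1_over_n])
  have small: "\<forall>\<^sub>F k in sequentially. h k < a" if "0 < a" for a
    using order_tendstoD(2)[OF h0 that] .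
  define y where "y k r = (if r < L then r + h k else r - h k)" for k r
  define Q where "Q k r = (c (y k r) - c r) /\<^sub>R (y k r - r)" for k r
  have rs01: "r \<in> {0..L}" if "r \<in> set rs" for r using rs(3) that by (auto simp: velocity_dom_def)
  have yin: "\<forall>\<^sub>F k in sequentially. 0 \<le> y k r \<and> y k r \<le> L" if "r \<in> set rs" for r
  proof (cases "r < L")
    case True
    then have "\<forall>\<^sub>F k in sequentially. h k < L - r" by (intro small) simp
    then show ?thesis by eventually_elim (use True rs01[OF that] h in \<open>auto simp: y_def less_imp_le add_nonneg_nonneg\<close>)
  next
    case False
    have "\<forall>\<^sub>F k in sequentially. h k < L" using L by (rule small)
    then show ?thesis by eventually_elim (use False rs01[OF that] h in \<open>auto simp: y_def intro: order.trans less_imp_le\<close>)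
  qed
  have ylim: "filterlim (\<lambda>k. y k r) (at r within {0..L}) sequentially" if "r \<in> set rs" for r
    unfolding filterlim_at
  proof
    show "\<forall>\<^sub>F k in sequentially. y k r \<in> {0..L} \<and> y k r \<noteq> r"
      using yin[OF that] by eventually_elim (use less_imp_neq[OF h] in \<open>auto simp: y_def\<close>)
    have "(\<lambda>k. r + h k) \<longlonglongrightarrow> r + 0" "(\<lambda>k. r - h k) \<longlonglongrightarrow> r - 0" by (intro tendsto_intros h0)+
    then show "((\<lambda>k. y k r) \<longlongrightarrow> r) sequentially" by (cases "r < L") (auto simp: y_def)
  qed
  have lim: "(\<lambda>k. Q k r) \<longlonglongrightarrow> velocity c L r" if "r \<in> set rs" for r
    unfolding Q_def by (rule filterlim_compose[OF velocity_quotient ylim]) (use rs that in auto)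
  have ne: "velocity c L r \<noteq> 0" if "r \<in> set rs" for r using convex_curve_speed[of r] rs(3) that by force
  have tend: "(\<lambda>k. ctrn (map (Q k) rs)) \<longlonglongrightarrow> ctrn (map (velocity c L) rs)"
    by (rule tendsto_ctrn) (use lim ne rs in auto)
  have 1: "\<forall>\<^sub>F k in sequentially. \<forall>r\<in>set rs. 0 \<le> y k r \<and> y k r \<le> L \<and> Q k r \<noteq> 0"
  proof (intro eventually_ball_finite ballI)
    fix r assume r: "r \<in> set rs"
    show "\<forall>\<^sub>F k in sequentially. 0 \<le> y k r \<and> y k r \<le> L \<and> Q k r \<noteq> 0"
      using yin[OF r] tendsto_imp_eventually_ne[OF lim[OF r] ne[OF r]] by eventually_elim auto
  qed simp
  have 2: "\<forall>\<^sub>F k in sequentially. \<forall>r\<in>set rs. \<forall>r'\<in>set rs. r < r' \<longrightarrow> 2 * h k < r' - r"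
  proof (intro eventually_ball_finite ballI)
    fix r r' assume "r \<in> set rs" "r' \<in> set rs"
    show "\<forall>\<^sub>F k in sequentially. r < r' \<longrightarrow> 2 * h k < r' - r"
    proof (cases "r < r'")
      case True
      then have "\<forall>\<^sub>F k in sequentially. h k < (r' - r) / 2" by (intro small) simp
      then show ?thesis by eventually_elim simp
    qed simp
  qed auto
  have "\<forall>\<^sub>F k in sequentially. ctrn (map (Q k) rs) \<le> 2 * pi"
    using 1 2
  proof eventually_elim
    case (elim k)
    define q where "q r = (if r < L then (r, r + h k) else (r - h k, r))" for r
    have e: "(\<lambda>(a, b). c b - c a) (q r) = h k *\<^sub>R Q k r" for r using h[of k] by (auto simp: q_def Q_def y_def scaleR_diff_right)
    have "ctrn (map (Q k) rs) = ctrn (map (\<lambda>r. h k *\<^sub>R Q k r) rs)"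
      using ctrn_map_scale[of rs "\<lambda>r. h k" "Q k"] h rs(2) by simp
    also have "map (\<lambda>r. h k *\<^sub>R Q k r) rs = map (\<lambda>(a, b). c b - c a) (map q rs)" unfolding map_map o_def e ..
    also have "ctrn \<dots> \<le> 2 * pi"
    proof (rule convex_curve_turn)
      have "sorted_wrt (\<lambda>r r'. snd (q r) \<le> fst (q r')) rs"
      proof (rule sorted_wrt_mono_rel[OF _ rs(1)])
        fix r r' assume r: "r \<in> set rs" "r' \<in> set rs" "r < r'"
        then have "2 * h k < r' - r" "r < L" using elim(2) rs01[of r'] by auto
        then show "snd (q r) \<le> fst (q r')" using h[of k] by (auto simp: q_def)
      qed
      then show "sorted_wrt (\<lambda>p q. snd p \<le> fst q) (map q rs)" by (simp add: sorted_wrt_map)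
      fix a b assume "(a, b) \<in> set (map q rs)"
      then obtain r where r: "r \<in> set rs" "(a, b) = q r" by auto
      have "0 \<le> y k r" "y k r \<le> L" "Q k r \<noteq> 0" using elim(1) r(1) by auto
      moreover have "c b - c a = h k *\<^sub>R Q k r" using e[of r] unfolding r(2)[symmetric] by simp
      ultimately show "0 \<le> a \<and> a < b \<and> b \<le> L \<and> c a \<noteq> c b"
        using r rs01[OF r(1)] h[of k] by (auto simp: q_def y_def split: if_splits)
    qed (use rs in auto)
    finally show ?case .
  qed
  then show ?thesis by (rule tendsto_upperbound[OF tend]) simp
qed

lemma convex_curve_rotation: "full_rotation c L \<le> 2 * pi"
  unfolding full_rotation_def variation_def
proof (rule cSup_least)
  obtain s where s: "0 < s" "s < L" "c differentiable (at s)"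
    using convex_curve_tame[OF conv_c] unfolding tame_curve_def by blast
  then have "s \<in> velocity_dom c L" by (simp add: velocity_dom_def at_within_Icc_at)
  then have "subdivision (velocity_dom c L) 0 (\<lambda>_. s)" by (simp add: subdivision_def)
  then show "variation_sums (velocity c L) (velocity_dom c L) \<noteq> {}" unfolding variation_sums_def by blast
next
  fix x assume "x \<in> variation_sums (velocity c L) (velocity_dom c L)"
  then obtain n t where x: "x = (\<Sum>i=1..n. circle_dist (velocity c L (t i)) (velocity c L (t (i - 1)))) +
      circle_dist (velocity c L (t n)) (velocity c L (t 0))" and s: "subdivision (velocity_dom c L) n t"
    unfolding variation_sums_def by blast
  have "x = ctrn (map (velocity c L) (map t [0..<Suc n]))"
    unfolding x by (rule variation_sum_ctrn, rule convex_curve_speed) (use s in \<open>auto simp: subdivision_def\<close>)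
  also have "\<dots> \<le> 2 * pi" by (rule velocity_turn) (use subdivision_list[OF s] in auto)
  finally show "x \<le> 2 * pi" .
qed

end

subsection \<open>The perimeter of a convex curve\<close>

lemma abs_sin_antideriv:
  obtains F where "\<And>t. (F has_real_derivative \<bar>sin t\<bar>) (at t)" "\<And>t. F (t + 2 * pi) = F t + 4"
proof -
  obtain F where F: "\<And>t. (F has_real_derivative \<bar>sin t\<bar>) (at t)"
    using antideriv[of "\<lambda>t. \<bar>sin t\<bar>"] continuous_on_rabs[OF continuous_on_sin[OF continuous_on_id]] by blast
  have F1: "F (t + pi) = F t + (F pi - F 0)" for t
  proof -
    have "((\<lambda>t. F (t + pi) - F t) has_real_derivative 0) (at t)" for t
      by (auto intro!: derivative_eq_intros DERIV_chain2[OF F] F)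
    from constant_of_zero_deriv[OF this, of t 0] show ?thesis by simp
  qed
  have "F pi + cos pi = F 0 + cos 0"
  proof (rule DERIV_isconst_end[of 0 pi "\<lambda>t. F t + cos t"])
    show "continuous_on {0..pi} (\<lambda>t. F t + cos t)"
      by (intro continuous_intros DERIV_continuous_on) (auto intro: has_field_derivative_at_within F)
    fix t :: real assume t: "0 < t" "t < pi"
    then have "\<bar>sin t\<bar> = sin t" using sin_gt_zero[of t] by simp
    then show "((\<lambda>t. F t + cos t) has_real_derivative 0) (at t)" using F[of t] by (auto intro!: derivative_eq_intros)
  qed simp
  then have "F pi - F 0 = 2" by simp
  then have "F (t + 2 * pi) = F t + 4" for t using F1[of t] F1[of "t + pi"] by (simp add: add.assoc)
  then show ?thesis using that F by blast
qed

lemma plen_ge_dist: "ps \<noteq> [] \<Longrightarrow> dist (hd ps) (last ps) \<le> plen ps"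
proof (induction ps rule: induct_list012)
  case (3 x y zs)
  then show ?case using dist_triangle[of x "last (y # zs)" y] by auto
qed auto

text \<open>A closed polygon passes from \<open>p\<close> to \<open>q\<close> and also back.\<close>

lemma closed_plen_ge:
  assumes "p \<in> set ps" "q \<in> set ps" "hd ps = last ps"
  shows "2 * dist p q \<le> plen ps"
proof -
  have *: "2 * dist p q \<le> plen ps" if ps: "ps = as @ p # bs" "q \<in> set (p # bs)" for p q as bs
  proof (cases "q = p")
    case False
    then obtain ds es where bs: "bs = ds @ q # es" using ps(2) by (auto dest: split_list)
    have "plen ps = plen (as @ [p]) + (plen (p # ds @ [q]) + plen (q # es))"
      unfolding ps(1) bs using plen_split[of as p "ds @ q # es"] plen_split[of "p # ds" q es] by simp
    moreover have "dist (hd ps) p \<le> plen (as @ [p])" using plen_ge_dist[of "as @ [p]"] by (cases as) (auto simp: ps(1))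
    moreover have "dist p q \<le> plen (p # ds @ [q])" using plen_ge_dist[of "p # ds @ [q]"] by simp
    moreover have "dist q (last ps) \<le> plen (q # es)" using plen_ge_dist[of "q # es"] by (auto simp: ps(1) bs)
    moreover have "dist p q \<le> dist (hd ps) p + dist q (last ps)"
      using dist_triangle[of p q "hd ps"] assms(3) by (simp add: dist_commute)
    ultimately show ?thesis by linarith
  qed (use plen_edges[of ps] in \<open>auto intro!: sum_list_nonneg\<close>)
  obtain as bs where ps: "ps = as @ p # bs" using assms(1) by (meson split_list)
  show ?thesis
  proof (cases "q \<in> set (p # bs)")
    case True
    then show ?thesis using * ps by blast
  next
    case False
    then have "q \<in> set as" using assms(2) ps by auto
    then obtain as1 as2 where "as = as1 @ q # as2" by (meson split_list)
    then have "ps = as1 @ q # (as2 @ p # bs)" using ps by simp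
    from *[OF this, of p] show ?thesis by (simp add: dist_commute)
  qed
qed

text \<open>Every nonzero edge has the form \<open>e = \<bar>e\<bar> cis \<alpha>\<close>, and \<open>\<bar>sin\<bar>\<close> has integral \<open>4\<close> over a period.\<close>

lemma projected_length:
  obtains G where "\<And>t. (G has_real_derivative plen (map (\<lambda>p. of_real (p \<bullet> nrm t)) ps)) (at t)"
    "\<And>t. G (t + 2 * pi) = G t + 4 * plen ps"
proof -
  obtain F where F: "\<And>t. (F has_real_derivative \<bar>sin t\<bar>) (at t)" "\<And>t. F (t + 2 * pi) = F t + 4"
    using abs_sin_antideriv by blast
  have "\<exists>G. (\<forall>t. (G has_real_derivative plen (map (\<lambda>p. of_real (p \<bullet> nrm t)) ps)) (at t)) \<and> (\<forall>t. G (t + 2 * pi) = G t + 4 * plen ps)"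
  proof (induction ps rule: induct_list012)
    case (3 x y zs)
    then obtain G where G: "\<And>t. (G has_real_derivative plen (map (\<lambda>p. of_real (p \<bullet> nrm t)) (y # zs))) (at t)"
      "\<And>t. G (t + 2 * pi) = G t + 4 * plen (y # zs)" by blast
    define a where "a = Arg (y - x)"
    have xy: "y - x = dist x y *\<^sub>R cis a"
      using rcis_cmod_Arg[of "y - x"] by (simp add: a_def rcis_def dist_norm norm_minus_commute scaleR_conv_of_real)
    have "dist (of_real (x \<bullet> nrm t)) (of_real (y \<bullet> nrm t) :: complex) = dist x y * \<bar>sin (t - a)\<bar>" for t
    proof -
      have "dist (of_real (x \<bullet> nrm t)) (of_real (y \<bullet> nrm t) :: complex) = \<bar>(y - x) \<bullet> nrm t\<bar>"
        by (simp add: dist_of_real dist_real_def inner_diff_left abs_minus_commute)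
      also have "\<dots> = dist x y * \<bar>sin (t - a)\<bar>" by (subst xy) (simp add: inner_cis_nrm abs_mult)
      finally show ?thesis .
    qed
    moreover have "((\<lambda>t. dist x y * F (t - a) + G t) has_real_derivative
      dist x y * \<bar>sin (t - a)\<bar> + plen (map (\<lambda>p. of_real (p \<bullet> nrm t)) (y # zs))) (at t)" for t
      by (auto intro!: derivative_eq_intros DERIV_chain2[OF F(1)] G(1))
    moreover have "F (t + 2 * pi - a) = F (t - a) + 4" for t using F(2)[of "t - a"] by (simp add: algebra_simps)
    ultimately show ?case using G(2)
      by (intro exI[of _ "\<lambda>t. dist x y * F (t - a) + G t"]) (simp add: algebra_simps)
  qed (auto intro!: exI[of _ "\<lambda>_. 0"])
  then show ?thesis using that by blast
qed

text \<open>The projection of an inscribed closed polygon to any line covers its width twice.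
  Integration over all directions turns the widths into \<open>crad\<close> and the edges into four
  times the length; nodes at distance \<open>m\<close> along the curve miss at most
  \<open>2 * m\<close> of each width.\<close>

lemma cauchy_perimeter:
  assumes c: "convex_closed_curve c L"
  shows "2 * pi * crad (closed_region c L) \<le> L"
proof -
  define K where "K = closed_region c L"
  note R = convex_closed_curve_region[OF c, folded K_def]
  interpret convex_body K by (rule R(1))
  have cc: "closed_curve c L" using c by (simp add: convex_closed_curve_def)
  have L: "0 < L" "c 0 = c L" using cc by (auto simp: closed_curve_def)
  have bound: "2 * pi * crad K \<le> L + 2 * pi * (L / real N)" if N: "0 < N" for N :: nat
  proof -
    define m where "m = L / real N"
    have m: "0 < m" using N L by (simp add: m_def)
    define ts where "ts = map (\<lambda>i. real i * m) [0..<Suc N]"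
    define ps where "ps = map c ts"
    have Nm: "real N * m = L" using N by (simp add: m_def)
    have ts: "sorted_wrt (<) ts" unfolding ts_def sorted_wrt_map sorted_wrt_iff_nth_less
      using m by (auto simp: nth_append less_Suc_eq simp del: upt_Suc)
    have ts01: "set ts \<subseteq> {0..L}"
    proof
      fix t assume "t \<in> set ts"
      then obtain i where i: "i \<le> N" "t = real i * m" by (auto simp: ts_def less_Suc_eq_le simp del: upt_Suc)
      have "real i * m \<le> real N * m" using i m by (intro mult_right_mono) auto
      then show "t \<in> {0..L}" using i m Nm by auto
    qed
    have lenL: "plen ps \<le> L" unfolding ps_def by (rule closed_curve_plen(1)[OF cc _ ts ts01]) (use L in auto)
    have "hd ts = 0" unfolding ts_def by (simp add: hd_conv_nth nth_append del: upt_Suc)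
    then have "hd ps = c 0" unfolding ps_def using hd_map[of ts c] by (simp add: ts_def del: upt_Suc map_map)
    moreover have "last ps = c L" unfolding ps_def ts_def by (simp add: Nm)
    ultimately have closed: "hd ps = last ps" using L by simp
    have near: "\<exists>p\<in>set ps. hs K t \<le> p \<bullet> nrm t + m" for t
    proof -
      obtain x where x: "x \<in> K" "hs K t = x \<bullet> nrm t" using hs_attained by blast
      then have "supp K x t" by (simp add: supp_def ds_def)
      then obtain s where s: "s \<in> {0..L}" "x = c s" using R(5) x supp_not_interior by blast
      define i where "i = nat \<lfloor>s / m\<rfloor>"
      have "real i = of_int \<lfloor>s / m\<rfloor>" using s m by (simp add: i_def)
      then have i: "real i \<le> s / m" "s / m < real i + 1" by linarith+
      then have ri: "real i * m \<le> s" "s - real i * m \<le> m" using m by (auto simp: field_simps)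
      have "real i * m \<le> real N * m" using ri s Nm by simp
      then have "i \<le> N" using m by simp
      then have "real i * m \<in> set ts" by (auto simp: ts_def simp del: upt_Suc)
      then have "c (real i * m) \<in> set ps" by (simp add: ps_def)
      moreover have "x \<bullet> nrm t - c (real i * m) \<bullet> nrm t \<le> norm (x - c (real i * m))"
        using norm_cauchy_schwarz[of "x - c (real i * m)" "nrm t"] by (simp add: inner_diff_left)
      moreover have "norm (x - c (real i * m)) \<le> m"
        using closed_curve_lipschitz[OF cc, of s "real i * m"] s ri m by (simp add: dist_norm)
      ultimately show ?thesis using x(2) by (intro bexI[of _ "c (real i * m)"]) linarith+
    qed
    obtain G where G: "\<And>t. (G has_real_derivative plen (map (\<lambda>p. of_real (p \<bullet> nrm t)) ps)) (at t)"
      "\<And>t. G (t + 2 * pi) = G t + 4 * plen ps" using projected_length[of ps] by blast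
    have proj: "2 * (hs K t + hs K (t + pi) - 2 * m) \<le> plen (map (\<lambda>p. of_real (p \<bullet> nrm t)) ps)" for t
    proof -
      obtain p q where p: "p \<in> set ps" "hs K t \<le> p \<bullet> nrm t + m" and q: "q \<in> set ps" "hs K (t + pi) \<le> q \<bullet> nrm (t + pi) + m"
        using near by blast
      have "hs K t + hs K (t + pi) - 2 * m \<le> p \<bullet> nrm t - q \<bullet> nrm t"
        using p(2) q(2) by (simp add: inner_nrm)
      also have "\<dots> \<le> dist (of_real (p \<bullet> nrm t)) (of_real (q \<bullet> nrm t) :: complex)" by (simp add: dist_of_real dist_real_def)
      also have "2 * \<dots> \<le> plen (map (\<lambda>p. of_real (p \<bullet> nrm t)) ps)"
      proof (rule closed_plen_ge)
        have "ps \<noteq> []" using p(1) by auto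
        then show "hd (map (\<lambda>p. complex_of_real (p \<bullet> nrm t)) ps) = last (map (\<lambda>p. complex_of_real (p \<bullet> nrm t)) ps)"
          using closed by (simp add: hd_map last_map)
      qed (use p(1) q(1) in auto)
      finally show ?thesis by simp
    qed
    \<comment> \<open>The two integrals over a period are compared through antiderivatives:
      \<open>H\<close> has a nonnegative derivative.\<close>
    define H where "H t = G t - 2 * (hint K t + hint K (t + pi) - 2 * m * t)" for t
    have "H 0 \<le> H (2 * pi)"
    proof (rule DERIV_nonneg_imp_nondecreasing[where f = H])
      fix t :: real
      have "(H has_real_derivative plen (map (\<lambda>p. of_real (p \<bullet> nrm t)) ps) - 2 * (hs K t + hs K (t + pi) - 2 * m)) (at t)"
        unfolding H_def by (auto intro!: derivative_eq_intros DERIV_chain2[OF hint_deriv] hint_deriv G(1))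
      then show "\<exists>D. (H has_real_derivative D) (at t) \<and> 0 \<le> D" using proj[of t] by (intro exI conjI) auto
    qed simp
    moreover have "H (2 * pi) = H 0 + 4 * plen ps - 2 * (2 * (2 * pi * crad K) - 2 * m * (2 * pi))"
      using G(2)[of 0] hint_2pi[of 0] hint_2pi[of pi] by (simp add: H_def algebra_simps)
    ultimately have "2 * (2 * (2 * pi * crad K) - 2 * m * (2 * pi)) \<le> 4 * L" using lenL by linarith
    then have "2 * pi * crad K \<le> L + 2 * pi * m" by (simp add: algebra_simps)
    then show ?thesis by (simp add: m_def)
  qed
  have "2 * pi * crad K \<le> L"
  proof (rule field_le_epsilon)
    fix e :: real assume e: "0 < e"
    obtain N :: nat where N: "2 * pi * L / e < real N" using reals_Archimedean2 by blast
    have "0 < 2 * pi * L / e" using e L by simp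
    then have N0: "0 < N" using N by (cases N) auto
    then have "2 * pi * (L / real N) \<le> e" using N e by (simp add: field_simps)
    then show "2 * pi * crad K \<le> L + e" using bound[OF N0] by linarith
  qed
  then show ?thesis by (simp add: K_def)
qed

subsection \<open>The case of equality\<close>

lemma frac_small_imp_Ints:
  fixes w :: real
  assumes "\<And>d. 0 < d \<Longrightarrow> \<exists>k::int. 0 \<le> w - of_int k \<and> w - of_int k < d"
  shows "w \<in> \<int>"
proof -
  have "frac w \<le> 0"
  proof (rule field_le_epsilon)
    fix d :: real assume "0 < d"
    then obtain k :: int where k: "0 \<le> w - of_int k" "w - of_int k < min d 1" using assms[of "min d 1"] by auto
    then have "\<lfloor>w\<rfloor> = k" by linarith
    then show "frac w \<le> 0 + d" using k by (simp add: frac_def)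
  qed
  then have "frac w = 0" using frac_ge_0[of w] by simp
  then show ?thesis by (simp add: frac_eq_0_iff)
qed

lemma frac_of_abs_less:
  fixes u P :: real
  assumes "0 < P" "\<bar>u\<bar> < P"
  shows "P * frac (u / P) = (if 0 \<le> u then u else u + P)"
proof (cases "0 \<le> u")
  case True
  then have "frac (u / P) = u / P" using assms by (simp add: frac_eq)
  then show ?thesis using True assms by simp
next
  case False
  then have "-1 < u / P" "u / P < 0" using assms by (auto simp: field_simps)
  then have "\<lfloor>u / P\<rfloor> = -1" by linarith
  then show ?thesis using False assms by (simp add: frac_def field_simps)
qed

text \<open>The increments of the position \<open>\<tau>\<close> along a fine subdivision are at least the chords, hence they add up to
  the elapsed parameter.\<close>

lemma advance_eq:
  assumes c: "closed_curve c L" and c1: "closed_curve c1 P"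
    and tau: "\<And>s. s \<in> {0..L} \<Longrightarrow> 0 \<le> \<tau> s \<and> \<tau> s < P \<and> c s = c1 (\<tau> s)"
    and sg: "\<sigma> = 1 \<or> \<sigma> = (-1::real)"
    and adv: "\<And>s s'. 0 \<le> s \<Longrightarrow> s < s' \<Longrightarrow> s' \<le> L \<Longrightarrow> P * frac (\<sigma> * (\<tau> s' - \<tau> s) / P) \<le> s' - s"
    and s: "s \<in> {0..L}"
  shows "(s - \<sigma> * (\<tau> s - \<tau> 0)) / P \<in> \<int>"
proof (rule frac_small_imp_Ints)
  fix d :: real assume d: "0 < d"
  have P: "0 < P" "c1 0 = c1 P" using c1 by (auto simp: closed_curve_def)
  define m where "m u = P * frac (\<sigma> * u / P)" for u
  \<comment> \<open>The chord is at most as long as either of the two arcs between its end points,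
    in particular the one counted by \<open>m\<close>.\<close>
  have chord: "dist (c t) (c t') \<le> m (\<tau> t' - \<tau> t)" if t: "t \<in> {0..L}" "t' \<in> {0..L}" for t t'
  proof -
    define u where "u = \<tau> t' - \<tau> t"
    note a = tau[OF t(1)] and b = tau[OF t(2)]
    have u: "\<bar>u\<bar> < P" "\<bar>\<sigma> * u\<bar> < P" using a b sg by (auto simp: u_def abs_if)
    have le1: "dist (c t) (c t') \<le> \<bar>u\<bar>"
      using closed_curve_lipschitz[OF c1, of "\<tau> t" "\<tau> t'"] a b by (simp add: u_def abs_minus_commute)
    have le2: "dist (c t) (c t') \<le> P - \<bar>u\<bar>"
    proof -
      have *: "dist (c1 x) (c1 y) \<le> P - (y - x)" if "0 \<le> x" "x \<le> y" "y \<le> P" for x y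
        using closed_curve_lipschitz[OF c1, of x 0] closed_curve_lipschitz[OF c1, of P y]
          dist_triangle[of "c1 x" "c1 y" "c1 0"] that P by simp
      show ?thesis
        using *[of "\<tau> t" "\<tau> t'"] *[of "\<tau> t'" "\<tau> t"] a b by (cases "\<tau> t \<le> \<tau> t'") (auto simp: u_def dist_commute)
    qed
    have "m u = (if 0 \<le> \<sigma> * u then \<sigma> * u else \<sigma> * u + P)" unfolding m_def by (rule frac_of_abs_less[OF P(1) u(2)])
    then show ?thesis using le1 le2 sg by (auto simp: u_def[symmetric] abs_if split: if_splits)
  qed
  \<comment> \<open>Arc lengths add up only modulo \<open>P\<close>; the integer \<open>k\<close>
    accounts for the completed rounds.\<close>
  have poly: "\<exists>k::int. plen (map c ts) \<le> \<sigma> * (\<tau> (last ts) - \<tau> (hd ts)) + P * of_int k \<and>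
      \<sigma> * (\<tau> (last ts) - \<tau> (hd ts)) + P * of_int k \<le> last ts - hd ts"
    if "sorted_wrt (<) ts" "set ts \<subseteq> {0..L}" "ts \<noteq> []" for ts
    using that
  proof (induction ts rule: induct_list012)
    case (2 x)
    then show ?case by (auto intro!: exI[of _ 0])
  next
    case (3 x y zs)
    then obtain k :: int where k: "plen (map c (y # zs)) \<le> \<sigma> * (\<tau> (last (y # zs)) - \<tau> y) + P * of_int k"
      "\<sigma> * (\<tau> (last (y # zs)) - \<tau> y) + P * of_int k \<le> last (y # zs) - y" by auto
    have xy: "x \<in> {0..L}" "y \<in> {0..L}" "x < y" using 3 by auto
    define j where "j = - \<lfloor>\<sigma> * (\<tau> y - \<tau> x) / P\<rfloor>"
    have j: "m (\<tau> y - \<tau> x) = \<sigma> * (\<tau> y - \<tau> x) + P * of_int j" using P by (simp add: m_def frac_def j_def field_simps)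
    have "dist (c x) (c y) \<le> \<sigma> * (\<tau> y - \<tau> x) + P * of_int j" "\<sigma> * (\<tau> y - \<tau> x) + P * of_int j \<le> y - x"
      using chord[of x y] adv[of x y] xy j by (auto simp: m_def)
    then show ?case using k by (intro exI[of _ "k + j"]) (simp add: algebra_simps)
  qed simp
  have "0 \<in> {0..s}" "0 < P * d" using s P d by auto
  then obtain ts where ts: "sorted_wrt (<) ts" "set ts \<subseteq> {0..s}" "{0, s} \<subseteq> set ts" "s - P * d < plen (map c ts)"
    using closed_curve_refine[OF c s, of "{0, s}" "P * d"] s by auto
  have hl: "hd ts = 0" "last ts = s"
    by (rule sorted_hd[OF ts(1)], use ts in auto) (rule sorted_last[OF ts(1)], use ts in auto)
  have "ts \<noteq> []" "set ts \<subseteq> {0..L}" using ts s by auto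
  then obtain k :: int where k: "s - P * d < \<sigma> * (\<tau> s - \<tau> 0) + P * of_int k" "\<sigma> * (\<tau> s - \<tau> 0) + P * of_int k \<le> s"
    using poly[OF ts(1)] ts(4) hl by force
  have "(s - \<sigma> * (\<tau> s - \<tau> 0)) / P - of_int k = (s - (\<sigma> * (\<tau> s - \<tau> 0) + P * of_int k)) / P"
    using P by (simp add: field_simps)
  moreover have "0 \<le> (s - (\<sigma> * (\<tau> s - \<tau> 0) + P * of_int k)) / P" using k P by simp
  moreover have "(s - (\<sigma> * (\<tau> s - \<tau> 0) + P * of_int k)) / P < d" using k P by (simp add: field_simps)
  ultimately show "\<exists>k::int. 0 \<le> (s - \<sigma> * (\<tau> s - \<tau> 0)) / P - of_int k \<and> (s - \<sigma> * (\<tau> s - \<tau> 0)) / P - of_int k < d"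
    by (intro exI[of _ k]) simp
qed

text \<open>By \<open>advance_eq\<close> the position moves with unit speed modulo \<open>P\<close>.
  It has returned at \<open>L\<close>, so \<open>L\<close> is a multiple of \<open>P\<close>; the
  starting point is \<open>\<tau> 0\<close>.\<close>

lemma multiple_circuitI:
  assumes c: "closed_curve c L" and c1: "closed_curve c1 P"
    and tau: "\<And>s. s \<in> {0..L} \<Longrightarrow> 0 \<le> \<tau> s \<and> \<tau> s < P \<and> c s = c1 (\<tau> s)" and closed: "\<tau> L = \<tau> 0"
    and sg: "\<sigma> = 1 \<or> \<sigma> = (-1::real)"
    and adv: "\<And>s s'. 0 \<le> s \<Longrightarrow> s < s' \<Longrightarrow> s' \<le> L \<Longrightarrow> P * frac (\<sigma> * (\<tau> s' - \<tau> s) / P) \<le> s' - s"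
  shows "multiple_circuit c L c1 P"
proof -
  have P: "0 < P" "0 < L" using c c1 by (auto simp: closed_curve_def)
  have eq: "(s - \<sigma> * (\<tau> s - \<tau> 0)) / P \<in> \<int>" if "s \<in> {0..L}" for s
    by (rule advance_eq[OF c c1 tau sg adv that])
  have "L / P \<in> \<int>" using eq[of L] closed P by simp
  then obtain n :: int where n: "L / P = of_int n" by (auto elim: Ints_cases)
  then have "0 < n" using P by (metis divide_pos_pos of_int_0_less_iff)
  define k where "k = nat n"
  have k: "1 \<le> k" "L = real k * P" using n \<open>0 < n\<close> P by (auto simp: k_def field_simps)
  have "c s = periodic_ext c1 P (\<tau> 0 + \<sigma> * s)" if s: "s \<in> {0..L}" for s
  proof -
    obtain w :: int where w: "(s - \<sigma> * (\<tau> s - \<tau> 0)) / P = of_int w" using eq[OF s] by (auto elim: Ints_cases)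
    have "s = \<sigma> * (\<tau> s - \<tau> 0) + P * of_int w" using w P by (simp add: field_simps)
    then have "\<sigma> * s = (\<tau> s - \<tau> 0) + P * (\<sigma> * of_int w)" using sg by (auto simp: algebra_simps)
    then have "(\<tau> 0 + \<sigma> * s) / P = \<tau> s / P + \<sigma> * of_int w" using P by (simp add: field_simps)
    moreover have "\<exists>j::int. \<sigma> * of_int w = of_int j" using sg by (metis mult_1 mult_minus1 of_int_minus)
    then obtain j :: int where "\<sigma> * of_int w = of_int j" by blast
    ultimately have "frac ((\<tau> 0 + \<sigma> * s) / P) = frac (\<tau> s / P)" by (simp add: frac_def)
    also have "\<dots> = \<tau> s / P" using tau[OF s] P by (simp add: frac_eq)
    finally show ?thesis using tau[OF s] P by (simp add: periodic_ext_def)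
  qed
  then show ?thesis unfolding multiple_circuit_def
    using k sg by (intro exI[of _ k] exI[of _ "\<tau> 0"] bexI[of _ \<sigma>]) auto
qed

section \<open>Reading off the arc length from the parameter\<close>

context convex_body
begin

text \<open>The angles are lifted such that the boundary arc from \<open>x\<close> to \<open>y\<close> corresponds to the interval from \<open>\<theta>\<close> to \<open>\<theta>'\<close>.\<close>

definition arc_angles :: "complex \<Rightarrow> complex \<Rightarrow> real \<Rightarrow> real \<Rightarrow> real \<Rightarrow> bool" where
  "arc_angles x y \<theta> \<omega> \<theta>' \<longleftrightarrow> supp K x \<theta> \<and> supp K y \<theta>' \<and> x \<noteq> y \<and> y - x = of_real (norm (y - x)) * cis \<omega> \<and>
    \<theta> \<le> \<omega> \<and> \<omega> \<le> \<theta> + pi \<and> \<omega> \<le> \<theta>' \<and> \<theta>' \<le> \<omega> + pi"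

lemma arc_angles_exist:
  assumes "x \<in> K" "x \<notin> interior K" "y \<in> K" "y \<notin> interior K" "x \<noteq> y"
  shows "\<exists>\<theta> \<omega> \<theta>'. arc_angles x y \<theta> \<omega> \<theta>'"
proof -
  obtain \<theta> where t: "supp K x \<theta>" using frontier_supp assms by blast
  obtain \<theta>1 where t1: "supp K y \<theta>1" using frontier_supp assms by blast
  obtain \<omega> where w: "\<theta> \<le> \<omega>" "\<omega> \<le> \<theta> + pi" "y - x = of_real (norm (y - x)) * cis \<omega>"
    using lift_out[OF t assms(3)] assms(5) by metis
  obtain \<theta>' where t': "\<omega> \<le> \<theta>'" "\<theta>' \<le> \<omega> + pi" "cis \<theta>' = cis \<theta>1"
    using lift_in[OF t1 assms(1) _ w(3)] assms(5) by metis
  have "supp K y \<theta>'" using supp_cis_cong t1 t'(3) by blast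
  then show ?thesis using t w t' assms(5) unfolding arc_angles_def by blast
qed

lemma arc_angles_reverse:
  assumes "arc_angles x y \<theta> \<omega> \<theta>'"
  shows "arc_angles y x \<theta>' (\<omega> + pi) (\<theta> + 2 * pi)"
proof -
  have h: "supp K x \<theta>" "supp K y \<theta>'" "x \<noteq> y" "y - x = of_real (norm (y - x)) * cis \<omega>"
    "\<theta> \<le> \<omega>" "\<omega> \<le> \<theta> + pi" "\<omega> \<le> \<theta>'" "\<theta>' \<le> \<omega> + pi"
    using assms unfolding arc_angles_def by blast+
  have "cis (\<theta> + 2 * pi) = cis \<theta>" by (simp add: complex_eq_iff)
  then have "supp K x (\<theta> + 2 * pi)" using supp_cis_cong h(1) by blast
  moreover have "x - y = of_real (norm (x - y)) * cis (\<omega> + pi)"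
  proof -
    have "x - y = - (of_real (norm (y - x)) * cis \<omega>)" unfolding h(4)[symmetric] by simp
    then show ?thesis by (simp add: cis_mult[symmetric] norm_minus_commute)
  qed
  moreover have "\<theta>' \<le> \<omega> + pi" "\<omega> + pi \<le> \<theta>' + pi" "\<omega> + pi \<le> \<theta> + 2 * pi" "\<theta> + 2 * pi \<le> (\<omega> + pi) + pi" using h by simp_all
  ultimately show ?thesis using h(2,3) unfolding arc_angles_def by blast
qed

end

text \<open>The elapsed parameter is at least the length of the boundary arc swept in the sense
  \<open>a\<close>, between \<open>s\<close> and \<open>s'\<close> as well as on the complementary
  part.\<close>

definition optimal_on :: "complex set \<Rightarrow> (real \<Rightarrow> complex) \<Rightarrow> real \<Rightarrow> bool \<Rightarrow> bool" where
  "optimal_on K c L a \<longleftrightarrow> (\<forall>s s' \<theta> \<omega> \<theta>'. 0 \<le> s \<longrightarrow> s < s' \<longrightarrow> s' \<le> L \<longrightarrow> convex_body.arc_angles K (c s) (c s') \<theta> \<omega> \<theta>' \<longrightarrow>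
    (let A = arcpos K (c s') \<theta>' - arcpos K (c s) \<theta> in
    if a then A \<le> s' - s \<and> 2 * pi * crad K - A \<le> L - (s' - s) else 2 * pi * crad K - A \<le> s' - s \<and> A \<le> L - (s' - s)))"

lemma (in tcurve_in) optimal_on_exists:
  assumes "\<Lambda> = crad K * W" "convex hull (c ` {0..\<Lambda>}) = K" "interior K \<noteq> {}"
  shows "\<exists>a. optimal_on K c \<Lambda> a"
proof -
  from optimal_curve(1)[OF assms] obtain a where a: "\<And>s s' \<theta> \<theta>' \<omega>. 0 \<le> s \<Longrightarrow> s < s' \<Longrightarrow> s' \<le> \<Lambda> \<Longrightarrow> supp K (c s) \<theta> \<Longrightarrow> supp K (c s') \<theta>' \<Longrightarrow>
    c s \<noteq> c s' \<Longrightarrow> c s' - c s = of_real (norm (c s' - c s)) * cis \<omega> \<Longrightarrow> \<theta> \<le> \<omega> \<Longrightarrow> \<omega> \<le> \<theta> + pi \<Longrightarrow> \<omega> \<le> \<theta>' \<Longrightarrow> \<theta>' \<le> \<omega> + pi \<Longrightarrow>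
    (if a then arcpos K (c s') \<theta>' - arcpos K (c s) \<theta> \<le> s' - s \<and> 2 * pi * crad K - (arcpos K (c s') \<theta>' - arcpos K (c s) \<theta>) \<le> \<Lambda> - (s' - s)
    else 2 * pi * crad K - (arcpos K (c s') \<theta>' - arcpos K (c s) \<theta>) \<le> s' - s \<and> arcpos K (c s') \<theta>' - arcpos K (c s) \<theta> \<le> \<Lambda> - (s' - s))"
    by blast
  show ?thesis unfolding optimal_on_def arc_angles_def Let_def
  proof (intro exI[of _ a] allI impI, elim conjE)
    fix s s' \<theta> \<omega> \<theta>' assume "0 \<le> s" "s < s'" "s' \<le> \<Lambda>" "supp K (c s) \<theta>" "supp K (c s') \<theta>'" "c s \<noteq> c s'"
      "c s' - c s = of_real (norm (c s' - c s)) * cis \<omega>" "\<theta> \<le> \<omega>" "\<omega> \<le> \<theta> + pi" "\<omega> \<le> \<theta>'" "\<theta>' \<le> \<omega> + pi"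
    then show "if a then arcpos K (c s') \<theta>' - arcpos K (c s) \<theta> \<le> s' - s \<and> 2 * pi * crad K - (arcpos K (c s') \<theta>' - arcpos K (c s) \<theta>) \<le> \<Lambda> - (s' - s)
      else 2 * pi * crad K - (arcpos K (c s') \<theta>' - arcpos K (c s) \<theta>) \<le> s' - s \<and> arcpos K (c s') \<theta>' - arcpos K (c s) \<theta> \<le> \<Lambda> - (s' - s)"
      by (rule a)
  qed
qed

text \<open>For a curve whose length is the perimeter the two inequalities of
  \<open>optimal_on\<close> are complementary, so both are equalities. If \<open>t' < t\<close>,
  they are applied to the reversed arc.\<close>

lemma (in convex_body) optimal_arc:
  assumes o: "optimal_on K c1 P a" and P: "P = 2 * pi * crad K" "0 < P"
    and t: "0 \<le> t" "t < P" "0 \<le> t'" "t' < P" and arc: "arc_angles (c1 t) (c1 t') \<theta> \<omega> \<theta>'"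
  defines "A \<equiv> arcpos K (c1 t') \<theta>' - arcpos K (c1 t) \<theta>"
  shows "A = P * frac ((if a then t' - t else t - t') / P)" "P - A = P * frac ((if a then t - t' else t' - t) / P)"
proof -
  have ne: "t \<noteq> t'" using arc by (auto simp: arc_angles_def)
  have "A = (if a then t' - t else P - (t' - t))" if "t < t'"
    using o[unfolded optimal_on_def, rule_format, OF t(1) that _ arc] t P(1) by (auto simp: A_def Let_def split: if_splits)
  moreover have "P - A = (if a then t - t' else P - (t - t'))" if "t' < t"
  proof -
    have "arcpos K (c1 t) (\<theta> + 2 * pi) - arcpos K (c1 t') \<theta>' = P - A" unfolding arcpos_2pi by (simp add: A_def P(1))
    then show ?thesis
      using o[unfolded optimal_on_def, rule_format, OF t(3) that _ arc_angles_reverse[OF arc]] t P(1) by (auto simp: Let_def split: if_splits)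
  qed
  ultimately show "A = P * frac ((if a then t' - t else t - t') / P)" "P - A = P * frac ((if a then t - t' else t' - t) / P)"
    using frac_of_abs_less[OF P(2), of "t' - t"] frac_of_abs_less[OF P(2), of "t - t'"] t ne
    by (cases "t < t'"; cases a; auto)+
qed

theorem mainTheorem1:
  fixes \<Gamma> \<Gamma>1 :: "real \<Rightarrow> complex" and L L1 :: real
  assumes "convex_closed_curve \<Gamma>1 L1"
    and "closed_curve \<Gamma> L"
    and "BV1 \<Gamma> L"
    and "\<Gamma> ` {0..L} \<subseteq> closed_region \<Gamma>1 L1"
  shows "mean_abs_curvature \<Gamma> L \<ge> mean_abs_curvature \<Gamma>1 L1 \<and>
    (mean_abs_curvature \<Gamma> L = mean_abs_curvature \<Gamma>1 L1 \<longrightarrow> multiple_circuit \<Gamma> L \<Gamma>1 L1)"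
proof -
  define K where "K = closed_region \<Gamma>1 L1"
  define K0 where "K0 = convex hull (\<Gamma> ` {0..L})"
  define V where "V = full_rotation \<Gamma> L"
  define V1 where "V1 = full_rotation \<Gamma>1 L1"
  note R = convex_closed_curve_region[OF assms(1), folded K_def]
  interpret K: convex_body K by (rule R(1))
  have cc1: "closed_curve \<Gamma>1 L1" using assms(1) by (rule convex_curve_closed)
  have L: "0 < L" "\<Gamma> 0 = \<Gamma> L" "0 < L1" "\<Gamma>1 0 = \<Gamma>1 L1" using assms(2) cc1 by (auto simp: closed_curve_def)
  have comp: "compact (\<Gamma> ` {0..L})"
    by (intro compact_continuous_image closed_curve_continuous[OF assms(2)]) auto
  have ne: "\<Gamma> ` {0..L} \<noteq> {}" using L by auto
  have sub: "K0 \<subseteq> K" unfolding K0_def using assms(4) K.conv by (intro hull_minimal) (auto simp: K_def)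
  have body0: "convex_body K0" unfolding K0_def
    by unfold_locales (use comp ne in \<open>auto simp: compact_convex_hull\<close>)
  have im0: "\<Gamma> ` {0..L} \<subseteq> K0" unfolding K0_def by (rule hull_subset)
  have tc: "tcurve \<Gamma> L V" unfolding V_def by (rule BV1_tcurve[OF assms(2,3)])
  have in0: "tcurve_in \<Gamma> L V K0" using tc body0 im0 by (simp add: tcurve_in_def tcurve_in_axioms_def)
  \<comment> \<open>A curve point that supports the hull in the direction 0 serves as the contact at
    which the curve is opened.\<close>
  obtain t0 where t0: "t0 \<in> {0..L}" "hs K0 0 = \<Gamma> t0 \<bullet> nrm 0"
    using K.hull_supp[OF comp ne, of 0] by (auto simp: K0_def)
  then have "supp K0 (\<Gamma> t0) 0" using im0 by (auto simp: supp_def ds_def)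
  from tcurve_in.length_le[OF in0 t0(1) this] have len: "L \<le> crad K0 * V" .
  have c0: "0 \<le> crad K0" by (rule convex_body.crad_nonneg[OF body0])
  have V: "0 < V"
  proof (rule ccontr)
    assume "\<not> ?thesis"
    then have "crad K0 * V \<le> 0" using c0 by (simp add: mult_nonneg_nonpos)
    then show False using len L by simp
  qed
  have mono: "crad K0 \<le> crad K" by (rule K.crad_mono[OF body0 sub])
  have cauchy: "2 * pi * crad K \<le> L1" using cauchy_perimeter[OF assms(1)] by (simp add: K_def)
  have V1: "V1 \<le> 2 * pi" unfolding V1_def by (rule convex_curve_rotation[OF assms(1)])
  have "crad K0 * V \<le> crad K * V" using mono V by (simp add: mult_right_mono)
  moreover have "2 * pi * (crad K * V) \<le> L1 * V" using cauchy V by (simp add: mult_right_mono mult.assoc[symmetric])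
  ultimately have main: "2 * pi * L \<le> L1 * V" using len pi_gt_zero by (smt (verit) mult_left_mono)
  have ge: "2 * pi / L1 \<le> V / L" using main L by (simp add: field_simps)
  have le1: "V1 / L1 \<le> 2 * pi / L1" using V1 L by (simp add: divide_right_mono)
  have part1: "mean_abs_curvature \<Gamma>1 L1 \<le> mean_abs_curvature \<Gamma> L"
    using ge le1 by (simp add: mean_abs_curvature_def V_def V1_def)
  have "multiple_circuit \<Gamma> L \<Gamma>1 L1" if eq: "mean_abs_curvature \<Gamma> L = mean_abs_curvature \<Gamma>1 L1"
  proof -
    have "V / L = 2 * pi / L1" using eq ge le1 by (simp add: mean_abs_curvature_def V_def V1_def)
    then have e: "L1 * V = 2 * pi * L" using L by (simp add: field_simps)
    have "2 * pi * (crad K0 * V) \<le> 2 * pi * crad K * V" using mono V by (simp add: mult_right_mono)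
    moreover have "2 * pi * crad K * V \<le> L1 * V" using cauchy V by (simp add: mult_right_mono)
    moreover have "2 * pi * L \<le> 2 * pi * (crad K0 * V)" using len by simp
    \<comment> \<open>Equality of the curvatures closes the chain of inequalities from
      \<open>2 * pi * L\<close> to \<open>L1 * V\<close>; both \<open>crad\<close> terms are
      squeezed.\<close>
    ultimately have "2 * pi * (crad K0 * V) = L1 * V" "2 * pi * crad K * V = L1 * V" using e by linarith+
    then have cr: "L1 = 2 * pi * crad K" "crad K0 = crad K" using V by auto
    have K0: "K0 = K" by (rule K.crad_strict[OF body0 sub]) (simp add: cr)
    have LV: "L = crad K * V" using e cr(1) by simp
    have inK: "tcurve_in \<Gamma> L V K" using in0 K0 by simp
    have in1: "tcurve_in \<Gamma>1 L1 (2 * pi) K"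
      using convex_curve_tcurve[OF assms(1)] R(1,3) by (simp add: tcurve_in_def tcurve_in_axioms_def)
    obtain a where a: "optimal_on K \<Gamma> L a"
      using tcurve_in.optimal_on_exists[OF inK LV _ R(2)] K0 by (auto simp: K0_def)
    have "L1 = crad K * (2 * pi)" using cr(1) by simp
    from tcurve_in.optimal_on_exists[OF in1 this R(6)[symmetric] R(2)]
    obtain a1 where a1: "optimal_on K \<Gamma>1 L1 a1" by blast
    have hullK: "convex hull (\<Gamma> ` {0..L}) = K" using K0 by (simp add: K0_def)
    have bd: "\<Gamma> s \<in> K" "\<Gamma> s \<notin> interior K" if "s \<in> {0..L}" for s
      using im0 K0 that tcurve_in.optimal_curve(2)[OF inK LV hullK R(2) that] by auto
    have "\<exists>t. 0 \<le> t \<and> t < L1 \<and> x = \<Gamma>1 t" if "x \<in> \<Gamma> ` {0..L}" for x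
    proof -
      have "x \<in> K - interior K" using bd that by auto
      then obtain t where t: "t \<in> {0..L1}" "x = \<Gamma>1 t" using R(5) by blast
      then show ?thesis using L by (cases "t = L1") (auto intro: exI[of _ 0])
    qed
    \<comment> \<open>The position is a function of the point and not of the parameter. Hence \<tau>
      agrees at 0 and \<open>L\<close>, and equal points of \<Gamma> show no advance.\<close>
    then obtain pos where pos: "\<And>x. x \<in> \<Gamma> ` {0..L} \<Longrightarrow> 0 \<le> pos x \<and> pos x < L1 \<and> x = \<Gamma>1 (pos x)" by metis
    define \<tau> where "\<tau> s = pos (\<Gamma> s)" for s
    have tau: "0 \<le> \<tau> s \<and> \<tau> s < L1 \<and> \<Gamma> s = \<Gamma>1 (\<tau> s)" if "s \<in> {0..L}" for s
      using pos[of "\<Gamma> s"] that by (simp add: \<tau>_def)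
    \<comment> \<open>Both \<Gamma> and \<Gamma>1 are optimal in \<open>K\<close>, each with its own
      sense; comparing the two senses gives the orientation of the circuit.\<close>
    define \<sigma> :: real where "\<sigma> = (if a = a1 then 1 else -1)"
    show ?thesis
    proof (rule multiple_circuitI[OF assms(2) cc1 tau])
      show "\<tau> L = \<tau> 0" using L by (simp add: \<tau>_def)
      show "\<sigma> = 1 \<or> \<sigma> = -1" by (simp add: \<sigma>_def)
      fix s s' :: real assume s: "0 \<le> s" "s < s'" "s' \<le> L"
      then have s01: "s \<in> {0..L}" "s' \<in> {0..L}" by auto
      show "L1 * frac (\<sigma> * (\<tau> s' - \<tau> s) / L1) \<le> s' - s"
      proof (cases "\<Gamma> s = \<Gamma> s'")
        case True
        then show ?thesis using s by (simp add: \<tau>_def)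
      next
        case False
        obtain \<theta> \<omega> \<theta>' where arc: "K.arc_angles (\<Gamma> s) (\<Gamma> s') \<theta> \<omega> \<theta>'"
          using K.arc_angles_exist[OF bd[OF s01(1)] bd[OF s01(2)] False] by blast
        define A where "A = arcpos K (\<Gamma> s') \<theta>' - arcpos K (\<Gamma> s) \<theta>"
        have 1: "if a then A \<le> s' - s else L1 - A \<le> s' - s"
          using a[unfolded optimal_on_def, rule_format, OF s arc] cr(1) by (auto simp: A_def Let_def split: if_splits)
        have t: "\<Gamma>1 (\<tau> s) = \<Gamma> s" "\<Gamma>1 (\<tau> s') = \<Gamma> s'" using tau s01 by auto
        have tb: "0 \<le> \<tau> s" "\<tau> s < L1" "0 \<le> \<tau> s'" "\<tau> s' < L1" using tau s01 by auto
        note 2 = K.optimal_arc[OF a1 cr(1) L(3) tb, unfolded t, OF arc, folded A_def]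
        show ?thesis using 1 2 by (cases a; cases a1) (simp_all add: \<sigma>_def)
      qed
    qed
  qed
  then show ?thesis using part1 by blast
qed

end
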